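(* Let $R$ be a commutative Noetherian ring with identity, let $I_1,\ldots,I_t$ be ideals of $R$, let $M$ and $N$ be finitely generated $R$-modules, and let $N' \subseteq N$ be a submodule. Fix an integer $i \ge 0$. For $\mathbf{n} = (n_1,\ldots,n_t) \in \mathbb{N}^t$ put $\mathbf{I}^{\mathbf{n}} := I_1^{n_1}\cdots I_t^{n_t}$ and $$W_{\mathbf{n}} := \operatorname{Ext}_R^i\left(M, N/\mathbf{I}^{\mathbf{n}} N'\right), \qquad W'_{\mathbf{n}} := \operatorname{Tor}_i^R\left(M, N/\mathbf{I}^{\mathbf{n}} N'\right).$$ Then there exists $\mathbf{k} \in \mathbb{N}^t$ such that the sets $\operatorname{Ass}_R(W_{\mathbf{n}})$ and $\operatorname{Ass}_R(W'_{\mathbf{n}})$ are independent of $\mathbf{n}$ for all $\mathbf{n} \ge \mathbf{k}$; that is, $\operatorname{Ass}_R(W_{\mathbf{n}}) = \operatorname{Ass}_R(W_{\mathbf{k}})$ and $\operatorname{Ass}_R(W'_{\mathbf{n}}) = \operatorname{Ass}_R(W'_{\mathbf{k}})$ for all $\mathbf{n} \ge \mathbf{k}$.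
   Context: $\mathbb{N} = \{n \in \mathbb{Z} : n \ge 0\}$. The order on $\mathbb{N}^t$ is componentwise: $\mathbf{n} \ge \mathbf{k}$ means $n_j \ge k_j$ for all $1 \le j \le t$. For an $R$-module $X$, $\operatorname{Ass}_R(X)$ denotes the set of associated prime ideals of $X$, i.e. prime ideals of $R$ that are annihilators of elements of $X$. *)

theory Defs
  imports "HOL-Algebra.Module" "HOL-Algebra.Ideal_Product" "HOL-Algebra.Ring_Divisibility"
begin

section \<open>Submodules, quotients and associated primes\<close>

definition submodule_span ::
    "('a, 'r) ring_scheme \<Rightarrow> ('a, 'm, 'e) module_scheme \<Rightarrow> 'm set \<Rightarrow> 'm set" where
  "submodule_span R M S = \<Inter>{H. submodule H R M \<and> S \<subseteq> H}"

definition finitely_generated_module ::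
    "('a, 'r) ring_scheme \<Rightarrow> ('a, 'm, 'e) module_scheme \<Rightarrow> bool" where
  "finitely_generated_module R M \<longleftrightarrow>
     module R M \<and> (\<exists>S \<subseteq> carrier M. finite S \<and> submodule_span R M S = carrier M)"

definition ideal_smult ::
    "('a, 'r) ring_scheme \<Rightarrow> ('a, 'm, 'e) module_scheme \<Rightarrow> 'a set \<Rightarrow> 'm set \<Rightarrow> 'm set" where
  "ideal_smult R M J H = submodule_span R M {a \<odot>\<^bsub>M\<^esub> x | a x. a \<in> J \<and> x \<in> H}"

text \<open>The record type of modules extends that of rings; the fields \<open>monoid.mult\<close> and \<open>one\<close> play no
  role for modules and are left undefined in all the constructions below.\<close>

definition quotient_module :: "('a, 'm, 'e) module_scheme \<Rightarrow> 'm set \<Rightarrow> ('a, 'm set) module" where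
  "quotient_module M H =
     \<lparr>carrier = a_rcosets\<^bsub>M\<^esub> H, monoid.mult = undefined, one = undefined,
      zero = H, add = (<+>\<^bsub>M\<^esub>), smult = (\<lambda>r C. \<Union>x\<in>C. H +>\<^bsub>M\<^esub> (r \<odot>\<^bsub>M\<^esub> x))\<rparr>"

definition Ass :: "('a, 'r) ring_scheme \<Rightarrow> ('a, 'm, 'e) module_scheme \<Rightarrow> 'a set set" where
  "Ass R X = {P. primeideal P R \<and>
     (\<exists>x \<in> carrier X. P = {r \<in> carrier R. r \<odot>\<^bsub>X\<^esub> x = \<zero>\<^bsub>X\<^esub>})}"

text \<open>The product \<open>I\<^sub>1\<^bsup>n\<^sub>1\<^esup> \<cdots> I\<^sub>t\<^bsup>n\<^sub>t\<^esup>\<close>, formed in the commutative monoid of ideals of \<open>R\<close>,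
  whose unit is \<open>R\<close> itself.\<close>

definition ideal_multipower ::
    "('a, 'r) ring_scheme \<Rightarrow> nat \<Rightarrow> (nat \<Rightarrow> 'a set) \<Rightarrow> (nat \<Rightarrow> nat) \<Rightarrow> 'a set" where
  "ideal_multipower R t I n =
     (\<Otimes>\<^bsub>ideals_set R\<^esub> j \<in> {1..t}. I j [^]\<^bsub>ideals_set R\<^esub> n j)"


section \<open>Modules of homomorphisms\<close>

definition Hom_module :: "('a, 'r) ring_scheme \<Rightarrow> ('a, 'm, 'e) module_scheme \<Rightarrow>
    ('a, 'n, 'f) module_scheme \<Rightarrow> ('a, 'm \<Rightarrow> 'n) module" where
  "Hom_module R M N =
     \<lparr>carrier = {f \<in> carrier M \<rightarrow>\<^sub>E carrier N.
        (\<forall>x \<in> carrier M. \<forall>y \<in> carrier M. f (x \<oplus>\<^bsub>M\<^esub> y) = f x \<oplus>\<^bsub>N\<^esub> f y) \<and>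
        (\<forall>r \<in> carrier R. \<forall>x \<in> carrier M. f (r \<odot>\<^bsub>M\<^esub> x) = r \<odot>\<^bsub>N\<^esub> f x)},
      monoid.mult = undefined, one = undefined,
      zero = (\<lambda>x \<in> carrier M. \<zero>\<^bsub>N\<^esub>),
      add = (\<lambda>f g. \<lambda>x \<in> carrier M. f x \<oplus>\<^bsub>N\<^esub> g x),
      smult = (\<lambda>r f. \<lambda>x \<in> carrier M. r \<odot>\<^bsub>N\<^esub> f x)\<rparr>"


section \<open>Free modules\<close>

text \<open>The free module on a set \<open>B\<close>: finitely supported \<open>R\<close>-valued functions vanishing outside \<open>B\<close>.\<close>

definition free_module :: "('a, 'r) ring_scheme \<Rightarrow> 'b set \<Rightarrow> ('a, 'b \<Rightarrow> 'a) module" where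
  "free_module R B =
     \<lparr>carrier = {z. (\<forall>b. z b \<in> carrier R) \<and> (\<forall>b. b \<notin> B \<longrightarrow> z b = \<zero>\<^bsub>R\<^esub>) \<and> finite {b. z b \<noteq> \<zero>\<^bsub>R\<^esub>}},
      monoid.mult = undefined, one = undefined,
      zero = (\<lambda>b. \<zero>\<^bsub>R\<^esub>),
      add = (\<lambda>y z b. y b \<oplus>\<^bsub>R\<^esub> z b),
      smult = (\<lambda>r z b. r \<otimes>\<^bsub>R\<^esub> z b)\<rparr>"

definition free_gen :: "('a, 'r) ring_scheme \<Rightarrow> 'b \<Rightarrow> 'b \<Rightarrow> 'a" where
  "free_gen R b = (\<lambda>c. if c = b then \<one>\<^bsub>R\<^esub> else \<zero>\<^bsub>R\<^esub>)"

text \<open>The linear map from a free module to \<open>X\<close> with prescribed values \<open>f b\<close> on the basis.\<close>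

definition linear_extension :: "('a, 'r) ring_scheme \<Rightarrow> ('a, 'm, 'e) module_scheme \<Rightarrow>
    ('b \<Rightarrow> 'm) \<Rightarrow> ('b \<Rightarrow> 'a) \<Rightarrow> 'm" where
  "linear_extension R X f z = (\<Oplus>\<^bsub>X\<^esub> b \<in> {b. z b \<noteq> \<zero>\<^bsub>R\<^esub>}. z b \<odot>\<^bsub>X\<^esub> f b)"


section \<open>Tensor products\<close>

definition tensor_relations :: "('a, 'r) ring_scheme \<Rightarrow> ('a, 'm, 'e) module_scheme \<Rightarrow>
    ('a, 'n, 'f) module_scheme \<Rightarrow> ('m \<times> 'n \<Rightarrow> 'a) set" where
  "tensor_relations R A B =
     (let F = free_module R (carrier A \<times> carrier B); e = (\<lambda>a b. free_gen R (a, b)) in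
      {e (a \<oplus>\<^bsub>A\<^esub> a') b \<ominus>\<^bsub>F\<^esub> (e a b \<oplus>\<^bsub>F\<^esub> e a' b)
         | a a' b. a \<in> carrier A \<and> a' \<in> carrier A \<and> b \<in> carrier B} \<union>
      {e a (b \<oplus>\<^bsub>B\<^esub> b') \<ominus>\<^bsub>F\<^esub> (e a b \<oplus>\<^bsub>F\<^esub> e a b')
         | a b b'. a \<in> carrier A \<and> b \<in> carrier B \<and> b' \<in> carrier B} \<union>
      {e (r \<odot>\<^bsub>A\<^esub> a) b \<ominus>\<^bsub>F\<^esub> (r \<odot>\<^bsub>F\<^esub> e a b)
         | r a b. r \<in> carrier R \<and> a \<in> carrier A \<and> b \<in> carrier B} \<union>
      {e a (r \<odot>\<^bsub>B\<^esub> b) \<ominus>\<^bsub>F\<^esub> (r \<odot>\<^bsub>F\<^esub> e a b)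
         | r a b. r \<in> carrier R \<and> a \<in> carrier A \<and> b \<in> carrier B})"

definition tensor_kernel :: "('a, 'r) ring_scheme \<Rightarrow> ('a, 'm, 'e) module_scheme \<Rightarrow>
    ('a, 'n, 'f) module_scheme \<Rightarrow> ('m \<times> 'n \<Rightarrow> 'a) set" where
  "tensor_kernel R A B =
     submodule_span R (free_module R (carrier A \<times> carrier B)) (tensor_relations R A B)"

definition tensor_module :: "('a, 'r) ring_scheme \<Rightarrow> ('a, 'm, 'e) module_scheme \<Rightarrow>
    ('a, 'n, 'f) module_scheme \<Rightarrow> ('a, ('m \<times> 'n \<Rightarrow> 'a) set) module" where
  "tensor_module R A B =
     quotient_module (free_module R (carrier A \<times> carrier B)) (tensor_kernel R A B)"

definition pure_tensor :: "('a, 'r) ring_scheme \<Rightarrow> ('a, 'm, 'e) module_scheme \<Rightarrow>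
    ('a, 'n, 'f) module_scheme \<Rightarrow> 'm \<Rightarrow> 'n \<Rightarrow> ('m \<times> 'n \<Rightarrow> 'a) set" where
  "pure_tensor R A B a b =
     tensor_kernel R A B +>\<^bsub>free_module R (carrier A \<times> carrier B)\<^esub> free_gen R (a, b)"

text \<open>The map \<open>f \<otimes> id\<close> into \<open>A' \<otimes> B\<close> induced by a linear map \<open>f\<close> into \<open>A'\<close>.  A tensor is a coset
  \<open>C\<close>, on which the linear map determined by \<open>(a, b) \<mapsto> f a \<otimes> b\<close> is constant.\<close>

definition tensor_map :: "('a, 'r) ring_scheme \<Rightarrow> ('a, 'm', 'e) module_scheme \<Rightarrow>
    ('a, 'n, 'f) module_scheme \<Rightarrow> ('m \<Rightarrow> 'm') \<Rightarrow> ('m \<times> 'n \<Rightarrow> 'a) set \<Rightarrow> ('m' \<times> 'n \<Rightarrow> 'a) set" where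
  "tensor_map R A' B f C =
     the_elem (linear_extension R (tensor_module R A' B) (\<lambda>(a, b). pure_tensor R A' B (f a) b) ` C)"


section \<open>The canonical free resolution\<close>

text \<open>
  Every module \<open>M\<close> has a functorial free resolution
  \<open>\<cdots> \<rightarrow> F\<^sub>2 \<rightarrow> F\<^sub>1 \<rightarrow> F\<^sub>0 \<rightarrow> M \<rightarrow> 0\<close>: take for \<open>F\<^sub>0\<close> the free module on the elements of \<open>M\<close>, and for
  \<open>F\<^bsub>n+1\<^esub>\<close> the free module on all formal linear combinations of basis elements of \<open>F\<^sub>n\<close> that
  represent elements of the kernel of the map out of \<open>F\<^sub>n\<close>.  The basis elements are encoded in one
  datatype, so that all \<open>F\<^sub>n\<close> live in the same type: \<open>Gen x\<close> is the basis element of \<open>F\<^sub>0\<close>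
  mapping to \<open>x\<close>, and \<open>Syz [(r\<^sub>1, g\<^sub>1), \<dots>, (r\<^sub>k, g\<^sub>k)]\<close> is the one mapping to
  \<open>r\<^sub>1 g\<^sub>1 + \<cdots> + r\<^sub>k g\<^sub>k\<close>.
\<close>

datatype ('a, 'm) res_gen = Gen 'm | Syz "('a \<times> ('a, 'm) res_gen) list"

fun lin_comb :: "('a, 'r) ring_scheme \<Rightarrow> ('a \<times> 'b) list \<Rightarrow> 'b \<Rightarrow> 'a" where
  "lin_comb R [] = (\<lambda>_. \<zero>\<^bsub>R\<^esub>)"
| "lin_comb R ((r, g) # xs) = (lin_comb R xs)(g := r \<oplus>\<^bsub>R\<^esub> lin_comb R xs g)"

definition res_aug :: "('a, 'r) ring_scheme \<Rightarrow> ('a, 'm, 'e) module_scheme \<Rightarrow>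
    (('a, 'm) res_gen \<Rightarrow> 'a) \<Rightarrow> 'm" where
  "res_aug R M = linear_extension R M (\<lambda>g. case g of Gen x \<Rightarrow> x | Syz _ \<Rightarrow> \<zero>\<^bsub>M\<^esub>)"

definition res_diff :: "('a, 'r) ring_scheme \<Rightarrow>
    (('a, 'm) res_gen \<Rightarrow> 'a) \<Rightarrow> ('a, 'm) res_gen \<Rightarrow> 'a" where
  "res_diff R = linear_extension R (free_module R UNIV)
     (\<lambda>g. case g of Gen _ \<Rightarrow> (\<lambda>_. \<zero>\<^bsub>R\<^esub>) | Syz xs \<Rightarrow> lin_comb R xs)"

primrec res_basis :: "('a, 'r) ring_scheme \<Rightarrow> ('a, 'm, 'e) module_scheme \<Rightarrow>
    nat \<Rightarrow> ('a, 'm) res_gen set" where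
  "res_basis R M 0 = Gen ` carrier M"
| "res_basis R M (Suc n) = {Syz xs | xs.
     set xs \<subseteq> carrier R \<times> res_basis R M n \<and>
     (if n = 0 then res_aug R M (lin_comb R xs) = \<zero>\<^bsub>M\<^esub>
      else res_diff R (lin_comb R xs) = (\<lambda>_. \<zero>\<^bsub>R\<^esub>))}"

definition res_module :: "('a, 'r) ring_scheme \<Rightarrow> ('a, 'm, 'e) module_scheme \<Rightarrow>
    nat \<Rightarrow> ('a, ('a, 'm) res_gen \<Rightarrow> 'a) module" where
  "res_module R M n = free_module R (res_basis R M n)"


subsection \<open>Exactness of the resolution\<close>

lemma free_module_simps [simp]:
  "zero (free_module R B) = (\<lambda>b. \<zero>\<^bsub>R\<^esub>)"
  "add (free_module R B) y z = (\<lambda>b. y b \<oplus>\<^bsub>R\<^esub> z b)"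
  "smult (free_module R B) r z = (\<lambda>b. r \<otimes>\<^bsub>R\<^esub> z b)"
  by (simp_all add: free_module_def)

lemma carrier_free_module:
  "z \<in> carrier (free_module R B) \<longleftrightarrow>
     (\<forall>b. z b \<in> carrier R) \<and> (\<forall>b. b \<notin> B \<longrightarrow> z b = \<zero>\<^bsub>R\<^esub>) \<and> finite {b. z b \<noteq> \<zero>\<^bsub>R\<^esub>}"
  by (simp add: free_module_def)

lemma free_module_add_closed:
  fixes R (structure)
  assumes "cring R" "y \<in> carrier (free_module R B)" "z \<in> carrier (free_module R B)"
  shows "(\<lambda>b. y b \<oplus>\<^bsub>R\<^esub> z b) \<in> carrier (free_module R B)"
proof -
  interpret cring R by fact
  have "finite {b. y b \<oplus> z b \<noteq> \<zero>}"
    by (rule finite_subset[of _ "{b. y b \<noteq> \<zero>} \<union> {b. z b \<noteq> \<zero>}"])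
       (use assms in \<open>auto simp: carrier_free_module\<close>)
  then show ?thesis using assms by (auto simp: carrier_free_module)
qed

lemma free_module_smult_closed:
  fixes R (structure)
  assumes "cring R" "r \<in> carrier R" "z \<in> carrier (free_module R B)"
  shows "(\<lambda>b. r \<otimes>\<^bsub>R\<^esub> z b) \<in> carrier (free_module R B)"
proof -
  interpret cring R by fact
  have "finite {b. r \<otimes> z b \<noteq> \<zero>}"
    by (rule finite_subset[of _ "{b. z b \<noteq> \<zero>}"])
       (use assms in \<open>auto simp: carrier_free_module\<close>)
  then show ?thesis using assms by (auto simp: carrier_free_module)
qed

lemma module_free_module:
  fixes R (structure)
  assumes "cring R"
  shows "module R (free_module R B)"
proof -
  interpret cring R by fact
  show ?thesis
  proof (rule moduleI)
    show "abelian_group (free_module R B)"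
    proof (rule abelian_groupI)
      fix x assume x: "x \<in> carrier (free_module R B)"
      let ?y = "\<lambda>b. \<ominus> x b"
      have "{b. \<ominus> x b \<noteq> \<zero>} \<subseteq> {b. x b \<noteq> \<zero>}" by auto
      then have "?y \<in> carrier (free_module R B)"
        using x by (auto simp: carrier_free_module intro: finite_subset)
      moreover have "?y \<oplus>\<^bsub>free_module R B\<^esub> x = \<zero>\<^bsub>free_module R B\<^esub>"
        using x by (auto simp: carrier_free_module l_neg)
      ultimately show "\<exists>y\<in>carrier (free_module R B). y \<oplus>\<^bsub>free_module R B\<^esub> x = \<zero>\<^bsub>free_module R B\<^esub>"
        by blast
    next
      fix x y z
      assume *: "x \<in> carrier (free_module R B)" "y \<in> carrier (free_module R B)"
      show "x \<oplus>\<^bsub>free_module R B\<^esub> y = y \<oplus>\<^bsub>free_module R B\<^esub> x"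
        using * by (simp add: carrier_free_module a_comm)
      show "x \<oplus>\<^bsub>free_module R B\<^esub> y \<in> carrier (free_module R B)"
        using * free_module_add_closed assms by simp
      assume "z \<in> carrier (free_module R B)"
      then show "x \<oplus>\<^bsub>free_module R B\<^esub> y \<oplus>\<^bsub>free_module R B\<^esub> z =
          x \<oplus>\<^bsub>free_module R B\<^esub> (y \<oplus>\<^bsub>free_module R B\<^esub> z)"
        using * by (simp add: carrier_free_module a_assoc)
    qed (auto simp: carrier_free_module)
  next
    fix a x assume "a \<in> carrier R" "x \<in> carrier (free_module R B)"
    then show "a \<odot>\<^bsub>free_module R B\<^esub> x \<in> carrier (free_module R B)"
      using free_module_smult_closed assms by simp
  qed (use assms in \<open>auto simp: carrier_free_module l_distr r_distr m_assoc\<close>)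
qed

lemma linear_extension_superset:
  fixes R (structure)
  assumes "module R X" "z \<in> carrier (free_module R B)" "f \<in> B \<rightarrow> carrier X"
    and "finite S" "{b. z b \<noteq> \<zero>\<^bsub>R\<^esub>} \<subseteq> S" "S \<subseteq> B"
  shows "linear_extension R X f z = (\<Oplus>\<^bsub>X\<^esub> b \<in> S. z b \<odot>\<^bsub>X\<^esub> f b)"
proof -
  interpret module R X by fact
  show ?thesis unfolding linear_extension_def
    by (rule M.add.finprod_mono_neutral_cong_left)
       (use assms in \<open>auto simp: carrier_free_module Pi_iff\<close>)
qed

lemma free_support: "z \<in> carrier (free_module R B) \<Longrightarrow> {b. z b \<noteq> \<zero>\<^bsub>R\<^esub>} \<subseteq> B"
  by (auto simp: carrier_free_module)

lemma linear_extension_closed: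
  fixes R (structure)
  assumes "module R X" "z \<in> carrier (free_module R B)" "f \<in> B \<rightarrow> carrier X"
  shows "linear_extension R X f z \<in> carrier X"
proof -
  interpret module R X by fact
  show ?thesis unfolding linear_extension_def
    using assms free_support[OF assms(2)]
    by (intro M.finsum_closed) (auto simp: carrier_free_module Pi_iff)
qed

lemma linear_extension_add:
  fixes R (structure)
  assumes "module R X" "y \<in> carrier (free_module R B)" "z \<in> carrier (free_module R B)"
    and "f \<in> B \<rightarrow> carrier X"
  shows "linear_extension R X f (\<lambda>b. y b \<oplus>\<^bsub>R\<^esub> z b) =
    linear_extension R X f y \<oplus>\<^bsub>X\<^esub> linear_extension R X f z"
proof -
  interpret module R X by fact
  let ?S = "{b. y b \<noteq> \<zero>} \<union> {b. z b \<noteq> \<zero>}"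
  have S: "finite ?S" "?S \<subseteq> B" using assms by (auto simp: carrier_free_module)
  have yz: "(\<lambda>b. y b \<oplus> z b) \<in> carrier (free_module R B)"
    using free_module_add_closed assms R.is_cring by blast
  have sub: "{b. y b \<oplus> z b \<noteq> \<zero>} \<subseteq> ?S" by auto
  have "linear_extension R X f (\<lambda>b. y b \<oplus>\<^bsub>R\<^esub> z b) = (\<Oplus>\<^bsub>X\<^esub> b \<in> ?S. (y b \<oplus> z b) \<odot>\<^bsub>X\<^esub> f b)"
    by (rule linear_extension_superset[OF assms(1) yz assms(4) S(1) sub S(2)])
  also have "\<dots> = (\<Oplus>\<^bsub>X\<^esub> b \<in> ?S. y b \<odot>\<^bsub>X\<^esub> f b \<oplus>\<^bsub>X\<^esub> z b \<odot>\<^bsub>X\<^esub> f b)"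
    by (rule M.finsum_cong') (use assms S in \<open>auto simp: carrier_free_module Pi_iff smult_l_distr\<close>)
  also have "\<dots> = (\<Oplus>\<^bsub>X\<^esub> b \<in> ?S. y b \<odot>\<^bsub>X\<^esub> f b) \<oplus>\<^bsub>X\<^esub> (\<Oplus>\<^bsub>X\<^esub> b \<in> ?S. z b \<odot>\<^bsub>X\<^esub> f b)"
    by (rule M.finsum_addf) (use assms S in \<open>auto simp: carrier_free_module Pi_iff\<close>)
  also have "(\<Oplus>\<^bsub>X\<^esub> b \<in> ?S. y b \<odot>\<^bsub>X\<^esub> f b) = linear_extension R X f y"
    by (rule linear_extension_superset[symmetric, OF assms(1,2,4) S(1) _ S(2)]) auto
  also have "(\<Oplus>\<^bsub>X\<^esub> b \<in> ?S. z b \<odot>\<^bsub>X\<^esub> f b) = linear_extension R X f z"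
    by (rule linear_extension_superset[symmetric, OF assms(1,3,4) S(1) _ S(2)]) auto
  finally show ?thesis .
qed

lemma linear_extension_smult:
  fixes R (structure)
  assumes "module R X" "r \<in> carrier R" "z \<in> carrier (free_module R B)"
    and "f \<in> B \<rightarrow> carrier X"
  shows "linear_extension R X f (\<lambda>b. r \<otimes>\<^bsub>R\<^esub> z b) = r \<odot>\<^bsub>X\<^esub> linear_extension R X f z"
proof -
  interpret module R X by fact
  let ?S = "{b. z b \<noteq> \<zero>}"
  have S: "finite ?S" "?S \<subseteq> B" using assms by (auto simp: carrier_free_module)
  have rz: "(\<lambda>b. r \<otimes> z b) \<in> carrier (free_module R B)"
    by (rule free_module_smult_closed[OF R.is_cring assms(2,3)])
  have sub: "{b. r \<otimes> z b \<noteq> \<zero>} \<subseteq> ?S" using assms by auto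
  have "linear_extension R X f (\<lambda>b. r \<otimes> z b) = (\<Oplus>\<^bsub>X\<^esub> b \<in> ?S. (r \<otimes> z b) \<odot>\<^bsub>X\<^esub> f b)"
    by (rule linear_extension_superset[OF assms(1) rz assms(4) S(1) sub S(2)])
  also have "\<dots> = (\<Oplus>\<^bsub>X\<^esub> b \<in> ?S. r \<odot>\<^bsub>X\<^esub> (z b \<odot>\<^bsub>X\<^esub> f b))"
    by (rule M.finsum_cong') (use assms S in \<open>auto simp: carrier_free_module Pi_iff smult_assoc1\<close>)
  also have "\<dots> = r \<odot>\<^bsub>X\<^esub> linear_extension R X f z"
    unfolding linear_extension_def
    by (rule finsum_smult_ldistr[symmetric]) (use assms S in \<open>auto simp: carrier_free_module Pi_iff\<close>)
  finally show ?thesis .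
qed

lemma free_gen_closed:
  fixes R (structure)
  assumes "cring R" "b \<in> B" shows "free_gen R b \<in> carrier (free_module R B)"
proof -
  interpret cring R by fact
  have "{c. free_gen R b c \<noteq> \<zero>} \<subseteq> {b}" by (auto simp: free_gen_def)
  then have "finite {c. free_gen R b c \<noteq> \<zero>}" using finite_subset by blast
  then show ?thesis using assms by (auto simp: carrier_free_module free_gen_def)
qed

lemma linear_extension_gen:
  fixes R (structure)
  assumes "module R X" "b \<in> B" "f \<in> B \<rightarrow> carrier X"
  shows "linear_extension R X f (free_gen R b) = f b"
proof -
  interpret module R X by fact
  have "linear_extension R X f (free_gen R b) = (\<Oplus>\<^bsub>X\<^esub> c \<in> {b}. free_gen R b c \<odot>\<^bsub>X\<^esub> f c)"
    by (rule linear_extension_superset[OF assms(1) free_gen_closed[OF R.is_cring assms(2)] assms(3)])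
       (use assms in \<open>auto simp: free_gen_def\<close>)
  also have "\<dots> = f b" using assms by (auto simp: free_gen_def Pi_iff)
  finally show ?thesis .
qed

lemma lin_comb_closed:
  fixes R (structure)
  assumes "cring R" "set xs \<subseteq> carrier R \<times> B"
  shows "lin_comb R xs \<in> carrier (free_module R B)"
  using assms(2)
proof (induction xs)
  case Nil
  interpret cring R by fact
  show ?case by (auto simp: carrier_free_module)
next
  case (Cons p xs)
  interpret cring R by fact
  obtain r g where p: "p = (r, g)" by force
  let ?z = "lin_comb R xs"
  have z: "?z \<in> carrier (free_module R B)" using Cons by auto
  have "{b. (?z(g := r \<oplus> ?z g)) b \<noteq> \<zero>} \<subseteq> insert g {b. ?z b \<noteq> \<zero>}" by auto
  then have "finite {b. (?z(g := r \<oplus> ?z g)) b \<noteq> \<zero>}"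
    by (rule finite_subset) (use z in \<open>simp add: carrier_free_module\<close>)
  then show ?case using z Cons.prems p by (auto simp: carrier_free_module)
qed

lemma lin_comb_distinct:
  fixes R (structure)
  assumes "cring R" "\<And>b. z b \<in> carrier R" "distinct bs"
  shows "lin_comb R (map (\<lambda>b. (z b, b)) bs) = (\<lambda>b. if b \<in> set bs then z b else \<zero>\<^bsub>R\<^esub>)"
  using assms(3)
proof (induction bs)
  case (Cons b bs)
  interpret cring R by fact
  show ?case using Cons assms(2) by (auto simp: fun_eq_iff)
qed auto

lemma lin_comb_surj:
  fixes R (structure)
  assumes "cring R" "z \<in> carrier (free_module R B)"
  shows "\<exists>xs. set xs \<subseteq> carrier R \<times> B \<and> lin_comb R xs = z"
proof -
  obtain bs where bs: "set bs = {b. z b \<noteq> \<zero>\<^bsub>R\<^esub>}" "distinct bs"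
    using assms(2) finite_distinct_list by (metis carrier_free_module)
  have "lin_comb R (map (\<lambda>b. (z b, b)) bs) = z"
    using lin_comb_distinct[OF assms(1) _ bs(2), of z] assms(2) bs(1)
    by (auto simp: carrier_free_module fun_eq_iff)
  moreover have "set (map (\<lambda>b. (z b, b)) bs) \<subseteq> carrier R \<times> B"
    using assms(2) bs(1) by (auto simp: carrier_free_module)
  ultimately show ?thesis by blast
qed

abbreviation (input) "aug_fun M \<equiv> (\<lambda>g. case g of Gen x \<Rightarrow> x | Syz _ \<Rightarrow> \<zero>\<^bsub>M\<^esub>)"
abbreviation (input) "diff_fun R \<equiv> (\<lambda>g. case g of Gen _ \<Rightarrow> (\<lambda>_. \<zero>\<^bsub>R\<^esub>) | Syz xs \<Rightarrow> lin_comb R xs)"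

lemma res_basis_Suc_elim:
  fixes R (structure)
  assumes "g \<in> res_basis R M (Suc n)"
  obtains xs where "g = Syz xs" "set xs \<subseteq> carrier R \<times> res_basis R M n"
    "if n = 0 then res_aug R M (lin_comb R xs) = \<zero>\<^bsub>M\<^esub>
      else res_diff R (lin_comb R xs) = (\<lambda>_. \<zero>\<^bsub>R\<^esub>)"
  using assms by auto

lemma diff_fun: "cring R \<Longrightarrow> diff_fun R \<in> res_basis R M (Suc n) \<rightarrow> carrier (res_module R M n)"
  by (auto simp: res_module_def intro!: lin_comb_closed)

lemma diff_fun':
  fixes R (structure)
  assumes "cring R"
  shows "diff_fun R \<in> res_basis R M n \<rightarrow> carrier (free_module R UNIV)"
proof -
  interpret cring R by fact
  show ?thesis
  proof (cases n)
    case 0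
    then show ?thesis by (auto simp: carrier_free_module)
  next
    case (Suc k)
    have "carrier (res_module R M k) \<subseteq> carrier (free_module R UNIV)"
      by (auto simp: res_module_def carrier_free_module)
    then show ?thesis using diff_fun[OF assms, of M k] Suc by blast
  qed
qed

lemma aug_fun: "module R M \<Longrightarrow> aug_fun M \<in> res_basis R M 0 \<rightarrow> carrier M"
  by auto

lemma finsum_free_UNIV:
  fixes R (structure)
  assumes "cring R" "h \<in> S \<rightarrow> carrier (free_module R B)"
  shows "finsum (free_module R UNIV) h S = finsum (free_module R B) h S"
proof -
  interpret U: module R "free_module R UNIV" using assms module_free_module by blast
  interpret B: module R "free_module R B" using assms module_free_module by blast
  have sub: "carrier (free_module R B) \<subseteq> carrier (free_module R UNIV)"
    by (auto simp: carrier_free_module)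
  show ?thesis
  proof (cases "finite S")
    case True
    then show ?thesis using assms(2)
    proof (induction S)
      case (insert x F)
      then have "h \<in> F \<rightarrow> carrier (free_module R UNIV)" "h x \<in> carrier (free_module R UNIV)"
        using sub by auto
      then show ?case using insert by auto
    qed simp
  qed (simp add: finsum_def finprod_def)
qed

lemma res_diff_closed:
  fixes R (structure)
  assumes "cring R" "z \<in> carrier (res_module R M (Suc n))"
  shows "res_diff R z \<in> carrier (res_module R M n)"
proof -
  interpret B: module R "res_module R M n" using assms module_free_module unfolding res_module_def by blast
  have *: "(\<lambda>b. z b \<odot>\<^bsub>free_module R UNIV\<^esub> diff_fun R b) \<in> {b. z b \<noteq> \<zero>\<^bsub>R\<^esub>} \<rightarrow> carrier (res_module R M n)"
  proof
    fix b assume "b \<in> {b. z b \<noteq> \<zero>\<^bsub>R\<^esub>}"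
    then have "b \<in> res_basis R M (Suc n)" "z b \<in> carrier R"
      using assms(2) by (auto simp: res_module_def carrier_free_module simp del: res_basis.simps)
    then show "z b \<odot>\<^bsub>free_module R UNIV\<^esub> diff_fun R b \<in> carrier (res_module R M n)"
      using diff_fun[OF assms(1), of M n] B.smult_closed[of "z b" "diff_fun R b"]
      by (simp add: res_module_def Pi_iff del: res_basis.simps)
  qed
  show ?thesis unfolding res_diff_def linear_extension_def
    using finsum_free_UNIV[OF assms(1) *[unfolded res_module_def]] B.M.finsum_closed[OF *]
    by (simp add: res_module_def)
qed

lemma linear_finsum_zero:
  fixes R (structure)
  assumes "module R X" "module R Y"
    and "\<And>x. x \<in> carrier X \<Longrightarrow> f x \<in> carrier Y"
    and "\<And>x y. x \<in> carrier X \<Longrightarrow> y \<in> carrier X \<Longrightarrow> f (x \<oplus>\<^bsub>X\<^esub> y) = f x \<oplus>\<^bsub>Y\<^esub> f y"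
    and "f \<zero>\<^bsub>X\<^esub> = \<zero>\<^bsub>Y\<^esub>"
    and "finite S" "h \<in> S \<rightarrow> carrier X" "\<And>b. b \<in> S \<Longrightarrow> f (h b) = \<zero>\<^bsub>Y\<^esub>"
  shows "f (finsum X h S) = \<zero>\<^bsub>Y\<^esub>"
proof -
  interpret X: module R X by fact
  interpret Y: module R Y by fact
  show ?thesis using assms(6-8)
  proof (induction S)
    case (insert x F)
    then have "h \<in> F \<rightarrow> carrier X" "h x \<in> carrier X" by auto
    with insert assms(4) show ?case by simp
  qed (use assms(5) in simp)
qed

lemma lin_zero: "module R X \<Longrightarrow> linear_extension R X f (\<lambda>b. \<zero>\<^bsub>R\<^esub>) = \<zero>\<^bsub>X\<^esub>"
  by (simp add: linear_extension_def module_def abelian_group_def abelian_monoid.finsum_empty)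

lemma res_aug_surj:
  fixes R (structure)
  assumes "module R M"
  shows "res_aug R M ` carrier (res_module R M 0) = carrier M"
proof -
  interpret module R M by fact
  have "res_aug R M (free_gen R (Gen x)) = x" if "x \<in> carrier M" for x
    unfolding res_aug_def
    by (subst linear_extension_gen[OF assms _ aug_fun[OF assms]]) (use that in auto)
  moreover have "free_gen R (Gen x) \<in> carrier (res_module R M 0)" if "x \<in> carrier M" for x
    using that free_gen_closed[OF R.is_cring, of "Gen x" "Gen ` carrier M"] by (simp add: res_module_def)
  moreover have "res_aug R M z \<in> carrier M" if "z \<in> carrier (res_module R M 0)" for z
    using linear_extension_closed[OF assms _ aug_fun[OF assms], of z] that
    by (auto simp: res_module_def res_aug_def)
  ultimately show ?thesis by (metis (no_types, lifting) image_eqI image_subsetI subsetI subset_antisym)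
qed

lemma res_exact_aux:
  fixes R (structure)
  assumes M: "module R M"
    and Y: "module R Y" and f: "f \<in> res_basis R M n \<rightarrow> carrier Y"
    and cyc: "\<And>xs. set xs \<subseteq> carrier R \<times> res_basis R M n \<Longrightarrow>
        Syz xs \<in> res_basis R M (Suc n) \<longleftrightarrow> linear_extension R Y f (lin_comb R xs) = \<zero>\<^bsub>Y\<^esub>"
  shows "{z \<in> carrier (res_module R M n). linear_extension R Y f z = \<zero>\<^bsub>Y\<^esub>} =
    res_diff R ` carrier (res_module R M (Suc n))" (is "?A = ?B")
proof
  interpret module R M by fact
  interpret B: module R "free_module R (res_basis R M n)" using R.is_cring module_free_module by blast
  show "?A \<subseteq> ?B"
  proof
    fix z assume z: "z \<in> ?A"
    then obtain xs where xs: "set xs \<subseteq> carrier R \<times> res_basis R M n" "lin_comb R xs = z"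
      using lin_comb_surj[OF R.is_cring] unfolding res_module_def by blast
    then have S: "Syz xs \<in> res_basis R M (Suc n)" using cyc z by auto
    have "res_diff R (free_gen R (Syz xs)) = z"
      unfolding res_diff_def
      using linear_extension_gen[OF module_free_module[OF R.is_cring] S diff_fun'[OF R.is_cring]] xs by simp
    moreover have "free_gen R (Syz xs) \<in> carrier (res_module R M (Suc n))"
      using free_gen_closed[OF R.is_cring S] by (simp add: res_module_def)
    ultimately show "z \<in> ?B" by blast
  qed
  show "?B \<subseteq> ?A"
  proof
    fix y assume "y \<in> ?B"
    then obtain z where z: "z \<in> carrier (res_module R M (Suc n))" "y = res_diff R z" by blast
    let ?S = "{b. z b \<noteq> \<zero>}" and ?h = "\<lambda>b. z b \<odot>\<^bsub>free_module R UNIV\<^esub> diff_fun R b"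
    have S: "b \<in> res_basis R M (Suc n)" "z b \<in> carrier R" if "b \<in> ?S" for b
      using that z(1) by (auto simp: res_module_def carrier_free_module simp del: res_basis.simps)
    have d: "diff_fun R b \<in> carrier (free_module R (res_basis R M n))" if "b \<in> ?S" for b
      using diff_fun[OF R.is_cring, of M n] S(1)[OF that] by (simp add: res_module_def Pi_iff del: res_basis.simps)
    have h: "?h \<in> ?S \<rightarrow> carrier (free_module R (res_basis R M n))"
      using free_module_smult_closed[OF R.is_cring S(2) d] by (simp add: Pi_iff)
    have y: "y = finsum (free_module R (res_basis R M n)) ?h ?S"
      using finsum_free_UNIV[OF R.is_cring h] z(2)
      by (simp add: res_diff_def linear_extension_def)
    have "linear_extension R Y f (finsum (free_module R (res_basis R M n)) ?h ?S) = \<zero>\<^bsub>Y\<^esub>"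
    proof (rule linear_finsum_zero[OF B.module_axioms Y _ _ _ _ h])
      fix b assume b: "b \<in> ?S"
      obtain xs where xs: "b = Syz xs" "set xs \<subseteq> carrier R \<times> res_basis R M n"
        using S(1)[OF b] by (elim res_basis_Suc_elim)
      have "linear_extension R Y f (diff_fun R b) = \<zero>\<^bsub>Y\<^esub>"
        using cyc[OF xs(2)] S(1)[OF b] xs(1) by simp
      then show "linear_extension R Y f (?h b) = \<zero>\<^bsub>Y\<^esub>"
        using linear_extension_smult[OF Y S(2)[OF b] d[OF b] f] module.smult_r_null[OF Y S(2)[OF b]]
        by simp
    qed (use z in \<open>auto simp: linear_extension_closed[OF Y _ f] linear_extension_add[OF Y _ _ f]
          lin_zero[OF Y] res_module_def carrier_free_module\<close>)
    moreover have "y \<in> carrier (res_module R M n)"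
      using res_diff_closed[OF R.is_cring z(1)] z(2) by simp
    ultimately show "y \<in> ?A" using y by simp
  qed
qed

lemma res_exact_0:
  fixes R (structure)
  assumes "module R M"
  shows "a_kernel (res_module R M 0) M (res_aug R M) = res_diff R ` carrier (res_module R M 1)"
  using res_exact_aux[OF assms assms aug_fun[OF assms]]
  by (simp add: a_kernel_def kernel_def res_aug_def)

lemma res_exact_Suc:
  fixes R (structure)
  assumes "module R M"
  shows "a_kernel (res_module R M (Suc n)) (res_module R M n) (res_diff R) =
     res_diff R ` carrier (res_module R M (Suc (Suc n)))"
proof -
  interpret module R M by fact
  show ?thesis
    using res_exact_aux[OF assms module_free_module[OF R.is_cring, of UNIV] diff_fun'[OF R.is_cring, of M "Suc n"]]
    by (simp add: a_kernel_def kernel_def res_diff_def res_module_def)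
qed


section \<open>Ext and Tor\<close>

definition Ext_cochain where
  "Ext_cochain R M X n = Hom_module R (res_module R M n) X"

definition Ext_diff where
  "Ext_diff R M n f = restrict (f \<circ> res_diff R) (carrier (res_module R M (Suc n)))"

definition Ext_coboundaries where
  "Ext_coboundaries R M X n = (case n of
     0 \<Rightarrow> {\<zero>\<^bsub>Ext_cochain R M X 0\<^esub>}
   | Suc k \<Rightarrow> Ext_diff R M k ` carrier (Ext_cochain R M X k))"

definition Ext :: "('a, 'r) ring_scheme \<Rightarrow> nat \<Rightarrow> ('a, 'm, 'e) module_scheme \<Rightarrow>
    ('a, 'n, 'f) module_scheme \<Rightarrow> ('a, ((('a, 'm) res_gen \<Rightarrow> 'a) \<Rightarrow> 'n) set) module" where
  "Ext R i M X =
     quotient_module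
       ((Ext_cochain R M X i)\<lparr>carrier :=
          a_kernel (Ext_cochain R M X i) (Ext_cochain R M X (Suc i)) (Ext_diff R M i)\<rparr>)
       (Ext_coboundaries R M X i)"

definition Tor_chain where
  "Tor_chain R M X n = tensor_module R (res_module R M n) X"

definition Tor_diff where
  "Tor_diff R M X n = tensor_map R (res_module R M n) X (res_diff R)"

definition Tor_cycles where
  "Tor_cycles R M X n = (case n of
     0 \<Rightarrow> carrier (Tor_chain R M X 0)
   | Suc k \<Rightarrow> a_kernel (Tor_chain R M X (Suc k)) (Tor_chain R M X k) (Tor_diff R M X k))"

definition Tor :: "('a, 'r) ring_scheme \<Rightarrow> nat \<Rightarrow> ('a, 'm, 'e) module_scheme \<Rightarrow>
    ('a, 'n, 'f) module_scheme \<Rightarrow>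
    ('a, (((('a, 'm) res_gen \<Rightarrow> 'a) \<times> 'n \<Rightarrow> 'a) set) set) module" where
  "Tor R i M X =
     quotient_module
       ((Tor_chain R M X i)\<lparr>carrier := Tor_cycles R M X i\<rparr>)
       (Tor_diff R M X i ` carrier (Tor_chain R M X (Suc i)))"

end

theory Submission
  imports Defs "HOL-Library.Multiset"
begin

text \<open>Put \<open>Y\<^sub>n = I\<^sup>n N'\<close>. Inside the canonical free resolution of \<open>M\<close> choose a subresolution whose terms
  have finite bases. On each term of the large resolution the identity is \<open>p + \<partial>h + h\<partial>\<close> with \<open>p\<close>
  mapping into the subresolution, so Ext and Tor with values in \<open>N/Y\<^sub>n\<close> can be computed from the
  subresolution. Writing out the (co)cycles, a prime \<open>P\<close> is associated to them iff
  \<open>P = (D + Y\<^sub>n\<^sup>B : u)\<close> for some \<open>u\<close> in a finite sum \<open>N\<^sup>B\<close> with \<open>g u \<in> Y\<^sub>n\<^sup>C\<close>, where neither the linear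
  map \<open>g\<close> nor the submodule \<open>D\<close> depends on \<open>n\<close>.

  Only finitely many primes \<open>P\<close> occur for all \<open>n\<close> together. Filtering by the quotients of
  \<open>D + Y\<^sub>n\<^sup>B\<close> by the same module for \<open>n + e\<^sub>j\<close>, one has to bound the primes of \<open>(D + Y\<^sub>n\<^sup>B)/J\<^sub>n\<close> for a
  graded family of submodules \<open>J\<^sub>n\<close> that contain \<open>D\<close>. These families satisfy the ascending chain
  condition. If \<open>Q\<close> is maximal among the annihilators of nonzero elements of the quotients, then adding to each
  \<open>J\<^sub>n\<close> all elements that \<open>Q\<close> moves into \<open>J\<^sub>n\<close> loses at most the prime \<open>Q\<close>.

  Fix \<open>P\<close> and let \<open>T\<^sub>n\<close> be the set of all \<open>u\<close> with \<open>g u \<in> Y\<^sub>n\<^sup>C\<close> and \<open>P u \<subseteq> D + Y\<^sub>n\<^sup>B\<close>. Then \<open>P\<close> is not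
  associated at \<open>n\<close> iff every \<open>u \<in> T\<^sub>n\<close> is moved into \<open>D + Y\<^sub>n\<^sup>B\<close> by some \<open>s \<notin> P\<close>. By Artin--Rees,
  for large \<open>n\<close> and \<open>n' = n + e\<^sub>j\<close>, the module \<open>T\<^sub>n\<^sub>'\<close> is generated by \<open>I\<^sub>j T\<^sub>n\<close> and the \<open>u \<in> T\<^sub>n\<^sub>'\<close> with
  \<open>g u = 0\<close> and \<open>P u \<subseteq> D\<close>. If \<open>I\<^sub>j\<close> is not contained in \<open>P\<close>, some element of \<open>I\<^sub>j\<close> outside \<open>P\<close> moves
  \<open>D + Y\<^sub>n\<^sup>B\<close> into \<open>D + Y\<^sub>n\<^sub>'\<^sup>B\<close>; otherwise a second application of Artin--Rees moves the generators
  of the second kind even into \<open>D\<close>. So \<open>P\<close> is not associated at \<open>n + e\<^sub>j\<close> either, and membership of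
  each of the finitely many primes is eventually constant.

  Artin--Rees for several ideals is proved without Rees algebras. Monomials in fixed generators
  of the ideals are ordered linearly, the submodules of leading coefficients are compared, and
  Dickson's lemma bounds the exponents. An exponent vector \<open>n\<close> is represented by the
  multiset in which \<open>j\<close> has multiplicity \<open>n\<^sub>j\<close>.\<close>

section \<open>Submodules and linear maps\<close>

text \<open>Two obstacles shape the proof. The canonical resolution is free on very large sets, so
  its cochains satisfy no chain condition. The comparison with a finite subresolution is made over R
  alone, by a homotopy; it therefore holds for every coefficient module at once, and the same finite
  bases serve for all n. Secondly, the modules N/Y_n are not the components of one finitely
  generated graded module: the elements with g u = 0 and the submodule D stay the same while Y_n
  shrinks. Artin--Rees is therefore always used relative to fixed data: it splits a family into a
  part that no longer depends on n and a part generated from one degree below. The comparison of n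
  with n + e_j works in one direction only: being non-associated is passed upwards. This is enough
  for a single prime, which is either associated at every large n or missing at some large n and
  then missing everywhere above it. But the threshold depends on the prime, so the finiteness of the
  set of all primes that ever occur has to be proved beforehand and independently of
  stability.\<close>

context module
begin

lemma submodule_span_incl: "S \<subseteq> submodule_span R M S"
  by (auto simp: submodule_span_def)

lemma submodule_span_least: "submodule H R M \<Longrightarrow> S \<subseteq> H \<Longrightarrow> submodule_span R M S \<subseteq> H"
  by (auto simp: submodule_span_def)

lemma submodule_zero_closed: "submodule H R M \<Longrightarrow> \<zero>\<^bsub>M\<^esub> \<in> H"
  using submodule.axioms(1) subgroup.one_closed by fastforce

lemma submodule_Inter:
  assumes "\<A> \<noteq> {}" "\<And>H. H \<in> \<A> \<Longrightarrow> submodule H R M"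
  shows "submodule (\<Inter>\<A>) R M"
proof (rule submoduleI)
  show "\<Inter>\<A> \<subseteq> carrier M" using assms submoduleE(1) by blast
  show "\<zero>\<^bsub>M\<^esub> \<in> \<Inter>\<A>" using assms(2) submodule_zero_closed by blast
  show "\<ominus>\<^bsub>M\<^esub> a \<in> \<Inter>\<A>" if "a \<in> \<Inter>\<A>" for a
    using that submoduleE(3)[OF assms(2)] by blast
  show "a \<oplus>\<^bsub>M\<^esub> b \<in> \<Inter>\<A>" if "a \<in> \<Inter>\<A>" "b \<in> \<Inter>\<A>" for a b
    using that submoduleE(5)[OF assms(2)] by blast
  show "r \<odot>\<^bsub>M\<^esub> a \<in> \<Inter>\<A>" if "r \<in> carrier R" "a \<in> \<Inter>\<A>" for r a
    using that submoduleE(4)[OF assms(2)] by blast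
qed

lemma submodule_span_submodule:
  assumes "S \<subseteq> carrier M"
  shows "submodule (submodule_span R M S) R M"
  unfolding submodule_span_def
  by (rule submodule_Inter) (use assms carrier_is_submodule in auto)

lemma submodule_span_mono:
  assumes "S \<subseteq> submodule_span R M T" "T \<subseteq> carrier M"
  shows "submodule_span R M S \<subseteq> submodule_span R M T"
  using assms submodule_span_least submodule_span_submodule by blast

lemma submodule_span_subset_carrier: "S \<subseteq> carrier M \<Longrightarrow> submodule_span R M S \<subseteq> carrier M"
  by (simp add: submodule_span_least carrier_is_submodule)

lemma submodule_span_self: "submodule H R M \<Longrightarrow> submodule_span R M H = H"
  by (simp add: submodule_span_least submodule_span_incl subset_antisym)

lemma submoduleI':
  assumes "H \<subseteq> carrier M" "\<zero>\<^bsub>M\<^esub> \<in> H"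
    and "\<And>a b. a \<in> H \<Longrightarrow> b \<in> H \<Longrightarrow> a \<oplus>\<^bsub>M\<^esub> b \<in> H"
    and "\<And>r x. r \<in> carrier R \<Longrightarrow> x \<in> H \<Longrightarrow> r \<odot>\<^bsub>M\<^esub> x \<in> H"
  shows "submodule H R M"
proof (rule submoduleI)
  fix a assume a: "a \<in> H"
  then have "\<ominus>\<^bsub>M\<^esub> a = (\<ominus>\<^bsub>R\<^esub> \<one>\<^bsub>R\<^esub>) \<odot>\<^bsub>M\<^esub> a"
    using assms(1) smult_l_minus[of "\<one>\<^bsub>R\<^esub>" a] by auto
  then show "\<ominus>\<^bsub>M\<^esub> a \<in> H" using assms(4) a by simp
qed (use assms in auto)

lemma submodule_span_induct [consumes 1, case_names carrier zero gen add smult]: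
  assumes "x \<in> submodule_span R M S" "S \<subseteq> carrier M"
    and "P \<zero>\<^bsub>M\<^esub>"
    and "\<And>x. x \<in> S \<Longrightarrow> P x"
    and "\<And>x y. x \<in> carrier M \<Longrightarrow> y \<in> carrier M \<Longrightarrow> P x \<Longrightarrow> P y \<Longrightarrow> P (x \<oplus>\<^bsub>M\<^esub> y)"
    and "\<And>r x. r \<in> carrier R \<Longrightarrow> x \<in> carrier M \<Longrightarrow> P x \<Longrightarrow> P (r \<odot>\<^bsub>M\<^esub> x)"
  shows "P x"
proof -
  have "submodule {x \<in> carrier M. P x} R M"
    by (rule submoduleI') (use assms in auto)
  then show ?thesis using submodule_span_least[of "{x \<in> carrier M. P x}" S] assms by blast
qed

lemma add_add_swap:
  assumes "a \<in> carrier M" "b \<in> carrier M" "c \<in> carrier M" "d \<in> carrier M"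
  shows "(a \<oplus>\<^bsub>M\<^esub> b) \<oplus>\<^bsub>M\<^esub> (c \<oplus>\<^bsub>M\<^esub> d) = (a \<oplus>\<^bsub>M\<^esub> c) \<oplus>\<^bsub>M\<^esub> (b \<oplus>\<^bsub>M\<^esub> d)"
  using assms by (simp add: M.a_ac)

lemma submodule_span_Un:
  assumes "S \<subseteq> carrier M" "T \<subseteq> carrier M" "x \<in> submodule_span R M (S \<union> T)"
  obtains a b where "a \<in> submodule_span R M S" "b \<in> submodule_span R M T" "x = a \<oplus>\<^bsub>M\<^esub> b"
proof -
  note SS = submodule_span_submodule[OF assms(1)] and ST = submodule_span_submodule[OF assms(2)]
  have "\<exists>a b. a \<in> submodule_span R M S \<and> b \<in> submodule_span R M T \<and> x = a \<oplus>\<^bsub>M\<^esub> b"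
    using assms(3)
  proof (induction rule: submodule_span_induct)
    case carrier
    then show ?case using assms by auto
  next
    case zero
    then show ?case using submodule_zero_closed SS ST M.zero_closed M.r_zero by metis
  next
    case (gen x)
    then have x: "x \<in> carrier M" using assms by auto
    show ?case
    proof (cases "x \<in> S")
      case True
      then have "x \<in> submodule_span R M S" using submodule_span_incl by blast
      then show ?thesis using submodule_zero_closed[OF ST] x M.r_zero by metis
    next
      case False
      then have "x \<in> submodule_span R M T" using submodule_span_incl gen by blast
      then show ?thesis using submodule_zero_closed[OF SS] x M.l_zero by metis
    qed
  next
    case (add x y)
    then obtain a b a' b' where *: "a \<in> submodule_span R M S" "b \<in> submodule_span R M T" "x = a \<oplus>\<^bsub>M\<^esub> b"
       "a' \<in> submodule_span R M S" "b' \<in> submodule_span R M T" "y = a' \<oplus>\<^bsub>M\<^esub> b'" by blast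
    then have "x \<oplus>\<^bsub>M\<^esub> y = (a \<oplus>\<^bsub>M\<^esub> a') \<oplus>\<^bsub>M\<^esub> (b \<oplus>\<^bsub>M\<^esub> b')"
      using submoduleE(1)[OF SS] submoduleE(1)[OF ST] by (auto intro!: add_add_swap)
    then show ?case using submoduleE(5)[OF SS *(1,4)] submoduleE(5)[OF ST *(2,5)] by blast
  next
    case (smult r x)
    then obtain a b where *: "a \<in> submodule_span R M S" "b \<in> submodule_span R M T" "x = a \<oplus>\<^bsub>M\<^esub> b" by blast
    then have "r \<odot>\<^bsub>M\<^esub> x = r \<odot>\<^bsub>M\<^esub> a \<oplus>\<^bsub>M\<^esub> r \<odot>\<^bsub>M\<^esub> b"
      using smult submoduleE(1)[OF SS] submoduleE(1)[OF ST] by (auto intro!: smult_r_distr)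
    then show ?case using submoduleE(4)[OF SS smult(1) *(1)] submoduleE(4)[OF ST smult(1) *(2)] by blast
  qed
  then show ?thesis using that by blast
qed

lemma submodule_Int:
  assumes "submodule H R M" "submodule K R M"
  shows "submodule (H \<inter> K) R M"
  using submodule_Inter[of "{H, K}"] assms by auto

lemma submodule_singleton_zero: "submodule {\<zero>\<^bsub>M\<^esub>} R M"
  by (rule submoduleI') auto

lemma submodule_add_cancel:
  assumes "submodule H R M" "x \<in> carrier M" "y \<in> H" "x \<oplus>\<^bsub>M\<^esub> y \<in> H"
  shows "x \<in> H"
proof -
  have y: "y \<in> carrier M" using submoduleE(1)[OF assms(1)] assms(3) by auto
  have "x = (x \<oplus>\<^bsub>M\<^esub> y) \<oplus>\<^bsub>M\<^esub> \<ominus>\<^bsub>M\<^esub> y"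
    using assms(2) y by (simp add: M.a_assoc M.r_neg)
  then show ?thesis using submoduleE(5)[OF assms(1,4) submoduleE(3)[OF assms(1,3)]] by simp
qed

lemma submodule_chain_Union:
  assumes "\<And>i::nat. submodule (H i) R M" "\<And>i. H i \<subseteq> H (Suc i)"
  shows "submodule (\<Union>i. H i) R M"
proof (rule submoduleI')
  have mono: "H i \<subseteq> H j" if "i \<le> j" for i j
    using assms(2) that by (rule lift_Suc_mono_le)
  show "(\<Union>i. H i) \<subseteq> carrier M" using submoduleE(1) assms by blast
  show "\<zero>\<^bsub>M\<^esub> \<in> (\<Union>i. H i)" using submodule_zero_closed assms by blast
  show "a \<oplus>\<^bsub>M\<^esub> b \<in> (\<Union>i. H i)" if ab: "a \<in> (\<Union>i. H i)" "b \<in> (\<Union>i. H i)" for a b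
  proof -
    obtain i j where "a \<in> H i" "b \<in> H j" using ab by auto
    then have "a \<in> H (max i j)" "b \<in> H (max i j)" using mono[of i "max i j"] mono[of j "max i j"] by auto
    then show ?thesis using submoduleE(5)[OF assms(1)] by blast
  qed
  show "r \<odot>\<^bsub>M\<^esub> x \<in> (\<Union>i. H i)" if "r \<in> carrier R" "x \<in> (\<Union>i. H i)" for r x
    using that submoduleE(4)[OF assms(1)] by blast
qed

end

text \<open>Unlike the elements of \<open>Hom_module\<close>, these functions need not be
  extensional, so composites, sums and coordinate projections can be used as plain terms.\<close>

definition linear_map ::
    "('a, 'r) ring_scheme \<Rightarrow> ('a, 'm, 'e) module_scheme \<Rightarrow> ('a, 'n, 'f) module_scheme \<Rightarrow>
     ('m \<Rightarrow> 'n) \<Rightarrow> bool" where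
  "linear_map R X Y f \<longleftrightarrow> f \<in> carrier X \<rightarrow> carrier Y \<and>
     (\<forall>x\<in>carrier X. \<forall>y\<in>carrier X. f (x \<oplus>\<^bsub>X\<^esub> y) = f x \<oplus>\<^bsub>Y\<^esub> f y) \<and>
     (\<forall>r\<in>carrier R. \<forall>x\<in>carrier X. f (r \<odot>\<^bsub>X\<^esub> x) = r \<odot>\<^bsub>Y\<^esub> f x)"

lemma linear_mapI:
  assumes "\<And>x. x \<in> carrier X \<Longrightarrow> f x \<in> carrier Y"
    and "\<And>x y. x \<in> carrier X \<Longrightarrow> y \<in> carrier X \<Longrightarrow> f (x \<oplus>\<^bsub>X\<^esub> y) = f x \<oplus>\<^bsub>Y\<^esub> f y"
    and "\<And>r x. r \<in> carrier R \<Longrightarrow> x \<in> carrier X \<Longrightarrow> f (r \<odot>\<^bsub>X\<^esub> x) = r \<odot>\<^bsub>Y\<^esub> f x"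
  shows "linear_map R X Y f"
  using assms by (auto simp: linear_map_def)

lemma linear_map_closed: "linear_map R X Y f \<Longrightarrow> x \<in> carrier X \<Longrightarrow> f x \<in> carrier Y"
  by (auto simp: linear_map_def)

lemma linear_map_add:
  "linear_map R X Y f \<Longrightarrow> x \<in> carrier X \<Longrightarrow> y \<in> carrier X \<Longrightarrow> f (x \<oplus>\<^bsub>X\<^esub> y) = f x \<oplus>\<^bsub>Y\<^esub> f y"
  by (auto simp: linear_map_def)

lemma linear_map_smult:
  "linear_map R X Y f \<Longrightarrow> r \<in> carrier R \<Longrightarrow> x \<in> carrier X \<Longrightarrow> f (r \<odot>\<^bsub>X\<^esub> x) = r \<odot>\<^bsub>Y\<^esub> f x"
  by (auto simp: linear_map_def)

lemma linear_map_zero: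
  fixes R (structure)
  assumes "module R X" "module R Y" "linear_map R X Y f"
  shows "f \<zero>\<^bsub>X\<^esub> = \<zero>\<^bsub>Y\<^esub>"
proof -
  interpret X: module R X by fact
  interpret Y: module R Y by fact
  have "f (\<zero> \<odot>\<^bsub>X\<^esub> \<zero>\<^bsub>X\<^esub>) = \<zero> \<odot>\<^bsub>Y\<^esub> f \<zero>\<^bsub>X\<^esub>"
    using assms by (intro linear_map_smult) auto
  then show ?thesis using linear_map_closed[OF assms(3)] by simp
qed

lemma linear_map_id: "linear_map R X X (\<lambda>x. x)"
  by (auto simp: linear_map_def)

lemma (in module) linear_map_scale:
  "r \<in> carrier R \<Longrightarrow> linear_map R M M (\<lambda>x. r \<odot>\<^bsub>M\<^esub> x)"
  by (rule linear_mapI) (auto simp: smult_r_distr smult_assoc1[symmetric] R.m_comm)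

lemma linear_map_neg:
  fixes R (structure)
  assumes "module R X" "module R Y" "linear_map R X Y f" "x \<in> carrier X"
  shows "f (\<ominus>\<^bsub>X\<^esub> x) = \<ominus>\<^bsub>Y\<^esub> f x"
proof -
  interpret X: module R X by fact
  interpret Y: module R Y by fact
  have fx: "f x \<in> carrier Y" using linear_map_closed assms by metis
  have "f (\<ominus>\<^bsub>X\<^esub> x) = f ((\<ominus> \<one>) \<odot>\<^bsub>X\<^esub> x)" using assms(4) X.smult_l_minus[of \<one> x] by simp
  also have "\<dots> = (\<ominus> \<one>) \<odot>\<^bsub>Y\<^esub> f x" using linear_map_smult[OF assms(3) _ assms(4)] by simp
  also have "\<dots> = \<ominus>\<^bsub>Y\<^esub> f x" using fx Y.smult_l_minus[of \<one> "f x"] by simp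
  finally show ?thesis .
qed

lemma submodule_vimage:
  fixes R (structure)
  assumes "module R X" "module R Y" "linear_map R X Y f" "submodule H R Y"
  shows "submodule {x \<in> carrier X. f x \<in> H} R X"
proof -
  interpret X: module R X by fact
  interpret Y: module R Y by fact
  show ?thesis
    by (rule X.submoduleI')
       (use assms Y.submoduleE[OF assms(4)] Y.submodule_zero_closed[OF assms(4)] linear_map_zero[OF assms(1-3)]
         in \<open>auto simp: linear_map_add[OF assms(3)] linear_map_smult[OF assms(3)]\<close>)
qed

lemma submodule_image:
  fixes R (structure)
  assumes "module R X" "module R Y" "linear_map R X Y f" "submodule H R X"
  shows "submodule (f ` H) R Y"
proof -
  interpret X: module R X by fact
  interpret Y: module R Y by fact
  note sub = X.submoduleE(1)[OF assms(4)]
  show ?thesis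
  proof (rule Y.submoduleI')
    show "f ` H \<subseteq> carrier Y" using sub linear_map_closed[OF assms(3)] by blast
    show "\<zero>\<^bsub>Y\<^esub> \<in> f ` H" using linear_map_zero[OF assms(1-3)] X.submodule_zero_closed[OF assms(4)]
      by (metis image_eqI)
    fix a b assume "a \<in> f ` H" "b \<in> f ` H"
    then obtain x y where *: "x \<in> H" "a = f x" "y \<in> H" "b = f y" by blast
    then show "a \<oplus>\<^bsub>Y\<^esub> b \<in> f ` H"
      using X.submoduleE(5)[OF assms(4) *(1,3)] linear_map_add[OF assms(3), of x y] sub
      by (metis image_eqI subsetD)
  next
    fix r a assume r: "r \<in> carrier R" and "a \<in> f ` H"
    then obtain x where *: "x \<in> H" "a = f x" by blast
    then show "r \<odot>\<^bsub>Y\<^esub> a \<in> f ` H"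
      using X.submoduleE(4)[OF assms(4) r *(1)] linear_map_smult[OF assms(3) r, of x] sub
      by (metis image_eqI subsetD)
  qed
qed

section \<open>Noetherian modules\<close>

definition noetherian_module :: "('a, 'r) ring_scheme \<Rightarrow> ('a, 'm, 'e) module_scheme \<Rightarrow> bool" where
  "noetherian_module R M \<longleftrightarrow> module R M \<and>
     (\<forall>H. submodule H R M \<longrightarrow> (\<exists>T\<subseteq>H. finite T \<and> submodule_span R M T = H))"

context module
begin

text \<open>This is the ideal (H + K : z). It serves twice: with K zero as the annihilator of z
  modulo H, and with K the span of the other generators as the ideal of coefficients of z in
  \<open>fg_submodules_of_fg\<close>.\<close>

lemma ideal_colon_modulo:
  assumes H: "submodule H R M" and K: "submodule K R M" and z: "z \<in> carrier M"
  shows "ideal {r \<in> carrier R. \<exists>k\<in>K. r \<odot>\<^bsub>M\<^esub> z \<oplus>\<^bsub>M\<^esub> k \<in> H} R"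
proof -
  define I where "I = {r \<in> carrier R. \<exists>k\<in>K. r \<odot>\<^bsub>M\<^esub> z \<oplus>\<^bsub>M\<^esub> k \<in> H}"
  have Kc: "K \<subseteq> carrier M" using submoduleE(1)[OF K] .
  have "ideal I R"
  proof (rule idealI)
    show "ring R" by unfold_locales
    show "subgroup I (add_monoid R)"
    proof (rule R.add.subgroupI)
      show "I \<noteq> {}" using submodule_zero_closed[OF H] submodule_zero_closed[OF K] z
        by (auto simp: I_def intro!: exI[of _ "\<zero>\<^bsub>R\<^esub>"] bexI[of _ "\<zero>\<^bsub>M\<^esub>"])
      fix r assume "r \<in> I"
      then obtain k where k: "r \<in> carrier R" "k \<in> K" "r \<odot>\<^bsub>M\<^esub> z \<oplus>\<^bsub>M\<^esub> k \<in> H" by (auto simp: I_def)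
      have "\<ominus>\<^bsub>M\<^esub> (r \<odot>\<^bsub>M\<^esub> z \<oplus>\<^bsub>M\<^esub> k) = (\<ominus>\<^bsub>R\<^esub> r) \<odot>\<^bsub>M\<^esub> z \<oplus>\<^bsub>M\<^esub> \<ominus>\<^bsub>M\<^esub> k"
        using k z Kc by (auto simp: M.minus_add smult_l_minus)
      then show "\<ominus>\<^bsub>R\<^esub> r \<in> I" using submoduleE(3)[OF H k(3)] submoduleE(3)[OF K k(2)] k(1)
        by (auto simp: I_def)
      fix s assume "s \<in> I"
      then obtain l where l: "s \<in> carrier R" "l \<in> K" "s \<odot>\<^bsub>M\<^esub> z \<oplus>\<^bsub>M\<^esub> l \<in> H" by (auto simp: I_def)
      have "(r \<odot>\<^bsub>M\<^esub> z \<oplus>\<^bsub>M\<^esub> k) \<oplus>\<^bsub>M\<^esub> (s \<odot>\<^bsub>M\<^esub> z \<oplus>\<^bsub>M\<^esub> l) = (r \<oplus>\<^bsub>R\<^esub> s) \<odot>\<^bsub>M\<^esub> z \<oplus>\<^bsub>M\<^esub> (k \<oplus>\<^bsub>M\<^esub> l)"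
        using k l z Kc add_add_swap[of "r \<odot>\<^bsub>M\<^esub> z" k "s \<odot>\<^bsub>M\<^esub> z" l] by (auto simp: smult_l_distr)
      then show "r \<oplus>\<^bsub>R\<^esub> s \<in> I" using submoduleE(5)[OF H k(3) l(3)] submoduleE(5)[OF K k(2) l(2)] k(1) l(1)
        by (auto simp: I_def)
    qed (auto simp: I_def)
    fix r s assume "r \<in> I" and s: "s \<in> carrier R"
    then obtain k where k: "r \<in> carrier R" "k \<in> K" "r \<odot>\<^bsub>M\<^esub> z \<oplus>\<^bsub>M\<^esub> k \<in> H" by (auto simp: I_def)
    have "s \<odot>\<^bsub>M\<^esub> (r \<odot>\<^bsub>M\<^esub> z \<oplus>\<^bsub>M\<^esub> k) = (s \<otimes>\<^bsub>R\<^esub> r) \<odot>\<^bsub>M\<^esub> z \<oplus>\<^bsub>M\<^esub> s \<odot>\<^bsub>M\<^esub> k"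
      using k s z Kc by (auto simp: smult_r_distr smult_assoc1)
    then show "s \<otimes>\<^bsub>R\<^esub> r \<in> I" using submoduleE(4)[OF H s k(3)] submoduleE(4)[OF K s k(2)] k(1) s
      by (auto simp: I_def)
    then show "r \<otimes>\<^bsub>R\<^esub> s \<in> I" using k(1) s R.m_comm by simp
  qed
  then show ?thesis by (simp add: I_def)
qed

lemma ideal_colon:
  assumes "submodule H R M" "x \<in> carrier M"
  shows "ideal {r \<in> carrier R. r \<odot>\<^bsub>M\<^esub> x \<in> H} R"
proof -
  have "{r \<in> carrier R. r \<odot>\<^bsub>M\<^esub> x \<in> H} =
      {r \<in> carrier R. \<exists>k\<in>{\<zero>\<^bsub>M\<^esub>}. r \<odot>\<^bsub>M\<^esub> x \<oplus>\<^bsub>M\<^esub> k \<in> H}"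
    using assms(2) by auto
  then show ?thesis using ideal_colon_modulo[OF assms(1) submodule_singleton_zero assms(2)] by simp
qed

text \<open>Split off one generator z. Then H is controlled by its intersection with the span of the
  remaining generators, finitely generated by induction, and by the ideal of coefficients with which
  z occurs in H, finitely generated because R is Noetherian.\<close>

lemma fg_submodules_of_fg:
  assumes noeth: "noetherian_ring R" and "finite S" "S \<subseteq> carrier M"
    and "submodule H R M" "H \<subseteq> submodule_span R M S"
  shows "\<exists>T\<subseteq>H. finite T \<and> submodule_span R M T = H"
  using assms(2-5)
proof (induction S arbitrary: H rule: finite_induct)
  case empty
  have "submodule_span R M {} = {\<zero>\<^bsub>M\<^esub>}"
    using submodule_span_least[OF submodule_singleton_zero, of "{}"]
      submodule_zero_closed[OF submodule_span_submodule[of "{}"]] by auto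
  moreover have "submodule_span R M {} \<subseteq> H" using submodule_span_least[OF empty(2)] by simp
  ultimately show ?case using empty by (intro exI[of _ "{}"]) auto
next
  case (insert z S)
  note H = \<open>submodule H R M\<close>
  let ?K = "submodule_span R M S"
  have S: "S \<subseteq> carrier M" and z: "z \<in> carrier M" using insert by auto
  note K = submodule_span_submodule[OF S]
  have Hc: "H \<subseteq> carrier M" and Kc: "?K \<subseteq> carrier M" using submoduleE(1) H K by auto
  obtain T where T: "T \<subseteq> H \<inter> ?K" "finite T" "submodule_span R M T = H \<inter> ?K"
    using insert.IH[OF S submodule_Int[OF H K]] by auto
  have span: "\<exists>r\<in>carrier R. \<exists>k\<in>?K. h = r \<odot>\<^bsub>M\<^esub> z \<oplus>\<^bsub>M\<^esub> k" if "h \<in> H" for h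
  proof -
    have "h \<in> submodule_span R M ({z} \<union> S)" using that insert by auto
    then obtain a k where ak: "a \<in> submodule_span R M {z}" "k \<in> ?K" "h = a \<oplus>\<^bsub>M\<^esub> k"
      using submodule_span_Un[of "{z}" S h] S z by auto
    have "\<exists>r\<in>carrier R. a = r \<odot>\<^bsub>M\<^esub> z" using ak(1)
    proof (induction rule: submodule_span_induct)
      case carrier then show ?case using z by auto
    next
      case zero then show ?case using z by (intro bexI[of _ "\<zero>\<^bsub>R\<^esub>"]) auto
    next
      case (gen x) then show ?case using z by (intro bexI[of _ "\<one>\<^bsub>R\<^esub>"]) auto
    next
      case (add x y) then show ?case using z smult_l_distr by (metis R.add.m_closed)
    next
      case (smult r x) then show ?case using z smult_assoc1 by (metis R.m_closed)
    qed
    then show ?thesis using ak by auto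
  qed
  define I where "I = {r \<in> carrier R. \<exists>k\<in>?K. r \<odot>\<^bsub>M\<^esub> z \<oplus>\<^bsub>M\<^esub> k \<in> H}"
  have "ideal I R" unfolding I_def by (rule ideal_colon_modulo[OF H K z])
  then obtain A where A: "A \<subseteq> carrier R" "finite A" "I = genideal R A"
    using noetherian_ring.finetely_gen[OF noeth] by blast
  have AI: "A \<subseteq> I" using A R.genideal_self by blast
  have "\<forall>r\<in>A. \<exists>k\<in>?K. r \<odot>\<^bsub>M\<^esub> z \<oplus>\<^bsub>M\<^esub> k \<in> H" using AI by (auto simp: I_def)
  then obtain k where k: "\<And>r. r \<in> A \<Longrightarrow> k r \<in> ?K" "\<And>r. r \<in> A \<Longrightarrow> r \<odot>\<^bsub>M\<^esub> z \<oplus>\<^bsub>M\<^esub> k r \<in> H"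
    by metis
  define T' where "T' = T \<union> (\<lambda>r. r \<odot>\<^bsub>M\<^esub> z \<oplus>\<^bsub>M\<^esub> k r) ` A"
  have T'H: "T' \<subseteq> H" and fin: "finite T'" using T k A by (auto simp: T'_def)
  let ?L = "submodule_span R M T'"
  have T'c: "T' \<subseteq> carrier M" using T'H Hc by blast
  note L = submodule_span_submodule[OF T'c]
  have LH: "?L \<subseteq> H" using submodule_span_least[OF H T'H] .
  have sub: "H \<inter> ?K \<subseteq> ?L" using T(3) submodule_span_least[OF L, of T] submodule_span_incl[of T']
    by (auto simp: T'_def)
  \<comment> \<open>The coefficients of z that occur in the span of the chosen elements again form
    an ideal. It contains the generators A of I, so every coefficient that occurs in H is already
    realized there, and the difference of the two elements lies in the intersection of H with the
    span of S.\<close>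
  define I' where "I' = {r \<in> carrier R. \<exists>k\<in>?K. r \<odot>\<^bsub>M\<^esub> z \<oplus>\<^bsub>M\<^esub> k \<in> ?L}"
  have I': "ideal I' R" unfolding I'_def by (rule ideal_colon_modulo[OF L K z])
  have "A \<subseteq> I'" using k A(1) submodule_span_incl[of T'] unfolding I'_def T'_def by blast
  then have II': "I \<subseteq> I'" using A(3) R.genideal_minimal[OF I'] by blast
  have "H \<subseteq> ?L"
  proof
    fix h assume h: "h \<in> H"
    obtain r k where rk: "r \<in> carrier R" "k \<in> ?K" "h = r \<odot>\<^bsub>M\<^esub> z \<oplus>\<^bsub>M\<^esub> k" using span[OF h] by blast
    then have "r \<in> I'" using h II' by (auto simp: I_def)
    then obtain l where l: "l \<in> ?K" "r \<odot>\<^bsub>M\<^esub> z \<oplus>\<^bsub>M\<^esub> l \<in> ?L" by (auto simp: I'_def)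
    have c: "k \<in> carrier M" "l \<in> carrier M" "r \<odot>\<^bsub>M\<^esub> z \<in> carrier M" using rk l Kc z by auto
    let ?d = "k \<oplus>\<^bsub>M\<^esub> \<ominus>\<^bsub>M\<^esub> l"
    have eq: "h = ?d \<oplus>\<^bsub>M\<^esub> (r \<odot>\<^bsub>M\<^esub> z \<oplus>\<^bsub>M\<^esub> l)"
    proof -
      have "?d \<oplus>\<^bsub>M\<^esub> (r \<odot>\<^bsub>M\<^esub> z \<oplus>\<^bsub>M\<^esub> l) = (k \<oplus>\<^bsub>M\<^esub> r \<odot>\<^bsub>M\<^esub> z) \<oplus>\<^bsub>M\<^esub> (\<ominus>\<^bsub>M\<^esub> l \<oplus>\<^bsub>M\<^esub> l)"
        by (rule add_add_swap) (use c in auto)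
      then show ?thesis using c rk by (simp add: M.l_neg M.r_neg M.a_comm)
    qed
    have "?d \<in> ?K" using submoduleE(5)[OF K rk(2) submoduleE(3)[OF K l(1)]] .
    moreover have "?d \<in> H"
      by (rule submodule_add_cancel[OF H]) (use c eq h LH l in auto)
    ultimately have "?d \<in> ?L" using sub by blast
    then show "h \<in> ?L" using eq submoduleE(5)[OF L _ l(2)] by simp
  qed
  then show ?case using T'H fin LH by blast
qed

end

lemma noetherian_module_of_fg:
  assumes "noetherian_ring R" "finitely_generated_module R M"
  shows "noetherian_module R M"
  using assms module.fg_submodules_of_fg[of R M] module.submoduleE(1)[of R M]
  unfolding noetherian_module_def finitely_generated_module_def by metis

lemma noetherian_chain_stable:
  assumes "noetherian_module R M" "\<And>i::nat. submodule (H i) R M" "\<And>i. H i \<subseteq> H (Suc i)"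
  shows "\<exists>m. \<forall>i\<ge>m. H i = H m"
proof -
  interpret module R M using assms(1) by (simp add: noetherian_module_def)
  have mono: "H i \<subseteq> H j" if "i \<le> j" for i j
    using assms(3) that by (rule lift_Suc_mono_le)
  obtain T where T: "T \<subseteq> (\<Union>i. H i)" "finite T" "submodule_span R M T = (\<Union>i. H i)"
    using assms(1) submodule_chain_Union[of H, OF assms(2,3)] unfolding noetherian_module_def by metis
  have "\<exists>m. T \<subseteq> H m" using T(2,1)
  proof induction
    case (insert x F)
    then obtain m i where "F \<subseteq> H m" "x \<in> H i" by auto
    then show ?case using mono[of m "max m i"] mono[of i "max m i"] by (intro exI[of _ "max m i"]) auto
  qed auto
  then obtain m where "T \<subseteq> H m" ..
  then have "(\<Union>i. H i) \<subseteq> H m" using submodule_span_least[OF assms(2)] T(3) by metis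
  then show ?thesis using mono by (intro exI[of _ m]) blast
qed

section \<open>Monomials and Artin--Rees\<close>

lemma incseq_subseq_nat:
  fixes s :: "nat \<Rightarrow> nat"
  shows "\<exists>f. strict_mono f \<and> incseq (\<lambda>n. s (f n))"
proof -
  obtain f where f: "strict_mono f" "monoseq (\<lambda>n. s (f n))" using seq_monosub by blast
  show ?thesis
  proof (cases "incseq (\<lambda>n. s (f n))")
    case False
    then have dec: "s (f j) \<le> s (f i)" if "i \<le> j" for i j
      using f(2) that by (auto simp: monoseq_iff decseq_def)
    \<comment> \<open>A nonincreasing sequence of natural numbers is constant from the index on at
      which it attains its minimum.\<close>
    define m where "m = (ARG_MIN (\<lambda>i. s (f i)) i. True)"
    have m: "s (f m) \<le> s (f i)" for i unfolding m_def by (rule arg_min_nat_le) simp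
    have "s (f (m + i)) = s (f m)" for i
      using m[of "m + i"] dec[of m "m + i"] by simp
    then show ?thesis using f(1)
      by (intro exI[of _ "\<lambda>i. f (m + i)"]) (auto simp: strict_mono_def incseq_def)
  qed (use f in auto)
qed

text \<open>The coordinates are treated one after another; passing to a further subsequence keeps
  the earlier coordinates monotone.\<close>

lemma dickson:
  fixes c :: "nat \<Rightarrow> 'v \<Rightarrow> nat"
  assumes "finite V"
  shows "\<exists>f. strict_mono f \<and> (\<forall>v\<in>V. incseq (\<lambda>i. c (f i) v))"
  using assms
proof (induction V)
  case empty
  show ?case by (intro exI[of _ id]) (auto simp: strict_mono_def)
next
  case (insert v V)
  then obtain f where f: "strict_mono f" "\<forall>v\<in>V. incseq (\<lambda>i. c (f i) v)" by blast
  obtain g where g: "strict_mono g" "incseq (\<lambda>i. c (f (g i)) v)"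
    using incseq_subseq_nat[of "\<lambda>i. c (f i) v"] by blast
  have "incseq (\<lambda>i. c (f (g i)) w)" if "w \<in> V" for w
    using f(2) g(1) that by (auto simp: incseq_def strict_mono_less_eq)
  moreover have "strict_mono (\<lambda>i. f (g i))" using f(1) g(1) by (auto simp: strict_mono_def)
  ultimately show ?case using g(2) by (intro exI[of _ "\<lambda>i. f (g i)"]) auto
qed

text \<open>Otherwise one could choose an infinite sequence of exponents none of which lies above an
  earlier one with the same submodule. Dickson's lemma extracts an increasing subsequence, and along
  it the ascending chain condition makes L eventually constant, a contradiction.\<close>

lemma finite_basis_of_monotone_submodules:
  fixes L :: "nat multiset \<Rightarrow> 'm set"
  assumes noeth: "noetherian_module R M" and "finite V"
    and sub: "\<And>e. set_mset e \<subseteq> V \<Longrightarrow> submodule (L e) R M"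
    and mono: "\<And>e f. set_mset e \<subseteq> V \<Longrightarrow> set_mset f \<subseteq> V \<Longrightarrow> e \<subseteq># f \<Longrightarrow> L e \<subseteq> L f"
  obtains E where "finite E" "\<And>e. e \<in> E \<Longrightarrow> set_mset e \<subseteq> V"
    "\<And>e. set_mset e \<subseteq> V \<Longrightarrow> \<exists>e0\<in>E. e0 \<subseteq># e \<and> L e0 = L e"
proof (rule ccontr)
  assume contr: "\<not> thesis"
  define P where "P = (\<lambda>(f :: nat \<Rightarrow> nat multiset) (i :: nat) r. set_mset r \<subseteq> V \<and> (\<forall>j<i. \<not> (f j \<subseteq># r \<and> L (f j) = L r)))"
  have "\<exists>f. \<forall>i::nat. P f i (f i)"
  proof (rule dependent_wellorder_choice)
    fix i :: nat and f assume IH: "\<And>j. j < i \<Longrightarrow> P f j (f j)"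
    show "\<exists>r. P f i r"
    proof (rule ccontr)
      assume "\<nexists>r. P f i r"
      then have "\<exists>e0\<in>f ` {..<i}. e0 \<subseteq># e \<and> L e0 = L e" if "set_mset e \<subseteq> V" for e
        using that unfolding P_def by blast
      moreover have "set_mset e \<subseteq> V" if "e \<in> f ` {..<i}" for e using IH that by (auto simp: P_def)
      ultimately show False using contr that[of "f ` {..<i}"] by blast
    qed
  qed (auto simp: P_def)
  then obtain x where x: "\<And>i. P x i (x i)" by blast
  then have xV: "set_mset (x i) \<subseteq> V" for i by (auto simp: P_def)
  obtain s where s: "strict_mono s" "\<forall>v\<in>V. incseq (\<lambda>i. count (x (s i)) v)"
    using dickson[OF assms(2), of "\<lambda>i. count (x i)"] by blast
  have le: "x (s i) \<subseteq># x (s j)" if "i \<le> j" for i j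
  proof (rule mset_subset_eqI)
    fix v show "count (x (s i)) v \<le> count (x (s j)) v"
    proof (cases "v \<in> V")
      case False
      then have "v \<notin># x (s i)" using xV by blast
      then show ?thesis by (simp add: not_in_iff)
    qed (use s that in \<open>auto simp: incseq_def\<close>)
  qed
  obtain m where m: "\<forall>i\<ge>m. L (x (s i)) = L (x (s m))"
    using noetherian_chain_stable[OF noeth, of "\<lambda>i. L (x (s i))"] sub xV mono le
    by (metis le_add1 plus_1_eq_Suc add.commute)
  have "s m < s (Suc m)" using s(1) by (auto simp: strict_mono_def)
  moreover have "L (x (s m)) = L (x (s (Suc m)))" using m[rule_format, of "Suc m"] by simp
  ultimately show False using x[of "s (Suc m)"] le[of m "Suc m"] unfolding P_def by simp
qed

text \<open>Being compatible with addition (\<open>lex_less_add\<close>), this order lets leading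
  terms behave well under multiplication by monomials. Only exponents of one multidegree are
  compared, a finite set, so inductions run over the number of monomials left.\<close>

definition lex_less :: "nat multiset \<Rightarrow> nat multiset \<Rightarrow> bool" where
  "lex_less e f \<longleftrightarrow> (\<exists>i. count e i < count f i \<and> (\<forall>j<i. count e j = count f j))"

lemma lex_less_trans: "lex_less e f \<Longrightarrow> lex_less f g \<Longrightarrow> lex_less e g"
proof -
  assume "lex_less e f" "lex_less f g"
  then obtain i j where ij: "count e i < count f i" "\<forall>k<i. count e k = count f k"
    "count f j < count g j" "\<forall>k<j. count f k = count g k" unfolding lex_less_def by blast
  show ?thesis unfolding lex_less_def
  proof (intro exI[of _ "min i j"] conjI)
    show "count e (min i j) < count g (min i j)"
      using ij by (cases i j rule: linorder_cases) (auto simp: min_def)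
    show "\<forall>k<min i j. count e k = count g k" using ij by auto
  qed
qed

lemma lex_less_irrefl: "\<not> lex_less e e"
  by (simp add: lex_less_def)

lemma lex_less_total: "e \<noteq> f \<Longrightarrow> lex_less e f \<or> lex_less f e"
proof -
  assume "e \<noteq> f"
  then have ex: "\<exists>i. count e i \<noteq> count f i" by (auto simp: multiset_eq_iff)
  define i where "i = (LEAST i. count e i \<noteq> count f i)"
  have "count e i \<noteq> count f i" unfolding i_def using ex by (rule LeastI_ex)
  moreover have "count e j = count f j" if "j < i" for j using that not_less_Least i_def by blast
  ultimately show ?thesis unfolding lex_less_def by (metis linorder_neqE_nat)
qed

lemma lex_less_add: "lex_less e f \<Longrightarrow> lex_less (g + e) (g + f)"
  by (auto simp: lex_less_def)

lemma lex_max: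
  assumes "finite A" "A \<noteq> {}"
  obtains e where "e \<in> A" "\<And>f. f \<in> A \<Longrightarrow> f \<noteq> e \<Longrightarrow> lex_less f e"
proof -
  have "\<exists>e\<in>A. \<forall>f\<in>A. f \<noteq> e \<longrightarrow> lex_less f e" using assms
  proof (induction rule: finite_ne_induct)
    case (insert x F)
    then obtain e where e: "e \<in> F" "\<forall>f\<in>F. f \<noteq> e \<longrightarrow> lex_less f e" by blast
    show ?case
    proof (cases "lex_less e x")
      case True
      have "lex_less f x" if "f \<in> F" for f
        using e(2) that True lex_less_trans[of f e x] by (cases "f = e") auto
      then show ?thesis by blast
    next
      case False
      then have "x \<noteq> e \<Longrightarrow> lex_less x e" using lex_less_total[of e x] by blast
      then show ?thesis using e by blast
    qed
  qed simp
  then show ?thesis using that by blast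
qed

text \<open>Each v in V is the index of a generator \<open>a v\<close>, and its colour says which
  ideal it helps to generate. A multiset over V is the exponent vector of a monomial; applying
  \<open>col\<close> to its elements gives the multidegree of that monomial. The indices are natural
  numbers so that \<open>lex_less\<close> applies.\<close>

locale graded_generators = cring R + noetherian_ring R for R :: "('a, 'r) ring_scheme" (structure) +
  fixes V :: "nat set" and a :: "nat \<Rightarrow> 'a" and col :: "nat \<Rightarrow> 'c"
  assumes finite_V: "finite V" and a_closed: "v \<in> V \<Longrightarrow> a v \<in> carrier R"
begin

definition monomial :: "nat multiset \<Rightarrow> 'a" where
  "monomial e = (\<Otimes>v\<in>V. a v [^] count e v)"

lemma monomial_closed [simp, intro]: "monomial e \<in> carrier R"
  unfolding monomial_def by (rule finprod_closed) (auto simp: a_closed)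

lemma monomial_empty [simp]: "monomial {#} = \<one>"
  unfolding monomial_def by (simp add: finprod_one_eqI)

lemma monomial_union: "monomial (e + f) = monomial e \<otimes> monomial f"
proof -
  have "monomial (e + f) = (\<Otimes>v\<in>V. a v [^] count e v \<otimes> a v [^] count f v)"
    unfolding monomial_def by (rule finprod_cong') (auto simp: a_closed nat_pow_mult)
  then show ?thesis unfolding monomial_def by (simp add: a_closed finprod_multf Pi_iff)
qed

lemma monomial_single: "v \<in> V \<Longrightarrow> monomial {#v#} = a v"
proof -
  assume v: "v \<in> V"
  have "monomial {#v#} = (\<Otimes>w\<in>V. if v = w then a w else \<one>)"
    unfolding monomial_def by (rule finprod_cong') (auto simp: a_closed)
  also have "\<dots> = a v" using v finite_V a_closed by (intro finprod_singleton) auto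
  finally show ?thesis .
qed

definition exponents :: "'c multiset \<Rightarrow> nat multiset set" where
  "exponents n = {e. set_mset e \<subseteq> V \<and> image_mset col e = n}"

lemma finite_exponents: "finite (exponents n)"
proof (rule finite_subset)
  show "exponents n \<subseteq> {e. set_mset e \<subseteq> V \<and> size e = size n}" by (auto simp: exponents_def)
  show "finite {e. set_mset e \<subseteq> V \<and> size e = size n}"
    using finite_multisets_of_size[OF finite_V] by (simp add: multisets_of_size_def)
qed

lemma exponents_add: "e \<in> exponents n \<Longrightarrow> f \<in> exponents m \<Longrightarrow> f + e \<in> exponents (m + n)"
  by (auto simp: exponents_def)

text \<open>The set A is arbitrary because the leading term argument also needs the truncations of
  \<open>exponents n\<close> below a given monomial.\<close>

definition monomial_span ::
    "('a, 'm, 'e) module_scheme \<Rightarrow> 'm set \<Rightarrow> 'm set \<Rightarrow> nat multiset set \<Rightarrow> 'm set" where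
  "monomial_span Z D C A = submodule_span R Z (D \<union> {monomial e \<odot>\<^bsub>Z\<^esub> c | e c. e \<in> A \<and> c \<in> C})"

text \<open>\<open>ideal_power Z D C n\<close> is \<open>D + I\<^sup>n C\<close>, where the multiset \<open>n\<close> stands for the exponent vector
  of its multiplicities and \<open>I\<^sub>j\<close> is generated by the elements \<open>a v\<close> of colour \<open>j\<close>.\<close>

definition ideal_power ::
    "('a, 'm, 'e) module_scheme \<Rightarrow> 'm set \<Rightarrow> 'm set \<Rightarrow> 'c multiset \<Rightarrow> 'm set" where
  "ideal_power Z D C n = monomial_span Z D C (exponents n)"

text \<open>Degree by degree, these are the data of a graded submodule of X[T] over the multigraded
  Rees algebra, in which each \<open>a v\<close> acts with the degree of its colour.\<close>

definition graded_family ::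
    "('a, 'm, 'e) module_scheme \<Rightarrow> ('c multiset \<Rightarrow> 'm set) \<Rightarrow> bool" where
  "graded_family X S \<longleftrightarrow> (\<forall>n. submodule (S n) R X) \<and>
     (\<forall>v\<in>V. \<forall>n. \<forall>x\<in>S n. a v \<odot>\<^bsub>X\<^esub> x \<in> S (add_mset (col v) n))"

lemma graded_familyD:
  assumes "graded_family X S"
  shows "submodule (S n) R X" "v \<in> V \<Longrightarrow> x \<in> S n \<Longrightarrow> a v \<odot>\<^bsub>X\<^esub> x \<in> S (add_mset (col v) n)"
  using assms by (auto simp: graded_family_def)

lemma graded_family_monomial:
  assumes "module R X" "graded_family X S" "x \<in> S n" "set_mset f \<subseteq> V"
  shows "monomial f \<odot>\<^bsub>X\<^esub> x \<in> S (image_mset col f + n)"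
  using assms(4)
proof (induction f)
  case empty
  interpret X: module R X by fact
  show ?case using assms(3) subsetD[OF X.submoduleE(1)[OF graded_familyD(1)[OF assms(2)]] assms(3)] by simp
next
  case (add v f)
  interpret X: module R X by fact
  have x: "x \<in> carrier X" using assms(3) X.submoduleE(1)[OF graded_familyD(1)[OF assms(2)]] by auto
  have "monomial (add_mset v f) = a v \<otimes> monomial f"
    using monomial_union[of "{#v#}" f] monomial_single add.prems by simp
  then have "monomial (add_mset v f) \<odot>\<^bsub>X\<^esub> x = a v \<odot>\<^bsub>X\<^esub> (monomial f \<odot>\<^bsub>X\<^esub> x)"
    using x a_closed add.prems by (simp add: X.smult_assoc1)
  then show ?case using add graded_familyD(2)[OF assms(2)] by simp
qed

context
  fixes Z :: "('a, 'm, 'e) module_scheme" and D C :: "'m set"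
  assumes Z: "module R Z" and D: "submodule D R Z" and C: "submodule C R Z"
begin

interpretation Z: module R Z by fact

lemma monomial_span_gens: "D \<union> {monomial e \<odot>\<^bsub>Z\<^esub> c | e c. e \<in> A \<and> c \<in> C} \<subseteq> carrier Z"
  using Z.submoduleE(1)[OF D] Z.submoduleE(1)[OF C] by auto

lemma monomial_span_submodule: "submodule (monomial_span Z D C A) R Z"
  unfolding monomial_span_def by (rule Z.submodule_span_submodule[OF monomial_span_gens])

lemma monomial_span_mono: "A \<subseteq> B \<Longrightarrow> monomial_span Z D C A \<subseteq> monomial_span Z D C B"
  unfolding monomial_span_def
  by (rule Z.submodule_span_mono[OF _ monomial_span_gens])
     (rule subset_trans[OF _ Z.submodule_span_incl], auto)

lemma monomial_span_empty: "monomial_span Z D C {} = D"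
  unfolding monomial_span_def using Z.submodule_span_self[OF D] by simp

lemma monomial_span_base: "D \<subseteq> monomial_span Z D C A"
  using monomial_span_mono[of "{}" A] monomial_span_empty by simp

lemma monomial_span_gen: "e \<in> A \<Longrightarrow> c \<in> C \<Longrightarrow> monomial e \<odot>\<^bsub>Z\<^esub> c \<in> monomial_span Z D C A"
  unfolding monomial_span_def
  by (rule subsetD[OF Z.submodule_span_incl]) auto

text \<open>The multiples of one monomial by elements of C already form a submodule, the image of C
  under scaling; hence a single coefficient c is enough.\<close>

lemma monomial_span_decompose:
  assumes "x \<in> monomial_span Z D C A" "e \<in> A"
  obtains c y where "c \<in> C" "y \<in> monomial_span Z D C (A - {e})" "x = monomial e \<odot>\<^bsub>Z\<^esub> c \<oplus>\<^bsub>Z\<^esub> y"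
proof -
  let ?T = "{monomial e \<odot>\<^bsub>Z\<^esub> c | c. c \<in> C}"
  let ?S = "D \<union> {monomial f \<odot>\<^bsub>Z\<^esub> c | f c. f \<in> A - {e} \<and> c \<in> C}"
  have T: "?T \<subseteq> carrier Z" using Z.submoduleE(1)[OF C] by auto
  have "D \<union> {monomial e \<odot>\<^bsub>Z\<^esub> c | e c. e \<in> A \<and> c \<in> C} = ?T \<union> ?S" using assms(2) by blast
  then have "x \<in> submodule_span R Z (?T \<union> ?S)" using assms(1) by (simp add: monomial_span_def)
  then obtain p y where py: "p \<in> submodule_span R Z ?T" "y \<in> submodule_span R Z ?S" "x = p \<oplus>\<^bsub>Z\<^esub> y"
    by (rule Z.submodule_span_Un[OF T monomial_span_gens])
  have "submodule ((\<lambda>c. monomial e \<odot>\<^bsub>Z\<^esub> c) ` C) R Z"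
    by (rule submodule_image[OF Z Z Z.linear_map_scale C]) simp
  moreover have "?T = (\<lambda>c. monomial e \<odot>\<^bsub>Z\<^esub> c) ` C" by auto
  ultimately have "p \<in> ?T" using py(1) Z.submodule_span_self[of ?T] by simp
  then obtain c where "c \<in> C" "p = monomial e \<odot>\<^bsub>Z\<^esub> c" by blast
  then show ?thesis using that py(2,3) unfolding monomial_span_def by blast
qed

lemma monomial_smult_span:
  assumes "x \<in> monomial_span Z D C A"
  shows "monomial f \<odot>\<^bsub>Z\<^esub> x \<in> monomial_span Z D C ((+) f ` A)"
proof -
  note S = monomial_span_submodule[of "(+) f ` A"]
  have "submodule {x \<in> carrier Z. monomial f \<odot>\<^bsub>Z\<^esub> x \<in> monomial_span Z D C ((+) f ` A)} R Z"
    by (rule submodule_vimage[OF Z Z Z.linear_map_scale S]) simp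
  moreover have "D \<union> {monomial e \<odot>\<^bsub>Z\<^esub> c | e c. e \<in> A \<and> c \<in> C} \<subseteq>
      {x \<in> carrier Z. monomial f \<odot>\<^bsub>Z\<^esub> x \<in> monomial_span Z D C ((+) f ` A)}"
  proof -
    have "monomial f \<odot>\<^bsub>Z\<^esub> d \<in> monomial_span Z D C ((+) f ` A)" if "d \<in> D" for d
      using Z.submoduleE(4)[OF D _ that] monomial_span_base by blast
    moreover have "monomial f \<odot>\<^bsub>Z\<^esub> (monomial e \<odot>\<^bsub>Z\<^esub> c) \<in> monomial_span Z D C ((+) f ` A)"
      if "e \<in> A" "c \<in> C" for e c
    proof -
      have "c \<in> carrier Z" using that Z.submoduleE(1)[OF C] by blast
      then have "monomial f \<odot>\<^bsub>Z\<^esub> (monomial e \<odot>\<^bsub>Z\<^esub> c) = monomial (f + e) \<odot>\<^bsub>Z\<^esub> c"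
        by (simp add: monomial_union Z.smult_assoc1)
      then show ?thesis using monomial_span_gen[of "f + e" "(+) f ` A" c] that by simp
    qed
    ultimately show ?thesis using monomial_span_gens by blast
  qed
  ultimately have "monomial_span Z D C A \<subseteq>
      {x \<in> carrier Z. monomial f \<odot>\<^bsub>Z\<^esub> x \<in> monomial_span Z D C ((+) f ` A)}"
    unfolding monomial_span_def[of Z D C A] by (rule Z.submodule_span_least)
  then show ?thesis using assms by blast
qed

lemma graded_family_ideal_power: "graded_family Z (ideal_power Z D C)"
  unfolding graded_family_def ideal_power_def
proof (intro conjI allI ballI)
  fix v n x assume v: "v \<in> V" and x: "x \<in> monomial_span Z D C (exponents n)"
  have "a v \<odot>\<^bsub>Z\<^esub> x \<in> monomial_span Z D C ((+) {#v#} ` exponents n)"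
    using monomial_smult_span[OF x, of "{#v#}"] by (simp add: monomial_single v)
  moreover have "(+) {#v#} ` exponents n \<subseteq> exponents (add_mset (col v) n)"
    using v by (auto simp: exponents_def)
  ultimately show "a v \<odot>\<^bsub>Z\<^esub> x \<in> monomial_span Z D C (exponents (add_mset (col v) n))"
    using monomial_span_mono by blast
qed (rule monomial_span_submodule)

text \<open>The submodules \<open>lc e\<close> of leading coefficients grow with \<open>e\<close>, so by Dickson's lemma finitely
  many of them suffice; subtracting a multiple of a family member with the same leading
  coefficient then lowers the leading monomial.\<close>

lemma graded_family_generators:
  assumes X: "module R X" and noeth: "noetherian_module R Z"
    and g: "linear_map R X Z g" and S: "graded_family X S"
    and gS: "\<And>n. S n \<subseteq> {u. g u \<in> ideal_power Z D C n}"
  shows "\<exists>E. finite E \<and> (\<forall>d\<in>E. set_mset d \<subseteq> col ` V) \<and> (\<forall>n. S n \<subseteq> submodule_span R X ({u \<in> S n. g u \<in> D} \<union>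
     {monomial f \<odot>\<^bsub>X\<^esub> w | f d w. set_mset f \<subseteq> V \<and> d \<in> E \<and> image_mset col f + d = n \<and> w \<in> S d}))"
proof -
  interpret X: module R X by fact
  note Ssub = graded_familyD(1)[OF S]
  have Sc: "S n \<subseteq> carrier X" for n using X.submoduleE(1)[OF Ssub] .
  have gc: "g u \<in> carrier Z" if "u \<in> S n" for u n using linear_map_closed[OF g] Sc that by blast
  have Cc: "C \<subseteq> carrier Z" using Z.submoduleE(1)[OF C] .
  define below where "below = (\<lambda>e. {e' \<in> exponents (image_mset col e). lex_less e' e})"
  define lc where "lc = (\<lambda>e. {c \<in> C. \<exists>u \<in> S (image_mset col e). \<exists>y \<in> monomial_span Z D C (below e).
     g u = monomial e \<odot>\<^bsub>Z\<^esub> c \<oplus>\<^bsub>Z\<^esub> y})"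
  let ?Low = "\<lambda>e. monomial_span Z D C (below e)"
  have Lc: "monomial_span Z D C A \<subseteq> carrier Z" for A using Z.submoduleE(1)[OF monomial_span_submodule] .
  have lc_sub: "submodule (lc e) R Z" for e
  proof (rule Z.submoduleI')
    show "lc e \<subseteq> carrier Z" using Cc by (auto simp: lc_def)
    show "\<zero>\<^bsub>Z\<^esub> \<in> lc e"
      using Z.submodule_zero_closed[OF C] X.submodule_zero_closed[OF Ssub]
        Z.submodule_zero_closed[OF monomial_span_submodule] linear_map_zero[OF X Z g]
      by (auto simp: lc_def intro!: bexI[of _ "\<zero>\<^bsub>X\<^esub>"] bexI[of _ "\<zero>\<^bsub>Z\<^esub>"])
  next
    fix c c' assume "c \<in> lc e" "c' \<in> lc e"
    then obtain u y u' y' where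
      *: "c \<in> C" "u \<in> S (image_mset col e)" "y \<in> ?Low e" "g u = monomial e \<odot>\<^bsub>Z\<^esub> c \<oplus>\<^bsub>Z\<^esub> y"
         "c' \<in> C" "u' \<in> S (image_mset col e)" "y' \<in> ?Low e" "g u' = monomial e \<odot>\<^bsub>Z\<^esub> c' \<oplus>\<^bsub>Z\<^esub> y'"
      unfolding lc_def by blast
    have mem: "c \<in> carrier Z" "c' \<in> carrier Z" "y \<in> carrier Z" "y' \<in> carrier Z"
      using * Cc Lc by blast+
    have "g (u \<oplus>\<^bsub>X\<^esub> u') = (monomial e \<odot>\<^bsub>Z\<^esub> c \<oplus>\<^bsub>Z\<^esub> y) \<oplus>\<^bsub>Z\<^esub> (monomial e \<odot>\<^bsub>Z\<^esub> c' \<oplus>\<^bsub>Z\<^esub> y')"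
      using * Sc linear_map_add[OF g] by (metis subsetD)
    also have "\<dots> = monomial e \<odot>\<^bsub>Z\<^esub> (c \<oplus>\<^bsub>Z\<^esub> c') \<oplus>\<^bsub>Z\<^esub> (y \<oplus>\<^bsub>Z\<^esub> y')"
      using mem Z.add_add_swap[of "monomial e \<odot>\<^bsub>Z\<^esub> c" y "monomial e \<odot>\<^bsub>Z\<^esub> c'" y']
      by (simp add: Z.smult_r_distr)
    finally show "c \<oplus>\<^bsub>Z\<^esub> c' \<in> lc e"
      using Z.submoduleE(5)[OF C *(1,5)] X.submoduleE(5)[OF Ssub *(2,6)]
        Z.submoduleE(5)[OF monomial_span_submodule *(3,7)] unfolding lc_def by blast
  next
    fix r c assume r: "r \<in> carrier R" and "c \<in> lc e"
    then obtain u y where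
      *: "c \<in> C" "u \<in> S (image_mset col e)" "y \<in> ?Low e" "g u = monomial e \<odot>\<^bsub>Z\<^esub> c \<oplus>\<^bsub>Z\<^esub> y"
      unfolding lc_def by blast
    have mem: "c \<in> carrier Z" "y \<in> carrier Z" using * Cc Lc by blast+
    have "g (r \<odot>\<^bsub>X\<^esub> u) = r \<odot>\<^bsub>Z\<^esub> (monomial e \<odot>\<^bsub>Z\<^esub> c \<oplus>\<^bsub>Z\<^esub> y)"
      using * Sc linear_map_smult[OF g r] by (metis subsetD)
    also have "\<dots> = monomial e \<odot>\<^bsub>Z\<^esub> (r \<odot>\<^bsub>Z\<^esub> c) \<oplus>\<^bsub>Z\<^esub> (r \<odot>\<^bsub>Z\<^esub> y)"
      using mem r by (simp add: Z.smult_r_distr Z.smult_assoc1[symmetric] m_comm)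
    finally show "r \<odot>\<^bsub>Z\<^esub> c \<in> lc e"
      using Z.submoduleE(4)[OF C r *(1)] X.submoduleE(4)[OF Ssub r *(2)]
        Z.submoduleE(4)[OF monomial_span_submodule r *(3)] unfolding lc_def by blast
  qed
  have below_add: "(+) f ` below e \<subseteq> below (f + e)" if "set_mset f \<subseteq> V" for f e
    using that exponents_add[of _ "image_mset col e" f] by (auto simp: below_def lex_less_add exponents_def)
  \<comment> \<open>Multiplication by a monomial f moves a leading term at e to f + e with the same
    coefficient, and the remainder stays below f + e because the order is compatible with
    addition.\<close>
  have lift: "\<exists>u'\<in>S (image_mset col (f + e)). \<exists>y'\<in>?Low (f + e).
      u' = monomial f \<odot>\<^bsub>X\<^esub> u \<and> g u' = monomial (f + e) \<odot>\<^bsub>Z\<^esub> c \<oplus>\<^bsub>Z\<^esub> y'"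
    if "set_mset f \<subseteq> V" "c \<in> C" "u \<in> S (image_mset col e)" "y \<in> ?Low e"
      "g u = monomial e \<odot>\<^bsub>Z\<^esub> c \<oplus>\<^bsub>Z\<^esub> y" for f e c u y
  proof (intro bexI conjI)
    have mem: "c \<in> carrier Z" "y \<in> carrier Z" using that Cc Lc by blast+
    show "monomial f \<odot>\<^bsub>X\<^esub> u \<in> S (image_mset col (f + e))"
      using graded_family_monomial[OF X S that(3,1)] by simp
    show "monomial f \<odot>\<^bsub>Z\<^esub> y \<in> ?Low (f + e)"
      using monomial_smult_span[OF that(4), of f] monomial_span_mono[OF below_add[OF that(1)]] by blast
    have "g (monomial f \<odot>\<^bsub>X\<^esub> u) = monomial f \<odot>\<^bsub>Z\<^esub> g u"
      using that(3) Sc linear_map_smult[OF g] by blast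
    then show "g (monomial f \<odot>\<^bsub>X\<^esub> u) = monomial (f + e) \<odot>\<^bsub>Z\<^esub> c \<oplus>\<^bsub>Z\<^esub> monomial f \<odot>\<^bsub>Z\<^esub> y"
      using mem that(5) by (simp add: Z.smult_r_distr Z.smult_assoc1 monomial_union)
  qed simp
  obtain E where E: "finite E" "\<And>e. e \<in> E \<Longrightarrow> set_mset e \<subseteq> V"
    "\<And>e. set_mset e \<subseteq> V \<Longrightarrow> \<exists>e0\<in>E. e0 \<subseteq># e \<and> lc e0 = lc e"
  proof (rule finite_basis_of_monotone_submodules[OF noeth finite_V, of lc])
    fix e f assume "set_mset e \<subseteq> V" "set_mset f \<subseteq> V" "e \<subseteq># f"
    then have f: "f = (f - e) + e" "set_mset (f - e) \<subseteq> V"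
      by (auto simp: in_diffD subset_iff)
    show "lc e \<subseteq> lc f"
    proof
      fix c assume "c \<in> lc e"
      then obtain u y where
        *: "c \<in> C" "u \<in> S (image_mset col e)" "y \<in> ?Low e" "g u = monomial e \<odot>\<^bsub>Z\<^esub> c \<oplus>\<^bsub>Z\<^esub> y"
        unfolding lc_def by blast
      show "c \<in> lc f" using lift[OF f(2) *] *(1) unfolding f(1)[symmetric] lc_def by blast
    qed
  qed (use lc_sub in auto)
  define gens where "gens = (\<lambda>n. {monomial f \<odot>\<^bsub>X\<^esub> w | f d w.
     set_mset f \<subseteq> V \<and> d \<in> image_mset col ` E \<and> image_mset col f + d = n \<and> w \<in> S d})"
  define G where "G = (\<lambda>n. submodule_span R X ({u \<in> S n. g u \<in> D} \<union> gens n))"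
  have Ggens: "{u \<in> S n. g u \<in> D} \<union> gens n \<subseteq> carrier X" for n
    using Sc by (fastforce simp: gens_def)
  have Gsub: "submodule (G n) R X" for n
    unfolding G_def by (rule X.submodule_span_submodule[OF Ggens])
  have Gincl: "{u \<in> S n. g u \<in> D} \<union> gens n \<subseteq> G n" for n
    unfolding G_def by (rule X.submodule_span_incl)
  \<comment> \<open>The third hypothesis makes A an initial segment of \<open>exponents n\<close>.
    Removing its maximum e then leaves precisely \<open>below e\<close> (\<open>Ae\<close>), so the
    truncation of the induction agrees with the one used in \<open>lc\<close>.\<close>
  have main: "u \<in> G n" if "finite A" "A \<subseteq> exponents n"
    "\<forall>e\<in>A. \<forall>e'\<in>exponents n. lex_less e' e \<longrightarrow> e' \<in> A" "u \<in> S n" "g u \<in> monomial_span Z D C A" for A u n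
    using that
  proof (induction "card A" arbitrary: A u)
    case 0
    then have "A = {}" by simp
    then have "g u \<in> D" using 0 monomial_span_empty by simp
    then show ?case using subsetD[OF Gincl UnI1, of u n] 0 by simp
  next
    case (Suc k)
    then have "A \<noteq> {}" by auto
    obtain e where e: "e \<in> A" "\<And>f. f \<in> A \<Longrightarrow> f \<noteq> e \<Longrightarrow> lex_less f e"
      using lex_max[OF Suc.prems(1) \<open>A \<noteq> {}\<close>] by blast
    have en: "image_mset col e = n" "set_mset e \<subseteq> V" using e Suc.prems by (auto simp: exponents_def)
    have Ae: "A - {e} = below e"
      using e Suc.prems(2,3) lex_less_irrefl unfolding below_def en by blast
    obtain c y where cy: "c \<in> C" "y \<in> ?Low e" "g u = monomial e \<odot>\<^bsub>Z\<^esub> c \<oplus>\<^bsub>Z\<^esub> y"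
      using monomial_span_decompose[OF Suc.prems(5) e(1)] Ae by metis
    then have "c \<in> lc e" using Suc.prems(4) en unfolding lc_def by blast
    \<comment> \<open>The coefficient c already occurs at one of the finitely many exponents in E
      that lie below e. A monomial multiple of a family element of that degree therefore has the
      same leading term as u.\<close>
    then obtain e0 where e0: "e0 \<in> E" "e0 \<subseteq># e" "c \<in> lc e0" using E(3) en by metis
    then obtain w y0 where w: "w \<in> S (image_mset col e0)" "y0 \<in> ?Low e0"
        "g w = monomial e0 \<odot>\<^bsub>Z\<^esub> c \<oplus>\<^bsub>Z\<^esub> y0"
      unfolding lc_def by blast
    define f where "f = e - e0"
    have f: "f + e0 = e" "set_mset f \<subseteq> V" using e0(2) en(2) by (auto simp: f_def in_diffD subset_iff)
    obtain y' where w': "monomial f \<odot>\<^bsub>X\<^esub> w \<in> S n" "y' \<in> ?Low e"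
        "g (monomial f \<odot>\<^bsub>X\<^esub> w) = monomial e \<odot>\<^bsub>Z\<^esub> c \<oplus>\<^bsub>Z\<^esub> y'"
      using lift[OF f(2) cy(1) w] unfolding f(1) en(1) by blast
    let ?w = "monomial f \<odot>\<^bsub>X\<^esub> w" and ?u = "u \<oplus>\<^bsub>X\<^esub> \<ominus>\<^bsub>X\<^esub> (monomial f \<odot>\<^bsub>X\<^esub> w)"
    have w'G: "monomial f \<odot>\<^bsub>X\<^esub> w \<in> G n"
    proof -
      have "image_mset col f + image_mset col e0 = n" using f(1) en(1) by (metis image_mset_union)
      then have "?w \<in> gens n" unfolding gens_def using f(2) e0(1) w(1) by blast
      then show ?thesis using Gincl by blast
    qed
    have c: "u \<in> carrier X" "?w \<in> carrier X" using Suc.prems(4) w'(1) Sc by auto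
    have u': "?u \<in> S n" using X.submoduleE(3,5)[OF Ssub] Suc.prems(4) w'(1) by blast
    have eq: "u = ?u \<oplus>\<^bsub>X\<^esub> ?w" using c by (simp add: X.M.a_assoc X.M.l_neg)
    have mem: "c \<in> carrier Z" "y \<in> carrier Z" "y' \<in> carrier Z" "g ?u \<in> carrier Z"
      using cy w' Cc Lc gc[OF u'] by blast+
    have "monomial e \<odot>\<^bsub>Z\<^esub> c \<oplus>\<^bsub>Z\<^esub> y = g ?u \<oplus>\<^bsub>Z\<^esub> (monomial e \<odot>\<^bsub>Z\<^esub> c \<oplus>\<^bsub>Z\<^esub> y')"
      using linear_map_add[OF g, of ?u ?w] eq c w'(3) cy(3) by simp
    also have "\<dots> = monomial e \<odot>\<^bsub>Z\<^esub> c \<oplus>\<^bsub>Z\<^esub> (g ?u \<oplus>\<^bsub>Z\<^esub> y')" using mem by (simp add: Z.M.a_lcomm)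
    finally have "y = g ?u \<oplus>\<^bsub>Z\<^esub> y'" using mem by simp
    then have "g ?u \<in> ?Low e"
      using Z.submodule_add_cancel[OF monomial_span_submodule mem(4) w'(2)] cy(2) by simp
    have "?u \<in> G n"
    proof (rule Suc.hyps(1)[of "A - {e}"])
      show "k = card (A - {e})" using Suc.hyps(2) Suc.prems(1) e(1) by simp
      show "\<forall>e'\<in>A - {e}. \<forall>e''\<in>exponents n. lex_less e'' e' \<longrightarrow> e'' \<in> A - {e}"
        using Suc.prems(3) e lex_less_trans lex_less_irrefl by blast
      show "g ?u \<in> monomial_span Z D C (A - {e})" using \<open>g ?u \<in> ?Low e\<close> Ae by simp
    qed (use Suc.prems u' in auto)
    then show ?case using X.submoduleE(5)[OF Gsub _ w'G] eq by metis
  qed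
  have "S n \<subseteq> G n" for n
    using main[OF finite_exponents, of n n] gS unfolding ideal_power_def by blast
  moreover have "set_mset d \<subseteq> col ` V" if "d \<in> image_mset col ` E" for d
    using that E(2) by fastforce
  ultimately show ?thesis using E(1) unfolding G_def gens_def
    by (intro exI[of _ "image_mset col ` E"] conjI allI ballI) auto
qed

end

end

section \<open>Artin--Rees for a unit step of the exponent\<close>

context graded_generators
begin

text \<open>This one-step form of Artin--Rees fits the later comparison of n with n + e_j: apart
  from K, everything at n + e_j comes from S at n by multiplication with generators of colour
  j.\<close>

definition eventually_generated ::
    "('a, 'm, 'e) module_scheme \<Rightarrow> ('c multiset \<Rightarrow> 'm set) \<Rightarrow> ('c multiset \<Rightarrow> 'm set) \<Rightarrow> bool" where
  "eventually_generated X S K \<longleftrightarrow> (\<exists>k. set_mset k \<subseteq> col ` V \<and> (\<forall>n j. k \<subseteq># n \<longrightarrow>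
     S (add_mset j n) \<subseteq> submodule_span R X (K (add_mset j n) \<union>
       {a v \<odot>\<^bsub>X\<^esub> w | v w. v \<in> V \<and> col v = j \<and> w \<in> S n})))"

lemma graded_family_subset_carrier:
  assumes "module R X" "graded_family X S"
  shows "S n \<subseteq> carrier X"
  by (rule module.submoduleE(1)[OF assms(1) graded_familyD(1)[OF assms(2)]])

lemma eventually_generated_gens:
  assumes "module R X" "graded_family X S" "K n \<subseteq> carrier X"
  shows "K n \<union> {a v \<odot>\<^bsub>X\<^esub> w | v w. v \<in> V \<and> col v = j \<and> w \<in> S m} \<subseteq> carrier X"
proof -
  interpret X: module R X by fact
  show ?thesis using graded_family_subset_carrier[OF assms(1,2)] assms(3) a_closed by blast
qed

text \<open>The products in the second relation come from K, which is contained in S, so they are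
  among those of the first. The two thresholds are added.\<close>

lemma eventually_generated_trans:
  assumes X: "module R X" and S: "graded_family X S" and K: "graded_family X K" and L: "graded_family X L"
    and KS: "\<And>n. K n \<subseteq> S n"
    and SK: "eventually_generated X S K" and KL: "eventually_generated X K L"
  shows "eventually_generated X S L"
proof -
  interpret X: module R X by fact
  obtain k where k: "set_mset k \<subseteq> col ` V" "\<And>n j. k \<subseteq># n \<Longrightarrow> S (add_mset j n) \<subseteq> submodule_span R X (K (add_mset j n) \<union>
       {a v \<odot>\<^bsub>X\<^esub> w | v w. v \<in> V \<and> col v = j \<and> w \<in> S n})"
    using SK unfolding eventually_generated_def by blast
  obtain l where l: "set_mset l \<subseteq> col ` V" "\<And>n j. l \<subseteq># n \<Longrightarrow> K (add_mset j n) \<subseteq> submodule_span R X (L (add_mset j n) \<union>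
       {a v \<odot>\<^bsub>X\<^esub> w | v w. v \<in> V \<and> col v = j \<and> w \<in> K n})"
    using KL unfolding eventually_generated_def by blast
  have "S (add_mset j n) \<subseteq> submodule_span R X (L (add_mset j n) \<union>
       {a v \<odot>\<^bsub>X\<^esub> w | v w. v \<in> V \<and> col v = j \<and> w \<in> S n})" (is "_ \<subseteq> ?T") if "k + l \<subseteq># n" for n j
  proof -
    have kn: "k \<subseteq># n" "l \<subseteq># n" using that subset_mset.dual_order.trans[OF that] by auto
    note gens = eventually_generated_gens[OF X S, of L "add_mset j n" j n, OF graded_family_subset_carrier[OF X L]]
    have "{a v \<odot>\<^bsub>X\<^esub> w | v w. v \<in> V \<and> col v = j \<and> w \<in> K n} \<subseteq>
        {a v \<odot>\<^bsub>X\<^esub> w | v w. v \<in> V \<and> col v = j \<and> w \<in> S n}"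
      using KS by blast
    then have "L (add_mset j n) \<union> {a v \<odot>\<^bsub>X\<^esub> w | v w. v \<in> V \<and> col v = j \<and> w \<in> K n} \<subseteq> ?T"
      by (intro subset_trans[OF _ X.submodule_span_incl]) (rule Un_mono[OF subset_refl])
    then have "K (add_mset j n) \<subseteq> ?T"
      by (rule subset_trans[OF l(2)[OF kn(2)] X.submodule_span_mono[OF _ gens]])
    moreover have "{a v \<odot>\<^bsub>X\<^esub> w | v w. v \<in> V \<and> col v = j \<and> w \<in> S n} \<subseteq> ?T"
      by (rule subset_trans[OF _ X.submodule_span_incl]) blast
    ultimately have "K (add_mset j n) \<union> {a v \<odot>\<^bsub>X\<^esub> w | v w. v \<in> V \<and> col v = j \<and> w \<in> S n} \<subseteq> ?T"
      by (rule Un_least)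
    then show ?thesis by (rule subset_trans[OF k(2)[OF kn(1)] X.submodule_span_mono[OF _ gens]])
  qed
  then show ?thesis unfolding eventually_generated_def
    by (intro exI[of _ "k + l"]) (use k(1) l(1) in auto)
qed

text \<open>The threshold is the sum of the finitely many generator degrees. Above it each such
  degree d satisfies d \<le> n, so a monomial that leads from d to n + e_j has a factor of colour j.
  Splitting that factor off leaves an element of S at n.\<close>

lemma eventually_generated_linear:
  assumes X: "module R X" and Z: "noetherian_module R Z" and D: "submodule D R Z" and C: "submodule C R Z"
    and g: "linear_map R X Z g" and S: "graded_family X S"
    and gS: "\<And>n. S n \<subseteq> {u. g u \<in> ideal_power Z D C n}"
  shows "eventually_generated X S (\<lambda>n. {u \<in> S n. g u \<in> D})"
proof -
  interpret X: module R X by fact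
  have Zm: "module R Z" using Z by (simp add: noetherian_module_def)
  obtain E where E: "finite E" "\<And>d. d \<in> E \<Longrightarrow> set_mset d \<subseteq> col ` V"
    "\<forall>n. S n \<subseteq> submodule_span R X ({u \<in> S n. g u \<in> D} \<union>
     {monomial f \<odot>\<^bsub>X\<^esub> w | f d w. set_mset f \<subseteq> V \<and> d \<in> E \<and> image_mset col f + d = n \<and> w \<in> S d})"
    using graded_family_generators[OF Zm D C X Z g S gS] by (elim exE conjE, intro that) auto
  define k where "k = (\<Sum>d\<in>E. d)"
  have dk: "d \<subseteq># k" if "d \<in> E" for d
    using that E(1) by (simp add: k_def sum.remove)
  have "S (add_mset j n) \<subseteq> submodule_span R X ({u \<in> S (add_mset j n). g u \<in> D} \<union>
       {a v \<odot>\<^bsub>X\<^esub> w | v w. v \<in> V \<and> col v = j \<and> w \<in> S n})" (is "_ \<subseteq> submodule_span R X ?G")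
    if "k \<subseteq># n" for n j
  proof -
    have G: "?G \<subseteq> carrier X"
      by (rule eventually_generated_gens[OF X S, of "\<lambda>n. {u \<in> S n. g u \<in> D}"])
         (use graded_family_subset_carrier[OF X S] in auto)
    have "monomial f \<odot>\<^bsub>X\<^esub> w \<in> ?G"
      if *: "set_mset f \<subseteq> V" "d \<in> E" "image_mset col f + d = add_mset j n" "w \<in> S d" for f d w
    proof -
      have "d \<subseteq># n" using dk[OF *(2)] \<open>k \<subseteq># n\<close> by (rule subset_mset.order_trans)
      then obtain m where m: "n = m + d" by (metis add.commute subset_mset.less_eqE)
      then have fm: "image_mset col f = add_mset j m" using *(3) by auto
      then obtain v f' where f': "f = add_mset v f'" "col v = j" "image_mset col f' = m"
        using msed_map_invR[OF fm] by blast
      then have v: "v \<in> V" "set_mset f' \<subseteq> V" using *(1) by auto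
      have w: "w \<in> carrier X" using *(4) graded_family_subset_carrier[OF X S] by blast
      have "monomial f = a v \<otimes> monomial f'"
        using monomial_union[of "{#v#}" f'] monomial_single v f' by simp
      then have "monomial f \<odot>\<^bsub>X\<^esub> w = a v \<odot>\<^bsub>X\<^esub> (monomial f' \<odot>\<^bsub>X\<^esub> w)"
        using w v a_closed by (simp add: X.smult_assoc1)
      moreover have "monomial f' \<odot>\<^bsub>X\<^esub> w \<in> S n"
        using graded_family_monomial[OF X S *(4) v(2)] f'(3) m by simp
      ultimately show ?thesis using v(1) f'(2) by blast
    qed
    then have "{monomial f \<odot>\<^bsub>X\<^esub> w | f d w. set_mset f \<subseteq> V \<and> d \<in> E \<and>
        image_mset col f + d = add_mset j n \<and> w \<in> S d} \<subseteq> ?G" by blast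
    then have "{u \<in> S (add_mset j n). g u \<in> D} \<union> {monomial f \<odot>\<^bsub>X\<^esub> w | f d w. set_mset f \<subseteq> V \<and> d \<in> E \<and>
        image_mset col f + d = add_mset j n \<and> w \<in> S d} \<subseteq> submodule_span R X ?G"
      by (intro subset_trans[OF _ X.submodule_span_incl[of ?G]]) (rule Un_least[OF Un_upper1])
    from subset_trans[OF E(3)[rule_format, of "add_mset j n"] X.submodule_span_mono[OF this G]]
    show ?thesis .
  qed
  moreover have "set_mset k \<subseteq> col ` V" using E(1,2) by (auto simp: k_def set_mset_sum)
  ultimately show ?thesis unfolding eventually_generated_def by (intro exI[of _ k]) blast
qed

lemma graded_family_vimage:
  assumes X: "module R X" and Z: "module R Z" and g: "linear_map R X Z g" and S: "graded_family X S"
    and T: "graded_family Z T"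
  shows "graded_family X (\<lambda>n. {u \<in> S n. g u \<in> T n})"
  unfolding graded_family_def
proof (intro conjI allI ballI)
  interpret X: module R X by fact
  note Sc = graded_family_subset_carrier[OF X S]
  show "submodule {u \<in> S n. g u \<in> T n} R X" for n
  proof -
    have "{u \<in> S n. g u \<in> T n} = S n \<inter> {u \<in> carrier X. g u \<in> T n}" using Sc by blast
    then show ?thesis
      using X.submodule_Int[OF graded_familyD(1)[OF S] submodule_vimage[OF X Z g graded_familyD(1)[OF T]]]
      by simp
  qed
  fix v n u assume v: "v \<in> V" and u: "u \<in> {u \<in> S n. g u \<in> T n}"
  then have "u \<in> carrier X" using Sc by blast
  then have "g (a v \<odot>\<^bsub>X\<^esub> u) = a v \<odot>\<^bsub>Z\<^esub> g u" using linear_map_smult[OF g a_closed[OF v]] by blast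
  then show "a v \<odot>\<^bsub>X\<^esub> u \<in> {u \<in> S (add_mset (col v) n). g u \<in> T (add_mset (col v) n)}"
    using u graded_familyD(2)[OF S v] graded_familyD(2)[OF T v] by simp
qed

lemma graded_family_const:
  assumes "module R X" "submodule D R X"
  shows "graded_family X (\<lambda>n. D)"
  using assms module.submoduleE(4)[OF assms] a_closed by (auto simp: graded_family_def)

text \<open>One factor of colour j of each monomial is absorbed into C, which is stable under
  R.\<close>

lemma ideal_power_antimono:
  assumes Z: "module R Z" and D: "submodule D R Z" and C: "submodule C R Z"
  shows "ideal_power Z D C (add_mset j n) \<subseteq> ideal_power Z D C n"
proof -
  interpret Z: module R Z by fact
  note gen = monomial_span_gen[OF Z D C]
  have "monomial e \<odot>\<^bsub>Z\<^esub> c \<in> ideal_power Z D C n" if e: "e \<in> exponents (add_mset j n)" and c: "c \<in> C" for e c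
  proof -
    obtain v f where f: "e = add_mset v f" "col v = j" "image_mset col f = n"
      using e msed_map_invR[of col e j n] by (auto simp: exponents_def)
    then have v: "v \<in> V" "f \<in> exponents n" using e by (auto simp: exponents_def)
    have "c \<in> carrier Z" using c Z.submoduleE(1)[OF C] by blast
    moreover have "monomial e = monomial f \<otimes> a v"
      using monomial_union[of f "{#v#}"] monomial_single v f by simp
    ultimately have "monomial e \<odot>\<^bsub>Z\<^esub> c = monomial f \<odot>\<^bsub>Z\<^esub> (a v \<odot>\<^bsub>Z\<^esub> c)"
      using v a_closed by (simp add: Z.smult_assoc1)
    then show ?thesis using gen[OF v(2) Z.submoduleE(4)[OF C a_closed[OF v(1)] c]]
      by (simp add: ideal_power_def)
  qed
  then show ?thesis unfolding ideal_power_def[of Z D C "add_mset j n"] monomial_span_def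
    using monomial_span_base[OF Z D C] unfolding ideal_power_def
    by (intro Z.submodule_span_least[OF monomial_span_submodule[OF Z D C]]) blast
qed

lemma maximal_ideal_in_set:
  assumes "\<A> \<noteq> {}" "\<And>I. I \<in> \<A> \<Longrightarrow> ideal I R"
  obtains M where "M \<in> \<A>" "\<And>I. I \<in> \<A> \<Longrightarrow> M \<subseteq> I \<Longrightarrow> I = M"
proof -
  have "\<Union>\<C> \<in> \<A>" if "\<C> \<noteq> {}" "subset.chain \<A> \<C>" for \<C>
  proof -
    have "subset.chain {I. ideal I R} \<C>" using that(2) assms(2) by (auto simp: pred_on.chain_def)
    then have "\<Union>\<C> \<in> \<C>" using ideal_chain_is_trivial that(1) by blast
    then show ?thesis using that(2) by (auto simp: pred_on.chain_def)
  qed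
  then show ?thesis using subset_Zorn_nonempty[OF assms(1)] that by metis
qed

lemma primeideal_one_notin: "primeideal P R \<Longrightarrow> \<one> \<notin> P"
  using primeideal.I_notcarr ideal.one_imp_carrier primeideal.axioms(1) by metis

section \<open>Finiteness of the asymptotic primes\<close>

definition intermediate_family ::
    "('a, 'm, 'e) module_scheme \<Rightarrow> 'm set \<Rightarrow> 'm set \<Rightarrow> ('c multiset \<Rightarrow> 'm set) \<Rightarrow> bool" where
  "intermediate_family X D B J \<longleftrightarrow> graded_family X J \<and> (\<forall>n. D \<subseteq> J n \<and> J n \<subseteq> ideal_power X D B n)"

text \<open>The larger family is the first component, so well-foundedness of this relation is the
  ascending chain condition for intermediate families.\<close>

definition family_order :: "('a, 'm, 'e) module_scheme \<Rightarrow> 'm set \<Rightarrow> 'm set \<Rightarrow>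
    (('c multiset \<Rightarrow> 'm set) \<times> ('c multiset \<Rightarrow> 'm set)) set" where
  "family_order X D B = {(J', J). intermediate_family X D B J \<and> intermediate_family X D B J' \<and>
     (\<forall>n. J n \<subseteq> J' n) \<and> J \<noteq> J'}"

definition family_primes ::
    "('a, 'm, 'e) module_scheme \<Rightarrow> 'm set \<Rightarrow> 'm set \<Rightarrow> ('c multiset \<Rightarrow> 'm set) \<Rightarrow> 'a set set" where
  "family_primes X D B J = {P. primeideal P R \<and>
     (\<exists>n. \<exists>x\<in>ideal_power X D B n. P = {r \<in> carrier R. r \<odot>\<^bsub>X\<^esub> x \<in> J n})}"

context
  fixes X :: "('a, 'm, 'e) module_scheme" and D B :: "'m set"
  assumes noeth: "noetherian_module R X" and D: "submodule D R X" and B: "submodule B R X"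
begin

interpretation X: module R X using noeth by (simp add: noetherian_module_def)

text \<open>The union of an ascending chain of families is generated, modulo D, in finitely many
  degrees. In each of these degrees the chain stabilizes because X is Noetherian, and from then on
  the chain equals its union in all degrees, since every member contains D.\<close>

lemma wf_family_order: "wf (family_order X D B)"
  unfolding wf_iff_no_infinite_down_chain
proof
  assume "\<exists>f. \<forall>i. (f (Suc i), f i) \<in> family_order X D B"
  then obtain F where F: "\<And>i. (F (Suc i), F i) \<in> family_order X D B" by blast
  then have fam: "intermediate_family X D B (F i)" and inc: "F i n \<subseteq> F (Suc i) n" and ne: "F i \<noteq> F (Suc i)" for i n
    by (auto simp: family_order_def)
  have gr: "graded_family X (F i)" and DF: "D \<subseteq> F i n" "F i n \<subseteq> ideal_power X D B n" for i n
    using fam by (auto simp: intermediate_family_def)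
  have mono: "F i n \<subseteq> F j n" if "i \<le> j" for i j n
    using inc that by (rule lift_Suc_mono_le)
  define U where "U = (\<lambda>n. \<Union>i. F i n)"
  have U: "graded_family X U"
    unfolding graded_family_def U_def
    using X.submodule_chain_Union[of "\<lambda>i. F i n" for n, OF graded_familyD(1)[OF gr] inc]
      graded_familyD(2)[OF gr] by blast
  obtain E where E: "finite E"
    "\<forall>n. U n \<subseteq> submodule_span R X ({u \<in> U n. u \<in> D} \<union>
     {monomial f \<odot>\<^bsub>X\<^esub> w | f d w. set_mset f \<subseteq> V \<and> d \<in> E \<and> image_mset col f + d = n \<and> w \<in> U d})"
  proof -
    have "U n \<subseteq> {u. u \<in> ideal_power X D B n}" for n
      using DF(2) unfolding U_def by blast
    from graded_family_generators[OF X.module_axioms D B X.module_axioms noeth linear_map_id U this]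
    show ?thesis by (elim exE conjE, intro that) auto
  qed
  have "\<exists>m. \<forall>d\<in>E. \<forall>i\<ge>m. F i d = F m d" using E(1)
  proof induction
    case (insert d E)
    then obtain m where m: "\<forall>d\<in>E. \<forall>i\<ge>m. F i d = F m d" by blast
    obtain m' where m': "\<forall>i\<ge>m'. F i d = F m' d"
      using noetherian_chain_stable[OF noeth, of "\<lambda>i. F i d"] graded_familyD(1)[OF gr] inc by blast
    have "F i e = F (max m m') e" if "e \<in> insert d E" "i \<ge> max m m'" for e i
    proof (cases "e = d")
      case True
      then show ?thesis using m' that(2) by (metis max.bounded_iff max.cobounded2)
    next
      case False
      then show ?thesis using m that by (metis insert_iff max.bounded_iff max.cobounded1)
    qed
    then show ?case by blast
  qed simp
  then obtain m where m: "\<And>d i. d \<in> E \<Longrightarrow> i \<ge> m \<Longrightarrow> F i d = F m d" by blast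
  have UE: "U d = F m d" if "d \<in> E" for d
  proof -
    have "F i d \<subseteq> F m d" for i
      using mono[of i "max i m" d] m[OF that, of "max i m"] by auto
    then show ?thesis by (auto simp: U_def)
  qed
  have "U n \<subseteq> F m n" for n
  proof -
    have "monomial f \<odot>\<^bsub>X\<^esub> w \<in> F m n" if "set_mset f \<subseteq> V" "d \<in> E" "image_mset col f + d = n" "w \<in> U d" for f d w
      using graded_family_monomial[OF X.module_axioms gr, of w m d f] that UE by auto
    then have "{u \<in> U n. u \<in> D} \<union>
     {monomial f \<odot>\<^bsub>X\<^esub> w | f d w. set_mset f \<subseteq> V \<and> d \<in> E \<and> image_mset col f + d = n \<and> w \<in> U d} \<subseteq> F m n"
      using DF(1) by blast
    then show ?thesis using E(2)[rule_format, of n] X.submodule_span_least[OF graded_familyD(1)[OF gr]] by blast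
  qed
  then have "F (Suc m) n \<subseteq> F m n" for n unfolding U_def by blast
  then show False using inc ne[of m] by blast
qed

lemma finite_family_primes: "intermediate_family X D B J \<Longrightarrow> finite (family_primes X D B J)"
proof (induction J rule: wf_induct_rule[OF wf_family_order])
  case (1 J)
  let ?L = "ideal_power X D B"
  have gr: "graded_family X J" and DJ: "D \<subseteq> J n" "J n \<subseteq> ?L n" for n
    using 1(2) by (auto simp: intermediate_family_def)
  note L = graded_family_ideal_power[OF X.module_axioms D B]
  have Lc: "?L n \<subseteq> carrier X" for n using graded_family_subset_carrier[OF X.module_axioms L] .
  note Jsub = graded_familyD(1)[OF gr]
  show ?case
  proof (cases "\<forall>n. ?L n \<subseteq> J n")
    case True
    have False if P: "primeideal P R" "x \<in> ?L n" "P = {r \<in> carrier R. r \<odot>\<^bsub>X\<^esub> x \<in> J n}" for P x n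
    proof -
      have "\<one> \<odot>\<^bsub>X\<^esub> x \<in> J n" using True P(2) subsetD[OF Lc P(2)] by auto
      then show False using primeideal_one_notin[OF P(1)] P(3) by simp
    qed
    then have "family_primes X D B J = {}" by (auto simp: family_primes_def)
    then show ?thesis by simp
  next
    case False
    \<comment> \<open>The annihilators for all n are collected in one set, so that a single maximal
      Q serves in every degree.\<close>
    let ?\<A> = "{{r \<in> carrier R. r \<odot>\<^bsub>X\<^esub> x \<in> J n} | n x. x \<in> ?L n \<and> x \<notin> J n}"
    have "?\<A> \<noteq> {}" using False by blast
    moreover have "ideal I R" if "I \<in> ?\<A>" for I using that X.ideal_colon[OF Jsub] Lc by blast
    ultimately obtain Q where Q: "Q \<in> ?\<A>" "\<And>I. I \<in> ?\<A> \<Longrightarrow> Q \<subseteq> I \<Longrightarrow> I = Q"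
      using maximal_ideal_in_set[of ?\<A>] by blast
    then obtain n0 x0 where x0: "x0 \<in> ?L n0" "x0 \<notin> J n0" "Q = {r \<in> carrier R. r \<odot>\<^bsub>X\<^esub> x0 \<in> J n0}" by blast
    then have Qc: "Q \<subseteq> carrier R" by blast
    \<comment> \<open>This is the colon of J by Q inside ?L. It is strictly larger than J because it
      contains x0.\<close>
    define J' where "J' = (\<lambda>n. {x \<in> ?L n. \<forall>q\<in>Q. q \<odot>\<^bsub>X\<^esub> x \<in> J n})"
    have JJ': "J n \<subseteq> J' n" for n
      using DJ X.submoduleE(4)[OF Jsub] Qc unfolding J'_def by blast
    have "graded_family X J'"
      unfolding graded_family_def
    proof (intro conjI allI ballI)
      fix n
      show "submodule (J' n) R X"
      proof (rule X.submoduleI')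
        show "J' n \<subseteq> carrier X" using Lc by (auto simp: J'_def)
        show "\<zero>\<^bsub>X\<^esub> \<in> J' n" using JJ' X.submodule_zero_closed[OF Jsub] by blast
        fix x y assume xy: "x \<in> J' n" "y \<in> J' n"
        then have "x \<in> carrier X" "y \<in> carrier X" using Lc by (auto simp: J'_def)
        then show "x \<oplus>\<^bsub>X\<^esub> y \<in> J' n"
          using xy Qc X.submoduleE(5)[OF graded_familyD(1)[OF L]] X.submoduleE(5)[OF Jsub]
          by (auto simp: J'_def X.smult_r_distr subset_iff)
      next
        fix r x assume r: "r \<in> carrier R" and x: "x \<in> J' n"
        then have xc: "x \<in> carrier X" using Lc by (auto simp: J'_def)
        have "q \<odot>\<^bsub>X\<^esub> (r \<odot>\<^bsub>X\<^esub> x) = r \<odot>\<^bsub>X\<^esub> (q \<odot>\<^bsub>X\<^esub> x)" if "q \<in> Q" for q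
          using that Qc r xc by (simp add: X.smult_assoc1[symmetric] m_comm subset_iff)
        then show "r \<odot>\<^bsub>X\<^esub> x \<in> J' n"
          using x r X.submoduleE(4)[OF graded_familyD(1)[OF L] r] X.submoduleE(4)[OF Jsub r]
          by (auto simp: J'_def)
      qed
      fix v x assume v: "v \<in> V" and x: "x \<in> J' n"
      then have xc: "x \<in> carrier X" using Lc by (auto simp: J'_def)
      have "q \<odot>\<^bsub>X\<^esub> (a v \<odot>\<^bsub>X\<^esub> x) = a v \<odot>\<^bsub>X\<^esub> (q \<odot>\<^bsub>X\<^esub> x)" if "q \<in> Q" for q
        using that Qc a_closed[OF v] xc by (simp add: X.smult_assoc1[symmetric] m_comm subset_iff)
      then show "a v \<odot>\<^bsub>X\<^esub> x \<in> J' (add_mset (col v) n)"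
        using x graded_familyD(2)[OF L v] graded_familyD(2)[OF gr v] by (auto simp: J'_def)
    qed
    then have J': "intermediate_family X D B J'"
      using JJ' DJ(1) by (fastforce simp: intermediate_family_def J'_def)
    moreover have "x0 \<in> J' n0" using x0 by (auto simp: J'_def)
    ultimately have "(J', J) \<in> family_order X D B"
      using 1(2) JJ' x0(2) by (auto simp: family_order_def)
    then have fin: "finite (family_primes X D B J')" using 1(1) J' by blast
    have "family_primes X D B J \<subseteq> insert Q (family_primes X D B J')"
    proof
      fix P assume "P \<in> family_primes X D B J"
      then obtain n x where P: "primeideal P R" and x: "x \<in> ?L n" "P = {r \<in> carrier R. r \<odot>\<^bsub>X\<^esub> x \<in> J n}"
        by (auto simp: family_primes_def)
      have xc: "x \<in> carrier X" using x Lc by auto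
      \<comment> \<open>If some r outside P moves x into J', then r x is nonzero modulo J, its
        annihilator is still P because P is prime, and Q kills it; maximality of Q gives P = Q.
        Otherwise x has the same annihilator modulo J and modulo J', so P survives.\<close>
      show "P \<in> insert Q (family_primes X D B J')"
      proof (cases "\<exists>r\<in>carrier R - P. r \<odot>\<^bsub>X\<^esub> x \<in> J' n")
        case True
        then obtain r where r: "r \<in> carrier R" "r \<notin> P" "r \<odot>\<^bsub>X\<^esub> x \<in> J' n" by blast
        let ?y = "r \<odot>\<^bsub>X\<^esub> x"
        have y: "?y \<in> ?L n" "?y \<notin> J n" using r x(2) by (auto simp: J'_def)
        have Py: "{s \<in> carrier R. s \<odot>\<^bsub>X\<^esub> ?y \<in> J n} = P"
        proof -
          have "s \<odot>\<^bsub>X\<^esub> ?y \<in> J n \<longleftrightarrow> s \<in> P" if s: "s \<in> carrier R" for s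
          proof -
            have "s \<odot>\<^bsub>X\<^esub> ?y = (s \<otimes> r) \<odot>\<^bsub>X\<^esub> x" using s r xc by (simp add: X.smult_assoc1)
            then have "s \<odot>\<^bsub>X\<^esub> ?y \<in> J n \<longleftrightarrow> s \<otimes> r \<in> P" using x(2) s r by simp
            also have "\<dots> \<longleftrightarrow> s \<in> P"
              using primeideal.I_prime[OF P s r(1)] r ideal.I_r_closed[OF primeideal.axioms(1)[OF P]] by blast
            finally show ?thesis .
          qed
          then show ?thesis using x(2) by blast
        qed
        moreover have "Q \<subseteq> {s \<in> carrier R. s \<odot>\<^bsub>X\<^esub> ?y \<in> J n}" using r(3) Qc by (auto simp: J'_def)
        ultimately have "P = Q" using Q(2)[of P] y by blast
        then show ?thesis by simp
      next
        case False
        then have "P = {r \<in> carrier R. r \<odot>\<^bsub>X\<^esub> x \<in> J' n}" using x(2) JJ' by blast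
        then show ?thesis using P x(1) by (auto simp: family_primes_def)
      qed
    qed
    then show ?thesis using fin finite_subset by blast
  qed
qed

end

end

context graded_generators
begin

lemma ideal_power_base:
  assumes Z: "module R Z" and D: "submodule D R Z" and C: "submodule C R Z"
  shows "D \<subseteq> ideal_power Z D C n"
  unfolding ideal_power_def by (rule monomial_span_base[OF Z D C])

lemma ideal_power_empty:
  assumes Z: "module R Z" and D: "submodule D R Z" and C: "submodule C R Z"
  shows "C \<subseteq> ideal_power Z D C {#}"
proof
  fix c assume c: "c \<in> C"
  interpret Z: module R Z by fact
  have "monomial {#} \<odot>\<^bsub>Z\<^esub> c \<in> ideal_power Z D C {#}"
    unfolding ideal_power_def by (rule monomial_span_gen[OF Z D C _ c]) (simp add: exponents_def)
  then show "c \<in> ideal_power Z D C {#}" using c Z.submoduleE(1)[OF C] by auto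
qed

text \<open>The product s r lies in P only if s does. Hence an element with prime annihilator may be
  replaced by a multiple that lies in a smaller submodule.\<close>

lemma colon_smult_prime:
  assumes X: "module R X" and P: "primeideal P R" and x: "x \<in> carrier X"
    and Px: "P = {r \<in> carrier R. r \<odot>\<^bsub>X\<^esub> x \<in> H}" and r: "r \<in> carrier R" "r \<notin> P"
  shows "{s \<in> carrier R. s \<odot>\<^bsub>X\<^esub> (r \<odot>\<^bsub>X\<^esub> x) \<in> H} = P"
proof -
  interpret X: module R X by fact
  have "s \<odot>\<^bsub>X\<^esub> (r \<odot>\<^bsub>X\<^esub> x) \<in> H \<longleftrightarrow> s \<in> P" if s: "s \<in> carrier R" for s
  proof -
    have "s \<odot>\<^bsub>X\<^esub> (r \<odot>\<^bsub>X\<^esub> x) = (s \<otimes> r) \<odot>\<^bsub>X\<^esub> x" using s r x by (simp add: X.smult_assoc1)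
    then have "s \<odot>\<^bsub>X\<^esub> (r \<odot>\<^bsub>X\<^esub> x) \<in> H \<longleftrightarrow> s \<otimes> r \<in> P" using Px s r by simp
    also have "\<dots> \<longleftrightarrow> s \<in> P"
      using primeideal.I_prime[OF P s r(1)] r ideal.I_r_closed[OF primeideal.axioms(1)[OF P]] by blast
    finally show ?thesis .
  qed
  then show ?thesis using Px by blast
qed

definition quotient_primes :: "('a, 'm, 'e) module_scheme \<Rightarrow> 'm set \<Rightarrow> 'a set set" where
  "quotient_primes X H = {P. primeideal P R \<and> (\<exists>x\<in>carrier X. P = {r \<in> carrier R. r \<odot>\<^bsub>X\<^esub> x \<in> H})}"

text \<open>A prime of X modulo the power at n + e_j is a prime of X modulo the power at n, or a
  prime of the layer between the two. By induction only the exponent 0 and the layers matter, and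
  for fixed j all layers together are governed by one intermediate family.\<close>

lemma finite_asymptotic_primes:
  assumes noeth: "noetherian_module R X" and D: "submodule D R X" and B: "submodule B R X"
    and "finite J"
  shows "finite (\<Union>n\<in>{n. set_mset n \<subseteq> J}. quotient_primes X (ideal_power X D B n))"
proof -
  interpret X: module R X using noeth by (simp add: noetherian_module_def)
  note X = X.module_axioms
  let ?L = "ideal_power X D B"
  note L = graded_family_ideal_power[OF X D B]
  have Lc: "?L n \<subseteq> carrier X" for n by (rule graded_family_subset_carrier[OF X L])
  \<comment> \<open>At exponent 0 the whole module X has to be considered modulo ?L {#}. Taking ?L
    {#} as the fixed submodule and \<open>carrier X\<close> as the one multiplied by the ideals
    brings this into the form of \<open>family_primes\<close>.\<close>
  let ?base = "family_primes X (?L {#}) (carrier X) (\<lambda>_. ?L {#})"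
  let ?S = "\<lambda>j. family_primes X D B (\<lambda>n. ?L (add_mset j n))"
  have "finite ?base"
  proof (rule finite_family_primes[OF noeth graded_familyD(1)[OF L] X.carrier_is_submodule])
    show "intermediate_family X (?L {#}) (carrier X) (\<lambda>_. ?L {#})"
      unfolding intermediate_family_def
      using graded_family_const[OF X graded_familyD(1)[OF L]]
        ideal_power_base[OF X graded_familyD(1)[OF L] X.carrier_is_submodule] by blast
  qed
  moreover have "finite (?S j)" for j
  proof (rule finite_family_primes[OF noeth D B])
    have "graded_family X (\<lambda>n. ?L (add_mset j n))"
      unfolding graded_family_def
    proof (intro conjI allI ballI)
      fix v n x assume "v \<in> V" "x \<in> ?L (add_mset j n)"
      then have "a v \<odot>\<^bsub>X\<^esub> x \<in> ?L (add_mset (col v) (add_mset j n))" by (rule graded_familyD(2)[OF L])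
      then show "a v \<odot>\<^bsub>X\<^esub> x \<in> ?L (add_mset j (add_mset (col v) n))" by (simp add: add_mset_commute)
    qed (rule graded_familyD(1)[OF L])
    then show "intermediate_family X D B (\<lambda>n. ?L (add_mset j n))"
      unfolding intermediate_family_def
      using ideal_power_base[OF X D B] ideal_power_antimono[OF X D B] by simp
  qed
  ultimately have fin: "finite (?base \<union> (\<Union>j\<in>J. ?S j))" using assms(4) by blast
  have "quotient_primes X (?L n) \<subseteq> ?base \<union> (\<Union>j\<in>J. ?S j)" if "set_mset n \<subseteq> J" for n
    using that
  proof (induction n)
    case empty
    have "carrier X \<subseteq> ideal_power X (?L {#}) (carrier X) {#}"
      by (rule ideal_power_empty[OF X graded_familyD(1)[OF L] X.carrier_is_submodule])
    then have "quotient_primes X (?L {#}) \<subseteq> ?base"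
      unfolding quotient_primes_def family_primes_def
      by blast
    then show ?case by blast
  next
    case (add j n)
    show ?case
    proof
      fix P assume "P \<in> quotient_primes X (?L (add_mset j n))"
      then obtain x where P: "primeideal P R" and x: "x \<in> carrier X"
        "P = {r \<in> carrier R. r \<odot>\<^bsub>X\<^esub> x \<in> ?L (add_mset j n)}" by (auto simp: quotient_primes_def)
      show "P \<in> ?base \<union> (\<Union>j\<in>J. ?S j)"
      proof (cases "\<exists>r\<in>carrier R - P. r \<odot>\<^bsub>X\<^esub> x \<in> ?L n")
        case True
        then obtain r where r: "r \<in> carrier R" "r \<notin> P" "r \<odot>\<^bsub>X\<^esub> x \<in> ?L n" by blast
        then have "P \<in> ?S j"
          using colon_smult_prime[OF X P x r(1,2)] P unfolding family_primes_def by blast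
        then show ?thesis using add.prems by auto
      next
        case False
        then have "P = {r \<in> carrier R. r \<odot>\<^bsub>X\<^esub> x \<in> ?L n}"
          using x(2) ideal_power_antimono[OF X D B, of j n] by blast
        then have "P \<in> quotient_primes X (?L n)" using P x(1) unfolding quotient_primes_def by blast
        then show ?thesis using add by auto
      qed
    qed
  qed
  then show ?thesis by (intro finite_subset[OF UN_least fin]) simp
qed

section \<open>Stability of the associated primes\<close>

text \<open>Scaling by q is a linear map, so each element of Q is one application of
  \<open>eventually_generated_linear\<close>. The family cut down so far takes the place of S in the
  next application.\<close>

lemma eventually_generated_colon:
  assumes noeth: "noetherian_module R X" and D: "submodule D R X" and B: "submodule B R X"
    and "finite Q" "Q \<subseteq> carrier R" and "graded_family X S"
    and "\<And>n. S n \<subseteq> {u. \<forall>q\<in>Q. q \<odot>\<^bsub>X\<^esub> u \<in> ideal_power X D B n}"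
  shows "eventually_generated X S (\<lambda>n. {u \<in> S n. \<forall>q\<in>Q. q \<odot>\<^bsub>X\<^esub> u \<in> D}) \<and>
    graded_family X (\<lambda>n. {u \<in> S n. \<forall>q\<in>Q. q \<odot>\<^bsub>X\<^esub> u \<in> D})"
  using assms(4-)
proof (induction Q arbitrary: S rule: finite_induct)
  case empty
  interpret X: module R X using noeth by (simp add: noetherian_module_def)
  have "eventually_generated X S S" unfolding eventually_generated_def
    using X.submodule_span_incl by (intro exI[of _ "{#}"] conjI allI impI) (simp, blast)
  then show ?case using empty by simp
next
  case (insert q Q)
  interpret X: module R X using noeth by (simp add: noetherian_module_def)
  have q: "q \<in> carrier R" using insert by simp
  let ?K = "\<lambda>n. {u \<in> S n. q \<odot>\<^bsub>X\<^esub> u \<in> D}"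
  have g: "linear_map R X X (\<lambda>u. q \<odot>\<^bsub>X\<^esub> u)" by (rule X.linear_map_scale[OF q])
  have "S n \<subseteq> {u. q \<odot>\<^bsub>X\<^esub> u \<in> ideal_power X D B n}" for n using insert.prems(3)[of n] by blast
  note SK = eventually_generated_linear[OF X.module_axioms noeth D B g insert.prems(2) this]
  have K: "graded_family X ?K"
    by (rule graded_family_vimage[OF X.module_axioms X.module_axioms g insert.prems(2)
          graded_family_const[OF X.module_axioms D]])
  have "?K n \<subseteq> {u. \<forall>q\<in>Q. q \<odot>\<^bsub>X\<^esub> u \<in> ideal_power X D B n}" for n using insert.prems(3)[of n] by blast
  with insert.IH[OF _ K] insert.prems(1)
  have IH: "eventually_generated X ?K (\<lambda>n. {u \<in> ?K n. \<forall>q\<in>Q. q \<odot>\<^bsub>X\<^esub> u \<in> D})"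
    "graded_family X (\<lambda>n. {u \<in> ?K n. \<forall>q\<in>Q. q \<odot>\<^bsub>X\<^esub> u \<in> D})" by auto
  have eq: "{u \<in> ?K n. \<forall>q\<in>Q. q \<odot>\<^bsub>X\<^esub> u \<in> D} = {u \<in> S n. \<forall>q\<in>insert q Q. q \<odot>\<^bsub>X\<^esub> u \<in> D}" for n by blast
  have "eventually_generated X S (\<lambda>n. {u \<in> ?K n. \<forall>q\<in>Q. q \<odot>\<^bsub>X\<^esub> u \<in> D})"
    by (rule eventually_generated_trans[OF X.module_axioms insert.prems(2) K IH(2) _ SK IH(1)]) blast
  then show ?case using IH(2) unfolding eq by blast
qed

text \<open>In the applications g and D are two consecutive differentials of a complex, D being
  given as an image. The primes are then those associated to the homology in the middle, computed
  with lifts of chains from N/Y_n to N.\<close>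

definition homology_primes ::
    "('a, 'm, 'e) module_scheme \<Rightarrow> ('a, 'z, 'f) module_scheme \<Rightarrow> ('m \<Rightarrow> 'z) \<Rightarrow> 'z set \<Rightarrow>
     'm set \<Rightarrow> 'm set \<Rightarrow> 'c multiset \<Rightarrow> 'a set set" where
  "homology_primes X Z g C D B n = {P. primeideal P R \<and>
     (\<exists>u\<in>carrier X. g u \<in> ideal_power Z {\<zero>\<^bsub>Z\<^esub>} C n \<and>
       P = {r \<in> carrier R. r \<odot>\<^bsub>X\<^esub> u \<in> ideal_power X D B n})}"

context
  fixes X :: "('a, 'm, 'e) module_scheme" and Z :: "('a, 'z, 'f) module_scheme"
    and g :: "'m \<Rightarrow> 'z" and C :: "'z set" and D B :: "'m set" and J :: "'c set"
  assumes X: "noetherian_module R X" and Z: "noetherian_module R Z" and g: "linear_map R X Z g"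
    and C: "submodule C R Z" and D: "submodule D R X" and B: "submodule B R X"
    and J: "finite J" "col ` V \<subseteq> J"
begin

interpretation X: module R X using X by (simp add: noetherian_module_def)
interpretation Z: module R Z using Z by (simp add: noetherian_module_def)

lemma homology_primes_step:
  assumes P: "primeideal P R"
  obtains k where "set_mset k \<subseteq> J"
    "\<And>n j. set_mset n \<subseteq> J \<Longrightarrow> j \<in> J \<Longrightarrow> k \<subseteq># n \<Longrightarrow> P \<notin> homology_primes X Z g C D B n \<Longrightarrow> P \<notin> homology_primes X Z g C D B (add_mset j n)"
proof -
  let ?L = "ideal_power X D B" and ?Z = "ideal_power Z {\<zero>\<^bsub>Z\<^esub>} C"
  note Xm = X.module_axioms and Zm = Z.module_axioms and D0 = Z.submodule_singleton_zero
  note L = graded_family_ideal_power[OF Xm D B] and LZ = graded_family_ideal_power[OF Zm D0 C]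
  note idP = primeideal.axioms(1)[OF P]
  have Pc: "P \<subseteq> carrier R" using ideal.Icarr[OF idP] by blast
  have Lc: "?L n \<subseteq> carrier X" for n by (rule graded_family_subset_carrier[OF Xm L])
  \<comment> \<open>A finite generating set turns the condition that P moves u into a submodule into
    finitely many linear conditions, the form required by \<open>eventually_generated_colon\<close>.
    By \<open>PQ\<close> nothing is lost.\<close>
  obtain Q where Q: "Q \<subseteq> carrier R" "finite Q" "P = Idl Q" using finetely_gen[OF idP] by blast
  have QP: "Q \<subseteq> P" using Q genideal_self by blast
  have PQ: "\<forall>p\<in>P. p \<odot>\<^bsub>X\<^esub> u \<in> H" if "submodule H R X" "u \<in> carrier X" "\<forall>q\<in>Q. q \<odot>\<^bsub>X\<^esub> u \<in> H" for u H
  proof -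
    have "Idl Q \<subseteq> {r \<in> carrier R. r \<odot>\<^bsub>X\<^esub> u \<in> H}"
      by (rule genideal_minimal[OF X.ideal_colon[OF that(1,2)]]) (use that Q in blast)
    then show ?thesis using Q(3) by blast
  qed
  define T where "T = (\<lambda>n. {u \<in> carrier X. g u \<in> ?Z n \<and> (\<forall>q\<in>Q. q \<odot>\<^bsub>X\<^esub> u \<in> ?L n)})"
  have T: "graded_family X T"
    unfolding graded_family_def
  proof (intro conjI allI ballI)
    fix n
    have eq: "T n = \<Inter> (insert {u \<in> carrier X. g u \<in> ?Z n} ((\<lambda>q. {u \<in> carrier X. q \<odot>\<^bsub>X\<^esub> u \<in> ?L n}) ` Q))"
      by (auto simp: T_def)
    have 1: "submodule {u \<in> carrier X. g u \<in> ?Z n} R X"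
      by (rule submodule_vimage[OF Xm Zm g graded_familyD(1)[OF LZ]])
    have 2: "submodule {u \<in> carrier X. q \<odot>\<^bsub>X\<^esub> u \<in> ?L n} R X" if "q \<in> Q" for q
      by (rule submodule_vimage[OF Xm Xm X.linear_map_scale graded_familyD(1)[OF L]]) (use that Q in blast)
    show "submodule (T n) R X" unfolding eq by (rule X.submodule_Inter) (use 1 2 in auto)
    fix v u assume v: "v \<in> V" and "u \<in> T n"
    then have u: "u \<in> carrier X" "g u \<in> ?Z n" "\<And>q. q \<in> Q \<Longrightarrow> q \<odot>\<^bsub>X\<^esub> u \<in> ?L n" by (auto simp: T_def)
    have "q \<odot>\<^bsub>X\<^esub> (a v \<odot>\<^bsub>X\<^esub> u) = a v \<odot>\<^bsub>X\<^esub> (q \<odot>\<^bsub>X\<^esub> u)" if "q \<in> Q" for q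
      using subsetD[OF Q(1) that] a_closed[OF v] u by (simp add: X.smult_assoc1[symmetric] m_comm)
    then show "a v \<odot>\<^bsub>X\<^esub> u \<in> T (add_mset (col v) n)"
      using u a_closed[OF v] graded_familyD(2)[OF LZ v u(2)] graded_familyD(2)[OF L v u(3)]
        linear_map_smult[OF g a_closed[OF v] u(1)] by (simp add: T_def)
  qed
  have T_antimono: "T (add_mset j n) \<subseteq> T n" for j n
    using ideal_power_antimono[OF Xm D B, of j n] ideal_power_antimono[OF Zm D0 C, of j n] by (auto simp: T_def)
  \<comment> \<open>Two applications of Artin--Rees in a row: K0 sharpens the condition on g u to g
    u = 0, and K sharpens the condition on the multiples by Q to membership in D. What results lies
    in the submodule K', which does not depend on n.\<close>
  define K0 where "K0 = (\<lambda>n. {u \<in> T n. g u \<in> {\<zero>\<^bsub>Z\<^esub>}})"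
  define K where "K = (\<lambda>n. {u \<in> K0 n. \<forall>q\<in>Q. q \<odot>\<^bsub>X\<^esub> u \<in> D})"
  have "T n \<subseteq> {u. g u \<in> ?Z n}" for n by (auto simp: T_def)
  note TK0 = eventually_generated_linear[OF Xm Z D0 C g T this, folded K0_def]
  have K0: "graded_family X K0"
    unfolding K0_def by (rule graded_family_vimage[OF Xm Zm g T graded_family_const[OF Zm D0]])
  have "K0 n \<subseteq> {u. \<forall>q\<in>Q. q \<odot>\<^bsub>X\<^esub> u \<in> ?L n}" for n by (auto simp: K0_def T_def)
  note K0K = eventually_generated_colon[OF X D B Q(2,1) K0 this, folded K_def]
  have "eventually_generated X T K"
    by (rule eventually_generated_trans[OF Xm T K0 conjunct2[OF K0K] _ TK0 conjunct1[OF K0K]])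
       (auto simp: K0_def)
  then obtain k1 where k1: "set_mset k1 \<subseteq> col ` V" "\<And>n j. k1 \<subseteq># n \<Longrightarrow>
     T (add_mset j n) \<subseteq> submodule_span R X (K (add_mset j n) \<union>
       {a v \<odot>\<^bsub>X\<^esub> w | v w. v \<in> V \<and> col v = j \<and> w \<in> T n})"
    unfolding eventually_generated_def by blast
  define K' where "K' = {u \<in> carrier X. g u = \<zero>\<^bsub>Z\<^esub> \<and> (\<forall>q\<in>Q. q \<odot>\<^bsub>X\<^esub> u \<in> D)}"
  have KK': "K n \<subseteq> K'" for n by (auto simp: K_def K0_def K'_def T_def)
  have K'sub: "submodule K' R X"
  proof -
    have eq: "K' = \<Inter> (insert {u \<in> carrier X. g u \<in> {\<zero>\<^bsub>Z\<^esub>}} ((\<lambda>q. {u \<in> carrier X. q \<odot>\<^bsub>X\<^esub> u \<in> D}) ` Q))"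
      by (auto simp: K'_def)
    have 1: "submodule {u \<in> carrier X. g u \<in> {\<zero>\<^bsub>Z\<^esub>}} R X"
      by (rule submodule_vimage[OF Xm Zm g D0])
    have 2: "submodule {u \<in> carrier X. q \<odot>\<^bsub>X\<^esub> u \<in> D} R X" if "q \<in> Q" for q
      by (rule submodule_vimage[OF Xm Xm X.linear_map_scale D]) (use that Q in blast)
    show "submodule K' R X" unfolding eq by (rule X.submodule_Inter) (use 1 2 in auto)
  qed
  have PK': "p \<odot>\<^bsub>X\<^esub> u \<in> D" if "p \<in> P" "u \<in> K'" for p u
    using PQ[OF D, of u] that by (auto simp: K'_def)
  \<comment> \<open>Artin--Rees is now applied to the elements of K' that lie in ?L n, relative to
    D. Since P moves K' into D, their generators of the form \<open>a v\<close> times an element of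
    K' fall into D as soon as \<open>a v\<close> lies in P.\<close>
  define T' where "T' = (\<lambda>n. {u \<in> K'. u \<in> ?L n})"
  have T': "graded_family X T'"
    unfolding T'_def by (rule graded_family_vimage[OF Xm Xm linear_map_id graded_family_const[OF Xm K'sub] L])
  have "T' n \<subseteq> {u. u \<in> ?L n}" for n by (auto simp: T'_def)
  from eventually_generated_linear[OF Xm X D B linear_map_id T' this]
  obtain k2 where k2: "set_mset k2 \<subseteq> col ` V" "\<And>n j. k2 \<subseteq># n \<Longrightarrow>
     T' (add_mset j n) \<subseteq> submodule_span R X ({u \<in> T' (add_mset j n). u \<in> D} \<union>
       {a v \<odot>\<^bsub>X\<^esub> w | v w. v \<in> V \<and> col v = j \<and> w \<in> T' n})"
    unfolding eventually_generated_def by blast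
  \<comment> \<open>The finitely many conditions in T only give that P annihilates u. That nothing
    outside P does is kept separate, because only this half has to be propagated.\<close>
  have PA: "P \<in> homology_primes X Z g C D B n \<longleftrightarrow> (\<exists>u\<in>T n. \<forall>s\<in>carrier R - P. s \<odot>\<^bsub>X\<^esub> u \<notin> ?L n)" for n
  proof
    assume "P \<in> homology_primes X Z g C D B n"
    then obtain u where u: "u \<in> carrier X" "g u \<in> ?Z n" "P = {r \<in> carrier R. r \<odot>\<^bsub>X\<^esub> u \<in> ?L n}"
      unfolding homology_primes_def by blast
    have "u \<in> T n" unfolding T_def using QP u(1,2) u(3) by blast
    moreover have "\<forall>s\<in>carrier R - P. s \<odot>\<^bsub>X\<^esub> u \<notin> ?L n" using u(3) by blast
    ultimately show "\<exists>u\<in>T n. \<forall>s\<in>carrier R - P. s \<odot>\<^bsub>X\<^esub> u \<notin> ?L n" by blast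
  next
    assume "\<exists>u\<in>T n. \<forall>s\<in>carrier R - P. s \<odot>\<^bsub>X\<^esub> u \<notin> ?L n"
    then obtain u where u: "u \<in> carrier X" "g u \<in> ?Z n" "\<forall>q\<in>Q. q \<odot>\<^bsub>X\<^esub> u \<in> ?L n"
      "\<forall>s\<in>carrier R - P. s \<odot>\<^bsub>X\<^esub> u \<notin> ?L n" by (auto simp: T_def)
    then have "P = {r \<in> carrier R. r \<odot>\<^bsub>X\<^esub> u \<in> ?L n}"
      using PQ[OF graded_familyD(1)[OF L] u(1,3)] Pc by blast
    then show "P \<in> homology_primes X Z g C D B n"
      unfolding homology_primes_def using u(1,2) P by blast
  qed
  have one: "\<one> \<notin> P" by (rule primeideal_one_notin[OF P])
  \<comment> \<open>The summand \<open>mset_set J\<close> forces every colour to occur in n, so n =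
    m + e_j with m still above k2. The first Artin--Rees relation is used from n to n + e_j, the
    second one from m to n.\<close>
  define k where "k = k1 + k2 + mset_set J"
  show ?thesis
  proof (rule that[of k])
    show "set_mset k \<subseteq> J" using k1(1) k2(1) J by (auto simp: k_def)
    fix n j assume n: "set_mset n \<subseteq> J" and j: "j \<in> J" and kn: "k \<subseteq># n" and "P \<notin> homology_primes X Z g C D B n"
    then have kill: "\<exists>s\<in>carrier R - P. s \<odot>\<^bsub>X\<^esub> u \<in> ?L n" if "u \<in> T n" for u using PA that by blast
    have k1n: "k1 \<subseteq># n" using kn unfolding k_def by (meson mset_subset_eq_add_left subset_mset.order_trans)
    obtain m where m: "n = add_mset j m" "k2 \<subseteq># m"
    proof -
      have "k2 + {#j#} \<subseteq># k"
        using J j by (auto simp: k_def subseteq_mset_def count_mset_set)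
      then have le: "k2 + {#j#} \<subseteq># n" using kn by (rule subset_mset.order_trans)
      then obtain m where "n = k2 + {#j#} + m" by (metis subset_mset.less_eqE)
      then show ?thesis using that[of "k2 + m"] by simp
    qed
    let ?n = "add_mset j n"
    have mulP: "r \<otimes> s \<in> carrier R - P" if "r \<in> carrier R - P" "s \<in> carrier R - P" for r s
      using that primeideal.I_prime[OF P] by blast
    have "\<exists>s\<in>carrier R - P. s \<odot>\<^bsub>X\<^esub> u \<in> ?L ?n" if u: "u \<in> T ?n" for u
    proof (cases "\<exists>v\<in>V. col v = j \<and> a v \<notin> P")
      case True
      then obtain v where v: "v \<in> V" "col v = j" "a v \<in> carrier R - P" using a_closed by blast
      obtain s where s: "s \<in> carrier R - P" "s \<odot>\<^bsub>X\<^esub> u \<in> ?L n" using kill T_antimono u by blast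
      have "u \<in> carrier X" using u by (auto simp: T_def)
      then have "(a v \<otimes> s) \<odot>\<^bsub>X\<^esub> u = a v \<odot>\<^bsub>X\<^esub> (s \<odot>\<^bsub>X\<^esub> u)" using v s by (simp add: X.smult_assoc1)
      then show ?thesis using graded_familyD(2)[OF L v(1) s(2)] mulP[OF v(3) s(1)] v(2)
        by (intro bexI[of _ "a v \<otimes> s"]) simp_all
    next
      case False
      then have colP: "a v \<in> P" if "v \<in> V" "col v = j" for v using that by blast
      have "u \<in> submodule_span R X (K ?n \<union> {a v \<odot>\<^bsub>X\<^esub> w | v w. v \<in> V \<and> col v = j \<and> w \<in> T n})"
        using k1(2)[OF k1n] u by blast
      then show ?thesis
      proof (induction rule: X.submodule_span_induct)
        case carrier
        have "T n \<subseteq> carrier X" "K ?n \<subseteq> carrier X" by (auto simp: T_def K_def K0_def)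
        then show ?case using a_closed by blast
      next
        case zero
        show ?case using one X.submodule_zero_closed[OF graded_familyD(1)[OF L]]
          by (intro bexI[of _ \<one>]) auto
      next
        case (gen x)
        then show ?case
        proof
          \<comment> \<open>For such x some s outside P moves x into ?L n, so s x belongs to T' n.
            All generators of T' n lie in D, because the generators of colour j belong to P. Hence s
            x lies in D, which is contained in every ?L.\<close>
          assume x: "x \<in> K ?n"
          then have xK': "x \<in> K'" using KK' by blast
          have "x \<in> T n" using x T_antimono by (auto simp: K_def K0_def)
          then obtain s where s: "s \<in> carrier R - P" "s \<odot>\<^bsub>X\<^esub> x \<in> ?L n" using kill by blast
          then have "s \<odot>\<^bsub>X\<^esub> x \<in> T' n" using X.submoduleE(4)[OF K'sub _ xK'] by (auto simp: T'_def)
          then have sx: "s \<odot>\<^bsub>X\<^esub> x \<in> submodule_span R X ({u \<in> T' (add_mset j m). u \<in> D} \<union>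
            {a v \<odot>\<^bsub>X\<^esub> w | v w. v \<in> V \<and> col v = j \<and> w \<in> T' m})"
            using k2(2)[OF m(2), of j] m(1) by blast
          have "a v \<odot>\<^bsub>X\<^esub> w \<in> D" if "v \<in> V" "col v = j" "w \<in> T' m" for v w
            using PK'[OF colP[OF that(1,2)]] that(3) by (auto simp: T'_def)
          then have "{u \<in> T' (add_mset j m). u \<in> D} \<union>
            {a v \<odot>\<^bsub>X\<^esub> w | v w. v \<in> V \<and> col v = j \<and> w \<in> T' m} \<subseteq> D" by blast
          then have "s \<odot>\<^bsub>X\<^esub> x \<in> D" using X.submodule_span_least[OF D] sx by blast
          then show ?thesis using s(1) ideal_power_base[OF Xm D B] by blast
        next
          assume "x \<in> {a v \<odot>\<^bsub>X\<^esub> w | v w. v \<in> V \<and> col v = j \<and> w \<in> T n}"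
          then obtain v w where vw: "x = a v \<odot>\<^bsub>X\<^esub> w" "v \<in> V" "col v = j" "w \<in> T n" by blast
          obtain s where s: "s \<in> carrier R - P" "s \<odot>\<^bsub>X\<^esub> w \<in> ?L n" using kill[OF vw(4)] by blast
          have w: "w \<in> carrier X" using vw(4) by (auto simp: T_def)
          have "s \<odot>\<^bsub>X\<^esub> x = a v \<odot>\<^bsub>X\<^esub> (s \<odot>\<^bsub>X\<^esub> w)"
            using s(1) w a_closed[OF vw(2)] vw(1) by (simp add: X.smult_assoc1[symmetric] m_comm)
          then show ?thesis using graded_familyD(2)[OF L vw(2) s(2)] vw(3) s(1)
            by (intro bexI[of _ s]) simp_all
        qed
      next
        \<comment> \<open>The product of the two multipliers works for the sum and stays outside P
          because P is prime.\<close>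
        case (add x y)
        then obtain s s' where s: "s \<in> carrier R - P" "s \<odot>\<^bsub>X\<^esub> x \<in> ?L ?n"
          and s': "s' \<in> carrier R - P" "s' \<odot>\<^bsub>X\<^esub> y \<in> ?L ?n" by blast
        have "(s \<otimes> s') \<odot>\<^bsub>X\<^esub> (x \<oplus>\<^bsub>X\<^esub> y) = s' \<odot>\<^bsub>X\<^esub> (s \<odot>\<^bsub>X\<^esub> x) \<oplus>\<^bsub>X\<^esub> s \<odot>\<^bsub>X\<^esub> (s' \<odot>\<^bsub>X\<^esub> y)"
          using s(1) s'(1) add(1,2) by (simp add: X.smult_r_distr X.smult_assoc1[symmetric] m_comm)
        moreover have "s' \<odot>\<^bsub>X\<^esub> (s \<odot>\<^bsub>X\<^esub> x) \<oplus>\<^bsub>X\<^esub> s \<odot>\<^bsub>X\<^esub> (s' \<odot>\<^bsub>X\<^esub> y) \<in> ?L ?n"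
          using X.submoduleE(4,5)[OF graded_familyD(1)[OF L]] s s' by blast
        ultimately show ?case using mulP[OF s(1) s'(1)] by (intro bexI[of _ "s \<otimes> s'"]) simp_all
      next
        case (smult r x)
        then obtain s where s: "s \<in> carrier R - P" "s \<odot>\<^bsub>X\<^esub> x \<in> ?L ?n" by blast
        have "s \<odot>\<^bsub>X\<^esub> (r \<odot>\<^bsub>X\<^esub> x) = r \<odot>\<^bsub>X\<^esub> (s \<odot>\<^bsub>X\<^esub> x)"
          using s(1) smult(1,2) by (simp add: X.smult_assoc1[symmetric] m_comm)
        then show ?case using X.submoduleE(4)[OF graded_familyD(1)[OF L] smult(1) s(2)] s(1)
          by (intro bexI[of _ s]) simp_all
      qed
    qed
    then show "P \<notin> homology_primes X Z g C D B ?n" using PA by blast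
  qed
qed

text \<open>Above k, absence of P is inherited by all larger exponents. So either P is absent at
  some n above k, which then is the threshold, or P is present everywhere above k.\<close>

lemma homology_primes_prime_stable:
  assumes P: "primeideal P R"
  shows "\<exists>k. set_mset k \<subseteq> J \<and> (\<forall>n. set_mset n \<subseteq> J \<longrightarrow> k \<subseteq># n \<longrightarrow>
    (P \<in> homology_primes X Z g C D B n \<longleftrightarrow> P \<in> homology_primes X Z g C D B k))"
proof -
  obtain k where k: "set_mset k \<subseteq> J"
    "\<And>n j. set_mset n \<subseteq> J \<Longrightarrow> j \<in> J \<Longrightarrow> k \<subseteq># n \<Longrightarrow> P \<notin> homology_primes X Z g C D B n \<Longrightarrow> P \<notin> homology_primes X Z g C D B (add_mset j n)"
    using homology_primes_step[OF P] by blast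
  show ?thesis
  proof (cases "\<exists>n. set_mset n \<subseteq> J \<and> k \<subseteq># n \<and> P \<notin> homology_primes X Z g C D B n")
    case True
    then obtain n where n: "set_mset n \<subseteq> J" "k \<subseteq># n" "P \<notin> homology_primes X Z g C D B n" by blast
    have "P \<notin> homology_primes X Z g C D B (n + d)" if "set_mset d \<subseteq> J" for d using that
    proof (induction d)
      case (add j d)
      have "k \<subseteq># n + d" using n(2) by (meson mset_subset_eq_add_left subset_mset.order_trans)
      then show ?case using k(2)[of "n + d" j] add n(1) by simp
    qed (use n in simp)
    moreover have "\<exists>d. m = n + d \<and> set_mset d \<subseteq> J" if m: "set_mset m \<subseteq> J" "n \<subseteq># m" for m
    proof -
      obtain d where "m = n + d" using m(2) by (metis subset_mset.less_eqE)
      then show ?thesis using m(1) by auto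
    qed
    ultimately show ?thesis using n by (intro exI[of _ n]) blast
  next
    case False
    then show ?thesis using k(1) by (intro exI[of _ k]) blast
  qed
qed

text \<open>All occurring primes belong to one finite set, so the sum of their individual thresholds
  is defined and dominates each of them.\<close>

theorem homology_primes_stable:
  "\<exists>k. set_mset k \<subseteq> J \<and> (\<forall>n. set_mset n \<subseteq> J \<longrightarrow> k \<subseteq># n \<longrightarrow> homology_primes X Z g C D B n = homology_primes X Z g C D B k)"
proof -
  let ?F = "\<Union>n\<in>{n. set_mset n \<subseteq> J}. quotient_primes X (ideal_power X D B n)"
  have fin: "finite ?F" by (rule finite_asymptotic_primes[OF X D B J(1)])
  have sub: "homology_primes X Z g C D B n \<subseteq> ?F" if "set_mset n \<subseteq> J" for n
    using that unfolding homology_primes_def quotient_primes_def by blast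
  have prime: "primeideal P R" if "P \<in> ?F" for P using that by (auto simp: quotient_primes_def)
  then obtain kk where kk: "\<And>P. P \<in> ?F \<Longrightarrow> set_mset (kk P) \<subseteq> J"
    "\<And>P n. P \<in> ?F \<Longrightarrow> set_mset n \<subseteq> J \<Longrightarrow> kk P \<subseteq># n \<Longrightarrow>
      (P \<in> homology_primes X Z g C D B n \<longleftrightarrow> P \<in> homology_primes X Z g C D B (kk P))"
    using homology_primes_prime_stable by metis
  define k where "k = (\<Sum>P\<in>?F. kk P)"
  have k: "set_mset k \<subseteq> J" using kk(1) fin by (auto simp: k_def set_mset_sum)
  have le: "kk P \<subseteq># k" if "P \<in> ?F" for P using that fin by (simp add: k_def sum.remove)
  have "homology_primes X Z g C D B n = homology_primes X Z g C D B k" if n: "set_mset n \<subseteq> J" "k \<subseteq># n" for n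
  proof -
    have "P \<in> homology_primes X Z g C D B n \<longleftrightarrow> P \<in> homology_primes X Z g C D B k" if "P \<in> ?F" for P
      using kk(2)[OF that n(1) subset_mset.order_trans[OF le[OF that] n(2)]] kk(2)[OF that k le[OF that]]
      by blast
    then show ?thesis using sub[OF n(1)] sub[OF k] by blast
  qed
  then show ?thesis using k by blast
qed

end

end

section \<open>Quotients and direct sums\<close>

text \<open>The module axioms pass to any structure onto which a module maps compatibly with the
  operations. For quotients this reduces every axiom to a computation with representatives.\<close>

lemma module_surj_image:
  fixes R (structure)
  assumes "module R Q" and surj: "carrier Y = f ` carrier Q" and zero: "\<zero>\<^bsub>Y\<^esub> = f \<zero>\<^bsub>Q\<^esub>"
    and add: "\<And>x y. x \<in> carrier Q \<Longrightarrow> y \<in> carrier Q \<Longrightarrow> f x \<oplus>\<^bsub>Y\<^esub> f y = f (x \<oplus>\<^bsub>Q\<^esub> y)"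
    and smult: "\<And>r x. r \<in> carrier R \<Longrightarrow> x \<in> carrier Q \<Longrightarrow> r \<odot>\<^bsub>Y\<^esub> f x = f (r \<odot>\<^bsub>Q\<^esub> x)"
  shows "module R Y"
proof -
  interpret Q: module R Q by fact
  show ?thesis
  proof (rule moduleI)
    show "cring R" by (rule Q.R.is_cring)
    show "abelian_group Y"
    proof (rule abelian_groupI)
      fix x assume "x \<in> carrier Y"
      then obtain p where p: "p \<in> carrier Q" "x = f p" using surj by blast
      have "f (\<ominus>\<^bsub>Q\<^esub> p) \<oplus>\<^bsub>Y\<^esub> x = \<zero>\<^bsub>Y\<^esub>" using p add[of "\<ominus>\<^bsub>Q\<^esub> p" p] zero by (simp add: Q.M.l_neg)
      then show "\<exists>y\<in>carrier Y. y \<oplus>\<^bsub>Y\<^esub> x = \<zero>\<^bsub>Y\<^esub>" using p surj by blast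
    next
      fix x y z assume "x \<in> carrier Y" "y \<in> carrier Y"
      then obtain p q where *: "p \<in> carrier Q" "x = f p" "q \<in> carrier Q" "y = f q" using surj by blast
      then show "x \<oplus>\<^bsub>Y\<^esub> y \<in> carrier Y" "x \<oplus>\<^bsub>Y\<^esub> y = y \<oplus>\<^bsub>Y\<^esub> x"
        using surj by (auto simp: add Q.M.a_comm)
      assume "z \<in> carrier Y"
      then obtain r where "r \<in> carrier Q" "z = f r" using surj by blast
      then show "(x \<oplus>\<^bsub>Y\<^esub> y) \<oplus>\<^bsub>Y\<^esub> z = x \<oplus>\<^bsub>Y\<^esub> (y \<oplus>\<^bsub>Y\<^esub> z)"
        using * by (simp add: add Q.M.a_assoc)
    qed (use surj in \<open>auto simp: zero add\<close>)
  qed (auto simp: surj add smult Q.smult_l_distr Q.smult_r_distr Q.smult_assoc1)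
qed

context module
begin

context
  fixes H assumes H: "submodule H R M"
begin

lemma submodule_subgroup: "subgroup H (add_monoid M)"
  using H by (rule submodule.axioms(1))

lemma submodule_abelian_subgroup: "abelian_subgroup H M"
  by (rule abelian_subgroupI3) (auto simp: additive_subgroup_def submodule_subgroup M.abelian_group_axioms)

lemma coset_eq_iff:
  assumes "x \<in> carrier M" "y \<in> carrier M"
  shows "H +>\<^bsub>M\<^esub> x = H +>\<^bsub>M\<^esub> y \<longleftrightarrow> (\<exists>h\<in>H. x = h \<oplus>\<^bsub>M\<^esub> y)"
proof
  assume "H +>\<^bsub>M\<^esub> x = H +>\<^bsub>M\<^esub> y"
  moreover have "x \<in> H +>\<^bsub>M\<^esub> x"
    using abelian_subgroup.a_rcos_self[OF submodule_abelian_subgroup assms(1)] .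
  ultimately show "\<exists>h\<in>H. x = h \<oplus>\<^bsub>M\<^esub> y" by (auto simp: a_r_coset_def')
next
  assume "\<exists>h\<in>H. x = h \<oplus>\<^bsub>M\<^esub> y"
  then have "x \<in> H +>\<^bsub>M\<^esub> y" by (auto simp: a_r_coset_def')
  then show "H +>\<^bsub>M\<^esub> x = H +>\<^bsub>M\<^esub> y"
    using M.a_repr_independence[OF _ assms(2) submodule_subgroup] by simp
qed

lemma coset_eq_zero_iff: "x \<in> carrier M \<Longrightarrow> H +>\<^bsub>M\<^esub> x = H \<longleftrightarrow> x \<in> H"
  using M.a_coset_join1[OF _ _ submodule_subgroup] M.a_coset_join2[OF _ submodule_subgroup] by blast

lemma coset_zero: "H +>\<^bsub>M\<^esub> \<zero>\<^bsub>M\<^esub> = H"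
  using coset_eq_zero_iff submodule_zero_closed[OF H] by simp

lemma quotient_carrier: "carrier (quotient_module M H) = (\<lambda>x. H +>\<^bsub>M\<^esub> x) ` carrier M"
  by (auto simp: quotient_module_def A_RCOSETS_def')

lemma quotient_zero: "\<zero>\<^bsub>quotient_module M H\<^esub> = H"
  by (simp add: quotient_module_def)

lemma quotient_add:
  "x \<in> carrier M \<Longrightarrow> y \<in> carrier M \<Longrightarrow>
    (H +>\<^bsub>M\<^esub> x) \<oplus>\<^bsub>quotient_module M H\<^esub> (H +>\<^bsub>M\<^esub> y) = H +>\<^bsub>M\<^esub> (x \<oplus>\<^bsub>M\<^esub> y)"
  using abelian_subgroup.a_rcos_sum[OF submodule_abelian_subgroup] by (simp add: quotient_module_def)

text \<open>By definition a coset is scaled by taking a union over its representatives. All sets in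
  this nonempty union coincide because H is stable under r.\<close>

lemma quotient_smult:
  assumes r: "r \<in> carrier R" and x: "x \<in> carrier M"
  shows "r \<odot>\<^bsub>quotient_module M H\<^esub> (H +>\<^bsub>M\<^esub> x) = H +>\<^bsub>M\<^esub> (r \<odot>\<^bsub>M\<^esub> x)"
proof -
  have "H +>\<^bsub>M\<^esub> (r \<odot>\<^bsub>M\<^esub> y) = H +>\<^bsub>M\<^esub> (r \<odot>\<^bsub>M\<^esub> x)" if y: "y \<in> H +>\<^bsub>M\<^esub> x" for y
  proof -
    obtain h where h: "h \<in> H" "y = h \<oplus>\<^bsub>M\<^esub> x" using y by (auto simp: a_r_coset_def')
    have hc: "h \<in> carrier M" using h(1) submoduleE(1)[OF H] by blast
    then have "r \<odot>\<^bsub>M\<^esub> y = r \<odot>\<^bsub>M\<^esub> h \<oplus>\<^bsub>M\<^esub> r \<odot>\<^bsub>M\<^esub> x" using r x h by (simp add: smult_r_distr)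
    then show ?thesis using coset_eq_iff[of "r \<odot>\<^bsub>M\<^esub> y" "r \<odot>\<^bsub>M\<^esub> x"] r x hc h submoduleE(4)[OF H r h(1)] by auto
  qed
  moreover have "H +>\<^bsub>M\<^esub> x \<noteq> {}"
    using abelian_subgroup.a_rcos_self[OF submodule_abelian_subgroup x] by blast
  ultimately have "(\<Union>y\<in>H +>\<^bsub>M\<^esub> x. H +>\<^bsub>M\<^esub> (r \<odot>\<^bsub>M\<^esub> y)) = H +>\<^bsub>M\<^esub> (r \<odot>\<^bsub>M\<^esub> x)"
    by (intro SUP_eq_const)
  then show ?thesis by (simp add: quotient_module_def)
qed

lemma module_quotient: "module R (quotient_module M H)"
  by (rule module_surj_image[OF module_axioms, where f = "\<lambda>x. H +>\<^bsub>M\<^esub> x"])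
     (auto simp: quotient_carrier quotient_zero coset_zero quotient_add quotient_smult)

lemma linear_map_quotient: "linear_map R M (quotient_module M H) (\<lambda>x. H +>\<^bsub>M\<^esub> x)"
  by (rule linear_mapI) (auto simp: quotient_carrier quotient_add quotient_smult)

lemma Ass_quotient:
  "Ass R (quotient_module M H) =
    {P. primeideal P R \<and> (\<exists>x\<in>carrier M. P = {r \<in> carrier R. r \<odot>\<^bsub>M\<^esub> x \<in> H})}"
proof -
  have "{r \<in> carrier R. r \<odot>\<^bsub>quotient_module M H\<^esub> (H +>\<^bsub>M\<^esub> x) = H} = {r \<in> carrier R. r \<odot>\<^bsub>M\<^esub> x \<in> H}"
    if "x \<in> carrier M" for x
    by (rule Collect_cong, rule conj_cong[OF refl]) (simp add: quotient_smult coset_eq_zero_iff that)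
  then show ?thesis unfolding Ass_def quotient_carrier quotient_zero by (simp cong: conj_cong bex_cong)
qed

end

end

text \<open>As for \<open>free_module\<close>, elements are functions on the whole index type that
  vanish outside B. Sums over different index sets thus share a type, and enlarging B is an
  inclusion.\<close>

definition sum_module :: "('a, 'm, 'e) module_scheme \<Rightarrow> 'b set \<Rightarrow> ('a, 'b \<Rightarrow> 'm) module" where
  "sum_module X B =
     \<lparr>carrier = {u. (\<forall>b. u b \<in> carrier X) \<and> (\<forall>b. b \<notin> B \<longrightarrow> u b = \<zero>\<^bsub>X\<^esub>) \<and> finite {b. u b \<noteq> \<zero>\<^bsub>X\<^esub>}},
      monoid.mult = undefined, one = undefined,
      zero = (\<lambda>b. \<zero>\<^bsub>X\<^esub>),
      add = (\<lambda>u v b. u b \<oplus>\<^bsub>X\<^esub> v b),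
      smult = (\<lambda>r u b. r \<odot>\<^bsub>X\<^esub> u b)\<rparr>"

definition sum_single :: "('a, 'm, 'e) module_scheme \<Rightarrow> 'b \<Rightarrow> 'm \<Rightarrow> 'b \<Rightarrow> 'm" where
  "sum_single X b x = (\<lambda>c. if c = b then x else \<zero>\<^bsub>X\<^esub>)"

lemma sum_module_simps [simp]:
  "zero (sum_module X B) = (\<lambda>b. \<zero>\<^bsub>X\<^esub>)"
  "add (sum_module X B) u v = (\<lambda>b. u b \<oplus>\<^bsub>X\<^esub> v b)"
  "smult (sum_module X B) r u = (\<lambda>b. r \<odot>\<^bsub>X\<^esub> u b)"
  by (simp_all add: sum_module_def)

lemma carrier_sum_module:
  "u \<in> carrier (sum_module X B) \<longleftrightarrow>
     (\<forall>b. u b \<in> carrier X) \<and> (\<forall>b. b \<notin> B \<longrightarrow> u b = \<zero>\<^bsub>X\<^esub>) \<and> finite {b. u b \<noteq> \<zero>\<^bsub>X\<^esub>}"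
  by (simp add: sum_module_def)

lemma sum_module_finiteI:
  assumes "finite B" "\<And>b. b \<in> B \<Longrightarrow> u b \<in> carrier X" "\<And>b. b \<notin> B \<Longrightarrow> u b = \<zero>\<^bsub>X\<^esub>" "\<zero>\<^bsub>X\<^esub> \<in> carrier X"
  shows "u \<in> carrier (sum_module X B)"
proof -
  have "{b. u b \<noteq> \<zero>\<^bsub>X\<^esub>} \<subseteq> B" using assms(3) by auto
  then have "finite {b. u b \<noteq> \<zero>\<^bsub>X\<^esub>}" using assms(1) by (rule finite_subset)
  moreover have "u b \<in> carrier X" for b using assms(2-4) by (cases "b \<in> B") auto
  ultimately show ?thesis using assms(3) by (simp add: carrier_sum_module)
qed

lemma sum_module_mono: "B \<subseteq> B' \<Longrightarrow> u \<in> carrier (sum_module X B) \<Longrightarrow> u \<in> carrier (sum_module X B')"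
  by (auto simp: carrier_sum_module)

context module
begin

lemma sum_support_add:
  assumes "finite {b. u b \<noteq> \<zero>\<^bsub>M\<^esub>}" "finite {b. v b \<noteq> \<zero>\<^bsub>M\<^esub>}"
  shows "finite {b. u b \<oplus>\<^bsub>M\<^esub> v b \<noteq> \<zero>\<^bsub>M\<^esub>}"
  by (rule finite_subset[of _ "{b. u b \<noteq> \<zero>\<^bsub>M\<^esub>} \<union> {b. v b \<noteq> \<zero>\<^bsub>M\<^esub>}"]) (use assms in auto)

lemma module_sum_module: "module R (sum_module M B)"
proof (rule moduleI)
  show "cring R" by (rule R.is_cring)
  show "abelian_group (sum_module M B)"
  proof (rule abelian_groupI)
    fix x assume x: "x \<in> carrier (sum_module M B)"
    have "{b. \<ominus>\<^bsub>M\<^esub> x b \<noteq> \<zero>\<^bsub>M\<^esub>} \<subseteq> {b. x b \<noteq> \<zero>\<^bsub>M\<^esub>}" by auto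
    then have "(\<lambda>b. \<ominus>\<^bsub>M\<^esub> x b) \<in> carrier (sum_module M B)"
      using x finite_subset by (auto simp: carrier_sum_module)
    moreover have "(\<lambda>b. \<ominus>\<^bsub>M\<^esub> x b) \<oplus>\<^bsub>sum_module M B\<^esub> x = \<zero>\<^bsub>sum_module M B\<^esub>"
      using x by (auto simp: carrier_sum_module M.l_neg)
    ultimately show "\<exists>y\<in>carrier (sum_module M B). y \<oplus>\<^bsub>sum_module M B\<^esub> x = \<zero>\<^bsub>sum_module M B\<^esub>" by blast
  qed (auto simp: carrier_sum_module sum_support_add M.a_assoc, auto simp: M.a_comm)
  fix a x assume a: "a \<in> carrier R" and x: "x \<in> carrier (sum_module M B)"
  have "{b. a \<odot>\<^bsub>M\<^esub> x b \<noteq> \<zero>\<^bsub>M\<^esub>} \<subseteq> {b. x b \<noteq> \<zero>\<^bsub>M\<^esub>}" using a by auto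
  then show "a \<odot>\<^bsub>sum_module M B\<^esub> x \<in> carrier (sum_module M B)"
    using a x finite_subset by (auto simp: carrier_sum_module)
qed (auto simp: carrier_sum_module smult_l_distr smult_r_distr smult_assoc1)

lemma sum_single_closed [intro]:
  "b \<in> B \<Longrightarrow> x \<in> carrier M \<Longrightarrow> sum_single M b x \<in> carrier (sum_module M B)"
proof -
  assume "b \<in> B" "x \<in> carrier M"
  moreover have "{c. sum_single M b x c \<noteq> \<zero>\<^bsub>M\<^esub>} \<subseteq> {b}" by (auto simp: sum_single_def)
  ultimately show ?thesis using finite_subset by (auto simp: carrier_sum_module sum_single_def)
qed

lemma linear_map_sum_single: "b \<in> B \<Longrightarrow> linear_map R M (sum_module M B) (sum_single M b)"
  by (rule linear_mapI) (auto simp: sum_single_def fun_eq_iff intro: sum_single_closed[unfolded sum_single_def])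

lemma linear_map_sum_component: "linear_map R (sum_module M B) M (\<lambda>u. u b)"
  by (rule linear_mapI) (auto simp: carrier_sum_module)

lemma sum_module_induct [consumes 1, case_names zero add]:
  assumes "u \<in> carrier (sum_module M B)"
    and zero: "P (\<lambda>b. \<zero>\<^bsub>M\<^esub>)"
    and add: "\<And>b u. b \<in> B \<Longrightarrow> u b \<in> carrier M \<Longrightarrow> (\<lambda>c. if c = b then \<zero>\<^bsub>M\<^esub> else u c) \<in> carrier (sum_module M B) \<Longrightarrow>
      P (\<lambda>c. if c = b then \<zero>\<^bsub>M\<^esub> else u c) \<Longrightarrow> u \<in> carrier (sum_module M B) \<Longrightarrow>
      u = sum_single M b (u b) \<oplus>\<^bsub>sum_module M B\<^esub> (\<lambda>c. if c = b then \<zero>\<^bsub>M\<^esub> else u c) \<Longrightarrow> P u"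
  shows "P u"
  using assms(1)
proof (induction "card {b. u b \<noteq> \<zero>\<^bsub>M\<^esub>}" arbitrary: u)
  case 0
  then have "u = (\<lambda>b. \<zero>\<^bsub>M\<^esub>)" by (auto simp: carrier_sum_module fun_eq_iff)
  then show ?case using zero by simp
next
  case (Suc n)
  then obtain b where b: "u b \<noteq> \<zero>\<^bsub>M\<^esub>"
    by (metis (mono_tags, lifting) card.empty Collect_empty_eq nat.distinct(1))
  let ?u = "\<lambda>c. if c = b then \<zero>\<^bsub>M\<^esub> else u c"
  have supp: "{c. ?u c \<noteq> \<zero>\<^bsub>M\<^esub>} = {c. u c \<noteq> \<zero>\<^bsub>M\<^esub>} - {b}" by auto
  have fin: "finite {c. u c \<noteq> \<zero>\<^bsub>M\<^esub>}" using Suc.prems by (auto simp: carrier_sum_module)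
  have c: "?u \<in> carrier (sum_module M B)"
    using Suc.prems supp fin unfolding carrier_sum_module by auto
  have "n = card {c. ?u c \<noteq> \<zero>\<^bsub>M\<^esub>}" using Suc.hyps(2) supp fin b by simp
  then have "P ?u" using c by (rule Suc.hyps(1))
  moreover have "b \<in> B" "u b \<in> carrier M" using Suc.prems b by (auto simp: carrier_sum_module)
  moreover have "u = sum_single M b (u b) \<oplus>\<^bsub>sum_module M B\<^esub> ?u"
    using Suc.prems by (auto simp: fun_eq_iff carrier_sum_module sum_single_def)
  ultimately show ?case using add c Suc.prems by blast
qed

lemma sum_module_linear_eq:
  assumes Y: "module R Y" and p: "linear_map R (sum_module M B) Y p" and q: "linear_map R (sum_module M B) Y q"
    and eq: "\<And>b x. b \<in> B \<Longrightarrow> x \<in> carrier M \<Longrightarrow> p (sum_single M b x) = q (sum_single M b x)"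
    and u: "u \<in> carrier (sum_module M B)"
  shows "p u = q u"
  using u
proof (induction rule: sum_module_induct)
  case zero
  show ?case using linear_map_zero[OF module_sum_module Y p] linear_map_zero[OF module_sum_module Y q] by simp
next
  case (add b u)
  have "p u = p (sum_single M b (u b)) \<oplus>\<^bsub>Y\<^esub> p (\<lambda>c. if c = b then \<zero>\<^bsub>M\<^esub> else u c)"
    using arg_cong[OF add.hyps(5), of p] linear_map_add[OF p sum_single_closed[OF add.hyps(1,2)] add.hyps(3)]
    by (rule trans)
  moreover have "q u = q (sum_single M b (u b)) \<oplus>\<^bsub>Y\<^esub> q (\<lambda>c. if c = b then \<zero>\<^bsub>M\<^esub> else u c)"
    using arg_cong[OF add.hyps(5), of q] linear_map_add[OF q sum_single_closed[OF add.hyps(1,2)] add.hyps(3)]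
    by (rule trans)
  ultimately show ?case using add.IH eq[OF add.hyps(1,2)] by simp
qed

lemma sum_module_submodule_eq:
  assumes H: "submodule H R (sum_module M B)"
    and single: "\<And>b x. b \<in> B \<Longrightarrow> x \<in> carrier M \<Longrightarrow> sum_single M b x \<in> H"
  shows "carrier (sum_module M B) \<subseteq> H"
proof
  interpret S: module R "sum_module M B" by (rule module_sum_module)
  fix u assume "u \<in> carrier (sum_module M B)"
  then show "u \<in> H"
  proof (induction rule: sum_module_induct)
    case zero
    show ?case using S.submodule_zero_closed[OF H] by simp
  next
    case (add b u)
    show ?case
      using S.submoduleE(5)[OF H single[OF add.hyps(1,2)] add.IH] add.hyps(5) by (rule ssubst[rotated])
  qed
qed

end

lemma finitely_generated_sum_module:
  assumes "finitely_generated_module R M" "finite B"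
  shows "finitely_generated_module R (sum_module M B)"
proof -
  obtain T where T: "T \<subseteq> carrier M" "finite T" "submodule_span R M T = carrier M" and M: "module R M"
    using assms(1) by (auto simp: finitely_generated_module_def)
  interpret M: module R M by fact
  interpret S: module R "sum_module M B" by (rule M.module_sum_module)
  let ?G = "(\<lambda>(b, x). sum_single M b x) ` (B \<times> T)"
  have G: "?G \<subseteq> carrier (sum_module M B)" using T(1) by auto
  note sub = S.submodule_span_submodule[OF G]
  have "sum_single M b x \<in> submodule_span R (sum_module M B) ?G" if "b \<in> B" "x \<in> carrier M" for b x
  proof -
    have "submodule {x \<in> carrier M. sum_single M b x \<in> submodule_span R (sum_module M B) ?G} R M"
      by (rule submodule_vimage[OF M S.module_axioms M.linear_map_sum_single[OF that(1)] sub])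
    moreover have "T \<subseteq> {x \<in> carrier M. sum_single M b x \<in> submodule_span R (sum_module M B) ?G}"
    proof
      fix y assume y: "y \<in> T"
      then have "sum_single M b y \<in> ?G" using that(1) by (auto intro!: image_eqI[of _ _ "(b, y)"])
      then show "y \<in> {x \<in> carrier M. sum_single M b x \<in> submodule_span R (sum_module M B) ?G}"
        using S.submodule_span_incl[of ?G] T(1) y by blast
    qed
    ultimately show ?thesis using M.submodule_span_least T(3) that(2) by blast
  qed
  then have "carrier (sum_module M B) \<subseteq> submodule_span R (sum_module M B) ?G"
    by (rule M.sum_module_submodule_eq[OF sub])
  then have "submodule_span R (sum_module M B) ?G = carrier (sum_module M B)"
    using S.submodule_span_subset_carrier[OF G] by blast
  moreover have "finite ?G" using T(2) assms(2) by blast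
  ultimately show ?thesis unfolding finitely_generated_module_def
    using S.module_axioms G by blast
qed

section \<open>Linear maps between free modules and direct sums\<close>

lemma linear_map_comp:
  "linear_map R X Y f \<Longrightarrow> linear_map R Y Z g \<Longrightarrow> linear_map R X Z (\<lambda>x. g (f x))"
  by (rule linear_mapI) (simp_all add: linear_map_closed linear_map_add linear_map_smult)

lemma linear_map_plus:
  assumes "module R Y" "linear_map R X Y f" "linear_map R X Y g"
  shows "linear_map R X Y (\<lambda>x. f x \<oplus>\<^bsub>Y\<^esub> g x)"
proof -
  interpret Y: module R Y by fact
  note c = linear_map_closed[OF assms(2)] linear_map_closed[OF assms(3)]
  show ?thesis
  proof (rule linear_mapI)
    fix x y assume xy: "x \<in> carrier X" "y \<in> carrier X"
    show "f (x \<oplus>\<^bsub>X\<^esub> y) \<oplus>\<^bsub>Y\<^esub> g (x \<oplus>\<^bsub>X\<^esub> y) = f x \<oplus>\<^bsub>Y\<^esub> g x \<oplus>\<^bsub>Y\<^esub> (f y \<oplus>\<^bsub>Y\<^esub> g y)"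
      using xy c by (simp add: linear_map_add[OF assms(2)] linear_map_add[OF assms(3)] Y.add_add_swap)
  qed (use c in \<open>auto simp: linear_map_smult[OF assms(2)] linear_map_smult[OF assms(3)] Y.smult_r_distr\<close>)
qed

lemma linear_map_cong:
  assumes "linear_map R X Y f" "\<And>x. x \<in> carrier X \<Longrightarrow> f x = g x" "module R X"
  shows "linear_map R X Y g"
proof -
  interpret X: module R X by fact
  show ?thesis
    by (rule linear_mapI)
       (simp_all add: assms(2)[symmetric] linear_map_closed[OF assms(1)] linear_map_add[OF assms(1)]
         linear_map_smult[OF assms(1)])
qed

lemma linear_map_linear_extension:
  assumes "module R X" "f \<in> B \<rightarrow> carrier X"
  shows "linear_map R (free_module R B) X (linear_extension R X f)"
  by (rule linear_mapI)
     (simp_all add: linear_extension_closed[OF assms(1) _ assms(2)] linear_extension_add[OF assms(1) _ _ assms(2)]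
       linear_extension_smult[OF assms(1) _ _ assms(2)])

text \<open>By \<open>lin_comb_surj\<close> every element comes from a list of coefficients and
  basis elements, so linearity is applied by induction on that list.\<close>

lemma free_module_linear_eq:
  assumes X: "module R X" and p: "linear_map R (free_module R B) X p" and q: "linear_map R (free_module R B) X q"
    and eq: "\<And>b. b \<in> B \<Longrightarrow> p (free_gen R b) = q (free_gen R b)"
    and z: "z \<in> carrier (free_module R B)"
  shows "p z = q z"
proof -
  interpret X: module R X by fact
  note cr = X.R.is_cring
  note F = module_free_module[OF cr]
  obtain xs where xs: "set xs \<subseteq> carrier R \<times> B" "lin_comb R xs = z" using lin_comb_surj[OF cr z] by blast
  have "p (lin_comb R xs) = q (lin_comb R xs)" using xs(1)
  proof (induction xs)
    case Nil
    show ?case using linear_map_zero[OF F X p] linear_map_zero[OF F X q] by simp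
  next
    case (Cons rg xs)
    obtain r b where rb: "rg = (r, b)" by force
    then have r: "r \<in> carrier R" "b \<in> B" using Cons.prems by auto
    have l: "lin_comb R xs \<in> carrier (free_module R B)" using lin_comb_closed[OF cr] Cons.prems by auto
    note g = free_gen_closed[OF cr r(2)] and rg = free_module_smult_closed[OF cr r(1) free_gen_closed[OF cr r(2)]]
    have "lin_comb R (rg # xs) =
        (r \<odot>\<^bsub>free_module R B\<^esub> free_gen R b) \<oplus>\<^bsub>free_module R B\<^esub> lin_comb R xs"
      using l r by (auto simp: rb fun_eq_iff free_gen_def carrier_free_module)
    then show ?case
      using Cons linear_map_add[OF p _ l] linear_map_add[OF q _ l] rg
        linear_map_smult[OF p r(1) g] linear_map_smult[OF q r(1) g] eq[OF r(2)] by auto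
  qed
  then show ?thesis using xs(2) by simp
qed

lemma linear_map_free_inclusion: "B \<subseteq> B' \<Longrightarrow> linear_map R (free_module R B) (free_module R B') (\<lambda>z. z)"
  by (rule linear_mapI) (auto simp: carrier_free_module)

lemma linear_extension_cong:
  assumes "module R X" "z \<in> carrier (free_module R B)" "\<And>b. b \<in> B \<Longrightarrow> f b = g b" "f \<in> B \<rightarrow> carrier X"
  shows "linear_extension R X f z = linear_extension R X g z"
proof -
  interpret X: module R X by fact
  have g: "g \<in> B \<rightarrow> carrier X" using assms(3,4) by (auto simp: Pi_iff)
  show ?thesis
    by (rule free_module_linear_eq[OF assms(1) linear_map_linear_extension linear_map_linear_extension _ assms(2)])
       (use assms g in \<open>simp_all add: linear_extension_gen\<close>)
qed

text \<open>Extending into the free module on \<open>UNIV\<close> makes the value independent of the target basis.\<close>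

definition free_extension :: "('a, 'r) ring_scheme \<Rightarrow> ('b \<Rightarrow> 'c \<Rightarrow> 'a) \<Rightarrow> ('b \<Rightarrow> 'a) \<Rightarrow> 'c \<Rightarrow> 'a" where
  "free_extension R f = linear_extension R (free_module R UNIV) f"

lemma free_extension_eq:
  fixes R (structure)
  assumes "cring R" "f \<in> B \<rightarrow> carrier (free_module R C)" "z \<in> carrier (free_module R B)"
  shows "free_extension R f z = linear_extension R (free_module R C) f z"
proof -
  interpret cring R by fact
  show ?thesis unfolding free_extension_def linear_extension_def
  proof (rule trans[OF _ finsum_free_UNIV[OF assms(1)]])
    show "(\<lambda>b. z b \<odot>\<^bsub>free_module R C\<^esub> f b) \<in> {b. z b \<noteq> \<zero>} \<rightarrow> carrier (free_module R C)"
    proof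
      fix b assume "b \<in> {b. z b \<noteq> \<zero>}"
      then have "z b \<in> carrier R" "b \<in> B" using assms(3) by (auto simp: carrier_free_module)
      then show "z b \<odot>\<^bsub>free_module R C\<^esub> f b \<in> carrier (free_module R C)"
        using free_module_smult_closed[OF assms(1), of "z b" "f b" C] assms(2) by (simp add: Pi_iff)
    qed
  qed simp
qed

lemma linear_map_free_extension:
  assumes "cring R" "f \<in> B \<rightarrow> carrier (free_module R C)"
  shows "linear_map R (free_module R B) (free_module R C) (free_extension R f)"
  by (rule linear_map_cong[OF linear_map_linear_extension[OF module_free_module[OF assms(1)] assms(2)]])
     (auto simp: free_extension_eq[OF assms] module_free_module[OF assms(1)])

lemma free_extension_gen:
  assumes "cring R" "f \<in> B \<rightarrow> carrier (free_module R C)" "b \<in> B"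
  shows "free_extension R f (free_gen R b) = f b"
  using free_extension_eq[OF assms(1,2) free_gen_closed[OF assms(1,3)]]
    linear_extension_gen[OF module_free_module[OF assms(1)] assms(3,2)] by simp

lemma linear_extension_free_extension:
  assumes X: "module R X" and f: "f \<in> B \<rightarrow> carrier (free_module R C)" and g: "g \<in> C \<rightarrow> carrier X"
    and z: "z \<in> carrier (free_module R B)"
  shows "linear_extension R X g (free_extension R f z) = linear_extension R X (\<lambda>b. linear_extension R X g (f b)) z"
proof -
  have cr: "cring R" using X by (simp add: module_def)
  have gf: "(\<lambda>b. linear_extension R X g (f b)) \<in> B \<rightarrow> carrier X"
    using linear_extension_closed[OF X _ g] f by (auto simp: Pi_iff)
  show ?thesis
    by (rule free_module_linear_eq[OF X linear_map_comp[OF linear_map_free_extension[OF cr f]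
          linear_map_linear_extension[OF X g]] linear_map_linear_extension[OF X gf] _ z])
       (simp add: free_extension_gen[OF cr f] linear_extension_gen[OF X _ gf])
qed

lemma free_extension_comp:
  assumes "cring R" and f: "f \<in> B \<rightarrow> carrier (free_module R C)" and g: "g \<in> C \<rightarrow> carrier (free_module R E)"
    and z: "z \<in> carrier (free_module R B)"
  shows "free_extension R g (free_extension R f z) = free_extension R (\<lambda>b. free_extension R g (f b)) z"
proof -
  note F = module_free_module[OF assms(1)]
  have gf: "(\<lambda>b. free_extension R g (f b)) \<in> B \<rightarrow> carrier (free_module R E)"
    using linear_map_closed[OF linear_map_free_extension[OF assms(1) g]] f by (auto simp: Pi_iff)
  show ?thesis
    by (rule free_module_linear_eq[OF F linear_map_comp[OF linear_map_free_extension[OF assms(1) f]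
          linear_map_free_extension[OF assms(1) g]] linear_map_free_extension[OF assms(1) gf] _ z])
       (simp add: free_extension_gen[OF assms(1) f] free_extension_gen[OF assms(1) gf])
qed

section \<open>A finite subresolution and its contraction\<close>

lemma free_module_submodule_eq:
  fixes R (structure)
  assumes "cring R" and H: "submodule H R (free_module R B)" and gen: "\<And>b. b \<in> B \<Longrightarrow> free_gen R b \<in> H"
  shows "carrier (free_module R B) \<subseteq> H"
proof
  fix z assume z: "z \<in> carrier (free_module R B)"
  interpret cring R by fact
  interpret F: module R "free_module R B" by (rule module_free_module[OF assms(1)])
  obtain xs where xs: "set xs \<subseteq> carrier R \<times> B" "lin_comb R xs = z" using lin_comb_surj[OF assms(1) z] by blast
  have "lin_comb R xs \<in> H" using xs(1)
  proof (induction xs)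
    case Nil
    show ?case using F.submodule_zero_closed[OF H] by simp
  next
    case (Cons rg xs)
    obtain r b where rb: "rg = (r, b)" by force
    then have r: "r \<in> carrier R" "b \<in> B" using Cons.prems by auto
    have l: "lin_comb R xs \<in> carrier (free_module R B)" using lin_comb_closed[OF assms(1)] Cons.prems by auto
    have "lin_comb R (rg # xs) =
        (r \<odot>\<^bsub>free_module R B\<^esub> free_gen R b) \<oplus>\<^bsub>free_module R B\<^esub> lin_comb R xs"
      using l r by (auto simp: rb fun_eq_iff free_gen_def carrier_free_module)
    also have "\<dots> \<in> H"
      by (rule F.submoduleE(5)[OF H F.submoduleE(4)[OF H r(1) gen[OF r(2)]]]) (use Cons in auto)
    finally show ?case .
  qed
  then show "z \<in> H" using xs(2) by simp
qed

lemma finitely_generated_free_module: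
  fixes R (structure)
  assumes "cring R" "finite B"
  shows "finitely_generated_module R (free_module R B)"
proof -
  interpret F: module R "free_module R B" by (rule module_free_module[OF assms(1)])
  have G: "free_gen R ` B \<subseteq> carrier (free_module R B)" by (rule image_subsetI) (rule free_gen_closed[OF assms(1)])
  have "carrier (free_module R B) \<subseteq> submodule_span R (free_module R B) (free_gen R ` B)"
    by (rule free_module_submodule_eq[OF assms(1) F.submodule_span_submodule[OF G]])
       (rule subsetD[OF F.submodule_span_incl imageI])
  then show ?thesis unfolding finitely_generated_module_def
    using F.module_axioms G assms(2) F.submodule_span_subset_carrier[OF G] by blast
qed

lemma linear_extension_zero:
  fixes R (structure)
  assumes X: "module R X" and z: "z \<in> carrier (free_module R B)" and f: "\<And>b. b \<in> B \<Longrightarrow> f b = \<zero>\<^bsub>X\<^esub>"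
  shows "linear_extension R X f z = \<zero>\<^bsub>X\<^esub>"
proof -
  interpret X: module R X by fact
  have fX: "f \<in> B \<rightarrow> carrier X" using f by auto
  have zero: "linear_map R (free_module R B) X (\<lambda>_. \<zero>\<^bsub>X\<^esub>)" by (rule linear_mapI) auto
  show ?thesis
    by (rule free_module_linear_eq[OF X linear_map_linear_extension[OF X fX] zero _ z])
       (simp add: linear_extension_gen[OF X _ fX] f)
qed

text \<open>Both sides are linear in z, so the formula on basis elements is enough. The same d
  serves in two consecutive degrees, from C to B and from B to L, because the bases of all degrees
  share one type.\<close>

lemma contraction_identity:
  assumes cr: "cring R" and d: "d \<in> B \<rightarrow> carrier (free_module R L)" and d': "d \<in> C \<rightarrow> carrier (free_module R B)"
    and p: "p \<in> B \<rightarrow> carrier (free_module R B)" and h: "h \<in> B \<rightarrow> carrier (free_module R C)"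
    and g: "g \<in> L \<rightarrow> carrier (free_module R B)"
    and eq: "\<forall>b\<in>B. free_gen R b = p b \<oplus>\<^bsub>free_module R B\<^esub>
      (free_extension R d (h b) \<oplus>\<^bsub>free_module R B\<^esub> free_extension R g (d b))"
    and z: "z \<in> carrier (free_module R B)"
  shows "z = free_extension R p z \<oplus>\<^bsub>free_module R B\<^esub>
    (free_extension R d (free_extension R h z) \<oplus>\<^bsub>free_module R B\<^esub> free_extension R g (free_extension R d z))"
proof (rule free_module_linear_eq[OF module_free_module[OF cr] linear_map_id _ _ z])
  note F = module_free_module[OF cr]
  show "linear_map R (free_module R B) (free_module R B) (\<lambda>z. free_extension R p z \<oplus>\<^bsub>free_module R B\<^esub>
    (free_extension R d (free_extension R h z) \<oplus>\<^bsub>free_module R B\<^esub> free_extension R g (free_extension R d z)))"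
    by (intro linear_map_plus[OF F] linear_map_free_extension[OF cr p]
        linear_map_comp[OF linear_map_free_extension[OF cr h] linear_map_free_extension[OF cr d']]
        linear_map_comp[OF linear_map_free_extension[OF cr d] linear_map_free_extension[OF cr g]])
  fix b assume b: "b \<in> B"
  show "free_gen R b = free_extension R p (free_gen R b) \<oplus>\<^bsub>free_module R B\<^esub>
    (free_extension R d (free_extension R h (free_gen R b)) \<oplus>\<^bsub>free_module R B\<^esub>
      free_extension R g (free_extension R d (free_gen R b)))"
    unfolding free_extension_gen[OF cr p b] free_extension_gen[OF cr h b] free_extension_gen[OF cr d b]
    by (rule eq[rule_format, OF b])
qed

text \<open>The basis one degree down, empty below degree 0; this lets degree 0 be treated together
  with the others.\<close>

definition lower :: "(nat \<Rightarrow> 'b set) \<Rightarrow> nat \<Rightarrow> 'b set" where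
  "lower B n = (case n of 0 \<Rightarrow> {} | Suc k \<Rightarrow> B k)"

lemma lower_simps [simp]: "lower B 0 = {}" "lower B (Suc n) = B n"
  by (simp_all add: lower_def)

definition res_boundary :: "('a, 'r) ring_scheme \<Rightarrow> ('a, 'm) res_gen \<Rightarrow> ('a, 'm) res_gen \<Rightarrow> 'a" where
  "res_boundary R g = (case g of Gen _ \<Rightarrow> (\<lambda>_. \<zero>\<^bsub>R\<^esub>) | Syz xs \<Rightarrow> lin_comb R xs)"

lemma res_diff_eq: "res_diff R = free_extension R (res_boundary R)"
  by (simp add: res_diff_def free_extension_def res_boundary_def[abs_def])

text \<open>In degree 0 the cycles are the kernel of the augmentation, not of the zero differential.
  This is exactly the condition under which \<open>res_basis\<close> admits a \<open>Syz\<close>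
  element.\<close>

definition res_cycle :: "('a, 'r) ring_scheme \<Rightarrow> ('a, 'm, 'e) module_scheme \<Rightarrow> nat \<Rightarrow>
    (('a, 'm) res_gen \<Rightarrow> 'a) \<Rightarrow> bool" where
  "res_cycle R M n z \<longleftrightarrow> (if n = 0 then res_aug R M z = \<zero>\<^bsub>M\<^esub> else res_diff R z = (\<lambda>_. \<zero>\<^bsub>R\<^esub>))"

lemma zero_in_free_module:
  fixes R (structure)
  assumes "cring R"
  shows "(\<lambda>_. \<zero>) \<in> carrier (free_module R B)"
proof -
  interpret cring R by fact
  show ?thesis by (simp add: carrier_free_module)
qed

context
  fixes R :: "('a, 'r) ring_scheme" (structure) and M :: "('a, 'm, 'e) module_scheme"
  assumes M: "module R M"
begin

interpretation M: module R M by fact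

abbreviation (input) "basis \<equiv> res_basis R M"
abbreviation (input) "F n \<equiv> free_module R (basis n)"
abbreviation (input) "bd \<equiv> res_boundary R"
abbreviation (input) "ext \<equiv> free_extension R"

lemma cr: "cring R" by (rule M.R.is_cring)

lemma module_free: "module R (free_module R B)"
  by (rule module_free_module[OF cr])

declare res_basis.simps(2) [simp del]

lemma res_boundary_closed: "b \<in> basis n \<Longrightarrow> bd b \<in> carrier (free_module R (lower basis n))"
proof (cases n)
  case 0
  assume "b \<in> basis n"
  then have "bd b = (\<lambda>_. \<zero>)" using 0 by (auto simp: res_boundary_def)
  then show ?thesis using zero_in_free_module[OF cr] by simp
next
  case (Suc k)
  assume "b \<in> basis n"
  then obtain xs where "b = Syz xs" "set xs \<subseteq> carrier R \<times> basis k" using Suc by (auto simp: res_basis.simps(2))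
  then show ?thesis using lin_comb_closed[OF cr] Suc by (simp add: res_boundary_def)
qed

lemma res_boundary_Pi: "bd \<in> basis n \<rightarrow> carrier (free_module R (lower basis n))"
  using res_boundary_closed by blast

lemma linear_res_diff: "linear_map R (F n) (free_module R (lower basis n)) (res_diff R)"
  unfolding res_diff_eq by (rule linear_map_free_extension[OF cr res_boundary_Pi])

lemma linear_res_diff_Suc: "linear_map R (F (Suc n)) (F n) (res_diff R)"
  using linear_res_diff[of "Suc n"] unfolding lower_simps .

lemma res_diff_gen: "b \<in> basis n \<Longrightarrow> res_diff R (free_gen R b) = bd b"
  unfolding res_diff_eq by (rule free_extension_gen[OF cr res_boundary_Pi])

lemma res_cycle_iff: "{z \<in> carrier (F n). res_cycle R M n z} = res_diff R ` carrier (F (Suc n))"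
proof (cases n)
  case 0
  then show ?thesis using res_exact_0[OF M.module_axioms]
    by (simp add: res_cycle_def a_kernel_def kernel_def res_module_def)
next
  case (Suc k)
  then show ?thesis using res_exact_Suc[OF M.module_axioms, of k]
    by (simp add: res_cycle_def a_kernel_def kernel_def res_module_def)
qed

lemma res_diff_zero_0: "z \<in> carrier (F 0) \<Longrightarrow> res_diff R z = (\<lambda>_. \<zero>)"
  using linear_map_closed[OF linear_res_diff, of z 0] by (auto simp: carrier_free_module fun_eq_iff)

lemma res_diff_res_diff:
  assumes "z \<in> carrier (F (Suc n))"
  shows "res_diff R (res_diff R z) = (\<lambda>_. \<zero>)"
proof (cases n)
  case 0
  have "res_diff R z \<in> carrier (F 0)" using linear_map_closed[OF linear_res_diff assms] 0 by simp
  then show ?thesis by (rule res_diff_zero_0)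
next
  case (Suc k)
  have "res_diff R z \<in> {z \<in> carrier (F n). res_cycle R M n z}" using assms unfolding res_cycle_iff by blast
  then show ?thesis using Suc by (simp add: res_cycle_def)
qed

lemma res_diff_boundary:
  assumes "b \<in> basis n"
  shows "res_diff R (bd b) = (\<lambda>_. \<zero>)"
proof (cases n)
  case 0
  then have "bd b = (\<lambda>_. \<zero>)" using assms by (auto simp: res_boundary_def)
  then show ?thesis using res_diff_zero_0[OF zero_in_free_module[OF cr]] by simp
next
  case (Suc k)
  then show ?thesis
    using res_diff_res_diff[OF free_gen_closed[OF cr], of b k] assms res_diff_gen[OF assms] by simp
qed

context
  assumes noeth: "noetherian_ring R" and fgM: "finitely_generated_module R M"
begin

text \<open>The cycles over a finite basis S n are finitely generated, as R is Noetherian. Each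
  generator is a combination of elements of S n, and the corresponding formal combination
  \<open>Syz xs\<close> is itself a basis element of the canonical resolution. So the finite
  resolution sits inside the canonical one with the same differential.\<close>

lemma finite_subresolution:
  obtains S where "\<And>n. finite (S n)" "\<And>n. S n \<subseteq> basis n"
    "\<And>n b. b \<in> S n \<Longrightarrow> bd b \<in> carrier (free_module R (lower S n))"
    "res_aug R M ` carrier (free_module R (S 0)) = carrier M"
    "\<And>n z. z \<in> carrier (free_module R (S n)) \<Longrightarrow> res_cycle R M n z \<Longrightarrow>
      \<exists>w \<in> carrier (free_module R (S (Suc n))). res_diff R w = z"
proof -
  define P where "P = (\<lambda>n (S :: ('a, 'm) res_gen set). finite S \<and> S \<subseteq> basis n \<and>
     (n = 0 \<longrightarrow> res_aug R M ` carrier (free_module R S) = carrier M))"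
  define Q where "Q = (\<lambda>n (S :: ('a, 'm) res_gen set) S'. (\<forall>b\<in>S'. bd b \<in> carrier (free_module R S)) \<and>
     (\<forall>z\<in>carrier (free_module R S). res_cycle R M n z \<longrightarrow> (\<exists>w \<in> carrier (free_module R S'). res_diff R w = z)))"
  have "\<exists>S. \<forall>n. P n (S n) \<and> Q n (S n) (S (Suc n))"
  proof (rule dependent_nat_choice)
    obtain T where T: "T \<subseteq> carrier M" "finite T" "submodule_span R M T = carrier M"
      using fgM by (auto simp: finitely_generated_module_def)
    have af: "aug_fun M \<in> (Gen ` T :: ('a, 'm) res_gen set) \<rightarrow> carrier M" using T(1) by auto
    note lin = linear_map_linear_extension[OF M.module_axioms af, folded res_aug_def]
    have "submodule (res_aug R M ` carrier (free_module R (Gen ` T))) R M"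
      by (rule submodule_image[OF module_free M.module_axioms lin module.carrier_is_submodule[OF module_free]])
    moreover have "T \<subseteq> res_aug R M ` carrier (free_module R (Gen ` T))"
    proof
      fix t assume t: "t \<in> T"
      have "res_aug R M (free_gen R (Gen t)) = t"
        using linear_extension_gen[OF M.module_axioms _ af, of "Gen t"] t by (simp add: res_aug_def)
      then show "t \<in> res_aug R M ` carrier (free_module R (Gen ` T))"
        using free_gen_closed[OF cr, of "Gen t" "Gen ` T"] t by (metis image_eqI)
    qed
    ultimately have "carrier M \<subseteq> res_aug R M ` carrier (free_module R (Gen ` T))"
      using M.submodule_span_least T(3) by metis
    moreover have "res_aug R M ` carrier (free_module R (Gen ` T)) \<subseteq> carrier M"
      using linear_map_closed[OF lin] by blast
    ultimately have "P 0 (Gen ` T)" using T by (auto simp: P_def)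
    then show "\<exists>S. P 0 S" ..
  next
    fix S n assume "P n S"
    then have S: "finite S" "S \<subseteq> basis n" by (auto simp: P_def)
    have "submodule {z \<in> carrier (F n). res_cycle R M n z} R (F n)"
      unfolding res_cycle_iff
      using submodule_image[OF module_free module_free linear_res_diff_Suc
          module.carrier_is_submodule[OF module_free]] by simp
    from submodule_vimage[OF module_free module_free linear_map_free_inclusion[OF S(2)] this]
    have K: "submodule {z \<in> carrier (free_module R S). res_cycle R M n z} R (free_module R S)" (is "submodule ?K _ _")
    proof -
      have "carrier (free_module R S) \<subseteq> carrier (F n)"
        using linear_map_closed[OF linear_map_free_inclusion[OF S(2)]] by blast
      then have "{z \<in> carrier (free_module R S). z \<in> {z \<in> carrier (F n). res_cycle R M n z}} = ?K" by blast
      then show ?thesis using \<open>submodule {x \<in> carrier (free_module R S). x \<in> {z \<in> carrier (F n). res_cycle R M n z}} R (free_module R S)\<close> by simp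
    qed
    obtain T where T: "T \<subseteq> ?K" "finite T" "submodule_span R (free_module R S) T = ?K"
      using noetherian_module_of_fg[OF noeth finitely_generated_free_module[OF cr S(1)]] K
      unfolding noetherian_module_def by blast
    have "\<forall>z\<in>T. \<exists>xs. set xs \<subseteq> carrier R \<times> S \<and> lin_comb R xs = z"
      using lin_comb_surj[OF cr] T(1) by blast
    then obtain xs where xs: "\<And>z. z \<in> T \<Longrightarrow> set (xs z) \<subseteq> carrier R \<times> S" "\<And>z. z \<in> T \<Longrightarrow> lin_comb R (xs z) = z"
      by metis
    define S' where "S' = (\<lambda>z. Syz (xs z)) ` T"
    have S'B: "S' \<subseteq> basis (Suc n)"
    proof
      fix b assume "b \<in> S'"
      then obtain z where z: "z \<in> T" "b = Syz (xs z)" by (auto simp: S'_def)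
      have "set (xs z) \<subseteq> carrier R \<times> basis n" using xs(1)[OF z(1)] S(2) by blast
      moreover have "res_cycle R M n (lin_comb R (xs z))" using xs(2)[OF z(1)] T(1) z(1) by auto
      ultimately show "b \<in> basis (Suc n)" using z(2) by (auto simp: res_cycle_def res_basis.simps(2))
    qed
    have bdS': "bd b \<in> carrier (free_module R S)" if "b \<in> S'" for b
      using that lin_comb_closed[OF cr xs(1)] by (auto simp: S'_def res_boundary_def)
    then have lin: "linear_map R (free_module R S') (free_module R S) (res_diff R)"
      unfolding res_diff_eq by (intro linear_map_free_extension[OF cr]) blast
    have "submodule (res_diff R ` carrier (free_module R S')) R (free_module R S)"
      by (rule submodule_image[OF module_free module_free lin module.carrier_is_submodule[OF module_free]])
    moreover have "T \<subseteq> res_diff R ` carrier (free_module R S')"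
    proof
      fix z assume z: "z \<in> T"
      then have b: "Syz (xs z) \<in> S'" by (auto simp: S'_def)
      have "res_diff R (free_gen R (Syz (xs z))) = z"
        using res_diff_gen[of "Syz (xs z)" "Suc n"] S'B b xs(2)[OF z] by (auto simp: res_boundary_def)
      then show "z \<in> res_diff R ` carrier (free_module R S')"
        using free_gen_closed[OF cr b] by (metis image_eqI)
    qed
    ultimately have "?K \<subseteq> res_diff R ` carrier (free_module R S')"
      using module.submodule_span_least[OF module_free] T(3) by metis
    then have "P (Suc n) S' \<and> Q n S S'" using S'B T(2) bdS' by (auto simp: P_def Q_def S'_def)
    then show "\<exists>S'. P (Suc n) S' \<and> Q n S S'" ..
  qed
  then obtain S where S: "\<And>n. P n (S n)" "\<And>n. Q n (S n) (S (Suc n))" by blast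
  show ?thesis
  proof (rule that[of S])
    fix n b assume b: "b \<in> S n"
    show "bd b \<in> carrier (free_module R (lower S n))"
    proof (cases n)
      case 0
      have "b \<in> basis n" using b S(1)[of n] unfolding P_def by blast
      then show ?thesis using res_boundary_closed[of b n] 0 by simp
    next
      case (Suc k)
      then show ?thesis using S(2)[of k] b by (simp add: Q_def)
    qed
  qed (use S in \<open>simp_all add: P_def Q_def\<close>)
qed

text \<open>The identity 1 = p + d h + h d makes the subresolution a deformation retract of the
  canonical one. The homotopy h is constructed degree by degree; p is what remains, and by
  construction it takes values in the subresolution.\<close>

lemma subresolution_contraction:
  obtains S p h where "\<And>n. finite (S n)" "\<And>n. S n \<subseteq> basis n"
    "\<And>n b. b \<in> S n \<Longrightarrow> bd b \<in> carrier (free_module R (lower S n))"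
    "\<And>n. h n \<in> lower basis n \<rightarrow> carrier (F n)"
    "\<And>n b. b \<in> lower S n \<Longrightarrow> h n b = (\<lambda>_. \<zero>)"
    "\<And>n. p n \<in> basis n \<rightarrow> carrier (free_module R (S n))"
    "\<And>n b. b \<in> basis n \<Longrightarrow>
      free_gen R b = p n b \<oplus>\<^bsub>F n\<^esub> (res_diff R (h (Suc n) b) \<oplus>\<^bsub>F n\<^esub> ext (h n) (bd b))"
proof (rule finite_subresolution)
  fix S assume S: "\<And>n. finite (S n)" "\<And>n. S n \<subseteq> basis n"
    "\<And>n b. b \<in> S n \<Longrightarrow> bd b \<in> carrier (free_module R (lower S n))"
    "res_aug R M ` carrier (free_module R (S 0)) = carrier M"
    "\<And>n z. z \<in> carrier (free_module R (S n)) \<Longrightarrow> res_cycle R M n z \<Longrightarrow>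
      \<exists>w \<in> carrier (free_module R (S (Suc n))). res_diff R w = z"
  have SF: "carrier (free_module R (S n)) \<subseteq> carrier (F n)" for n
    using linear_map_closed[OF linear_map_free_inclusion[OF S(2)]] by blast
  \<comment> \<open>Invariant of the recursion: up to the contribution of the homotopy already
    constructed, every basis element is an element over S n plus a cycle. In Q this cycle has become
    the boundary of a value of the next homotopy.\<close>
  define P where "P = (\<lambda>n g. g \<in> lower basis n \<rightarrow> carrier (F n) \<and> (\<forall>b\<in>lower S n. g b = (\<lambda>_. \<zero>)) \<and>
     (\<forall>b\<in>basis n. \<exists>y\<in>carrier (free_module R (S n)). \<exists>z\<in>carrier (F n). res_cycle R M n z \<and>
        free_gen R b = y \<oplus>\<^bsub>F n\<^esub> (z \<oplus>\<^bsub>F n\<^esub> ext g (bd b))))"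
  define Q where "Q = (\<lambda>n g g'. \<forall>b\<in>basis n. \<exists>y\<in>carrier (free_module R (S n)).
     free_gen R b = y \<oplus>\<^bsub>F n\<^esub> (res_diff R (g' b) \<oplus>\<^bsub>F n\<^esub> ext g (bd b)))"
  have "\<exists>h. \<forall>n. P n (h n) \<and> Q n (h n) (h (Suc n))"
  proof (rule dependent_nat_choice)
    interpret F0: module R "F 0" by (rule module_free)
    note aug = linear_map_linear_extension[OF M.module_axioms aug_fun[OF M.module_axioms], folded res_aug_def]
    have "P 0 (\<lambda>_ _. \<zero>)"
      unfolding P_def
    proof (intro conjI ballI)
      fix b assume b: "b \<in> basis 0"
      let ?e = "free_gen R b"
      have e: "?e \<in> carrier (F 0)" by (rule free_gen_closed[OF cr b])
      \<comment> \<open>Already the free module on S 0 maps onto M, so b differs from some y over S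
        0 by an element of the kernel of the augmentation, a cycle in degree 0.\<close>
      obtain y where y: "y \<in> carrier (free_module R (S 0))" "res_aug R M y = res_aug R M ?e"
        using S(4) linear_map_closed[OF aug e] by (metis imageE)
      have yF: "y \<in> carrier (F 0)" using SF y(1) by blast
      let ?z = "?e \<oplus>\<^bsub>F 0\<^esub> \<ominus>\<^bsub>F 0\<^esub> y"
      have z: "?z \<in> carrier (F 0)" using e yF by (intro F0.M.a_closed F0.M.a_inv_closed)
      have "res_aug R M ?z = res_aug R M ?e \<oplus>\<^bsub>M\<^esub> \<ominus>\<^bsub>M\<^esub> res_aug R M y"
        using linear_map_add[OF aug e F0.M.a_inv_closed[OF yF]]
          linear_map_neg[OF F0.module_axioms M.module_axioms aug yF] by simp
      then have cyc: "res_cycle R M 0 ?z"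
        using y(2) linear_map_closed[OF aug e] by (simp add: res_cycle_def M.M.r_neg)
      have bd0: "bd b = (\<lambda>_. \<zero>)" using b by (auto simp: res_boundary_def)
      have "ext (\<lambda>_ _. \<zero>) (bd b) = (\<lambda>_. \<zero>)"
        unfolding bd0 using lin_zero[OF module_free, of UNIV] by (simp add: free_extension_def)
      then have "ext (\<lambda>_ _. \<zero>) (bd b) = \<zero>\<^bsub>F 0\<^esub>" by simp
      moreover have "?e = y \<oplus>\<^bsub>F 0\<^esub> (?z \<oplus>\<^bsub>F 0\<^esub> \<zero>\<^bsub>F 0\<^esub>)"
        unfolding F0.M.r_zero[OF z] F0.M.a_lcomm[OF yF e F0.M.a_inv_closed[OF yF]] F0.M.r_neg[OF yF]
        using F0.M.r_zero[OF e] by (rule sym)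
      ultimately show "\<exists>y\<in>carrier (free_module R (S 0)). \<exists>z\<in>carrier (F 0). res_cycle R M 0 z \<and>
        ?e = y \<oplus>\<^bsub>F 0\<^esub> (z \<oplus>\<^bsub>F 0\<^esub> ext (\<lambda>_ _. \<zero>) (bd b))"
        using y(1) z cyc by metis
    qed simp_all
    then show "\<exists>h. P 0 h" by (rule exI[of "P 0"])
  next
    fix g n assume "P n g"
    then have g: "g \<in> lower basis n \<rightarrow> carrier (F n)" "\<And>b. b \<in> lower S n \<Longrightarrow> g b = (\<lambda>_. \<zero>)"
      and ex: "\<And>b. b \<in> basis n \<Longrightarrow> \<exists>y\<in>carrier (free_module R (S n)). \<exists>z\<in>carrier (F n). res_cycle R M n z \<and>
        free_gen R b = y \<oplus>\<^bsub>F n\<^esub> (z \<oplus>\<^bsub>F n\<^esub> ext g (bd b))" by (auto simp: P_def)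
    interpret Fn: module R "F n" by (rule module_free)
    interpret Fs: module R "F (Suc n)" by (rule module_free)
    have "\<exists>y w. y \<in> carrier (free_module R (S n)) \<and> w \<in> carrier (F (Suc n)) \<and> (b \<in> S n \<longrightarrow> w = (\<lambda>_. \<zero>)) \<and>
        free_gen R b = y \<oplus>\<^bsub>F n\<^esub> (res_diff R w \<oplus>\<^bsub>F n\<^esub> ext g (bd b))" if b: "b \<in> basis n" for b
    proof (cases "b \<in> S n")
      \<comment> \<open>On the subresolution the value w = 0 is chosen deliberately. It keeps h zero
        there, and this later makes p the identity on the subresolution
        (\<open>p_S\<close>).\<close>
      case True
      have 1: "ext g (bd b) = \<zero>\<^bsub>F n\<^esub>"
        unfolding free_extension_def
        using linear_extension_zero[OF module_free S(3)[OF True], of g UNIV] g(2) by simp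
      have 2: "res_diff R (\<lambda>_. \<zero>) = \<zero>\<^bsub>F n\<^esub>"
        using linear_map_zero[OF module_free module_free linear_res_diff[of "Suc n"]] by simp
      have e: "free_gen R b \<in> carrier (F n)" by (rule free_gen_closed[OF cr b])
      have "free_gen R b = free_gen R b \<oplus>\<^bsub>F n\<^esub> (res_diff R (\<lambda>_. \<zero>) \<oplus>\<^bsub>F n\<^esub> ext g (bd b))"
        unfolding 1 2 Fn.M.r_zero[OF Fn.M.zero_closed] Fn.M.r_zero[OF e] ..
      then show ?thesis using free_gen_closed[OF cr True] zero_in_free_module[OF cr] by blast
    next
      case False
      obtain y z where yz: "y \<in> carrier (free_module R (S n))" "z \<in> carrier (F n)" "res_cycle R M n z"
        "free_gen R b = y \<oplus>\<^bsub>F n\<^esub> (z \<oplus>\<^bsub>F n\<^esub> ext g (bd b))" using ex[OF b] by blast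
      then have "z \<in> res_diff R ` carrier (F (Suc n))" using res_cycle_iff by blast
      then show ?thesis using yz False by blast
    qed
    then have "\<forall>b\<in>basis n. \<exists>y w. y \<in> carrier (free_module R (S n)) \<and> w \<in> carrier (F (Suc n)) \<and>
        (b \<in> S n \<longrightarrow> w = (\<lambda>_. \<zero>)) \<and>
        free_gen R b = y \<oplus>\<^bsub>F n\<^esub> (res_diff R w \<oplus>\<^bsub>F n\<^esub> ext g (bd b))" by (rule ballI)
    from bchoice[OF this] obtain y where "\<forall>b\<in>basis n. \<exists>w. y b \<in> carrier (free_module R (S n)) \<and>
        w \<in> carrier (F (Suc n)) \<and> (b \<in> S n \<longrightarrow> w = (\<lambda>_. \<zero>)) \<and>
        free_gen R b = y b \<oplus>\<^bsub>F n\<^esub> (res_diff R w \<oplus>\<^bsub>F n\<^esub> ext g (bd b))" by (rule exE)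
    from bchoice[OF this] obtain w where yw': "\<forall>b\<in>basis n. y b \<in> carrier (free_module R (S n)) \<and>
        w b \<in> carrier (F (Suc n)) \<and> (b \<in> S n \<longrightarrow> w b = (\<lambda>_. \<zero>)) \<and>
        free_gen R b = y b \<oplus>\<^bsub>F n\<^esub> (res_diff R (w b) \<oplus>\<^bsub>F n\<^esub> ext g (bd b))" by (rule exE)
    have yw: "\<And>b. b \<in> basis n \<Longrightarrow> y b \<in> carrier (free_module R (S n))"
      "\<And>b. b \<in> basis n \<Longrightarrow> w b \<in> carrier (F (Suc n))" "\<And>b. b \<in> basis n \<Longrightarrow> b \<in> S n \<Longrightarrow> w b = (\<lambda>_. \<zero>)"
      "\<And>b. b \<in> basis n \<Longrightarrow> free_gen R b = y b \<oplus>\<^bsub>F n\<^esub> (res_diff R (w b) \<oplus>\<^bsub>F n\<^esub> ext g (bd b))"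
      using yw' by (simp_all del: free_module_simps)
    have w: "w \<in> basis n \<rightarrow> carrier (F (Suc n))" and yS: "y \<in> basis n \<rightarrow> carrier (free_module R (S n))"
      using yw by blast+
    then have y: "y \<in> basis n \<rightarrow> carrier (F n)" using SF by blast
    have "\<forall>b\<in>basis n. free_gen R b = y b \<oplus>\<^bsub>F n\<^esub> (res_diff R (w b) \<oplus>\<^bsub>F n\<^esub> ext g (bd b))"
      by (rule ballI) (rule yw(4))
    note ident = contraction_identity[OF cr res_boundary_Pi res_boundary_Pi[of "Suc n", unfolded lower_simps]
        y w g(1) this[unfolded res_diff_eq], folded res_diff_eq]
    have "P (Suc n) w"
      unfolding P_def
    proof (intro conjI ballI)
      show "w \<in> lower basis (Suc n) \<rightarrow> carrier (F (Suc n))" using w by simp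
      show "w b = (\<lambda>_. \<zero>)" if "b \<in> lower S (Suc n)" for b using that yw(3) S(2) by auto
      fix c assume c: "c \<in> basis (Suc n)"
      let ?e = "free_gen R c" and ?x = "bd c"
      note lw = linear_map_free_extension[OF cr w]
      note ly = linear_map_free_extension[OF cr yS]
      note ld = linear_res_diff_Suc
      have x: "?x \<in> carrier (F n)" using res_boundary_closed[OF c] by simp
      have e: "?e \<in> carrier (F (Suc n))" by (rule free_gen_closed[OF cr c])
      have wx: "ext w ?x \<in> carrier (F (Suc n))" by (rule linear_map_closed[OF lw x])
      have yx: "ext y ?x \<in> carrier (free_module R (S n))" by (rule linear_map_closed[OF ly x])
      then have yxF: "ext y ?x \<in> carrier (F n)" using SF by blast
      have dwx: "res_diff R (ext w ?x) \<in> carrier (F n)" by (rule linear_map_closed[OF ld wx])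
      have "ext g (res_diff R ?x) = \<zero>\<^bsub>F n\<^esub>"
        using linear_map_zero[OF module_free module_free linear_map_free_extension[OF cr g(1)]]
        unfolding res_diff_boundary[OF c] by simp
      \<comment> \<open>Since ?x is itself a boundary, the term with g and the differential drops
        out of the identity in degree n.\<close>
      then have x_eq: "?x = ext y ?x \<oplus>\<^bsub>F n\<^esub> res_diff R (ext w ?x)"
        using ident[OF x] Fn.M.r_zero[OF dwx] by metis
      \<comment> \<open>Subtracting ext w ?x from c leaves an element whose boundary is ext y ?x, an
        element over S n. Being a cycle, it is the boundary of some y' over S (Suc n) by exactness
        of the subresolution, and ?f minus y' is the cycle required by P.\<close>
      let ?f = "?e \<oplus>\<^bsub>F (Suc n)\<^esub> \<ominus>\<^bsub>F (Suc n)\<^esub> ext w ?x"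
      have f: "?f \<in> carrier (F (Suc n))" using e wx by (intro Fs.M.a_closed Fs.M.a_inv_closed)
      have "res_diff R ?f = ?x \<oplus>\<^bsub>F n\<^esub> \<ominus>\<^bsub>F n\<^esub> res_diff R (ext w ?x)"
        using linear_map_add[OF ld e Fs.M.a_inv_closed[OF wx]]
          linear_map_neg[OF module_free module_free ld wx] res_diff_gen[OF c] by metis
      also have "\<dots> = ext y ?x \<oplus>\<^bsub>F n\<^esub> (res_diff R (ext w ?x) \<oplus>\<^bsub>F n\<^esub> \<ominus>\<^bsub>F n\<^esub> res_diff R (ext w ?x))"
        using x_eq Fn.M.a_assoc[OF yxF dwx Fn.M.a_inv_closed[OF dwx]] by metis
      also have "\<dots> = ext y ?x" unfolding Fn.M.r_neg[OF dwx] by (rule Fn.M.r_zero[OF yxF])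
      finally have df: "res_diff R ?f = ext y ?x" .
      then have "res_cycle R M n (ext y ?x)" using res_cycle_iff[of n] f by (metis (no_types, lifting) image_eqI mem_Collect_eq)
      then obtain y' where y': "y' \<in> carrier (free_module R (S (Suc n)))" "res_diff R y' = ext y ?x"
        using S(5)[OF yx] by blast
      then have y'F: "y' \<in> carrier (F (Suc n))" using SF by blast
      let ?z = "?f \<oplus>\<^bsub>F (Suc n)\<^esub> \<ominus>\<^bsub>F (Suc n)\<^esub> y'"
      have z: "?z \<in> carrier (F (Suc n))" by (rule Fs.M.a_closed[OF f Fs.M.a_inv_closed[OF y'F]])
      have "res_diff R ?z = ext y ?x \<oplus>\<^bsub>F n\<^esub> \<ominus>\<^bsub>F n\<^esub> ext y ?x"
        using linear_map_add[OF ld f Fs.M.a_inv_closed[OF y'F]]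
          linear_map_neg[OF module_free module_free ld y'F] df y'(2) by metis
      then have "res_diff R ?z = \<zero>\<^bsub>F n\<^esub>" using Fn.M.r_neg[OF yxF] by metis
      then have cyc: "res_cycle R M (Suc n) ?z" by (simp add: res_cycle_def)
      have "?e = y' \<oplus>\<^bsub>F (Suc n)\<^esub> (?z \<oplus>\<^bsub>F (Suc n)\<^esub> ext w ?x)"
      proof -
        have "?z \<oplus>\<^bsub>F (Suc n)\<^esub> y' = ?f"
          unfolding Fs.M.a_assoc[OF f Fs.M.a_inv_closed[OF y'F] y'F] Fs.M.l_neg[OF y'F] by (rule Fs.M.r_zero[OF f])
        moreover have "?f \<oplus>\<^bsub>F (Suc n)\<^esub> ext w ?x = ?e"
          unfolding Fs.M.a_assoc[OF e Fs.M.a_inv_closed[OF wx] wx] Fs.M.l_neg[OF wx] by (rule Fs.M.r_zero[OF e])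
        moreover have "y' \<oplus>\<^bsub>F (Suc n)\<^esub> (?z \<oplus>\<^bsub>F (Suc n)\<^esub> ext w ?x) = (?z \<oplus>\<^bsub>F (Suc n)\<^esub> y') \<oplus>\<^bsub>F (Suc n)\<^esub> ext w ?x"
          using Fs.M.a_assoc[OF y'F z wx] Fs.M.a_comm[OF y'F z] by metis
        ultimately show ?thesis by metis
      qed
      then show "\<exists>y\<in>carrier (free_module R (S (Suc n))). \<exists>z\<in>carrier (F (Suc n)). res_cycle R M (Suc n) z \<and>
        ?e = y \<oplus>\<^bsub>F (Suc n)\<^esub> (z \<oplus>\<^bsub>F (Suc n)\<^esub> ext w ?x)"
        using y'(1) z cyc by blast
    qed
    moreover have "Q n g w" unfolding Q_def using yw(1,4) by blast
    ultimately show "\<exists>g'. P (Suc n) g' \<and> Q n g g'" by blast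
  qed
  then obtain h where h: "\<And>n. P n (h n)" "\<And>n. Q n (h n) (h (Suc n))" by blast
  have "\<forall>n. \<exists>p. \<forall>b\<in>basis n. p b \<in> carrier (free_module R (S n)) \<and>
     free_gen R b = p b \<oplus>\<^bsub>F n\<^esub> (res_diff R (h (Suc n) b) \<oplus>\<^bsub>F n\<^esub> ext (h n) (bd b))"
    by (intro allI bchoice) (use h(2) in \<open>unfold Q_def, blast\<close>)
  from choice[OF this] obtain p where p': "\<forall>n. \<forall>b\<in>basis n. p n b \<in> carrier (free_module R (S n)) \<and>
     free_gen R b = p n b \<oplus>\<^bsub>F n\<^esub> (res_diff R (h (Suc n) b) \<oplus>\<^bsub>F n\<^esub> ext (h n) (bd b))" by (rule exE)
  have p: "\<And>n b. b \<in> basis n \<Longrightarrow> p n b \<in> carrier (free_module R (S n))"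
     "\<And>n b. b \<in> basis n \<Longrightarrow> free_gen R b = p n b \<oplus>\<^bsub>F n\<^esub> (res_diff R (h (Suc n) b) \<oplus>\<^bsub>F n\<^esub> ext (h n) (bd b))"
    using p' by (simp_all del: free_module_simps)
  show ?thesis
  proof (rule that[OF S(1-3), of h p])
    show "p n \<in> basis n \<rightarrow> carrier (free_module R (S n))" for n using p(1) by blast
  qed (use h(1) p(2) in \<open>auto simp: P_def simp del: free_module_simps\<close>)
qed

end

end

section \<open>Cohomology and homology of a contraction\<close>

lemma linear_extension_plus_fun:
  fixes R (structure)
  assumes X: "module R X" and f: "f \<in> B \<rightarrow> carrier X" and g: "g \<in> B \<rightarrow> carrier X"
    and z: "z \<in> carrier (free_module R B)"
  shows "linear_extension R X (\<lambda>b. f b \<oplus>\<^bsub>X\<^esub> g b) z = linear_extension R X f z \<oplus>\<^bsub>X\<^esub> linear_extension R X g z"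
proof -
  interpret X: module R X by fact
  have fg: "(\<lambda>b. f b \<oplus>\<^bsub>X\<^esub> g b) \<in> B \<rightarrow> carrier X" using f g by (auto simp: Pi_iff)
  show ?thesis
    by (rule free_module_linear_eq[OF X linear_map_linear_extension[OF X fg]
          linear_map_plus[OF X linear_map_linear_extension[OF X f] linear_map_linear_extension[OF X g]] _ z])
       (simp add: linear_extension_gen[OF X _ fg] linear_extension_gen[OF X _ f] linear_extension_gen[OF X _ g])
qed

lemma linear_extension_smult_fun:
  fixes R (structure)
  assumes X: "module R X" and f: "f \<in> B \<rightarrow> carrier X" and r: "r \<in> carrier R"
    and z: "z \<in> carrier (free_module R B)"
  shows "linear_extension R X (\<lambda>b. r \<odot>\<^bsub>X\<^esub> f b) z = r \<odot>\<^bsub>X\<^esub> linear_extension R X f z"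
proof -
  interpret X: module R X by fact
  have rf: "(\<lambda>b. r \<odot>\<^bsub>X\<^esub> f b) \<in> B \<rightarrow> carrier X" using f r by (auto simp: Pi_iff)
  show ?thesis
    by (rule free_module_linear_eq[OF X linear_map_linear_extension[OF X rf]
          linear_map_comp[OF linear_map_linear_extension[OF X f] X.linear_map_scale[OF r]] _ z])
       (simp add: linear_extension_gen[OF X _ rf] linear_extension_gen[OF X _ f])
qed

lemma linear_extension_closed':
  "module R X \<Longrightarrow> f \<in> B \<rightarrow> carrier X \<Longrightarrow> z \<in> carrier (free_module R B) \<Longrightarrow> linear_extension R X f z \<in> carrier X"
  by (rule linear_extension_closed)

definition sum_extension :: "('a, 'm, 'e) module_scheme \<Rightarrow> ('a, 'n, 'f) module_scheme \<Rightarrow>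
    ('b \<Rightarrow> 'm \<Rightarrow> 'n) \<Rightarrow> ('b \<Rightarrow> 'm) \<Rightarrow> 'n" where
  "sum_extension X Y l u = (\<Oplus>\<^bsub>Y\<^esub> b \<in> {b. u b \<noteq> \<zero>\<^bsub>X\<^esub>}. l b (u b))"

context
  fixes R :: "('a, 'r) ring_scheme" and X :: "('a, 'm, 'e) module_scheme"
    and Y :: "('a, 'n, 'f) module_scheme" and l :: "'b \<Rightarrow> 'm \<Rightarrow> 'n" and B :: "'b set"
  assumes X: "module R X" and Y: "module R Y" and l: "\<And>b. b \<in> B \<Longrightarrow> linear_map R X Y (l b)"
begin

interpretation X: module R X by fact
interpretation Y: module R Y by fact

lemma sum_extension_superset:
  assumes u: "u \<in> carrier (sum_module X B)" and "finite S" "{b. u b \<noteq> \<zero>\<^bsub>X\<^esub>} \<subseteq> S" "S \<subseteq> B"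
  shows "sum_extension X Y l u = (\<Oplus>\<^bsub>Y\<^esub> b \<in> S. l b (u b))"
  unfolding sum_extension_def
proof (rule Y.M.add.finprod_mono_neutral_cong_left)
  show "l b (u b) = \<zero>\<^bsub>Y\<^esub>" if "b \<in> S - {b. u b \<noteq> \<zero>\<^bsub>X\<^esub>}" for b
  proof -
    have "u b = \<zero>\<^bsub>X\<^esub>" "b \<in> B" using that assms(4) by auto
    then show ?thesis using linear_map_zero[OF X Y l] by simp
  qed
  show "(\<lambda>b. l b (u b)) \<in> S \<rightarrow> carrier Y"
    using linear_map_closed[OF l] u assms(4) by (auto simp: carrier_sum_module)
qed (use assms in auto)

lemma linear_map_sum_extension: "linear_map R (sum_module X B) Y (sum_extension X Y l)"
proof (rule linear_mapI)
  fix u assume u: "u \<in> carrier (sum_module X B)"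
  then have supp: "finite {b. u b \<noteq> \<zero>\<^bsub>X\<^esub>}" "{b. u b \<noteq> \<zero>\<^bsub>X\<^esub>} \<subseteq> B" "\<And>b. u b \<in> carrier X"
    by (auto simp: carrier_sum_module)
  have lu: "l b (u b) \<in> carrier Y" if "b \<in> B" for b using linear_map_closed[OF l[OF that] supp(3)] .
  then show "sum_extension X Y l u \<in> carrier Y"
    unfolding sum_extension_def by (intro Y.M.finsum_closed) (use supp in auto)
  show "sum_extension X Y l (r \<odot>\<^bsub>sum_module X B\<^esub> u) = r \<odot>\<^bsub>Y\<^esub> sum_extension X Y l u"
    if r: "r \<in> carrier R" for r
  proof -
    interpret S: module R "sum_module X B" by (rule X.module_sum_module)
    have ru: "(\<lambda>b. r \<odot>\<^bsub>X\<^esub> u b) \<in> carrier (sum_module X B)" using S.smult_closed[OF r u] by simp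
    have "{b. r \<odot>\<^bsub>X\<^esub> u b \<noteq> \<zero>\<^bsub>X\<^esub>} \<subseteq> {b. u b \<noteq> \<zero>\<^bsub>X\<^esub>}" using r by auto
    then have "sum_extension X Y l (\<lambda>b. r \<odot>\<^bsub>X\<^esub> u b) = (\<Oplus>\<^bsub>Y\<^esub> b \<in> {b. u b \<noteq> \<zero>\<^bsub>X\<^esub>}. l b (r \<odot>\<^bsub>X\<^esub> u b))"
      by (rule sum_extension_superset[OF ru supp(1) _ supp(2)])
    also have "\<dots> = (\<Oplus>\<^bsub>Y\<^esub> b \<in> {b. u b \<noteq> \<zero>\<^bsub>X\<^esub>}. r \<odot>\<^bsub>Y\<^esub> l b (u b))"
      by (rule Y.M.finsum_cong') (use supp lu r linear_map_smult[OF l] in \<open>auto simp: subset_iff\<close>)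
    also have "\<dots> = r \<odot>\<^bsub>Y\<^esub> sum_extension X Y l u"
      unfolding sum_extension_def
      by (rule Y.finsum_smult_ldistr[symmetric]) (use supp lu r in auto)
    finally show ?thesis by simp
  qed
  fix v assume v: "v \<in> carrier (sum_module X B)"
  then have suppv: "finite {b. v b \<noteq> \<zero>\<^bsub>X\<^esub>}" "{b. v b \<noteq> \<zero>\<^bsub>X\<^esub>} \<subseteq> B" "\<And>b. v b \<in> carrier X"
    by (auto simp: carrier_sum_module)
  have lv: "l b (v b) \<in> carrier Y" if "b \<in> B" for b using linear_map_closed[OF l[OF that] suppv(3)] .
  let ?S = "{b. u b \<noteq> \<zero>\<^bsub>X\<^esub>} \<union> {b. v b \<noteq> \<zero>\<^bsub>X\<^esub>}"
  have S: "finite ?S" "?S \<subseteq> B" using supp suppv by auto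
  interpret S: module R "sum_module X B" by (rule X.module_sum_module)
  have uv: "(\<lambda>b. u b \<oplus>\<^bsub>X\<^esub> v b) \<in> carrier (sum_module X B)" using S.M.a_closed[OF u v] by simp
  have "sum_extension X Y l (\<lambda>b. u b \<oplus>\<^bsub>X\<^esub> v b) = (\<Oplus>\<^bsub>Y\<^esub> b \<in> ?S. l b (u b \<oplus>\<^bsub>X\<^esub> v b))"
    by (rule sum_extension_superset[OF uv S(1) _ S(2)]) auto
  also have "\<dots> = (\<Oplus>\<^bsub>Y\<^esub> b \<in> ?S. l b (u b) \<oplus>\<^bsub>Y\<^esub> l b (v b))"
    by (rule Y.M.finsum_cong') (use S lu lv supp suppv linear_map_add[OF l] in \<open>auto simp: subset_iff\<close>)
  also have "\<dots> = (\<Oplus>\<^bsub>Y\<^esub> b \<in> ?S. l b (u b)) \<oplus>\<^bsub>Y\<^esub> (\<Oplus>\<^bsub>Y\<^esub> b \<in> ?S. l b (v b))"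
    by (rule Y.M.finsum_addf) (use S lu lv in auto)
  also have "(\<Oplus>\<^bsub>Y\<^esub> b \<in> ?S. l b (u b)) = sum_extension X Y l u"
    by (rule sum_extension_superset[symmetric, OF u S(1) _ S(2)]) auto
  also have "(\<Oplus>\<^bsub>Y\<^esub> b \<in> ?S. l b (v b)) = sum_extension X Y l v"
    by (rule sum_extension_superset[symmetric, OF v S(1) _ S(2)]) auto
  finally show "sum_extension X Y l (u \<oplus>\<^bsub>sum_module X B\<^esub> v) = sum_extension X Y l u \<oplus>\<^bsub>Y\<^esub> sum_extension X Y l v"
    by simp
qed

lemma sum_extension_single:
  assumes b: "b \<in> B" and x: "x \<in> carrier X"
  shows "sum_extension X Y l (sum_single X b x) = l b x"
proof -
  have "sum_extension X Y l (sum_single X b x) = (\<Oplus>\<^bsub>Y\<^esub> c \<in> {b}. l c (sum_single X b x c))"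
    by (rule sum_extension_superset[OF X.sum_single_closed[OF b x]]) (use b in \<open>auto simp: sum_single_def\<close>)
  also have "\<dots> = l b x" using linear_map_closed[OF l[OF b] x] by (simp add: sum_single_def)
  finally show ?thesis .
qed

end

text \<open>The coordinates of z \<otimes> x, when the tensor product of a free module with X is
  identified with a direct sum of copies of X.\<close>

definition scale_vector :: "('a, 'm, 'e) module_scheme \<Rightarrow> ('b \<Rightarrow> 'a) \<Rightarrow> 'm \<Rightarrow> 'b \<Rightarrow> 'm" where
  "scale_vector X z x = (\<lambda>b. z b \<odot>\<^bsub>X\<^esub> x)"

text \<open>The coordinate form of f \<otimes> id. As with \<open>free_extension\<close>, the target
  is taken over \<open>UNIV\<close>, so the value does not refer to a target basis.\<close>

definition pushforward :: "('a, 'm, 'e) module_scheme \<Rightarrow> ('b \<Rightarrow> 'c \<Rightarrow> 'a) \<Rightarrow> ('b \<Rightarrow> 'm) \<Rightarrow> 'c \<Rightarrow> 'm" where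
  "pushforward X f = sum_extension X (sum_module X UNIV) (\<lambda>b. scale_vector X (f b))"

context module
begin

lemma scale_vector_closed:
  assumes "z \<in> carrier (free_module R B)" "x \<in> carrier M"
  shows "scale_vector M z x \<in> carrier (sum_module M B)"
proof -
  have "{b. z b \<odot>\<^bsub>M\<^esub> x \<noteq> \<zero>\<^bsub>M\<^esub>} \<subseteq> {b. z b \<noteq> \<zero>\<^bsub>R\<^esub>}" using assms(2) by auto
  then have "finite {b. z b \<odot>\<^bsub>M\<^esub> x \<noteq> \<zero>\<^bsub>M\<^esub>}"
    by (rule finite_subset) (use assms in \<open>simp add: carrier_free_module\<close>)
  then show ?thesis using assms by (auto simp: carrier_sum_module carrier_free_module scale_vector_def)
qed

lemma linear_map_scale_vector:
  assumes "z \<in> carrier (free_module R B)"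
  shows "linear_map R M (sum_module M B) (scale_vector M z)"
  by (rule linear_mapI)
     (use assms scale_vector_closed[OF assms] in \<open>auto simp: scale_vector_def fun_eq_iff carrier_free_module smult_r_distr
       smult_assoc1[symmetric] R.m_comm\<close>)

lemma linear_map_scale_vector_left:
  assumes "x \<in> carrier M"
  shows "linear_map R (free_module R B) (sum_module M B) (\<lambda>z. scale_vector M z x)"
  by (rule linear_mapI)
     (use assms scale_vector_closed[OF _ assms] in \<open>auto simp: scale_vector_def fun_eq_iff carrier_free_module smult_l_distr
       smult_assoc1\<close>)

lemma scale_vector_gen: "x \<in> carrier M \<Longrightarrow> scale_vector M (free_gen R b) x = sum_single M b x"
  by (auto simp: scale_vector_def free_gen_def sum_single_def)

lemma carrier_sum_submodule_UNIV: "submodule (carrier (sum_module M C)) R (sum_module M UNIV)"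
proof -
  interpret C: module R "sum_module M C" by (rule module_sum_module)
  interpret U: module R "sum_module M UNIV" by (rule module_sum_module)
  show ?thesis
    by (rule U.submoduleI')
       (use C.M.zero_closed C.M.a_closed C.smult_closed in \<open>auto simp: sum_module_mono[of C UNIV]\<close>)
qed

context
  fixes f :: "'x \<Rightarrow> 'y \<Rightarrow> 'a" and B C
  assumes f: "f \<in> B \<rightarrow> carrier (free_module R C)"
begin

lemma scale_vector_linear_UNIV: "b \<in> B \<Longrightarrow> linear_map R M (sum_module M UNIV) (scale_vector M (f b))"
  using linear_map_scale_vector[of "f b" UNIV] f by (auto simp: Pi_iff carrier_free_module)

lemma pushforward_single:
  "b \<in> B \<Longrightarrow> x \<in> carrier M \<Longrightarrow> pushforward M f (sum_single M b x) = scale_vector M (f b) x"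
  unfolding pushforward_def
  by (rule sum_extension_single[OF module_axioms module_sum_module scale_vector_linear_UNIV])

text \<open>Linearity comes from the sum over \<open>UNIV\<close>. The elements supported in C form
  a submodule there, so it suffices to see that single summands are mapped into it.\<close>

lemma linear_map_pushforward: "linear_map R (sum_module M B) (sum_module M C) (pushforward M f)"
proof -
  have lin: "linear_map R (sum_module M B) (sum_module M UNIV) (pushforward M f)"
    unfolding pushforward_def
    by (rule linear_map_sum_extension[OF module_axioms module_sum_module scale_vector_linear_UNIV])
  have "submodule {u \<in> carrier (sum_module M B). pushforward M f u \<in> carrier (sum_module M C)} R (sum_module M B)"
    by (rule submodule_vimage[OF module_sum_module module_sum_module lin carrier_sum_submodule_UNIV])
  then have "carrier (sum_module M B) \<subseteq> {u \<in> carrier (sum_module M B). pushforward M f u \<in> carrier (sum_module M C)}"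
    by (rule sum_module_submodule_eq)
       (use f scale_vector_closed pushforward_single in \<open>auto simp: Pi_iff intro: sum_single_closed\<close>)
  then show ?thesis using lin by (auto simp: linear_map_def)
qed

lemma pushforward_scale:
  assumes z: "z \<in> carrier (free_module R B)" and x: "x \<in> carrier M"
  shows "pushforward M f (scale_vector M z x) = scale_vector M (free_extension R f z) x"
  by (rule free_module_linear_eq[OF module_sum_module
        linear_map_comp[OF linear_map_scale_vector_left[OF x] linear_map_pushforward]
        linear_map_comp[OF linear_map_free_extension[OF R.is_cring f] linear_map_scale_vector_left[OF x]] _ z])
     (simp add: scale_vector_gen[OF x] pushforward_single[OF _ x] free_extension_gen[OF R.is_cring f])

end

lemma pushforward_comp:
  assumes f: "f \<in> B \<rightarrow> carrier (free_module R C)" and g: "g \<in> C \<rightarrow> carrier (free_module R E)"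
    and u: "u \<in> carrier (sum_module M B)"
  shows "pushforward M g (pushforward M f u) = pushforward M (\<lambda>b. free_extension R g (f b)) u"
proof -
  have gf: "(\<lambda>b. free_extension R g (f b)) \<in> B \<rightarrow> carrier (free_module R E)"
    using linear_map_closed[OF linear_map_free_extension[OF R.is_cring g]] f by (auto simp: Pi_iff)
  show ?thesis
  proof (rule sum_module_linear_eq[OF module_sum_module
        linear_map_comp[OF linear_map_pushforward[OF f] linear_map_pushforward[OF g]] linear_map_pushforward[OF gf] _ u])
    fix b x assume bx: "b \<in> B" "x \<in> carrier M"
    have "f b \<in> carrier (free_module R C)" using f bx by blast
    then show "pushforward M g (pushforward M f (sum_single M b x)) =
        pushforward M (\<lambda>b. free_extension R g (f b)) (sum_single M b x)"
      unfolding pushforward_single[OF f bx] pushforward_single[OF gf bx] by (rule pushforward_scale[OF g _ bx(2)])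
  qed
qed

lemma pushforward_cong:
  assumes f: "f \<in> B \<rightarrow> carrier (free_module R C)" and "\<And>b. b \<in> B \<Longrightarrow> f b = g b"
    and u: "u \<in> carrier (sum_module M B)"
  shows "pushforward M f u = pushforward M g u"
proof -
  have g: "g \<in> B \<rightarrow> carrier (free_module R C)" using assms(1,2) by (auto simp: Pi_iff)
  show ?thesis
    by (rule sum_module_linear_eq[OF module_sum_module linear_map_pushforward[OF f] linear_map_pushforward[OF g] _ u])
       (simp add: pushforward_single[OF f] pushforward_single[OF g] assms(2))
qed

end

text \<open>The associated primes of the cohomology of Hom(F, X), with L, B, C the bases in degrees
  i - 1, i, i + 1 and a cochain recorded by its values on the basis. The formula makes sense for
  infinite and for finite bases alike.\<close>

definition ext_primes where
  "ext_primes R X L B C d = {P. primeideal P R \<and> (\<exists>f\<in>B \<rightarrow> carrier X.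
     (\<forall>c\<in>C. linear_extension R X f (d c) = \<zero>\<^bsub>X\<^esub>) \<and>
     P = {r \<in> carrier R. \<exists>h\<in>L \<rightarrow> carrier X. \<forall>b\<in>B. r \<odot>\<^bsub>X\<^esub> f b = linear_extension R X h (d b)})}"

text \<open>The counterpart for F \<otimes> X in coordinates, with B and C the bases in degrees i
  and i + 1.\<close>

definition tor_primes where
  "tor_primes R X B C d = {P. primeideal P R \<and> (\<exists>u\<in>carrier (sum_module X B).
     pushforward X d u = (\<lambda>_. \<zero>\<^bsub>X\<^esub>) \<and>
     P = {r \<in> carrier R. \<exists>v\<in>carrier (sum_module X C). (\<lambda>b. r \<odot>\<^bsub>X\<^esub> u b) = pushforward X d v})}"

text \<open>A deformation retraction of the free complex with bases B onto the subcomplex with bases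
  S. The coefficient module is absent from the data, so one contraction compares Ext and Tor for all
  coefficients.\<close>

locale contraction = cring R for R :: "('a, 'r) ring_scheme" (structure) +
  fixes B S :: "nat \<Rightarrow> 'g set" and d :: "'g \<Rightarrow> 'g \<Rightarrow> 'a" and h p :: "nat \<Rightarrow> 'g \<Rightarrow> 'g \<Rightarrow> 'a"
  assumes SB: "S n \<subseteq> B n"
    and d: "d \<in> B n \<rightarrow> carrier (free_module R (lower B n))"
    and dS: "d \<in> S n \<rightarrow> carrier (free_module R (lower S n))"
    and dd: "b \<in> B n \<Longrightarrow> free_extension R d (d b) = (\<lambda>_. \<zero>)"
    and h: "h n \<in> lower B n \<rightarrow> carrier (free_module R (B n))"
    and hS: "b \<in> lower S n \<Longrightarrow> h n b = (\<lambda>_. \<zero>)"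
    and p: "p n \<in> B n \<rightarrow> carrier (free_module R (S n))"
    and homotopy: "b \<in> B n \<Longrightarrow> free_gen R b = p n b \<oplus>\<^bsub>free_module R (B n)\<^esub>
      (free_extension R d (h (Suc n) b) \<oplus>\<^bsub>free_module R (B n)\<^esub> free_extension R (h n) (d b))"
begin

abbreviation (input) "Fr \<equiv> free_module R"
abbreviation (input) "lift \<equiv> free_extension R"

lemma cr: "cring R" ..

lemma module_F: "module R (Fr A)" by (rule module_free_module[OF cr])

lemma FSB: "z \<in> carrier (Fr (S n)) \<Longrightarrow> z \<in> carrier (Fr (B n))"
  using linear_map_closed[OF linear_map_free_inclusion[OF SB]] .

lemma d_Suc: "d \<in> B (Suc n) \<rightarrow> carrier (Fr (B n))" using d[of "Suc n"] unfolding lower_simps .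
lemma dS_Suc: "d \<in> S (Suc n) \<rightarrow> carrier (Fr (S n))" using dS[of "Suc n"] unfolding lower_simps .
lemma h_Suc: "h (Suc n) \<in> B n \<rightarrow> carrier (Fr (B (Suc n)))" using h[of "Suc n"] unfolding lower_simps .
lemma pB: "p n \<in> B n \<rightarrow> carrier (Fr (B n))" using p FSB by blast

definition pl :: "nat \<Rightarrow> 'g \<Rightarrow> 'g \<Rightarrow> 'a" where
  "pl n = (case n of 0 \<Rightarrow> (\<lambda>_ _. \<zero>) | Suc k \<Rightarrow> p k)"

lemma pl: "pl n \<in> lower B n \<rightarrow> carrier (Fr (lower S n))"
  using p by (cases n) (auto simp: pl_def)

lemma ext_zero: "f \<in> A \<rightarrow> carrier (Fr C) \<Longrightarrow> lift f (\<lambda>_. \<zero>) = (\<lambda>_. \<zero>)"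
  using linear_map_zero[OF module_F module_F linear_map_free_extension[OF cr], of f A C] by simp

text \<open>Apply d to the homotopy formula at c, and apply the homotopy formula to d c. Both
  results express d c with the same term d h d c, which cancels.\<close>

lemma p_chain_Suc:
  assumes c: "c \<in> B (Suc n)"
  shows "lift (p n) (d c) = lift d (p (Suc n) c)"
proof -
  interpret Fn: module R "Fr (B n)" by (rule module_F)
  interpret Fs: module R "Fr (B (Suc n))" by (rule module_F)
  note ld = linear_map_free_extension[OF cr d_Suc, of n]
  have x: "d c \<in> carrier (Fr (B n))" using d_Suc c by blast
  have pc: "p (Suc n) c \<in> carrier (Fr (B (Suc n)))" using pB c by blast
  have hc: "h (Suc (Suc n)) c \<in> carrier (Fr (B (Suc (Suc n))))" using h_Suc c by blast
  have hx: "lift (h (Suc n)) (d c) \<in> carrier (Fr (B (Suc n)))"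
    by (rule linear_map_closed[OF linear_map_free_extension[OF cr h_Suc] x])
  have dhc: "lift d (h (Suc (Suc n)) c) \<in> carrier (Fr (B (Suc n)))"
    by (rule linear_map_closed[OF linear_map_free_extension[OF cr d_Suc] hc])
  have px: "lift (p n) (d c) \<in> carrier (Fr (B n))"
    by (rule linear_map_closed[OF linear_map_free_extension[OF cr pB] x])
  have dpc: "lift d (p (Suc n) c) \<in> carrier (Fr (B n))" and dhx: "lift d (lift (h (Suc n)) (d c)) \<in> carrier (Fr (B n))"
    by (rule linear_map_closed[OF ld pc], rule linear_map_closed[OF ld hx])
  have ddh: "lift d (lift d (h (Suc (Suc n)) c)) = \<zero>\<^bsub>Fr (B n)\<^esub>"
  proof -
    have "lift d (lift d (h (Suc (Suc n)) c)) = lift (\<lambda>b. lift d (d b)) (h (Suc (Suc n)) c)"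
      by (rule free_extension_comp[OF cr d_Suc d_Suc hc])
    also have "\<dots> = \<zero>\<^bsub>Fr UNIV\<^esub>" unfolding free_extension_def[of R "\<lambda>b. lift d (d b)"]
      by (rule linear_extension_zero[OF module_F hc]) (use dd in simp)
    finally show ?thesis by simp
  qed
  have "d c = lift d (free_gen R c)" using free_extension_gen[OF cr d_Suc c] by simp
  also have "\<dots> = lift d (p (Suc n) c) \<oplus>\<^bsub>Fr (B n)\<^esub> (lift d (lift d (h (Suc (Suc n)) c)) \<oplus>\<^bsub>Fr (B n)\<^esub> lift d (lift (h (Suc n)) (d c)))"
    unfolding homotopy[OF c] linear_map_add[OF ld pc Fs.M.a_closed[OF dhc hx]] linear_map_add[OF ld dhc hx] ..
  also have "\<dots> = lift d (p (Suc n) c) \<oplus>\<^bsub>Fr (B n)\<^esub> lift d (lift (h (Suc n)) (d c))"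
    unfolding ddh Fn.M.l_zero[OF dhx] ..
  finally have 1: "d c = lift d (p (Suc n) c) \<oplus>\<^bsub>Fr (B n)\<^esub> lift d (lift (h (Suc n)) (d c))" .
  have "lift (h n) (lift d (d c)) = \<zero>\<^bsub>Fr (B n)\<^esub>"
    unfolding dd[OF c] using ext_zero[OF h] by simp
  moreover have "d c = lift (p n) (d c) \<oplus>\<^bsub>Fr (B n)\<^esub> (lift d (lift (h (Suc n)) (d c)) \<oplus>\<^bsub>Fr (B n)\<^esub> lift (h n) (lift d (d c)))"
    by (rule contraction_identity[OF cr d d_Suc pB h_Suc h _ x]) (use homotopy in blast)
  ultimately have 2: "d c = lift (p n) (d c) \<oplus>\<^bsub>Fr (B n)\<^esub> lift d (lift (h (Suc n)) (d c))"
    using Fn.M.r_zero[OF dhx] by metis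
  show ?thesis
    by (rule iffD1[OF Fn.M.add.right_cancel[OF dhx px dpc] trans[OF 2[symmetric] 1]])
qed

lemma F_empty: "z \<in> carrier (Fr {}) \<Longrightarrow> z = (\<lambda>_. \<zero>)"
  by (auto simp: carrier_free_module)

lemma p_chain:
  assumes b: "b \<in> B n"
  shows "lift (pl n) (d b) = lift d (p n b)"
proof (cases n)
  case 0
  have "d b \<in> carrier (Fr {})" using d[of n] b 0 by auto
  then have "d b = (\<lambda>_. \<zero>)" by (rule F_empty)
  moreover have "p n b \<in> carrier (Fr (S n))" using p b by blast
  then have "lift d (p n b) \<in> carrier (Fr {})"
    using linear_map_closed[OF linear_map_free_extension[OF cr dS], of "p n b" n] 0 by simp
  then have "lift d (p n b) = (\<lambda>_. \<zero>)" by (rule F_empty)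
  ultimately show ?thesis using ext_zero[OF pl] by simp
next
  case (Suc k)
  then show ?thesis using p_chain_Suc[of b k] b by (simp add: pl_def)
qed

text \<open>On S both homotopy terms vanish: h is zero on S, and d keeps the subcomplex inside
  itself.\<close>

lemma p_S:
  assumes b: "b \<in> S n"
  shows "p n b = free_gen R b"
proof -
  interpret Fn: module R "Fr (B n)" by (rule module_F)
  have bB: "b \<in> B n" using b SB by blast
  have db: "d b \<in> carrier (Fr (lower S n))" using dS b by blast
  have pb: "p n b \<in> carrier (Fr (B n))" using pB bB by blast
  have "lift (h n) (d b) = \<zero>\<^bsub>Fr UNIV\<^esub>"
    unfolding free_extension_def by (rule linear_extension_zero[OF module_F db]) (use hS in simp)
  moreover have "h (Suc n) b = (\<lambda>_. \<zero>)" using hS[of b "Suc n"] b by simp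
  then have "lift d (h (Suc n) b) = (\<lambda>_. \<zero>)" using ext_zero[OF d] by simp
  ultimately have "free_gen R b = p n b \<oplus>\<^bsub>Fr (B n)\<^esub> (\<zero>\<^bsub>Fr (B n)\<^esub> \<oplus>\<^bsub>Fr (B n)\<^esub> \<zero>\<^bsub>Fr (B n)\<^esub>)"
    using homotopy[OF bB] by simp
  then show ?thesis using Fn.M.r_zero[OF pb] Fn.M.r_zero[OF Fn.M.zero_closed] by metis
qed

section \<open>Comparison of cochains on the two complexes\<close>

context
  fixes X :: "('a, 'm, 'e) module_scheme" and i :: nat
  assumes X: "module R X"
begin

interpretation X: module R X by fact

text \<open>Evaluate f on the homotopy formula. The term f d h vanishes as f is a cocycle, and f p =
  g d p = g p d because p is a chain map. So the primitive of f is g p + f h, with \<open>pl\<close>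
  as p one degree down.\<close>

lemma coboundary_extend:
  assumes f: "f \<in> B i \<rightarrow> carrier X" and cocycle: "\<And>c. c \<in> B (Suc i) \<Longrightarrow> linear_extension R X f (d c) = \<zero>\<^bsub>X\<^esub>"
    and g: "g \<in> lower S i \<rightarrow> carrier X" and fg: "\<And>b. b \<in> S i \<Longrightarrow> f b = linear_extension R X g (d b)"
  shows "\<exists>g'\<in>lower B i \<rightarrow> carrier X. \<forall>b\<in>B i. f b = linear_extension R X g' (d b)"
proof (intro bexI ballI)
  let ?E = "linear_extension R X"
  let ?g1 = "\<lambda>l. ?E g (pl i l)" and ?g2 = "\<lambda>l. ?E f (h i l)"
  have g1: "?g1 \<in> lower B i \<rightarrow> carrier X"
    using linear_extension_closed'[OF X g] pl by (auto simp: Pi_iff)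
  have g2: "?g2 \<in> lower B i \<rightarrow> carrier X"
    using linear_extension_closed'[OF X f] h by (auto simp: Pi_iff)
  show "(\<lambda>l. ?g1 l \<oplus>\<^bsub>X\<^esub> ?g2 l) \<in> lower B i \<rightarrow> carrier X" using g1 g2 by (auto simp: Pi_iff)
  fix b assume b: "b \<in> B i"
  note lin = linear_map_linear_extension[OF X f]
  have db: "d b \<in> carrier (Fr (lower B i))" using d b by blast
  have pb: "p i b \<in> carrier (Fr (S i))" using p b by blast
  have hb: "h (Suc i) b \<in> carrier (Fr (B (Suc i)))" using h_Suc b by blast
  have hdb: "lift (h i) (d b) \<in> carrier (Fr (B i))"
    by (rule linear_map_closed[OF linear_map_free_extension[OF cr h] db])
  have dhb: "lift d (h (Suc i) b) \<in> carrier (Fr (B i))"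
    by (rule linear_map_closed[OF linear_map_free_extension[OF cr d_Suc] hb])
  interpret Fi: module R "Fr (B i)" by (rule module_F)
  have fb: "f b = ?E f (free_gen R b)" using linear_extension_gen[OF X b f] by simp
  have 0: "?E f (free_gen R b) = ?E f (p i b) \<oplus>\<^bsub>X\<^esub> (?E f (lift d (h (Suc i) b)) \<oplus>\<^bsub>X\<^esub> ?E f (lift (h i) (d b)))"
    unfolding homotopy[OF b] linear_map_add[OF lin FSB[OF pb] Fi.M.a_closed[OF dhb hdb]]
      linear_map_add[OF lin dhb hdb] ..
  have fS: "f \<in> S i \<rightarrow> carrier X" using f SB by blast
  have "?E f (p i b) = ?E (\<lambda>b. ?E g (d b)) (p i b)"
    by (rule linear_extension_cong[OF X pb _ fS]) (rule fg)
  also have "\<dots> = ?E g (lift d (p i b))" by (rule linear_extension_free_extension[OF X dS g pb, symmetric])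
  also have "\<dots> = ?E g (lift (pl i) (d b))" unfolding p_chain[OF b] ..
  also have "\<dots> = ?E ?g1 (d b)" by (rule linear_extension_free_extension[OF X pl g db])
  finally have 1: "?E f (p i b) = ?E ?g1 (d b)" .
  have "?E f (lift d (h (Suc i) b)) = ?E (\<lambda>c. ?E f (d c)) (h (Suc i) b)"
    by (rule linear_extension_free_extension[OF X d_Suc f hb])
  also have "\<dots> = \<zero>\<^bsub>X\<^esub>" by (rule linear_extension_zero[OF X hb cocycle])
  finally have 2: "?E f (lift d (h (Suc i) b)) = \<zero>\<^bsub>X\<^esub>" .
  have 3: "?E f (lift (h i) (d b)) = ?E ?g2 (d b)"
    by (rule linear_extension_free_extension[OF X h f db])
  have "f b = ?E ?g1 (d b) \<oplus>\<^bsub>X\<^esub> (\<zero>\<^bsub>X\<^esub> \<oplus>\<^bsub>X\<^esub> ?E ?g2 (d b))"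
    unfolding fb 0 1 2 3 ..
  also have "\<dots> = ?E ?g1 (d b) \<oplus>\<^bsub>X\<^esub> ?E ?g2 (d b)"
    using X.M.l_zero[OF linear_extension_closed'[OF X g2 db]] by simp
  also have "\<dots> = ?E (\<lambda>l. ?g1 l \<oplus>\<^bsub>X\<^esub> ?g2 l) (d b)"
    by (rule linear_extension_plus_fun[OF X g1 g2 db, symmetric])
  finally show "f b = ?E (\<lambda>l. ?g1 l \<oplus>\<^bsub>X\<^esub> ?g2 l) (d b)" .
qed

text \<open>Composition with the chain map p carries cocycles of the subcomplex to cocycles of the
  large complex.\<close>

lemma cocycle_extend:
  assumes g: "g \<in> S i \<rightarrow> carrier X" and cocycle: "\<And>c. c \<in> S (Suc i) \<Longrightarrow> linear_extension R X g (d c) = \<zero>\<^bsub>X\<^esub>"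
    and c: "c \<in> B (Suc i)"
  shows "linear_extension R X (\<lambda>b. linear_extension R X g (p i b)) (d c) = \<zero>\<^bsub>X\<^esub>"
proof -
  have dc: "d c \<in> carrier (Fr (B i))" using d_Suc c by blast
  have pc: "p (Suc i) c \<in> carrier (Fr (S (Suc i)))" using p c by blast
  have "linear_extension R X (\<lambda>b. linear_extension R X g (p i b)) (d c) = linear_extension R X g (lift (p i) (d c))"
    by (rule linear_extension_free_extension[OF X p g dc, symmetric])
  also have "\<dots> = linear_extension R X g (lift d (p (Suc i) c))" unfolding p_chain_Suc[OF c] ..
  also have "\<dots> = linear_extension R X (\<lambda>c. linear_extension R X g (d c)) (p (Suc i) c)"
    by (rule linear_extension_free_extension[OF X dS_Suc g pc])
  also have "\<dots> = \<zero>\<^bsub>X\<^esub>" by (rule linear_extension_zero[OF X pc cocycle])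
  finally show ?thesis .
qed

lemma coboundary_iff:
  assumes f: "f \<in> B i \<rightarrow> carrier X" and cocycle: "\<And>c. c \<in> B (Suc i) \<Longrightarrow> linear_extension R X f (d c) = \<zero>\<^bsub>X\<^esub>"
    and r: "r \<in> carrier R"
  shows "(\<exists>h\<in>lower B i \<rightarrow> carrier X. \<forall>b\<in>B i. r \<odot>\<^bsub>X\<^esub> f b = linear_extension R X h (d b)) \<longleftrightarrow>
    (\<exists>h\<in>lower S i \<rightarrow> carrier X. \<forall>b\<in>S i. r \<odot>\<^bsub>X\<^esub> f b = linear_extension R X h (d b))" (is "?L \<longleftrightarrow> ?R")
proof
  assume ?L
  then obtain k where k: "k \<in> lower B i \<rightarrow> carrier X" "\<forall>b\<in>B i. r \<odot>\<^bsub>X\<^esub> f b = linear_extension R X k (d b)" by blast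
  have "lower S i \<subseteq> lower B i" using SB by (cases i) auto
  then have "k \<in> lower S i \<rightarrow> carrier X" "\<forall>b\<in>S i. r \<odot>\<^bsub>X\<^esub> f b = linear_extension R X k (d b)"
    using k SB by blast+
  then show ?R by blast
next
  assume ?R
  then obtain k where k: "k \<in> lower S i \<rightarrow> carrier X" "\<And>b. b \<in> S i \<Longrightarrow> r \<odot>\<^bsub>X\<^esub> f b = linear_extension R X k (d b)" by blast
  have rf: "(\<lambda>b. r \<odot>\<^bsub>X\<^esub> f b) \<in> B i \<rightarrow> carrier X" using f r by (auto simp: Pi_iff)
  have "linear_extension R X (\<lambda>b. r \<odot>\<^bsub>X\<^esub> f b) (d c) = \<zero>\<^bsub>X\<^esub>" if c: "c \<in> B (Suc i)" for c
  proof -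
    have "d c \<in> carrier (Fr (B i))" using d_Suc c by blast
    then show ?thesis using linear_extension_smult_fun[OF X f r] cocycle[OF c] r by simp
  qed
  from coboundary_extend[OF rf this k] show ?L by blast
qed

text \<open>Cocycles of the large complex are restricted to S; cocycles of the small one are
  composed with p, which does not change them on S. In both directions \<open>coboundary_iff\<close>
  shows that the annihilator is kept.\<close>

lemma ext_primes_contraction:
  "ext_primes R X (lower B i) (B i) (B (Suc i)) d = ext_primes R X (lower S i) (S i) (S (Suc i)) d"
proof (intro equalityI subsetI)
  fix P assume "P \<in> ext_primes R X (lower B i) (B i) (B (Suc i)) d"
  then obtain f where P: "primeideal P R" and f: "f \<in> B i \<rightarrow> carrier X"
    "\<And>c. c \<in> B (Suc i) \<Longrightarrow> linear_extension R X f (d c) = \<zero>\<^bsub>X\<^esub>"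
    and eq: "P = {r \<in> carrier R. \<exists>h\<in>lower B i \<rightarrow> carrier X. \<forall>b\<in>B i. r \<odot>\<^bsub>X\<^esub> f b = linear_extension R X h (d b)}"
    unfolding ext_primes_def by blast
  have "P = {r \<in> carrier R. \<exists>h\<in>lower S i \<rightarrow> carrier X. \<forall>b\<in>S i. r \<odot>\<^bsub>X\<^esub> f b = linear_extension R X h (d b)}"
    unfolding eq by (rule Collect_cong, rule conj_cong[OF refl]) (rule coboundary_iff[OF f])
  moreover have "f \<in> S i \<rightarrow> carrier X" "\<forall>c\<in>S (Suc i). linear_extension R X f (d c) = \<zero>\<^bsub>X\<^esub>"
    using f SB by blast+
  ultimately show "P \<in> ext_primes R X (lower S i) (S i) (S (Suc i)) d"
    unfolding ext_primes_def using P by blast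
next
  fix P assume "P \<in> ext_primes R X (lower S i) (S i) (S (Suc i)) d"
  then obtain g where P: "primeideal P R" and g: "g \<in> S i \<rightarrow> carrier X"
    "\<And>c. c \<in> S (Suc i) \<Longrightarrow> linear_extension R X g (d c) = \<zero>\<^bsub>X\<^esub>"
    and eq: "P = {r \<in> carrier R. \<exists>h\<in>lower S i \<rightarrow> carrier X. \<forall>b\<in>S i. r \<odot>\<^bsub>X\<^esub> g b = linear_extension R X h (d b)}"
    unfolding ext_primes_def by blast
  let ?f = "\<lambda>b. linear_extension R X g (p i b)"
  have f: "?f \<in> B i \<rightarrow> carrier X" using linear_extension_closed'[OF X g(1)] p by (auto simp: Pi_iff)
  note cocycle = cocycle_extend[OF g]
  have fg: "?f b = g b" if "b \<in> S i" for b using p_S[OF that] linear_extension_gen[OF X that g(1)] by simp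
  have "P = {r \<in> carrier R. \<exists>h\<in>lower S i \<rightarrow> carrier X. \<forall>b\<in>S i. r \<odot>\<^bsub>X\<^esub> ?f b = linear_extension R X h (d b)}"
    unfolding eq by (simp add: fg)
  also have "\<dots> = {r \<in> carrier R. \<exists>h\<in>lower B i \<rightarrow> carrier X. \<forall>b\<in>B i. r \<odot>\<^bsub>X\<^esub> ?f b = linear_extension R X h (d b)}"
    by (rule Collect_cong, rule conj_cong[OF refl]) (rule coboundary_iff[OF f cocycle, symmetric])
  finally have "P = {r \<in> carrier R. \<exists>h\<in>lower B i \<rightarrow> carrier X. \<forall>b\<in>B i. r \<odot>\<^bsub>X\<^esub> ?f b = linear_extension R X h (d b)}" .
  moreover have "\<forall>c\<in>B (Suc i). linear_extension R X ?f (d c) = \<zero>\<^bsub>X\<^esub>" using cocycle by blast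
  ultimately show "P \<in> ext_primes R X (lower B i) (B i) (B (Suc i)) d"
    unfolding ext_primes_def using P f by blast
qed

section \<open>Comparison of chains on the two complexes\<close>

lemma sum_module_SB: "u \<in> carrier (sum_module X (S n)) \<Longrightarrow> u \<in> carrier (sum_module X (B n))"
  by (rule sum_module_mono[OF SB])

lemma pushforward_p_S:
  assumes u: "u \<in> carrier (sum_module X (S n))"
  shows "pushforward X (p n) u = u"
proof (rule X.sum_module_linear_eq[OF X.module_sum_module X.linear_map_pushforward linear_map_id _ u])
  show "p n \<in> S n \<rightarrow> carrier (Fr (S n))" using p SB by blast
  fix b x assume bx: "b \<in> S n" "x \<in> carrier X"
  then have "b \<in> B n" using SB by blast
  then show "pushforward X (p n) (sum_single X b x) = sum_single X b x"
    using X.pushforward_single[OF p _ bx(2)] p_S[OF bx(1)] X.scale_vector_gen[OF bx(2)] by simp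
qed

lemma pushforward_p_d:
  assumes v: "v \<in> carrier (sum_module X (B (Suc n)))"
  shows "pushforward X (p n) (pushforward X d v) = pushforward X d (pushforward X (p (Suc n)) v)"
proof -
  have pd: "(\<lambda>c. lift (p n) (d c)) \<in> B (Suc n) \<rightarrow> carrier (Fr (S n))"
    using linear_map_closed[OF linear_map_free_extension[OF cr p]] d_Suc by (auto simp: Pi_iff)
  have "pushforward X (p n) (pushforward X d v) = pushforward X (\<lambda>c. lift (p n) (d c)) v"
    by (rule X.pushforward_comp[OF d_Suc p v])
  also have "\<dots> = pushforward X (\<lambda>c. lift d (p (Suc n) c)) v"
    by (rule X.pushforward_cong[OF pd p_chain_Suc v])
  also have "\<dots> = pushforward X d (pushforward X (p (Suc n)) v)"
    by (rule X.pushforward_comp[OF p dS_Suc v, symmetric])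
  finally show ?thesis .
qed

lemma pushforward_pl_d:
  assumes u: "u \<in> carrier (sum_module X (B n))"
  shows "pushforward X (pl n) (pushforward X d u) = pushforward X d (pushforward X (p n) u)"
proof -
  have pd: "(\<lambda>c. lift (pl n) (d c)) \<in> B n \<rightarrow> carrier (Fr (lower S n))"
    using linear_map_closed[OF linear_map_free_extension[OF cr pl]] d by (auto simp: Pi_iff)
  have "pushforward X (pl n) (pushforward X d u) = pushforward X (\<lambda>c. lift (pl n) (d c)) u"
    by (rule X.pushforward_comp[OF d pl u])
  also have "\<dots> = pushforward X (\<lambda>c. lift d (p n c)) u"
    by (rule X.pushforward_cong[OF pd p_chain u])
  also have "\<dots> = pushforward X d (pushforward X (p n) u)"
    by (rule X.pushforward_comp[OF p dS u, symmetric])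
  finally show ?thesis .
qed

lemma pushforward_homotopy:
  assumes u: "u \<in> carrier (sum_module X (B n))"
  shows "u = pushforward X (p n) u \<oplus>\<^bsub>sum_module X (B n)\<^esub>
    (pushforward X d (pushforward X (h (Suc n)) u) \<oplus>\<^bsub>sum_module X (B n)\<^esub> pushforward X (h n) (pushforward X d u))"
proof (rule X.sum_module_linear_eq[OF X.module_sum_module linear_map_id _ _ u])
  show "linear_map R (sum_module X (B n)) (sum_module X (B n)) (\<lambda>u. pushforward X (p n) u \<oplus>\<^bsub>sum_module X (B n)\<^esub>
    (pushforward X d (pushforward X (h (Suc n)) u) \<oplus>\<^bsub>sum_module X (B n)\<^esub> pushforward X (h n) (pushforward X d u)))"
    by (intro linear_map_plus[OF X.module_sum_module] X.linear_map_pushforward[OF pB]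
        linear_map_comp[OF X.linear_map_pushforward[OF h_Suc] X.linear_map_pushforward[OF d_Suc]]
        linear_map_comp[OF X.linear_map_pushforward[OF d] X.linear_map_pushforward[OF h]])
  fix b x assume b: "b \<in> B n" and x: "x \<in> carrier X"
  interpret Fn: module R "Fr (B n)" by (rule module_F)
  have db: "d b \<in> carrier (Fr (lower B n))" using d b by blast
  have pb: "p n b \<in> carrier (Fr (B n))" using pB b by blast
  have hb: "h (Suc n) b \<in> carrier (Fr (B (Suc n)))" using h_Suc b by blast
  have hdb: "lift (h n) (d b) \<in> carrier (Fr (B n))"
    by (rule linear_map_closed[OF linear_map_free_extension[OF cr h] db])
  have dhb: "lift d (h (Suc n) b) \<in> carrier (Fr (B n))"
    by (rule linear_map_closed[OF linear_map_free_extension[OF cr d_Suc] hb])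
  note lin = X.linear_map_scale_vector_left[OF x, of "B n"]
  show "sum_single X b x = pushforward X (p n) (sum_single X b x) \<oplus>\<^bsub>sum_module X (B n)\<^esub>
    (pushforward X d (pushforward X (h (Suc n)) (sum_single X b x)) \<oplus>\<^bsub>sum_module X (B n)\<^esub>
      pushforward X (h n) (pushforward X d (sum_single X b x)))"
    unfolding X.pushforward_single[OF pB b x] X.pushforward_single[OF h_Suc b x] X.pushforward_single[OF d b x]
      X.pushforward_scale[OF d_Suc hb x] X.pushforward_scale[OF h db x]
      linear_map_add[OF lin dhb hdb, symmetric] linear_map_add[OF lin pb Fn.M.a_closed[OF dhb hdb], symmetric]
      homotopy[OF b, symmetric] X.scale_vector_gen[OF x] ..
qed

lemma pushforward_zero:
  assumes "f \<in> A \<rightarrow> carrier (Fr C)"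
  shows "pushforward X f (\<lambda>_. \<zero>\<^bsub>X\<^esub>) = (\<lambda>_. \<zero>\<^bsub>X\<^esub>)"
  using linear_map_zero[OF X.module_sum_module X.module_sum_module X.linear_map_pushforward[OF assms]] by simp

text \<open>If u over S equals d v, then u = p u = p d v = d p v, so p v is a preimage over
  S.\<close>

lemma boundary_iff:
  assumes u: "u \<in> carrier (sum_module X (S n))"
  shows "(\<exists>v\<in>carrier (sum_module X (B (Suc n))). u = pushforward X d v) \<longleftrightarrow>
    (\<exists>v\<in>carrier (sum_module X (S (Suc n))). u = pushforward X d v)"
proof
  assume "\<exists>v\<in>carrier (sum_module X (B (Suc n))). u = pushforward X d v"
  then obtain v where v: "v \<in> carrier (sum_module X (B (Suc n)))" "u = pushforward X d v" by blast
  have "u = pushforward X d (pushforward X (p (Suc n)) v)"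
    using pushforward_p_S[OF u] pushforward_p_d[OF v(1)] v(2) by simp
  then show "\<exists>v\<in>carrier (sum_module X (S (Suc n))). u = pushforward X d v"
    using linear_map_closed[OF X.linear_map_pushforward[OF p] v(1)] by blast
qed (use sum_module_SB in blast)

lemma tor_primes_contraction: "tor_primes R X (B i) (B (Suc i)) d = tor_primes R X (S i) (S (Suc i)) d"
proof (intro equalityI subsetI)
  interpret XS: module R "sum_module X (S i)" by (rule X.module_sum_module)
  interpret XB: module R "sum_module X (B i)" by (rule X.module_sum_module)
  fix P assume "P \<in> tor_primes R X (S i) (S (Suc i)) d"
  then obtain u where P: "primeideal P R" and u: "u \<in> carrier (sum_module X (S i))"
    "pushforward X d u = (\<lambda>_. \<zero>\<^bsub>X\<^esub>)"
    and eq: "P = {r \<in> carrier R. \<exists>v\<in>carrier (sum_module X (S (Suc i))). (\<lambda>b. r \<odot>\<^bsub>X\<^esub> u b) = pushforward X d v}"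
    unfolding tor_primes_def by blast
  have ru: "(\<lambda>b. r \<odot>\<^bsub>X\<^esub> u b) \<in> carrier (sum_module X (S i))" if "r \<in> carrier R" for r
    using XS.smult_closed[OF that u(1)] by simp
  have "P = {r \<in> carrier R. \<exists>v\<in>carrier (sum_module X (B (Suc i))). (\<lambda>b. r \<odot>\<^bsub>X\<^esub> u b) = pushforward X d v}"
    unfolding eq by (rule Collect_cong, rule conj_cong[OF refl]) (rule boundary_iff[OF ru, symmetric])
  then show "P \<in> tor_primes R X (B i) (B (Suc i)) d"
    unfolding tor_primes_def using P u(2) sum_module_SB[OF u(1)] by blast
next
  interpret XS: module R "sum_module X (S i)" by (rule X.module_sum_module)
  interpret XB: module R "sum_module X (B i)" by (rule X.module_sum_module)
  fix P assume "P \<in> tor_primes R X (B i) (B (Suc i)) d"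
  then obtain u where P: "primeideal P R" and u: "u \<in> carrier (sum_module X (B i))"
    "pushforward X d u = (\<lambda>_. \<zero>\<^bsub>X\<^esub>)"
    and eq: "P = {r \<in> carrier R. \<exists>v\<in>carrier (sum_module X (B (Suc i))). (\<lambda>b. r \<odot>\<^bsub>X\<^esub> u b) = pushforward X d v}"
    unfolding tor_primes_def by blast
  \<comment> \<open>As u is a cycle, the homotopy formula reads u = p u + d h u. Hence u and ?w
    differ by a boundary and have the same annihilator modulo boundaries.\<close>
  let ?w = "pushforward X (p i) u" and ?t = "pushforward X (h (Suc i)) u"
  note ld = X.linear_map_pushforward[OF d_Suc, of i]
  have w: "?w \<in> carrier (sum_module X (S i))" by (rule linear_map_closed[OF X.linear_map_pushforward[OF p] u(1)])
  have wB: "?w \<in> carrier (sum_module X (B i))" by (rule sum_module_SB[OF w])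
  have t: "?t \<in> carrier (sum_module X (B (Suc i)))"
    by (rule linear_map_closed[OF X.linear_map_pushforward[OF h_Suc] u(1)])
  have dt: "pushforward X d ?t \<in> carrier (sum_module X (B i))" by (rule linear_map_closed[OF ld t])
  have dw: "pushforward X d ?w = (\<lambda>_. \<zero>\<^bsub>X\<^esub>)"
    unfolding pushforward_pl_d[OF u(1), symmetric] u(2) by (rule pushforward_zero[OF pl])
  have "pushforward X (h i) (pushforward X d u) = \<zero>\<^bsub>sum_module X (B i)\<^esub>"
    unfolding u(2) using pushforward_zero[OF h] by simp
  then have u_eq: "u = ?w \<oplus>\<^bsub>sum_module X (B i)\<^esub> pushforward X d ?t"
    using pushforward_homotopy[OF u(1)] XB.M.r_zero[OF dt] by metis
  interpret XC: module R "sum_module X (B (Suc i))" by (rule X.module_sum_module)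
  have bd: "submodule (pushforward X d ` carrier (sum_module X (B (Suc i)))) R (sum_module X (B i))" (is "submodule ?D _ _")
    by (rule submodule_image[OF X.module_sum_module X.module_sum_module ld XC.carrier_is_submodule])
  have iff: "r \<odot>\<^bsub>sum_module X (B i)\<^esub> u \<in> ?D \<longleftrightarrow> r \<odot>\<^bsub>sum_module X (B i)\<^esub> ?w \<in> ?D" if r: "r \<in> carrier R" for r
  proof -
    have "r \<odot>\<^bsub>sum_module X (B i)\<^esub> u =
        r \<odot>\<^bsub>sum_module X (B i)\<^esub> ?w \<oplus>\<^bsub>sum_module X (B i)\<^esub> r \<odot>\<^bsub>sum_module X (B i)\<^esub> pushforward X d ?t"
      using arg_cong[OF u_eq, of "\<lambda>y. r \<odot>\<^bsub>sum_module X (B i)\<^esub> y"] XB.smult_r_distr[OF r wB dt] by (rule trans)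
    moreover have rdt: "r \<odot>\<^bsub>sum_module X (B i)\<^esub> pushforward X d ?t \<in> ?D"
      by (rule XB.submoduleE(4)[OF bd r imageI[OF t]])
    ultimately show ?thesis
      using XB.submodule_add_cancel[OF bd XB.smult_closed[OF r wB] rdt] XB.submoduleE(5)[OF bd _ rdt] by metis
  qed
  have rw: "(\<lambda>b. r \<odot>\<^bsub>X\<^esub> ?w b) \<in> carrier (sum_module X (S i))" if "r \<in> carrier R" for r
    using XS.smult_closed[OF that w] by simp
  have "P = {r \<in> carrier R. \<exists>v\<in>carrier (sum_module X (S (Suc i))). (\<lambda>b. r \<odot>\<^bsub>X\<^esub> ?w b) = pushforward X d v}"
    unfolding eq
  proof (rule Collect_cong, rule conj_cong[OF refl])
    fix r assume r: "r \<in> carrier R"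
    have "(\<exists>v\<in>carrier (sum_module X (B (Suc i))). (\<lambda>b. r \<odot>\<^bsub>X\<^esub> u b) = pushforward X d v) \<longleftrightarrow>
        (\<exists>v\<in>carrier (sum_module X (B (Suc i))). (\<lambda>b. r \<odot>\<^bsub>X\<^esub> ?w b) = pushforward X d v)"
      using iff[OF r] unfolding sum_module_simps image_iff .
    also have "\<dots> \<longleftrightarrow> (\<exists>v\<in>carrier (sum_module X (S (Suc i))). (\<lambda>b. r \<odot>\<^bsub>X\<^esub> ?w b) = pushforward X d v)"
      by (rule boundary_iff[OF rw[OF r]])
    finally show "(\<exists>v\<in>carrier (sum_module X (B (Suc i))). (\<lambda>b. r \<odot>\<^bsub>X\<^esub> u b) = pushforward X d v) \<longleftrightarrow>
        (\<exists>v\<in>carrier (sum_module X (S (Suc i))). (\<lambda>b. r \<odot>\<^bsub>X\<^esub> ?w b) = pushforward X d v)" .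
  qed
  then show "P \<in> tor_primes R X (S i) (S (Suc i)) d"
    unfolding tor_primes_def using P w dw by blast
qed

end

end

section \<open>Ext and Tor in coordinates\<close>

lemma Hom_module_simps:
  "carrier (Hom_module R A X) = {f \<in> carrier A \<rightarrow>\<^sub>E carrier X. linear_map R A X f}"
  "\<zero>\<^bsub>Hom_module R A X\<^esub> = (\<lambda>x \<in> carrier A. \<zero>\<^bsub>X\<^esub>)"
  "f \<oplus>\<^bsub>Hom_module R A X\<^esub> g = (\<lambda>x \<in> carrier A. f x \<oplus>\<^bsub>X\<^esub> g x)"
  "r \<odot>\<^bsub>Hom_module R A X\<^esub> f = (\<lambda>x \<in> carrier A. r \<odot>\<^bsub>X\<^esub> f x)"
  by (auto simp: Hom_module_def linear_map_def PiE_def)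

lemma linear_map_restrict:
  assumes "module R A" "linear_map R A X f"
  shows "restrict f (carrier A) \<in> carrier (Hom_module R A X)"
  using linear_map_cong[OF assms(2) _ assms(1), of "restrict f (carrier A)"] linear_map_closed[OF assms(2)]
  by (auto simp: Hom_module_simps)

lemma Hom_module_eqI:
  assumes "f \<in> carrier (Hom_module R A X)" "g \<in> carrier (Hom_module R A X)"
    and "\<And>x. x \<in> carrier A \<Longrightarrow> f x = g x"
  shows "f = g"
  using assms PiE_ext[of f "carrier A" "\<lambda>_. carrier X" g] by (simp add: Hom_module_simps)

lemma module_Hom_module:
  fixes R (structure)
  assumes A: "module R A" and X: "module R X"
  shows "module R (Hom_module R A X)"
proof -
  interpret A: module R A by fact
  interpret X: module R X by fact
  note [simp] = Hom_module_simps(2-4)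
  have lin: "linear_map R A X f" if "f \<in> carrier (Hom_module R A X)" for f
    using that by (simp add: Hom_module_simps(1))
  note cl = linear_map_closed[OF lin]
  have add: "f \<oplus>\<^bsub>Hom_module R A X\<^esub> g \<in> carrier (Hom_module R A X)"
    if "f \<in> carrier (Hom_module R A X)" "g \<in> carrier (Hom_module R A X)" for f g
    using linear_map_restrict[OF A linear_map_plus[OF X lin[OF that(1)] lin[OF that(2)]]] by simp
  have smult: "r \<odot>\<^bsub>Hom_module R A X\<^esub> f \<in> carrier (Hom_module R A X)"
    if "r \<in> carrier R" "f \<in> carrier (Hom_module R A X)" for r f
    using linear_map_restrict[OF A linear_map_comp[OF lin[OF that(2)] X.linear_map_scale[OF that(1)]]] by simp
  have zero: "\<zero>\<^bsub>Hom_module R A X\<^esub> \<in> carrier (Hom_module R A X)"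
    using linear_map_restrict[OF A, of X "\<lambda>_. \<zero>\<^bsub>X\<^esub>"] by (simp add: linear_map_def)
  show ?thesis
  proof (rule moduleI)
    show "cring R" by (rule A.R.is_cring)
    show "abelian_group (Hom_module R A X)"
    proof (rule abelian_groupI)
      fix f assume f: "f \<in> carrier (Hom_module R A X)"
      let ?g = "(\<ominus> \<one>) \<odot>\<^bsub>Hom_module R A X\<^esub> f"
      have "?g \<in> carrier (Hom_module R A X)" by (rule smult) (use f in auto)
      moreover have "?g \<oplus>\<^bsub>Hom_module R A X\<^esub> f = \<zero>\<^bsub>Hom_module R A X\<^esub>"
        by (rule Hom_module_eqI[OF add zero]) (use f cl calculation X.smult_l_minus[of \<one>] in \<open>auto simp: X.M.l_neg\<close>)
      ultimately show "\<exists>g\<in>carrier (Hom_module R A X). g \<oplus>\<^bsub>Hom_module R A X\<^esub> f = \<zero>\<^bsub>Hom_module R A X\<^esub>" by blast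
      show "\<zero>\<^bsub>Hom_module R A X\<^esub> \<oplus>\<^bsub>Hom_module R A X\<^esub> f = f"
        by (rule Hom_module_eqI[OF add[OF zero f] f]) (use cl f in simp)
      fix g assume g: "g \<in> carrier (Hom_module R A X)"
      show "f \<oplus>\<^bsub>Hom_module R A X\<^esub> g \<in> carrier (Hom_module R A X)" by (rule add[OF f g])
      show "f \<oplus>\<^bsub>Hom_module R A X\<^esub> g = g \<oplus>\<^bsub>Hom_module R A X\<^esub> f"
        by (rule Hom_module_eqI[OF add[OF f g] add[OF g f]]) (use cl f g in \<open>simp add: X.M.a_comm\<close>)
      fix k assume k: "k \<in> carrier (Hom_module R A X)"
      show "(f \<oplus>\<^bsub>Hom_module R A X\<^esub> g) \<oplus>\<^bsub>Hom_module R A X\<^esub> k = f \<oplus>\<^bsub>Hom_module R A X\<^esub> (g \<oplus>\<^bsub>Hom_module R A X\<^esub> k)"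
        by (rule Hom_module_eqI[OF add[OF add[OF f g] k] add[OF f add[OF g k]]])
           (use cl f g k in \<open>simp add: X.M.a_assoc\<close>)
    qed (rule zero)
    fix r f assume r: "r \<in> carrier R" and f: "f \<in> carrier (Hom_module R A X)"
    show "r \<odot>\<^bsub>Hom_module R A X\<^esub> f \<in> carrier (Hom_module R A X)" by (rule smult[OF r f])
    fix s assume s: "s \<in> carrier R"
    show "(r \<oplus> s) \<odot>\<^bsub>Hom_module R A X\<^esub> f = r \<odot>\<^bsub>Hom_module R A X\<^esub> f \<oplus>\<^bsub>Hom_module R A X\<^esub> s \<odot>\<^bsub>Hom_module R A X\<^esub> f"
      by (rule Hom_module_eqI[OF smult add[OF smult smult]]) (use r s f cl in \<open>simp_all add: X.smult_l_distr\<close>)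
    show "(r \<otimes> s) \<odot>\<^bsub>Hom_module R A X\<^esub> f = r \<odot>\<^bsub>Hom_module R A X\<^esub> (s \<odot>\<^bsub>Hom_module R A X\<^esub> f)"
      by (rule Hom_module_eqI[OF smult smult[OF _ smult]]) (use r s f cl in \<open>simp_all add: X.smult_assoc1\<close>)
  next
    fix r f g assume r: "r \<in> carrier R" and f: "f \<in> carrier (Hom_module R A X)" and g: "g \<in> carrier (Hom_module R A X)"
    show "r \<odot>\<^bsub>Hom_module R A X\<^esub> (f \<oplus>\<^bsub>Hom_module R A X\<^esub> g) =
        r \<odot>\<^bsub>Hom_module R A X\<^esub> f \<oplus>\<^bsub>Hom_module R A X\<^esub> r \<odot>\<^bsub>Hom_module R A X\<^esub> g"
      by (rule Hom_module_eqI[OF smult[OF r add[OF f g]] add[OF smult[OF r f] smult[OF r g]]])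
         (use r f g cl in \<open>simp add: X.smult_r_distr\<close>)
  next
    fix f assume f: "f \<in> carrier (Hom_module R A X)"
    show "\<one> \<odot>\<^bsub>Hom_module R A X\<^esub> f = f"
      by (rule Hom_module_eqI[OF smult f]) (use f cl in simp_all)
  qed
qed

text \<open>Both \<open>Ext\<close> and \<open>Tor\<close> are quotients of a record whose carrier
  was cut down while the operations were kept. Annihilators can therefore be computed in the large
  module Q.\<close>

lemma Ass_subquotient:
  assumes Q: "module R Q" and Z: "submodule Z R Q" and H: "submodule H R Q" and HZ: "H \<subseteq> Z"
  shows "Ass R (quotient_module (Q\<lparr>carrier := Z\<rparr>) H) =
    {P. primeideal P R \<and> (\<exists>x\<in>Z. P = {r \<in> carrier R. r \<odot>\<^bsub>Q\<^esub> x \<in> H})}"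
proof -
  interpret QZ: module R "Q\<lparr>carrier := Z\<rparr>" by (rule submodule.submodule_is_module[OF Z Q])
  have "module R ((Q\<lparr>carrier := Z\<rparr>)\<lparr>carrier := H\<rparr>)"
    using submodule.submodule_is_module[OF H Q] by simp
  then have "submodule H R (Q\<lparr>carrier := Z\<rparr>)" using QZ.module_incl_imp_submodule HZ by simp
  from QZ.Ass_quotient[OF this] show ?thesis by simp
qed

section \<open>Ext through values on the basis\<close>

context
  fixes R :: "('a, 'r) ring_scheme" (structure) and M :: "('a, 'm, 'e) module_scheme"
    and X :: "('a, 'n, 'f) module_scheme"
  assumes M: "module R M" and X: "module R X"
begin

interpretation M: module R M by fact
interpretation X: module R X by fact

lemma module_res: "module R (res_module R M n)"
  unfolding res_module_def by (rule module_free_module[OF M.R.is_cring])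

lemma module_Ext_cochain: "module R (Ext_cochain R M X n)"
  unfolding Ext_cochain_def by (rule module_Hom_module[OF module_res X])

lemma linear_res_diff': "linear_map R (res_module R M (Suc n)) (res_module R M n) (res_diff R)"
  unfolding res_module_def by (rule linear_res_diff_Suc[OF M])

lemma linear_Ext_diff: "linear_map R (Ext_cochain R M X n) (Ext_cochain R M X (Suc n)) (Ext_diff R M n)"
proof (rule linear_mapI)
  note dcl = linear_map_closed[OF linear_res_diff']
  fix f assume f: "f \<in> carrier (Ext_cochain R M X n)"
  then have lf: "linear_map R (res_module R M n) X f" by (simp add: Ext_cochain_def Hom_module_simps)
  show "Ext_diff R M n f \<in> carrier (Ext_cochain R M X (Suc n))"
    unfolding Ext_cochain_def Ext_diff_def comp_def
    by (rule linear_map_restrict[OF module_res linear_map_comp[OF linear_res_diff' lf]])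
  show "Ext_diff R M n (r \<odot>\<^bsub>Ext_cochain R M X n\<^esub> f) = r \<odot>\<^bsub>Ext_cochain R M X (Suc n)\<^esub> Ext_diff R M n f" for r
    using dcl by (auto simp: Ext_diff_def Ext_cochain_def Hom_module_simps(4) fun_eq_iff)
  fix g assume g: "g \<in> carrier (Ext_cochain R M X n)"
  show "Ext_diff R M n (f \<oplus>\<^bsub>Ext_cochain R M X n\<^esub> g) =
      Ext_diff R M n f \<oplus>\<^bsub>Ext_cochain R M X (Suc n)\<^esub> Ext_diff R M n g"
    using dcl by (auto simp: Ext_diff_def Ext_cochain_def Hom_module_simps(3) fun_eq_iff)
qed

lemma Ext_cochain_eval:
  assumes f: "f \<in> carrier (Ext_cochain R M X n)" and z: "z \<in> carrier (res_module R M n)"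
  shows "(\<lambda>b. f (free_gen R b)) \<in> res_basis R M n \<rightarrow> carrier X"
    and "f z = linear_extension R X (\<lambda>b. f (free_gen R b)) z"
proof -
  have lf: "linear_map R (free_module R (res_basis R M n)) X f"
    using f by (simp add: Ext_cochain_def Hom_module_simps res_module_def)
  show fb: "(\<lambda>b. f (free_gen R b)) \<in> res_basis R M n \<rightarrow> carrier X"
    using linear_map_closed[OF lf free_gen_closed[OF M.R.is_cring]] by blast
  show "f z = linear_extension R X (\<lambda>b. f (free_gen R b)) z"
    by (rule free_module_linear_eq[OF X lf linear_map_linear_extension[OF X fb] _ z[unfolded res_module_def]])
       (simp add: linear_extension_gen[OF X _ fb])
qed

lemma Ext_cochain_of:
  assumes f: "f \<in> res_basis R M n \<rightarrow> carrier X"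
  shows "restrict (linear_extension R X f) (carrier (res_module R M n)) \<in> carrier (Ext_cochain R M X n)"
  unfolding Ext_cochain_def
  by (rule linear_map_restrict[OF module_res]) (unfold res_module_def, rule linear_map_linear_extension[OF X f])

lemma Ext_cochain_eq_iff:
  assumes f: "f \<in> carrier (Ext_cochain R M X n)" and g: "g \<in> carrier (Ext_cochain R M X n)"
  shows "f = g \<longleftrightarrow> (\<forall>b\<in>res_basis R M n. f (free_gen R b) = g (free_gen R b))"
proof
  assume eq: "\<forall>b\<in>res_basis R M n. f (free_gen R b) = g (free_gen R b)"
  have "f z = g z" if z: "z \<in> carrier (res_module R M n)" for z
    unfolding Ext_cochain_eval(2)[OF f z] Ext_cochain_eval(2)[OF g z]
    by (rule linear_extension_cong[OF X z[unfolded res_module_def] _ Ext_cochain_eval(1)[OF f z]]) (use eq in blast)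
  then show "f = g" using f g Hom_module_eqI unfolding Ext_cochain_def by blast
qed simp

lemma res_gen_closed: "b \<in> res_basis R M n \<Longrightarrow> free_gen R b \<in> carrier (res_module R M n)"
  unfolding res_module_def by (rule free_gen_closed[OF M.R.is_cring])

lemma res_boundary_closed': "b \<in> res_basis R M (Suc n) \<Longrightarrow> res_boundary R b \<in> carrier (res_module R M n)"
  using res_boundary_closed[OF M, of b "Suc n"] by (simp add: res_module_def)

lemma Ext_diff_gen:
  assumes f: "f \<in> carrier (Ext_cochain R M X n)" and b: "b \<in> res_basis R M (Suc n)"
  shows "Ext_diff R M n f (free_gen R b) = linear_extension R X (\<lambda>b. f (free_gen R b)) (res_boundary R b)"
  using Ext_cochain_eval(2)[OF f res_boundary_closed'[OF b]] res_gen_closed[OF b] res_diff_gen[OF M b]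
  by (simp add: Ext_diff_def)

lemma Ext_coboundaries_iff:
  assumes f: "f \<in> carrier (Ext_cochain R M X n)"
  shows "f \<in> Ext_coboundaries R M X n \<longleftrightarrow> (\<exists>h\<in>lower (res_basis R M) n \<rightarrow> carrier X.
    \<forall>b\<in>res_basis R M n. f (free_gen R b) = linear_extension R X h (res_boundary R b))"
proof (cases n)
  \<comment> \<open>In degree 0 all boundaries of basis elements are zero, so the right-hand side
    says that f vanishes on the basis, that is, f is the zero cochain.\<close>
  case 0
  interpret E: module R "Ext_cochain R M X 0" by (rule module_Ext_cochain)
  have "linear_extension R X h (res_boundary R b) = \<zero>\<^bsub>X\<^esub>" if "b \<in> res_basis R M 0" for b and h :: "('a, 'm) res_gen \<Rightarrow> 'n"
    using that lin_zero[OF X] by (auto simp: res_boundary_def)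
  moreover have "\<zero>\<^bsub>Ext_cochain R M X 0\<^esub> (free_gen R b) = \<zero>\<^bsub>X\<^esub>" if "b \<in> res_basis R M 0" for b
    using res_gen_closed[OF that] by (simp add: Ext_cochain_def Hom_module_simps)
  ultimately show ?thesis
    using Ext_cochain_eq_iff[OF f[unfolded 0] E.M.zero_closed] 0 by (auto simp: Ext_coboundaries_def)
next
  case (Suc k)
  show ?thesis
  proof
    assume "f \<in> Ext_coboundaries R M X n"
    then obtain g where g: "g \<in> carrier (Ext_cochain R M X k)" "f = Ext_diff R M k g"
      using Suc by (auto simp: Ext_coboundaries_def)
    have "(\<lambda>b. g (free_gen R b)) \<in> res_basis R M k \<rightarrow> carrier X"
      using Ext_cochain_eval(1)[OF g(1) module.submodule_zero_closed[OF module_res module.carrier_is_submodule[OF module_res]]] .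
    then show "\<exists>h\<in>lower (res_basis R M) n \<rightarrow> carrier X.
        \<forall>b\<in>res_basis R M n. f (free_gen R b) = linear_extension R X h (res_boundary R b)"
      using Ext_diff_gen[OF g(1)] g(2) Suc by (intro bexI[of _ "\<lambda>b. g (free_gen R b)"]) auto
  next
    assume "\<exists>h\<in>lower (res_basis R M) n \<rightarrow> carrier X.
        \<forall>b\<in>res_basis R M n. f (free_gen R b) = linear_extension R X h (res_boundary R b)"
    then obtain h where h: "h \<in> res_basis R M k \<rightarrow> carrier X"
      "\<And>b. b \<in> res_basis R M (Suc k) \<Longrightarrow> f (free_gen R b) = linear_extension R X h (res_boundary R b)"
      using Suc unfolding Suc lower_simps by blast
    let ?g = "restrict (linear_extension R X h) (carrier (res_module R M k))"
    have g: "?g \<in> carrier (Ext_cochain R M X k)" by (rule Ext_cochain_of[OF h(1)])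
    have "f = Ext_diff R M k ?g"
      unfolding Ext_cochain_eq_iff[OF f[unfolded Suc] linear_map_closed[OF linear_Ext_diff g]]
    proof
      fix b assume b: "b \<in> res_basis R M (Suc k)"
      show "f (free_gen R b) = Ext_diff R M k ?g (free_gen R b)"
        using h(2)[OF b] res_boundary_closed'[OF b] res_gen_closed[OF b] res_diff_gen[OF M b]
        by (simp add: Ext_diff_def)
    qed
    then show "f \<in> Ext_coboundaries R M X n" using g Suc by (auto simp: Ext_coboundaries_def)
  qed
qed

lemma Ext_cocycle_iff:
  assumes f: "f \<in> carrier (Ext_cochain R M X n)"
  shows "Ext_diff R M n f = \<zero>\<^bsub>Ext_cochain R M X (Suc n)\<^esub> \<longleftrightarrow>
    (\<forall>c\<in>res_basis R M (Suc n). linear_extension R X (\<lambda>b. f (free_gen R b)) (res_boundary R c) = \<zero>\<^bsub>X\<^esub>)"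
proof -
  interpret E: module R "Ext_cochain R M X (Suc n)" by (rule module_Ext_cochain)
  have "\<zero>\<^bsub>Ext_cochain R M X (Suc n)\<^esub> (free_gen R b) = \<zero>\<^bsub>X\<^esub>" if "b \<in> res_basis R M (Suc n)" for b
    using res_gen_closed[OF that] by (simp add: Ext_cochain_def Hom_module_simps)
  then show ?thesis
    unfolding Ext_cochain_eq_iff[OF linear_map_closed[OF linear_Ext_diff f] E.M.zero_closed]
    using Ext_diff_gen[OF f] by simp
qed

theorem Ass_Ext:
  "Ass R (Ext R i M X) =
    ext_primes R X (lower (res_basis R M) i) (res_basis R M i) (res_basis R M (Suc i)) (res_boundary R)"
proof -
  interpret E: module R "Ext_cochain R M X i" by (rule module_Ext_cochain)
  interpret E': module R "Ext_cochain R M X (Suc i)" by (rule module_Ext_cochain)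
  let ?Z = "{f \<in> carrier (Ext_cochain R M X i). Ext_diff R M i f \<in> {\<zero>\<^bsub>Ext_cochain R M X (Suc i)\<^esub>}}"
  let ?H = "Ext_coboundaries R M X i"
  have Z: "submodule ?Z R (Ext_cochain R M X i)"
    by (rule submodule_vimage[OF module_Ext_cochain module_Ext_cochain linear_Ext_diff E'.submodule_singleton_zero])
  have H: "submodule ?H R (Ext_cochain R M X i)"
  proof (cases i)
    case 0
    then show ?thesis using E.submodule_singleton_zero by (simp add: Ext_coboundaries_def)
  next
    case (Suc k)
    interpret Ek: module R "Ext_cochain R M X k" by (rule module_Ext_cochain)
    show ?thesis
      using submodule_image[OF module_Ext_cochain module_Ext_cochain linear_Ext_diff Ek.carrier_is_submodule] Suc
      by (simp add: Ext_coboundaries_def)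
  qed
  have HZ: "?H \<subseteq> ?Z"
  proof
    fix f assume fH: "f \<in> ?H"
    then have f: "f \<in> carrier (Ext_cochain R M X i)" using E.submoduleE(1)[OF H] by blast
    obtain h where h: "h \<in> lower (res_basis R M) i \<rightarrow> carrier X"
      "\<And>b. b \<in> res_basis R M i \<Longrightarrow> f (free_gen R b) = linear_extension R X h (res_boundary R b)"
      using fH Ext_coboundaries_iff[OF f] by blast
    have "linear_extension R X (\<lambda>b. f (free_gen R b)) (res_boundary R c) = \<zero>\<^bsub>X\<^esub>"
      if c: "c \<in> res_basis R M (Suc i)" for c
    proof -
      note bc = res_boundary_closed'[OF c]
      note bc' = bc[unfolded res_module_def]
      have "linear_extension R X (\<lambda>b. f (free_gen R b)) (res_boundary R c) =
          linear_extension R X (\<lambda>b. linear_extension R X h (res_boundary R b)) (res_boundary R c)"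
        by (rule linear_extension_cong[OF X bc' h(2) Ext_cochain_eval(1)[OF f bc]])
      also have "\<dots> = linear_extension R X h (free_extension R (res_boundary R) (res_boundary R c))"
        by (rule linear_extension_free_extension[OF X res_boundary_Pi[OF M] h(1) bc', symmetric])
      also have "\<dots> = \<zero>\<^bsub>X\<^esub>"
        using res_diff_boundary[OF M c] lin_zero[OF X] unfolding res_diff_eq by simp
      finally show ?thesis .
    qed
    then show "f \<in> ?Z" using f Ext_cocycle_iff[OF f] by simp
  qed
  have ker: "a_kernel (Ext_cochain R M X i) (Ext_cochain R M X (Suc i)) (Ext_diff R M i) = ?Z"
    by (simp add: a_kernel_def kernel_def)
  have eq: "(r \<odot>\<^bsub>Ext_cochain R M X i\<^esub> f \<in> ?H) \<longleftrightarrow> (\<exists>h\<in>lower (res_basis R M) i \<rightarrow> carrier X.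
     \<forall>b\<in>res_basis R M i. r \<odot>\<^bsub>X\<^esub> f (free_gen R b) = linear_extension R X h (res_boundary R b))"
    if "r \<in> carrier R" "f \<in> carrier (Ext_cochain R M X i)" for r f
    unfolding Ext_coboundaries_iff[OF E.smult_closed[OF that]]
    using res_gen_closed by (simp add: Ext_cochain_def Hom_module_simps)
  have "Ass R (Ext R i M X) = {P. primeideal P R \<and> (\<exists>f\<in>?Z. P = {r \<in> carrier R. r \<odot>\<^bsub>Ext_cochain R M X i\<^esub> f \<in> ?H})}"
    unfolding Ext_def ker by (rule Ass_subquotient[OF module_Ext_cochain Z H HZ])
  also have "\<dots> = ext_primes R X (lower (res_basis R M) i) (res_basis R M i) (res_basis R M (Suc i)) (res_boundary R)"
  proof (intro equalityI subsetI)
    fix P assume "P \<in> {P. primeideal P R \<and> (\<exists>f\<in>?Z. P = {r \<in> carrier R. r \<odot>\<^bsub>Ext_cochain R M X i\<^esub> f \<in> ?H})}"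
    then obtain f where P: "primeideal P R" and f: "f \<in> carrier (Ext_cochain R M X i)"
      "Ext_diff R M i f = \<zero>\<^bsub>Ext_cochain R M X (Suc i)\<^esub>"
      and Pf: "P = {r \<in> carrier R. r \<odot>\<^bsub>Ext_cochain R M X i\<^esub> f \<in> ?H}" by blast
    let ?f = "\<lambda>b. f (free_gen R b)"
    have "?f \<in> res_basis R M i \<rightarrow> carrier X"
      by (rule Ext_cochain_eval(1)[OF f(1) module.submodule_zero_closed[OF module_res module.carrier_is_submodule[OF module_res]]])
    moreover have "\<forall>c\<in>res_basis R M (Suc i). linear_extension R X ?f (res_boundary R c) = \<zero>\<^bsub>X\<^esub>"
      using f(2) Ext_cocycle_iff[OF f(1)] by blast
    moreover have "P = {r \<in> carrier R. \<exists>h\<in>lower (res_basis R M) i \<rightarrow> carrier X.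
       \<forall>b\<in>res_basis R M i. r \<odot>\<^bsub>X\<^esub> ?f b = linear_extension R X h (res_boundary R b)}"
      unfolding Pf by (rule Collect_cong, rule conj_cong[OF refl]) (rule eq[OF _ f(1)])
    ultimately show "P \<in> ext_primes R X (lower (res_basis R M) i) (res_basis R M i) (res_basis R M (Suc i)) (res_boundary R)"
      unfolding ext_primes_def using P by (intro CollectI conjI bexI[of _ ?f])
  next
    fix P assume "P \<in> ext_primes R X (lower (res_basis R M) i) (res_basis R M i) (res_basis R M (Suc i)) (res_boundary R)"
    then obtain g where P: "primeideal P R" and g: "g \<in> res_basis R M i \<rightarrow> carrier X"
      "\<forall>c\<in>res_basis R M (Suc i). linear_extension R X g (res_boundary R c) = \<zero>\<^bsub>X\<^esub>"
      and Pg: "P = {r \<in> carrier R. \<exists>h\<in>lower (res_basis R M) i \<rightarrow> carrier X.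
       \<forall>b\<in>res_basis R M i. r \<odot>\<^bsub>X\<^esub> g b = linear_extension R X h (res_boundary R b)}"
      unfolding ext_primes_def by blast
    let ?f = "restrict (linear_extension R X g) (carrier (res_module R M i))"
    have f: "?f \<in> carrier (Ext_cochain R M X i)" by (rule Ext_cochain_of[OF g(1)])
    have fg: "?f (free_gen R b) = g b" if "b \<in> res_basis R M i" for b
      using res_gen_closed[OF that] linear_extension_gen[OF X that g(1)] by simp
    have "linear_extension R X (\<lambda>b. ?f (free_gen R b)) (res_boundary R c) = \<zero>\<^bsub>X\<^esub>" if c: "c \<in> res_basis R M (Suc i)" for c
    proof -
      note bc = res_boundary_closed'[OF c]
      have "linear_extension R X (\<lambda>b. ?f (free_gen R b)) (res_boundary R c) = linear_extension R X g (res_boundary R c)"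
        by (rule linear_extension_cong[OF X bc[unfolded res_module_def] fg Ext_cochain_eval(1)[OF f bc]])
      then show ?thesis using g(2) c by simp
    qed
    then have "?f \<in> ?Z" using f Ext_cocycle_iff[OF f] by blast
    moreover have "P = {r \<in> carrier R. r \<odot>\<^bsub>Ext_cochain R M X i\<^esub> ?f \<in> ?H}"
      unfolding Pg
    proof (rule Collect_cong, rule conj_cong[OF refl])
      fix r assume r: "r \<in> carrier R"
      show "(\<exists>h\<in>lower (res_basis R M) i \<rightarrow> carrier X.
         \<forall>b\<in>res_basis R M i. r \<odot>\<^bsub>X\<^esub> g b = linear_extension R X h (res_boundary R b)) \<longleftrightarrow>
         r \<odot>\<^bsub>Ext_cochain R M X i\<^esub> ?f \<in> ?H"
        unfolding eq[OF r f] by (intro bex_cong[OF refl] ball_cong[OF refl]) (simp only: fg)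
    qed
    ultimately show "P \<in> {P. primeideal P R \<and> (\<exists>f\<in>?Z. P = {r \<in> carrier R. r \<odot>\<^bsub>Ext_cochain R M X i\<^esub> f \<in> ?H})}"
      using P by blast
  qed
  finally show ?thesis .
qed

end

section \<open>The universal property of the tensor product\<close>

lemma (in module) a_minus_add_cancel:
  assumes "x \<in> carrier M" "y \<in> carrier M"
  shows "(x \<ominus>\<^bsub>M\<^esub> y) \<oplus>\<^bsub>M\<^esub> y = x"
  using assms by (simp add: a_minus_def M.a_assoc M.l_neg)

lemma linear_map_diff_zero:
  fixes R (structure)
  assumes A: "module R A" and Y: "module R Y" and T: "linear_map R A Y T"
    and xy: "x \<in> carrier A" "y \<in> carrier A" "T x = T y"
  shows "T (x \<ominus>\<^bsub>A\<^esub> y) = \<zero>\<^bsub>Y\<^esub>"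
proof -
  interpret A: module R A by fact
  interpret Y: module R Y by fact
  have "T (x \<ominus>\<^bsub>A\<^esub> y) = T x \<oplus>\<^bsub>Y\<^esub> \<ominus>\<^bsub>Y\<^esub> T y"
    unfolding a_minus_def linear_map_add[OF T xy(1) A.M.a_inv_closed[OF xy(2)]] linear_map_neg[OF A Y T xy(2)] ..
  then show ?thesis using xy(3) linear_map_closed[OF T xy(2)] by (simp add: Y.M.r_neg)
qed

definition bilinear_map where
  "bilinear_map R A X Y f \<longleftrightarrow>
     (\<forall>a\<in>carrier A. linear_map R X Y (f a)) \<and> (\<forall>x\<in>carrier X. linear_map R A Y (\<lambda>a. f a x))"

text \<open>The map out of the tensor product that belongs to a bilinear f. It generalizes the
  formula of \<open>tensor_map\<close>, so that induced maps are a special case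
  (\<open>tensor_map_eq\<close>).\<close>

definition tensor_lift where
  "tensor_lift R Y f C = the_elem (linear_extension R Y (\<lambda>(a, x). f a x) ` C)"

context
  fixes R :: "('a, 'r) ring_scheme" (structure) and A :: "('a, 'm, 'e) module_scheme"
    and X :: "('a, 'n, 'f) module_scheme"
  assumes A: "module R A" and X: "module R X"
begin

interpretation A: module R A by fact
interpretation X: module R X by fact

abbreviation (input) "FAX \<equiv> free_module R (carrier A \<times> carrier X)"

interpretation F: module R FAX by (rule module_free_module[OF A.R.is_cring])

lemma tensor_gen_closed: "a \<in> carrier A \<Longrightarrow> x \<in> carrier X \<Longrightarrow> free_gen R (a, x) \<in> carrier FAX"
  by (rule free_gen_closed[OF A.R.is_cring]) simp

lemma tensor_relations_cases:
  assumes "z \<in> tensor_relations R A X"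
  obtains (left_add) a a' x where "a \<in> carrier A" "a' \<in> carrier A" "x \<in> carrier X"
      "z = free_gen R (a \<oplus>\<^bsub>A\<^esub> a', x) \<ominus>\<^bsub>FAX\<^esub> (free_gen R (a, x) \<oplus>\<^bsub>FAX\<^esub> free_gen R (a', x))"
    | (right_add) a x x' where "a \<in> carrier A" "x \<in> carrier X" "x' \<in> carrier X"
      "z = free_gen R (a, x \<oplus>\<^bsub>X\<^esub> x') \<ominus>\<^bsub>FAX\<^esub> (free_gen R (a, x) \<oplus>\<^bsub>FAX\<^esub> free_gen R (a, x'))"
    | (left_smult) r a x where "r \<in> carrier R" "a \<in> carrier A" "x \<in> carrier X"
      "z = free_gen R (r \<odot>\<^bsub>A\<^esub> a, x) \<ominus>\<^bsub>FAX\<^esub> (r \<odot>\<^bsub>FAX\<^esub> free_gen R (a, x))"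
    | (right_smult) r a x where "r \<in> carrier R" "a \<in> carrier A" "x \<in> carrier X"
      "z = free_gen R (a, r \<odot>\<^bsub>X\<^esub> x) \<ominus>\<^bsub>FAX\<^esub> (r \<odot>\<^bsub>FAX\<^esub> free_gen R (a, x))"
  using assms unfolding tensor_relations_def Let_def
proof (elim UnE CollectE exE conjE)
  fix a a' x
  assume "z = free_gen R (a \<oplus>\<^bsub>A\<^esub> a', x) \<ominus>\<^bsub>FAX\<^esub> (free_gen R (a, x) \<oplus>\<^bsub>FAX\<^esub> free_gen R (a', x))"
    "a \<in> carrier A" "a' \<in> carrier A" "x \<in> carrier X"
  then show thesis by (intro left_add)
next
  fix a x x'
  assume "z = free_gen R (a, x \<oplus>\<^bsub>X\<^esub> x') \<ominus>\<^bsub>FAX\<^esub> (free_gen R (a, x) \<oplus>\<^bsub>FAX\<^esub> free_gen R (a, x'))"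
    "a \<in> carrier A" "x \<in> carrier X" "x' \<in> carrier X"
  then show thesis by (intro right_add)
next
  fix r a x
  assume "z = free_gen R (r \<odot>\<^bsub>A\<^esub> a, x) \<ominus>\<^bsub>FAX\<^esub> (r \<odot>\<^bsub>FAX\<^esub> free_gen R (a, x))"
    "r \<in> carrier R" "a \<in> carrier A" "x \<in> carrier X"
  then show thesis by (intro left_smult)
next
  fix r a x
  assume "z = free_gen R (a, r \<odot>\<^bsub>X\<^esub> x) \<ominus>\<^bsub>FAX\<^esub> (r \<odot>\<^bsub>FAX\<^esub> free_gen R (a, x))"
    "r \<in> carrier R" "a \<in> carrier A" "x \<in> carrier X"
  then show thesis by (intro right_smult)
qed

lemma tensor_relations_closed: "tensor_relations R A X \<subseteq> carrier FAX"
proof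
  fix z assume "z \<in> tensor_relations R A X"
  then show "z \<in> carrier FAX"
    by (cases rule: tensor_relations_cases)
       (simp_all only:, (intro F.M.minus_closed F.M.a_closed F.smult_closed tensor_gen_closed; simp)+)
qed

lemma tensor_kernel_submodule: "submodule (tensor_kernel R A X) R FAX"
  unfolding tensor_kernel_def by (rule F.submodule_span_submodule[OF tensor_relations_closed])

lemma module_tensor: "module R (tensor_module R A X)"
  unfolding tensor_module_def by (rule F.module_quotient[OF tensor_kernel_submodule])

lemma tensor_coset_eq:
  assumes "x \<in> carrier FAX" "y \<in> carrier FAX" "x \<ominus>\<^bsub>FAX\<^esub> y \<in> tensor_relations R A X"
  shows "tensor_kernel R A X +>\<^bsub>FAX\<^esub> x = tensor_kernel R A X +>\<^bsub>FAX\<^esub> y"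
proof -
  have "x \<ominus>\<^bsub>FAX\<^esub> y \<in> tensor_kernel R A X"
    unfolding tensor_kernel_def using F.submodule_span_incl assms(3) by blast
  moreover have "x = (x \<ominus>\<^bsub>FAX\<^esub> y) \<oplus>\<^bsub>FAX\<^esub> y" using F.a_minus_add_cancel[OF assms(1,2)] by (rule sym)
  ultimately show ?thesis unfolding F.coset_eq_iff[OF tensor_kernel_submodule assms(1,2)] by blast
qed

lemma pure_tensor_closed: "a \<in> carrier A \<Longrightarrow> x \<in> carrier X \<Longrightarrow> pure_tensor R A X a x \<in> carrier (tensor_module R A X)"
  unfolding pure_tensor_def tensor_module_def F.quotient_carrier[OF tensor_kernel_submodule]
  using tensor_gen_closed by blast

lemma bilinear_pure_tensor: "bilinear_map R A X (tensor_module R A X) (pure_tensor R A X)"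
proof -
  note cl = tensor_gen_closed
  have relI: "z \<in> tensor_relations R A X" if
    "(\<exists>a a' b. z = free_gen R (a \<oplus>\<^bsub>A\<^esub> a', b) \<ominus>\<^bsub>FAX\<^esub> (free_gen R (a, b) \<oplus>\<^bsub>FAX\<^esub> free_gen R (a', b)) \<and>
        a \<in> carrier A \<and> a' \<in> carrier A \<and> b \<in> carrier X) \<or>
     (\<exists>a b b'. z = free_gen R (a, b \<oplus>\<^bsub>X\<^esub> b') \<ominus>\<^bsub>FAX\<^esub> (free_gen R (a, b) \<oplus>\<^bsub>FAX\<^esub> free_gen R (a, b')) \<and>
        a \<in> carrier A \<and> b \<in> carrier X \<and> b' \<in> carrier X) \<or>
     (\<exists>r a b. z = free_gen R (r \<odot>\<^bsub>A\<^esub> a, b) \<ominus>\<^bsub>FAX\<^esub> (r \<odot>\<^bsub>FAX\<^esub> free_gen R (a, b)) \<and>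
        r \<in> carrier R \<and> a \<in> carrier A \<and> b \<in> carrier X) \<or>
     (\<exists>r a b. z = free_gen R (a, r \<odot>\<^bsub>X\<^esub> b) \<ominus>\<^bsub>FAX\<^esub> (r \<odot>\<^bsub>FAX\<^esub> free_gen R (a, b)) \<and>
        r \<in> carrier R \<and> a \<in> carrier A \<and> b \<in> carrier X)" for z
    using that unfolding tensor_relations_def Let_def by (simp only: Un_iff mem_Collect_eq disj_assoc)
  show ?thesis
    unfolding bilinear_map_def
  proof (intro conjI ballI)
    fix a assume a: "a \<in> carrier A"
    show "linear_map R X (tensor_module R A X) (pure_tensor R A X a)"
    proof (rule linear_mapI)
      fix x assume x: "x \<in> carrier X"
      show "pure_tensor R A X a x \<in> carrier (tensor_module R A X)" by (rule pure_tensor_closed[OF a x])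
      show "pure_tensor R A X a (r \<odot>\<^bsub>X\<^esub> x) = r \<odot>\<^bsub>tensor_module R A X\<^esub> pure_tensor R A X a x" if r: "r \<in> carrier R" for r
        unfolding pure_tensor_def tensor_module_def F.quotient_smult[OF tensor_kernel_submodule r cl[OF a x]]
        by (rule tensor_coset_eq[OF cl[OF a X.smult_closed[OF r x]] F.smult_closed[OF r cl[OF a x]] relI])
           (use a x r in blast)
      fix y assume y: "y \<in> carrier X"
      show "pure_tensor R A X a (x \<oplus>\<^bsub>X\<^esub> y) = pure_tensor R A X a x \<oplus>\<^bsub>tensor_module R A X\<^esub> pure_tensor R A X a y"
        unfolding pure_tensor_def tensor_module_def F.quotient_add[OF tensor_kernel_submodule cl[OF a x] cl[OF a y]]
        by (rule tensor_coset_eq[OF cl[OF a X.M.a_closed[OF x y]] F.M.a_closed[OF cl[OF a x] cl[OF a y]] relI])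
           (use a x y in blast)
    qed
  next
    fix x assume x: "x \<in> carrier X"
    show "linear_map R A (tensor_module R A X) (\<lambda>a. pure_tensor R A X a x)"
    proof (rule linear_mapI)
      fix a assume a: "a \<in> carrier A"
      show "pure_tensor R A X a x \<in> carrier (tensor_module R A X)" by (rule pure_tensor_closed[OF a x])
      show "pure_tensor R A X (r \<odot>\<^bsub>A\<^esub> a) x = r \<odot>\<^bsub>tensor_module R A X\<^esub> pure_tensor R A X a x" if r: "r \<in> carrier R" for r
        unfolding pure_tensor_def tensor_module_def F.quotient_smult[OF tensor_kernel_submodule r cl[OF a x]]
        by (rule tensor_coset_eq[OF cl[OF A.smult_closed[OF r a] x] F.smult_closed[OF r cl[OF a x]] relI])
           (use a x r in blast)
      fix b assume b: "b \<in> carrier A"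
      show "pure_tensor R A X (a \<oplus>\<^bsub>A\<^esub> b) x = pure_tensor R A X a x \<oplus>\<^bsub>tensor_module R A X\<^esub> pure_tensor R A X b x"
        unfolding pure_tensor_def tensor_module_def F.quotient_add[OF tensor_kernel_submodule cl[OF a x] cl[OF b x]]
        by (rule tensor_coset_eq[OF cl[OF A.M.a_closed[OF a b] x] F.M.a_closed[OF cl[OF a x] cl[OF b x]] relI])
           (use a b x in blast)
    qed
  qed
qed

lemma tensor_linear_eq:
  assumes Y: "module R Y" and p: "linear_map R (tensor_module R A X) Y p" and q: "linear_map R (tensor_module R A X) Y q"
    and eq: "\<And>a x. a \<in> carrier A \<Longrightarrow> x \<in> carrier X \<Longrightarrow> p (pure_tensor R A X a x) = q (pure_tensor R A X a x)"
    and C: "C \<in> carrier (tensor_module R A X)"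
  shows "p C = q C"
proof -
  let ?q = "\<lambda>z. tensor_kernel R A X +>\<^bsub>FAX\<^esub> z"
  have lq: "linear_map R FAX (tensor_module R A X) ?q"
    unfolding tensor_module_def by (rule F.linear_map_quotient[OF tensor_kernel_submodule])
  obtain z where z: "z \<in> carrier FAX" "C = ?q z"
    using C unfolding tensor_module_def F.quotient_carrier[OF tensor_kernel_submodule] by blast
  have "p (?q z) = q (?q z)"
  proof (rule free_module_linear_eq[OF Y linear_map_comp[OF lq p] linear_map_comp[OF lq q] _ z(1)])
    fix b assume "b \<in> carrier A \<times> carrier X"
    then show "p (?q (free_gen R b)) = q (?q (free_gen R b))"
      using eq by (auto simp: pure_tensor_def)
  qed
  then show ?thesis using z(2) by simp
qed

context
  fixes Y :: "('a, 'y, 'g) module_scheme" and f :: "'m \<Rightarrow> 'n \<Rightarrow> 'y"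
  assumes Y: "module R Y" and f: "bilinear_map R A X Y f"
begin

interpretation Y: module R Y by fact

lemma bilinear_left: "a \<in> carrier A \<Longrightarrow> linear_map R X Y (f a)"
  and bilinear_right: "x \<in> carrier X \<Longrightarrow> linear_map R A Y (\<lambda>a. f a x)"
  using f by (auto simp: bilinear_map_def)

lemma bilinear_Pi: "(\<lambda>(a, x). f a x) \<in> carrier A \<times> carrier X \<rightarrow> carrier Y"
  using linear_map_closed[OF bilinear_left] by auto

text \<open>Bilinearity of f says that the linear extension kills each of the four kinds of
  relations, hence their span. It is then constant on a coset, whose image is a singleton, so
  \<open>the_elem\<close> picks the intended value.\<close>

lemma tensor_lift_coset:
  assumes z: "z \<in> carrier FAX"
  shows "tensor_lift R Y f (tensor_kernel R A X +>\<^bsub>FAX\<^esub> z) = linear_extension R Y (\<lambda>(a, x). f a x) z"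
proof -
  let ?T = "linear_extension R Y (\<lambda>(a, x). f a x)"
  note T = linear_map_linear_extension[OF Y bilinear_Pi]
  have Tg: "?T (free_gen R (a, x)) = f a x" if "a \<in> carrier A" "x \<in> carrier X" for a x
    using linear_extension_gen[OF Y _ bilinear_Pi, of "(a, x)"] that by simp
  note cl = tensor_gen_closed
  have "tensor_relations R A X \<subseteq> {z \<in> carrier FAX. ?T z \<in> {\<zero>\<^bsub>Y\<^esub>}}"
  proof
    fix z assume zr: "z \<in> tensor_relations R A X"
    then have zF: "z \<in> carrier FAX" using tensor_relations_closed by blast
    from zr have "?T z = \<zero>\<^bsub>Y\<^esub>"
    proof (cases rule: tensor_relations_cases)
      case (left_add a a' x)
      note c = left_add(1-3)
      show ?thesis unfolding left_add(4)
      proof (rule linear_map_diff_zero[OF F.module_axioms Y T cl[OF A.M.a_closed[OF c(1,2)] c(3)]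
            F.M.a_closed[OF cl[OF c(1,3)] cl[OF c(2,3)]]])
        show "?T (free_gen R (a \<oplus>\<^bsub>A\<^esub> a', x)) = ?T (free_gen R (a, x) \<oplus>\<^bsub>FAX\<^esub> free_gen R (a', x))"
          unfolding linear_map_add[OF T cl[OF c(1,3)] cl[OF c(2,3)]] Tg[OF c(1,3)] Tg[OF c(2,3)]
            Tg[OF A.M.a_closed[OF c(1,2)] c(3)] by (rule linear_map_add[OF bilinear_right[OF c(3)] c(1,2)])
      qed
    next
      case (right_add a x x')
      note c = right_add(1-3)
      show ?thesis unfolding right_add(4)
      proof (rule linear_map_diff_zero[OF F.module_axioms Y T cl[OF c(1) X.M.a_closed[OF c(2,3)]]
            F.M.a_closed[OF cl[OF c(1,2)] cl[OF c(1,3)]]])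
        show "?T (free_gen R (a, x \<oplus>\<^bsub>X\<^esub> x')) = ?T (free_gen R (a, x) \<oplus>\<^bsub>FAX\<^esub> free_gen R (a, x'))"
          unfolding linear_map_add[OF T cl[OF c(1,2)] cl[OF c(1,3)]] Tg[OF c(1,3)] Tg[OF c(1,2)]
            Tg[OF c(1) X.M.a_closed[OF c(2,3)]] by (rule linear_map_add[OF bilinear_left[OF c(1)] c(2,3)])
      qed
    next
      case (left_smult r a x)
      note c = left_smult(1-3)
      show ?thesis unfolding left_smult(4)
      proof (rule linear_map_diff_zero[OF F.module_axioms Y T cl[OF A.smult_closed[OF c(1,2)] c(3)]
            F.smult_closed[OF c(1) cl[OF c(2,3)]]])
        show "?T (free_gen R (r \<odot>\<^bsub>A\<^esub> a, x)) = ?T (r \<odot>\<^bsub>FAX\<^esub> free_gen R (a, x))"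
          unfolding linear_map_smult[OF T c(1) cl[OF c(2,3)]] Tg[OF c(2,3)]
            Tg[OF A.smult_closed[OF c(1,2)] c(3)] by (rule linear_map_smult[OF bilinear_right[OF c(3)] c(1,2)])
      qed
    next
      case (right_smult r a x)
      note c = right_smult(1-3)
      show ?thesis unfolding right_smult(4)
      proof (rule linear_map_diff_zero[OF F.module_axioms Y T cl[OF c(2) X.smult_closed[OF c(1,3)]]
            F.smult_closed[OF c(1) cl[OF c(2,3)]]])
        show "?T (free_gen R (a, r \<odot>\<^bsub>X\<^esub> x)) = ?T (r \<odot>\<^bsub>FAX\<^esub> free_gen R (a, x))"
          unfolding linear_map_smult[OF T c(1) cl[OF c(2,3)]] Tg[OF c(2,3)]
            Tg[OF c(2) X.smult_closed[OF c(1,3)]] by (rule linear_map_smult[OF bilinear_left[OF c(2)] c(1,3)])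
      qed
    qed
    then show "z \<in> {z \<in> carrier FAX. ?T z \<in> {\<zero>\<^bsub>Y\<^esub>}}" using zF by blast
  qed
  then have "tensor_kernel R A X \<subseteq> {z \<in> carrier FAX. ?T z \<in> {\<zero>\<^bsub>Y\<^esub>}}"
    unfolding tensor_kernel_def
    by (rule F.submodule_span_least[OF submodule_vimage[OF F.module_axioms Y T Y.submodule_singleton_zero]])
  then have ker: "k \<in> carrier FAX" "?T k = \<zero>\<^bsub>Y\<^esub>" if "k \<in> tensor_kernel R A X" for k using that by blast+
  have "?T (k \<oplus>\<^bsub>FAX\<^esub> z) = ?T z" if k: "k \<in> tensor_kernel R A X" for k
    unfolding linear_map_add[OF T ker(1)[OF k] z] ker(2)[OF k] by (rule Y.M.l_zero[OF linear_map_closed[OF T z]])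
  then have "(\<Union>h\<in>tensor_kernel R A X. ?T ` {h \<oplus>\<^bsub>FAX\<^esub> z}) = {?T z}"
    using F.submodule_zero_closed[OF tensor_kernel_submodule]
    by (intro SUP_eq_const) (blast, simp del: free_module_simps)
  then have "?T ` (tensor_kernel R A X +>\<^bsub>FAX\<^esub> z) = {?T z}"
    unfolding a_r_coset_def' image_UN .
  then show ?thesis by (simp add: tensor_lift_def)
qed

lemma tensor_lift_pure: "a \<in> carrier A \<Longrightarrow> x \<in> carrier X \<Longrightarrow> tensor_lift R Y f (pure_tensor R A X a x) = f a x"
  unfolding pure_tensor_def tensor_lift_coset[OF tensor_gen_closed]
  using linear_extension_gen[OF Y _ bilinear_Pi, of "(a, x)"] by simp

lemma linear_tensor_lift: "linear_map R (tensor_module R A X) Y (tensor_lift R Y f)"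
proof -
  note T = linear_map_linear_extension[OF Y bilinear_Pi]
  note K = tensor_kernel_submodule
  show ?thesis
    unfolding tensor_module_def
  proof (rule linear_mapI)
    fix C assume "C \<in> carrier (quotient_module FAX (tensor_kernel R A X))"
    then obtain z where z: "z \<in> carrier FAX" "C = tensor_kernel R A X +>\<^bsub>FAX\<^esub> z"
      unfolding F.quotient_carrier[OF K] by blast
    show "tensor_lift R Y f C \<in> carrier Y"
      unfolding z(2) tensor_lift_coset[OF z(1)] by (rule linear_map_closed[OF T z(1)])
    show "tensor_lift R Y f (r \<odot>\<^bsub>quotient_module FAX (tensor_kernel R A X)\<^esub> C) = r \<odot>\<^bsub>Y\<^esub> tensor_lift R Y f C"
      if r: "r \<in> carrier R" for r
      unfolding z(2) F.quotient_smult[OF K r z(1)] tensor_lift_coset[OF z(1)] tensor_lift_coset[OF F.smult_closed[OF r z(1)]]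
      by (rule linear_map_smult[OF T r z(1)])
    fix C' assume "C' \<in> carrier (quotient_module FAX (tensor_kernel R A X))"
    then obtain z' where z': "z' \<in> carrier FAX" "C' = tensor_kernel R A X +>\<^bsub>FAX\<^esub> z'"
      unfolding F.quotient_carrier[OF K] by blast
    show "tensor_lift R Y f (C \<oplus>\<^bsub>quotient_module FAX (tensor_kernel R A X)\<^esub> C') = tensor_lift R Y f C \<oplus>\<^bsub>Y\<^esub> tensor_lift R Y f C'"
      unfolding z(2) z'(2) F.quotient_add[OF K z(1) z'(1)] tensor_lift_coset[OF z(1)] tensor_lift_coset[OF z'(1)]
        tensor_lift_coset[OF F.M.a_closed[OF z(1) z'(1)]]
      by (rule linear_map_add[OF T z(1) z'(1)])
  qed
qed

end

end

lemma tensor_map_eq: "tensor_map R A' X f = tensor_lift R (tensor_module R A' X) (\<lambda>a. pure_tensor R A' X (f a))"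
  by (simp add: tensor_map_def[abs_def] tensor_lift_def[abs_def])

lemma bilinear_tensor_map:
  assumes "module R A'" "module R X" "linear_map R A A' f"
  shows "bilinear_map R A X (tensor_module R A' X) (\<lambda>a. pure_tensor R A' X (f a))"
  using bilinear_pure_tensor[OF assms(1,2)] linear_map_comp[OF assms(3)] linear_map_closed[OF assms(3)]
  unfolding bilinear_map_def by blast

text \<open>With this map tensors, which are cosets of formal sums, become families of elements of X
  indexed by the basis.\<close>

definition tensor_coordinates where
  "tensor_coordinates R X B = tensor_lift R (sum_module X B) (scale_vector X)"

context
  fixes R :: "('a, 'r) ring_scheme" (structure) and X :: "('a, 'n, 'f) module_scheme"
  assumes X: "module R X"
begin

interpretation X: module R X by fact

lemma module_F': "module R (free_module R B)"
  by (rule module_free_module[OF X.R.is_cring])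

lemma bilinear_scale_vector: "bilinear_map R (free_module R B) X (sum_module X B) (scale_vector X)"
  unfolding bilinear_map_def using X.linear_map_scale_vector X.linear_map_scale_vector_left by blast

lemma linear_tensor_coordinates:
  "linear_map R (tensor_module R (free_module R B) X) (sum_module X B) (tensor_coordinates R X B)"
  unfolding tensor_coordinates_def
  by (rule linear_tensor_lift[OF module_F' X X.module_sum_module bilinear_scale_vector])

lemma tensor_coordinates_pure:
  assumes "z \<in> carrier (free_module R B)" "x \<in> carrier X"
  shows "tensor_coordinates R X B (pure_tensor R (free_module R B) X z x) = scale_vector X z x"
  unfolding tensor_coordinates_def
  by (rule tensor_lift_pure[OF module_F' X X.module_sum_module bilinear_scale_vector assms])

text \<open>The inverse sends x in the summand of b to the pure tensor of the basis element b with
  x. Both composites are linear, so they are compared on pure tensors and on single summands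
  respectively.\<close>

lemma bij_tensor_coordinates:
  "bij_betw (tensor_coordinates R X B) (carrier (tensor_module R (free_module R B) X)) (carrier (sum_module X B))"
proof -
  let ?F = "free_module R B"
  let ?T = "tensor_module R ?F X" and ?c = "tensor_coordinates R X B"
  let ?l = "\<lambda>b x. pure_tensor R ?F X (free_gen R b) x"
  let ?i = "sum_extension X ?T ?l"
  note T = module_tensor[OF module_F' X]
  have bil: "linear_map R X ?T (pure_tensor R ?F X z)" if "z \<in> carrier ?F" for z
    using bilinear_pure_tensor[OF module_F' X] that unfolding bilinear_map_def by blast
  have bir: "linear_map R ?F ?T (\<lambda>z. pure_tensor R ?F X z x)" if "x \<in> carrier X" for x
    using bilinear_pure_tensor[OF module_F' X] that unfolding bilinear_map_def by blast
  have l: "linear_map R X ?T (?l b)" if "b \<in> B" for b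
    by (rule bil[OF free_gen_closed[OF X.R.is_cring that]])
  note li = linear_map_sum_extension[OF X T l]
  note lc = linear_tensor_coordinates[of B]
  have scale: "?i (scale_vector X z x) = pure_tensor R ?F X z x" if z: "z \<in> carrier ?F" and x: "x \<in> carrier X" for z x
  proof (rule free_module_linear_eq[OF T linear_map_comp[OF X.linear_map_scale_vector_left[OF x] li] bir[OF x] _ z])
    fix b assume b: "b \<in> B"
    show "?i (scale_vector X (free_gen R b) x) = pure_tensor R ?F X (free_gen R b) x"
      unfolding X.scale_vector_gen[OF x] by (rule sum_extension_single[OF X T l b x])
  qed
  have ic: "?i (?c C) = C" if C: "C \<in> carrier ?T" for C
  proof (rule tensor_linear_eq[OF module_F' X T linear_map_comp[OF lc li] linear_map_id _ C])
    fix z x assume z: "z \<in> carrier ?F" and x: "x \<in> carrier X"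
    show "?i (?c (pure_tensor R ?F X z x)) = pure_tensor R ?F X z x"
      unfolding tensor_coordinates_pure[OF z x] by (rule scale[OF z x])
  qed
  have ci: "?c (?i u) = u" if u: "u \<in> carrier (sum_module X B)" for u
  proof (rule X.sum_module_linear_eq[OF X.module_sum_module linear_map_comp[OF li lc] linear_map_id _ u])
    fix b x assume b: "b \<in> B" and x: "x \<in> carrier X"
    have single: "?i (sum_single X b x) = ?l b x" by (rule sum_extension_single[OF X T l b x])
    show "?c (?i (sum_single X b x)) = sum_single X b x"
      unfolding single tensor_coordinates_pure[OF free_gen_closed[OF X.R.is_cring b] x]
      by (rule X.scale_vector_gen[OF x])
  qed
  show ?thesis
    by (rule bij_betw_byWitness[where f' = ?i])
       (use ic ci linear_map_closed[OF lc] linear_map_closed[OF li] in auto)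
qed

lemma tensor_coordinates_map:
  assumes f: "f \<in> B \<rightarrow> carrier (free_module R C)" and t: "t \<in> carrier (tensor_module R (free_module R B) X)"
  shows "tensor_coordinates R X C (tensor_map R (free_module R C) X (free_extension R f) t) =
    pushforward X f (tensor_coordinates R X B t)"
proof -
  note lf = linear_map_free_extension[OF X.R.is_cring f]
  note bil = bilinear_tensor_map[OF module_F' X lf]
  note T = module_tensor[OF module_F' X]
  show ?thesis
    unfolding tensor_map_eq
  proof (rule tensor_linear_eq[OF module_F' X X.module_sum_module
        linear_map_comp[OF linear_tensor_lift[OF module_F' X T bil] linear_tensor_coordinates]
        linear_map_comp[OF linear_tensor_coordinates X.linear_map_pushforward[OF f]] _ t])
    fix z x assume z: "z \<in> carrier (free_module R B)" and x: "x \<in> carrier X"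
    show "tensor_coordinates R X C (tensor_lift R (tensor_module R (free_module R C) X)
        (\<lambda>a. pure_tensor R (free_module R C) X (free_extension R f a)) (pure_tensor R (free_module R B) X z x)) =
      pushforward X f (tensor_coordinates R X B (pure_tensor R (free_module R B) X z x))"
      unfolding tensor_lift_pure[OF module_F' X T bil z x] tensor_coordinates_pure[OF z x]
        tensor_coordinates_pure[OF linear_map_closed[OF lf z] x] by (rule X.pushforward_scale[OF f z x, symmetric])
  qed
qed

lemma linear_tensor_map:
  assumes f: "f \<in> B \<rightarrow> carrier (free_module R C)"
  shows "linear_map R (tensor_module R (free_module R B) X) (tensor_module R (free_module R C) X)
    (tensor_map R (free_module R C) X (free_extension R f))"
  unfolding tensor_map_eq
  by (rule linear_tensor_lift[OF module_F' X module_tensor[OF module_F' X]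
        bilinear_tensor_map[OF module_F' X linear_map_free_extension[OF X.R.is_cring f]]])

end

section \<open>Tor in coordinates\<close>

context
  fixes R :: "('a, 'r) ring_scheme" (structure) and M :: "('a, 'm, 'e) module_scheme"
    and X :: "('a, 'n, 'f) module_scheme"
  assumes M: "module R M" and X: "module R X"
begin

interpretation M: module R M by fact
interpretation X: module R X by fact

abbreviation (input) "bas \<equiv> res_basis R M"
abbreviation (input) "crd n \<equiv> tensor_coordinates R X (res_basis R M n)"

lemma Tor_chain_eq: "Tor_chain R M X n = tensor_module R (free_module R (bas n)) X"
  by (simp add: Tor_chain_def res_module_def)

lemma module_Tor_chain: "module R (Tor_chain R M X n)"
  unfolding Tor_chain_eq by (rule module_tensor[OF module_F'[OF X] X])

lemma res_boundary_Suc: "res_boundary R \<in> bas (Suc n) \<rightarrow> carrier (free_module R (bas n))"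
  using res_boundary_Pi[OF M, of "Suc n"] unfolding lower_simps .

lemma linear_Tor_diff: "linear_map R (Tor_chain R M X (Suc n)) (Tor_chain R M X n) (Tor_diff R M X n)"
  unfolding Tor_chain_eq Tor_diff_def res_module_def res_diff_eq by (rule linear_tensor_map[OF X res_boundary_Suc])

lemma linear_crd: "linear_map R (Tor_chain R M X n) (sum_module X (bas n)) (crd n)"
  unfolding Tor_chain_eq by (rule linear_tensor_coordinates[OF X])

lemma bij_crd: "bij_betw (crd n) (carrier (Tor_chain R M X n)) (carrier (sum_module X (bas n)))"
  unfolding Tor_chain_eq by (rule bij_tensor_coordinates[OF X])

lemma crd_Tor_diff:
  "t \<in> carrier (Tor_chain R M X (Suc n)) \<Longrightarrow>
    crd n (Tor_diff R M X n t) = pushforward X (res_boundary R) (crd (Suc n) t)"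
  unfolding Tor_chain_eq Tor_diff_def res_module_def res_diff_eq
  by (rule tensor_coordinates_map[OF X res_boundary_Suc])

lemma Tor_cycles_iff:
  assumes t: "t \<in> carrier (Tor_chain R M X n)"
  shows "t \<in> Tor_cycles R M X n \<longleftrightarrow> pushforward X (res_boundary R) (crd n t) = (\<lambda>_. \<zero>\<^bsub>X\<^esub>)"
proof (cases n)
  \<comment> \<open>The boundary of a chain of degree 0 lies in the sum over the empty basis, so the
    condition holds automatically, as it must since every chain of degree 0 is a cycle.\<close>
  case 0
  have "pushforward X (res_boundary R) (crd n t) \<in> carrier (sum_module X {})"
    using linear_map_closed[OF X.linear_map_pushforward[OF res_boundary_Pi[OF M]] linear_map_closed[OF linear_crd t]] 0
    by simp
  then show ?thesis using t 0 by (auto simp: Tor_cycles_def carrier_sum_module)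
next
  case (Suc k)
  note t' = t[unfolded Suc]
  have dt: "Tor_diff R M X k t \<in> carrier (Tor_chain R M X k)" by (rule linear_map_closed[OF linear_Tor_diff t'])
  interpret T: module R "Tor_chain R M X k" by (rule module_Tor_chain)
  have "t \<in> Tor_cycles R M X n \<longleftrightarrow> Tor_diff R M X k t = \<zero>\<^bsub>Tor_chain R M X k\<^esub>"
    using t' Suc by (simp add: Tor_cycles_def a_kernel_def kernel_def)
  also have "\<dots> \<longleftrightarrow> crd k (Tor_diff R M X k t) = crd k \<zero>\<^bsub>Tor_chain R M X k\<^esub>"
    using inj_on_eq_iff[OF bij_betw_imp_inj_on[OF bij_crd] dt T.M.zero_closed] by simp
  also have "crd k \<zero>\<^bsub>Tor_chain R M X k\<^esub> = (\<lambda>_. \<zero>\<^bsub>X\<^esub>)"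
    using linear_map_zero[OF module_Tor_chain X.module_sum_module linear_crd] by simp
  finally show ?thesis unfolding crd_Tor_diff[OF t'] Suc .
qed

theorem Ass_Tor: "Ass R (Tor R i M X) = tor_primes R X (bas i) (bas (Suc i)) (res_boundary R)"
proof -
  interpret T: module R "Tor_chain R M X i" by (rule module_Tor_chain)
  interpret T': module R "Tor_chain R M X (Suc i)" by (rule module_Tor_chain)
  interpret Sl: module R "sum_module X (lower bas i)" by (rule X.module_sum_module)
  let ?d = "pushforward X (res_boundary R)"
  let ?Z = "Tor_cycles R M X i" and ?H = "Tor_diff R M X i ` carrier (Tor_chain R M X (Suc i))"
  note lp = X.linear_map_pushforward[OF res_boundary_Pi[OF M], of i]
  have Zc: "?Z \<subseteq> carrier (Tor_chain R M X i)"
    by (cases i) (auto simp: Tor_cycles_def a_kernel_def kernel_def)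
  have "?Z = {t \<in> carrier (Tor_chain R M X i). ?d (crd i t) \<in> {\<zero>\<^bsub>sum_module X (lower bas i)\<^esub>}}"
    using Zc Tor_cycles_iff by auto
  then have Z: "submodule ?Z R (Tor_chain R M X i)"
    using submodule_vimage[OF module_Tor_chain X.module_sum_module linear_map_comp[OF linear_crd lp]
        Sl.submodule_singleton_zero] by (rule ssubst)
  have H: "submodule ?H R (Tor_chain R M X i)"
    by (rule submodule_image[OF module_Tor_chain module_Tor_chain linear_Tor_diff T'.carrier_is_submodule])
  have dd: "?d (?d v) = (\<lambda>_. \<zero>\<^bsub>X\<^esub>)" if v: "v \<in> carrier (sum_module X (bas (Suc i)))" for v
  proof -
    have cl: "(\<lambda>b. free_extension R (res_boundary R) (res_boundary R b)) \<in> bas (Suc i) \<rightarrow> carrier (free_module R (lower bas i))"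
      using linear_map_closed[OF linear_map_free_extension[OF M.R.is_cring res_boundary_Pi[OF M]]] res_boundary_Suc
      by (auto simp: Pi_iff)
    have eq0: "free_extension R (res_boundary R) (res_boundary R b) = (\<lambda>_. \<zero>)" if "b \<in> bas (Suc i)" for b
      using res_diff_boundary[OF M that] unfolding res_diff_eq .
    have zero: "linear_map R (sum_module X (bas (Suc i))) (sum_module X (lower bas i)) (\<lambda>_. \<zero>\<^bsub>sum_module X (lower bas i)\<^esub>)"
      by (rule linear_mapI) (use Sl.M.zero_closed Sl.M.l_zero[OF Sl.M.zero_closed] Sl.smult_r_null in \<open>auto simp del: sum_module_simps\<close>)
    have "?d (?d v) = pushforward X (\<lambda>b. free_extension R (res_boundary R) (res_boundary R b)) v"
      by (rule X.pushforward_comp[OF res_boundary_Suc res_boundary_Pi[OF M] v])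
    also have "\<dots> = \<zero>\<^bsub>sum_module X (lower bas i)\<^esub>"
    proof (rule X.sum_module_linear_eq[OF X.module_sum_module X.linear_map_pushforward[OF cl] zero _ v])
      fix b x assume b: "b \<in> bas (Suc i)" and x: "x \<in> carrier X"
      show "pushforward X (\<lambda>b. free_extension R (res_boundary R) (res_boundary R b)) (sum_single X b x) =
          \<zero>\<^bsub>sum_module X (lower bas i)\<^esub>"
        unfolding X.pushforward_single[OF cl b x] eq0[OF b] using x by (simp add: scale_vector_def)
    qed
    finally show ?thesis by simp
  qed
  have HZ: "?H \<subseteq> ?Z"
  proof
    fix t assume "t \<in> ?H"
    then obtain s where s: "s \<in> carrier (Tor_chain R M X (Suc i))" "t = Tor_diff R M X i s" by blast
    have t: "t \<in> carrier (Tor_chain R M X i)" unfolding s(2) by (rule linear_map_closed[OF linear_Tor_diff s(1)])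
    have "?d (crd i t) = (\<lambda>_. \<zero>\<^bsub>X\<^esub>)"
      unfolding s(2) crd_Tor_diff[OF s(1)] by (rule dd[OF linear_map_closed[OF linear_crd s(1)]])
    then show "t \<in> ?Z" using Tor_cycles_iff[OF t] by blast
  qed
  \<comment> \<open>Coordinates are bijective in each degree: surjectivity in degree Suc i provides
    a chain with coordinates v, and injectivity in degree i identifies its boundary with t.\<close>
  have memH: "t \<in> ?H \<longleftrightarrow> (\<exists>v\<in>carrier (sum_module X (bas (Suc i))). crd i t = ?d v)"
    if t: "t \<in> carrier (Tor_chain R M X i)" for t
  proof
    assume "t \<in> ?H"
    then obtain s where s: "t = Tor_diff R M X i s" "s \<in> carrier (Tor_chain R M X (Suc i))" by (rule imageE)
    show "\<exists>v\<in>carrier (sum_module X (bas (Suc i))). crd i t = ?d v"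
      unfolding s(1) crd_Tor_diff[OF s(2)] by (rule bexI[OF refl linear_map_closed[OF linear_crd s(2)]])
  next
    assume "\<exists>v\<in>carrier (sum_module X (bas (Suc i))). crd i t = ?d v"
    then obtain v where v: "v \<in> carrier (sum_module X (bas (Suc i)))" "crd i t = ?d v" by (rule bexE)
    have "v \<in> crd (Suc i) ` carrier (Tor_chain R M X (Suc i))"
      unfolding bij_betw_imp_surj_on[OF bij_crd] by (rule v(1))
    then obtain s where s: "v = crd (Suc i) s" "s \<in> carrier (Tor_chain R M X (Suc i))" by (rule imageE)
    have "crd i t = crd i (Tor_diff R M X i s)" unfolding crd_Tor_diff[OF s(2)] v(2) s(1) ..
    then have "t = Tor_diff R M X i s"
      by (rule inj_onD[OF bij_betw_imp_inj_on[OF bij_crd] _ t linear_map_closed[OF linear_Tor_diff s(2)]])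
    then show "t \<in> ?H" using imageI[OF s(2)] by (rule ssubst)
  qed
  have eq: "{r \<in> carrier R. r \<odot>\<^bsub>Tor_chain R M X i\<^esub> t \<in> ?H} =
     {r \<in> carrier R. \<exists>v\<in>carrier (sum_module X (bas (Suc i))). (\<lambda>b. r \<odot>\<^bsub>X\<^esub> crd i t b) = ?d v}"
    if t: "t \<in> carrier (Tor_chain R M X i)" for t
  proof (rule Collect_cong, rule conj_cong[OF refl])
    fix r assume r: "r \<in> carrier R"
    show "r \<odot>\<^bsub>Tor_chain R M X i\<^esub> t \<in> ?H \<longleftrightarrow> (\<exists>v\<in>carrier (sum_module X (bas (Suc i))). (\<lambda>b. r \<odot>\<^bsub>X\<^esub> crd i t b) = ?d v)"
      unfolding memH[OF T.smult_closed[OF r t]] linear_map_smult[OF linear_crd r t] by simp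
  qed
  have "Ass R (Tor R i M X) = {P. primeideal P R \<and> (\<exists>t\<in>?Z. P = {r \<in> carrier R. r \<odot>\<^bsub>Tor_chain R M X i\<^esub> t \<in> ?H})}"
    unfolding Tor_def by (rule Ass_subquotient[OF module_Tor_chain Z H HZ])
  also have "\<dots> = tor_primes R X (bas i) (bas (Suc i)) (res_boundary R)"
  proof (intro equalityI subsetI)
    fix P assume "P \<in> {P. primeideal P R \<and> (\<exists>t\<in>?Z. P = {r \<in> carrier R. r \<odot>\<^bsub>Tor_chain R M X i\<^esub> t \<in> ?H})}"
    then obtain t where P: "primeideal P R" and t: "t \<in> ?Z" and Pt: "P = {r \<in> carrier R. r \<odot>\<^bsub>Tor_chain R M X i\<^esub> t \<in> ?H}"
      by blast
    have tc: "t \<in> carrier (Tor_chain R M X i)" using t Zc by blast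
    show "P \<in> tor_primes R X (bas i) (bas (Suc i)) (res_boundary R)"
      unfolding tor_primes_def
      using P Pt[unfolded eq[OF tc]] iffD1[OF Tor_cycles_iff[OF tc] t] linear_map_closed[OF linear_crd tc]
      by (intro CollectI conjI bexI[of _ "crd i t"])
  next
    fix P assume "P \<in> tor_primes R X (bas i) (bas (Suc i)) (res_boundary R)"
    then obtain u where P: "primeideal P R" and u: "u \<in> carrier (sum_module X (bas i))" "?d u = (\<lambda>_. \<zero>\<^bsub>X\<^esub>)"
      and Pu: "P = {r \<in> carrier R. \<exists>v\<in>carrier (sum_module X (bas (Suc i))). (\<lambda>b. r \<odot>\<^bsub>X\<^esub> u b) = ?d v}"
      unfolding tor_primes_def by blast
    have "u \<in> crd i ` carrier (Tor_chain R M X i)"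
      unfolding bij_betw_imp_surj_on[OF bij_crd] by (rule u(1))
    then obtain t where t: "u = crd i t" "t \<in> carrier (Tor_chain R M X i)" by (rule imageE)
    have "t \<in> ?Z" using Tor_cycles_iff[OF t(2)] u(2) t(1) by blast
    moreover have "P = {r \<in> carrier R. r \<odot>\<^bsub>Tor_chain R M X i\<^esub> t \<in> ?H}" unfolding eq[OF t(2)] Pu t(1) ..
    ultimately show "P \<in> {P. primeideal P R \<and> (\<exists>t\<in>?Z. P = {r \<in> carrier R. r \<odot>\<^bsub>Tor_chain R M X i\<^esub> t \<in> ?H})}"
      using P by blast
  qed
  finally show ?thesis .
qed

end

section \<open>Powers of ideals acting on direct sums\<close>

definition sum_submodule :: "('a, 'm, 'e) module_scheme \<Rightarrow> 'b set \<Rightarrow> 'm set \<Rightarrow> ('b \<Rightarrow> 'm) set" where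
  "sum_submodule N B H = {u \<in> carrier (sum_module N B). \<forall>b. u b \<in> H}"

lemma (in module) submodule_sum_submodule:
  assumes H: "submodule H R M"
  shows "submodule (sum_submodule M B H) R (sum_module M B)"
proof -
  interpret S: module R "sum_module M B" by (rule module_sum_module)
  show ?thesis unfolding sum_submodule_def
    by (rule S.submoduleI')
       (use S.M.zero_closed S.M.a_closed S.smult_closed submodule_zero_closed[OF H] submoduleE(4,5)[OF H] in auto)
qed

context graded_generators
begin

lemma ideal_power_submodule:
  "module R Z \<Longrightarrow> submodule D R Z \<Longrightarrow> submodule C R Z \<Longrightarrow> submodule (ideal_power Z D C n) R Z"
  unfolding ideal_power_def by (rule monomial_span_submodule)

lemma ideal_power_least:
  assumes Z: "module R Z" and H: "submodule H R Z" and "D \<subseteq> H"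
    and gen: "\<And>e c. e \<in> exponents n \<Longrightarrow> c \<in> C \<Longrightarrow> monomial e \<odot>\<^bsub>Z\<^esub> c \<in> H"
  shows "ideal_power Z D C n \<subseteq> H"
  unfolding ideal_power_def monomial_span_def
  by (rule module.submodule_span_least[OF Z H]) (use assms(3) gen in blast)

lemma ideal_power_linear_image:
  assumes Y: "module R Y" and Z: "module R Z" and C: "submodule C R Y" and C': "submodule C' R Z"
    and f: "linear_map R Y Z f" and fC: "f ` C \<subseteq> C'"
    and x: "x \<in> ideal_power Y {\<zero>\<^bsub>Y\<^esub>} C n"
  shows "f x \<in> ideal_power Z {\<zero>\<^bsub>Z\<^esub>} C' n"
proof -
  interpret Y: module R Y by fact
  interpret Z: module R Z by fact
  note D0 = Z.submodule_singleton_zero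
  let ?H = "{y \<in> carrier Y. f y \<in> ideal_power Z {\<zero>\<^bsub>Z\<^esub>} C' n}"
  have "ideal_power Y {\<zero>\<^bsub>Y\<^esub>} C n \<subseteq> ?H"
  proof (rule ideal_power_least[OF Y submodule_vimage[OF Y Z f ideal_power_submodule[OF Z D0 C']]])
    show "{\<zero>\<^bsub>Y\<^esub>} \<subseteq> ?H"
      using linear_map_zero[OF Y Z f] Z.submodule_zero_closed[OF ideal_power_submodule[OF Z D0 C']] by simp
    fix e c assume e: "e \<in> exponents n" and c: "c \<in> C"
    have cY: "c \<in> carrier Y" using c Y.submoduleE(1)[OF C] by blast
    have "f (monomial e \<odot>\<^bsub>Y\<^esub> c) = monomial e \<odot>\<^bsub>Z\<^esub> f c" by (rule linear_map_smult[OF f monomial_closed cY])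
    also have "\<dots> \<in> ideal_power Z {\<zero>\<^bsub>Z\<^esub>} C' n"
      unfolding ideal_power_def by (rule monomial_span_gen[OF Z D0 C' e]) (use fC c in blast)
    finally show "monomial e \<odot>\<^bsub>Y\<^esub> c \<in> ?H" using cY by simp
  qed
  then show ?thesis using x by blast
qed

text \<open>Linear maps carry ideal powers into ideal powers
  (\<open>ideal_power_linear_image\<close>). Applied to coordinate projections this gives one
  direction; applied to the inclusions of summands it gives the other, as every element is a finite
  sum of its components.\<close>

lemma ideal_power_sum_module:
  assumes N: "module R N" and H: "submodule H R N" and u: "u \<in> carrier (sum_module N B)"
  shows "u \<in> ideal_power (sum_module N B) {\<lambda>_. \<zero>\<^bsub>N\<^esub>} (sum_submodule N B H) n \<longleftrightarrow>
    (\<forall>b. u b \<in> ideal_power N {\<zero>\<^bsub>N\<^esub>} H n)"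
proof
  interpret N: module R N by fact
  note S = N.module_sum_module and SH = N.submodule_sum_submodule[OF H]
  assume "u \<in> ideal_power (sum_module N B) {\<lambda>_. \<zero>\<^bsub>N\<^esub>} (sum_submodule N B H) n"
  then have u': "u \<in> ideal_power (sum_module N B) {\<zero>\<^bsub>sum_module N B\<^esub>} (sum_submodule N B H) n" by simp
  have "(\<lambda>u. u b) ` sum_submodule N B H \<subseteq> H" for b by (auto simp: sum_submodule_def)
  from ideal_power_linear_image[OF S N SH H N.linear_map_sum_component this u']
  show "\<forall>b. u b \<in> ideal_power N {\<zero>\<^bsub>N\<^esub>} H n" by blast
next
  interpret N: module R N by fact
  interpret S: module R "sum_module N B" by (rule N.module_sum_module)
  note SH = N.submodule_sum_submodule[OF H, of B]
  let ?P = "ideal_power (sum_module N B) {\<zero>\<^bsub>sum_module N B\<^esub>} (sum_submodule N B H) n"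
  let ?Y = "ideal_power N {\<zero>\<^bsub>N\<^esub>} H n"
  have P: "submodule ?P R (sum_module N B)"
    by (rule ideal_power_submodule[OF S.module_axioms S.submodule_singleton_zero SH])
  have Y: "submodule ?Y R N" by (rule ideal_power_submodule[OF N N.submodule_singleton_zero H])
  have single: "sum_single N b y \<in> ?P" if "b \<in> B" "y \<in> ?Y" for b y
  proof (rule ideal_power_linear_image[OF N S.module_axioms H SH N.linear_map_sum_single[OF that(1)] _ that(2)])
    have "sum_single N b h \<in> sum_submodule N B H" if "h \<in> H" for h
      using N.sum_single_closed[OF \<open>b \<in> B\<close>, of h] N.submoduleE(1)[OF H] N.submodule_zero_closed[OF H] that
      by (auto simp: sum_submodule_def sum_single_def)
    then show "sum_single N b ` H \<subseteq> sum_submodule N B H" by blast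
  qed
  have "(\<forall>b. u b \<in> ?Y) \<longrightarrow> u \<in> ?P"
    using u
  proof (induction rule: N.sum_module_induct)
    case zero
    show ?case using S.submodule_zero_closed[OF P] by simp
  next
    case (add b u)
    show ?case
    proof
      assume uY: "\<forall>b. u b \<in> ?Y"
      have "(\<lambda>c. if c = b then \<zero>\<^bsub>N\<^esub> else u c) \<in> ?P"
        using add.IH uY N.submodule_zero_closed[OF Y] by simp
      from S.submoduleE(5)[OF P single[OF add.hyps(1), of "u b"] this] uY
      show "u \<in> ?P" using add.hyps(5) by metis
    qed
  qed
  moreover assume "\<forall>b. u b \<in> ?Y"
  ultimately show "u \<in> ideal_power (sum_module N B) {\<lambda>_. \<zero>\<^bsub>N\<^esub>} (sum_submodule N B H) n" by simp
qed

lemma ideal_power_decompose: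
  assumes Z: "module R Z" and D: "submodule D R Z" and C: "submodule C R Z"
  shows "x \<in> ideal_power Z D C n \<longleftrightarrow> (\<exists>d\<in>D. \<exists>y\<in>ideal_power Z {\<zero>\<^bsub>Z\<^esub>} C n. x = d \<oplus>\<^bsub>Z\<^esub> y)"
proof
  interpret Z: module R Z by fact
  note D0 = Z.submodule_singleton_zero
  let ?G = "{\<zero>\<^bsub>Z\<^esub>} \<union> {monomial e \<odot>\<^bsub>Z\<^esub> c | e c. e \<in> exponents n \<and> c \<in> C}"
  assume x: "x \<in> ideal_power Z D C n"
  have "D \<union> {monomial e \<odot>\<^bsub>Z\<^esub> c | e c. e \<in> exponents n \<and> c \<in> C} = D \<union> ?G"
    using Z.submodule_zero_closed[OF D] by blast
  then have "x \<in> submodule_span R Z (D \<union> ?G)" using x unfolding ideal_power_def monomial_span_def by simp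
  then obtain d y where "d \<in> submodule_span R Z D" "y \<in> submodule_span R Z ?G" "x = d \<oplus>\<^bsub>Z\<^esub> y"
    by (rule Z.submodule_span_Un[OF Z.submoduleE(1)[OF D] monomial_span_gens[OF Z D0 C]])
  then show "\<exists>d\<in>D. \<exists>y\<in>ideal_power Z {\<zero>\<^bsub>Z\<^esub>} C n. x = d \<oplus>\<^bsub>Z\<^esub> y"
    unfolding Z.submodule_span_self[OF D] ideal_power_def monomial_span_def by blast
next
  interpret Z: module R Z by fact
  note P = ideal_power_submodule[OF Z D C, of n]
  assume "\<exists>d\<in>D. \<exists>y\<in>ideal_power Z {\<zero>\<^bsub>Z\<^esub>} C n. x = d \<oplus>\<^bsub>Z\<^esub> y"
  then obtain d y where dy: "d \<in> D" "y \<in> ideal_power Z {\<zero>\<^bsub>Z\<^esub>} C n" "x = d \<oplus>\<^bsub>Z\<^esub> y" by blast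
  have "ideal_power Z {\<zero>\<^bsub>Z\<^esub>} C n \<subseteq> ideal_power Z D C n"
  proof (rule ideal_power_least[OF Z P])
    show "{\<zero>\<^bsub>Z\<^esub>} \<subseteq> ideal_power Z D C n" using Z.submodule_zero_closed[OF P] by simp
    show "monomial e \<odot>\<^bsub>Z\<^esub> c \<in> ideal_power Z D C n" if "e \<in> exponents n" "c \<in> C" for e c
      unfolding ideal_power_def by (rule monomial_span_gen[OF Z D C that])
  qed
  then show "x \<in> ideal_power Z D C n"
    using Z.submoduleE(5)[OF P, of d y] ideal_power_base[OF Z D C] dy by blast
qed

text \<open>This brings \<open>homology_primes\<close> into the coordinate form in which
  \<open>ext_primes_quotient\<close> and \<open>tor_primes_quotient\<close> state their results; H
  is the submodule multiplied by the ideals in each coordinate.\<close>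

lemma homology_primes_sum_module:
  assumes N: "module R N" and H: "submodule H R N" and "finite B"
    and g: "linear_map R (sum_module N B) (sum_module N C) g"
    and g': "linear_map R (sum_module N L) (sum_module N B) g'"
  shows "homology_primes (sum_module N B) (sum_module N C) g (sum_submodule N C H)
      (g' ` carrier (sum_module N L)) (sum_submodule N B H) n =
    {P. primeideal P R \<and> (\<exists>u\<in>carrier (sum_module N B).
      (\<forall>c. g u c \<in> ideal_power N {\<zero>\<^bsub>N\<^esub>} H n) \<and>
      P = {r \<in> carrier R. \<exists>v\<in>carrier (sum_module N L). \<forall>b\<in>B.
        \<exists>y\<in>ideal_power N {\<zero>\<^bsub>N\<^esub>} H n. r \<odot>\<^bsub>N\<^esub> u b = y \<oplus>\<^bsub>N\<^esub> g' v b})}"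
proof -
  interpret N: module R N by fact
  interpret SB: module R "sum_module N B" by (rule N.module_sum_module)
  interpret SL: module R "sum_module N L" by (rule N.module_sum_module)
  let ?Y = "ideal_power N {\<zero>\<^bsub>N\<^esub>} H n"
  note SH = N.submodule_sum_submodule[OF H]
  have D: "submodule (g' ` carrier (sum_module N L)) R (sum_module N B)"
    by (rule submodule_image[OF SL.module_axioms SB.module_axioms g' SL.carrier_is_submodule])
  have Y: "submodule ?Y R N" by (rule ideal_power_submodule[OF N N.submodule_singleton_zero H])
  have Yc: "?Y \<subseteq> carrier N" by (rule N.submoduleE(1)[OF Y])
  have 1: "g u \<in> ideal_power (sum_module N C) {\<zero>\<^bsub>sum_module N C\<^esub>} (sum_submodule N C H) n \<longleftrightarrow> (\<forall>c. g u c \<in> ?Y)"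
    if u: "u \<in> carrier (sum_module N B)" for u
    using ideal_power_sum_module[OF N H linear_map_closed[OF g u]] by simp
  have 2: "w \<in> ideal_power (sum_module N B) (g' ` carrier (sum_module N L)) (sum_submodule N B H) n \<longleftrightarrow>
      (\<exists>v\<in>carrier (sum_module N L). \<forall>b\<in>B. \<exists>y\<in>?Y. w b = y \<oplus>\<^bsub>N\<^esub> g' v b)"
    if w: "w \<in> carrier (sum_module N B)" for w
  proof
    assume "w \<in> ideal_power (sum_module N B) (g' ` carrier (sum_module N L)) (sum_submodule N B H) n"
    then obtain v y where v: "v \<in> carrier (sum_module N L)" and wv: "w = g' v \<oplus>\<^bsub>sum_module N B\<^esub> y"
      and y: "y \<in> ideal_power (sum_module N B) {\<zero>\<^bsub>sum_module N B\<^esub>} (sum_submodule N B H) n"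
      unfolding ideal_power_decompose[OF SB.module_axioms D SH] by blast
    have yc: "y \<in> carrier (sum_module N B)"
      using y SB.submoduleE(1)[OF ideal_power_submodule[OF SB.module_axioms SB.submodule_singleton_zero SH]] by blast
    have yY: "y b \<in> ?Y" for b using y ideal_power_sum_module[OF N H yc] by simp
    have "w b = y b \<oplus>\<^bsub>N\<^esub> g' v b" for b
      using wv linear_map_closed[OF g' v] yc by (simp add: carrier_sum_module N.M.a_comm)
    then show "\<exists>v\<in>carrier (sum_module N L). \<forall>b\<in>B. \<exists>y\<in>?Y. w b = y \<oplus>\<^bsub>N\<^esub> g' v b" using v yY by blast
  next
    assume "\<exists>v\<in>carrier (sum_module N L). \<forall>b\<in>B. \<exists>y\<in>?Y. w b = y \<oplus>\<^bsub>N\<^esub> g' v b"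
    then obtain v where v: "v \<in> carrier (sum_module N L)" "\<forall>b\<in>B. \<exists>y\<in>?Y. w b = y \<oplus>\<^bsub>N\<^esub> g' v b" by blast
    from bchoice[OF v(2)[unfolded Bex_def]] obtain y0 where
      y0: "\<forall>b\<in>B. y0 b \<in> ?Y \<and> w b = y0 b \<oplus>\<^bsub>N\<^esub> g' v b" by blast
    \<comment> \<open>The correction terms are given on B only; extended by zero they form an
      element of the direct sum, its support being contained in the finite set B.\<close>
    define y where "y = (\<lambda>b. if b \<in> B then y0 b else \<zero>\<^bsub>N\<^esub>)"
    have yY: "y b \<in> ?Y" for b using y0 N.submodule_zero_closed[OF Y] by (simp add: y_def)
    have yc: "y \<in> carrier (sum_module N B)"
      by (rule sum_module_finiteI[OF assms(3)]) (use y0 Yc in \<open>auto simp: y_def\<close>)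
    then have yP: "y \<in> ideal_power (sum_module N B) {\<zero>\<^bsub>sum_module N B\<^esub>} (sum_submodule N B H) n"
      using ideal_power_sum_module[OF N H yc] yY by simp
    note gv = linear_map_closed[OF g' v(1)]
    have "w b = g' v b \<oplus>\<^bsub>N\<^esub> y b" for b
    proof (cases "b \<in> B")
      case True
      then have "w b = y b \<oplus>\<^bsub>N\<^esub> g' v b" using y0 by (simp add: y_def)
      then show ?thesis using gv yc by (simp add: carrier_sum_module N.M.a_comm)
    next
      case False
      then show ?thesis using w gv by (simp add: carrier_sum_module y_def)
    qed
    then have "w = g' v \<oplus>\<^bsub>sum_module N B\<^esub> y" by (simp add: fun_eq_iff)
    then show "w \<in> ideal_power (sum_module N B) (g' ` carrier (sum_module N L)) (sum_submodule N B H) n"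
      unfolding ideal_power_decompose[OF SB.module_axioms D SH] using yP v(1) by blast
  qed
  have 3: "{r \<in> carrier R. r \<odot>\<^bsub>sum_module N B\<^esub> u \<in>
        ideal_power (sum_module N B) (g' ` carrier (sum_module N L)) (sum_submodule N B H) n} =
      {r \<in> carrier R. \<exists>v\<in>carrier (sum_module N L). \<forall>b\<in>B. \<exists>y\<in>?Y. r \<odot>\<^bsub>N\<^esub> u b = y \<oplus>\<^bsub>N\<^esub> g' v b}"
    if u: "u \<in> carrier (sum_module N B)" for u
    by (rule Collect_cong, rule conj_cong[OF refl]) (use 2[OF SB.smult_closed[OF _ u]] in simp)
  show ?thesis unfolding homology_primes_def
    by (rule Collect_cong, rule conj_cong[OF refl], rule bex_cong[OF refl]) (simp only: 1 3)
qed

end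

section \<open>The action of products of ideals\<close>

context module
begin

lemma ideal_smult_gens:
  assumes "ideal I R" "H \<subseteq> carrier M"
  shows "{a \<odot>\<^bsub>M\<^esub> x | a x. a \<in> I \<and> x \<in> H} \<subseteq> carrier M"
  using assms ideal.Icarr[OF assms(1)] by blast

lemma submodule_ideal_smult:
  assumes "ideal I R" "H \<subseteq> carrier M"
  shows "submodule (ideal_smult R M I H) R M"
  unfolding ideal_smult_def by (rule submodule_span_submodule[OF ideal_smult_gens[OF assms]])

lemma ideal_smult_mem: "r \<in> I \<Longrightarrow> x \<in> H \<Longrightarrow> r \<odot>\<^bsub>M\<^esub> x \<in> ideal_smult R M I H"
  unfolding ideal_smult_def by (rule subsetD[OF submodule_span_incl]) blast

lemma ideal_smult_least:
  assumes "submodule K R M" "\<And>r x. r \<in> I \<Longrightarrow> x \<in> H \<Longrightarrow> r \<odot>\<^bsub>M\<^esub> x \<in> K"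
  shows "ideal_smult R M I H \<subseteq> K"
  unfolding ideal_smult_def by (rule submodule_span_least[OF assms(1)]) (use assms(2) in blast)

text \<open>On products i j the claim is associativity of scalar multiplication, and sums follow.
  Conversely, for fixed i the elements that i moves into the left-hand side form a submodule, and it
  contains all j x.\<close>

lemma ideal_smult_prod:
  assumes I: "ideal I R" and J: "ideal J R" and H: "submodule H R M"
  shows "ideal_smult R M (ideal_prod R I J) H = ideal_smult R M I (ideal_smult R M J H)"
proof
  have Hc: "H \<subseteq> carrier M" by (rule submoduleE(1)[OF H])
  note JH = submodule_ideal_smult[OF J Hc]
  note IJH = submodule_ideal_smult[OF I submoduleE(1)[OF JH]]
  have IJ: "ideal (ideal_prod R I J) R" by (rule R.ideal_prod_is_ideal[OF I J])
  show "ideal_smult R M (ideal_prod R I J) H \<subseteq> ideal_smult R M I (ideal_smult R M J H)"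
  proof (rule ideal_smult_least[OF IJH])
    fix r x assume r: "r \<in> ideal_prod R I J" and x: "x \<in> H"
    have xc: "x \<in> carrier M" using x Hc by blast
    from r show "r \<odot>\<^bsub>M\<^esub> x \<in> ideal_smult R M I (ideal_smult R M J H)"
    proof induction
      case (prod i j)
      have "i \<in> carrier R" "j \<in> carrier R" using prod ideal.Icarr[OF I] ideal.Icarr[OF J] by blast+
      then have "(i \<otimes>\<^bsub>R\<^esub> j) \<odot>\<^bsub>M\<^esub> x = i \<odot>\<^bsub>M\<^esub> (j \<odot>\<^bsub>M\<^esub> x)" using xc by (simp add: smult_assoc1)
      then show ?case using ideal_smult_mem[OF prod(1) ideal_smult_mem[OF prod(2) x]] by simp
    next
      case (sum s t)
      have "s \<in> carrier R" "t \<in> carrier R" using sum(1,2) ideal.Icarr[OF IJ] by blast+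
      then have "(s \<oplus>\<^bsub>R\<^esub> t) \<odot>\<^bsub>M\<^esub> x = s \<odot>\<^bsub>M\<^esub> x \<oplus>\<^bsub>M\<^esub> t \<odot>\<^bsub>M\<^esub> x" using xc by (simp add: smult_l_distr)
      then show ?case using submoduleE(5)[OF IJH sum.IH] by simp
    qed
  qed
  note P = submodule_ideal_smult[OF IJ Hc]
  show "ideal_smult R M I (ideal_smult R M J H) \<subseteq> ideal_smult R M (ideal_prod R I J) H"
  proof (rule ideal_smult_least[OF P])
    fix i y assume i: "i \<in> I" and y: "y \<in> ideal_smult R M J H"
    have ic: "i \<in> carrier R" using i ideal.Icarr[OF I] by blast
    have "ideal_smult R M J H \<subseteq> {y \<in> carrier M. i \<odot>\<^bsub>M\<^esub> y \<in> ideal_smult R M (ideal_prod R I J) H}"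
    proof (rule ideal_smult_least[OF submodule_vimage[OF module_axioms module_axioms linear_map_scale[OF ic] P]])
      fix j x assume j: "j \<in> J" and x: "x \<in> H"
      have c: "j \<in> carrier R" "x \<in> carrier M" using j x ideal.Icarr[OF J] Hc by blast+
      have "i \<odot>\<^bsub>M\<^esub> (j \<odot>\<^bsub>M\<^esub> x) = (i \<otimes>\<^bsub>R\<^esub> j) \<odot>\<^bsub>M\<^esub> x" using ic c by (simp add: smult_assoc1)
      then show "j \<odot>\<^bsub>M\<^esub> x \<in> {y \<in> carrier M. i \<odot>\<^bsub>M\<^esub> y \<in> ideal_smult R M (ideal_prod R I J) H}"
        using ideal_smult_mem[OF ideal_prod.prod[OF i j] x] c by simp
    qed
    then show "i \<odot>\<^bsub>M\<^esub> y \<in> ideal_smult R M (ideal_prod R I J) H" using y by blast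
  qed
qed

lemma ideal_smult_carrier:
  assumes H: "submodule H R M"
  shows "ideal_smult R M (carrier R) H = H"
proof
  show "ideal_smult R M (carrier R) H \<subseteq> H"
    by (rule ideal_smult_least[OF H]) (rule submoduleE(4)[OF H])
  have "\<one>\<^bsub>R\<^esub> \<odot>\<^bsub>M\<^esub> x \<in> ideal_smult R M (carrier R) H" if "x \<in> H" for x
    by (rule ideal_smult_mem[OF R.one_closed that])
  then show "H \<subseteq> ideal_smult R M (carrier R) H" using smult_one subsetD[OF submoduleE(1)[OF H]] by (metis subsetI)
qed

end

lemma (in cring) ideals_set_simps:
  "carrier (ideals_set R) = {I. ideal I R}" "\<one>\<^bsub>ideals_set R\<^esub> = carrier R" "I \<otimes>\<^bsub>ideals_set R\<^esub> J = ideal_prod R I J"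
  by (simp_all add: ideals_set_def)

lemma (in cring) ideal_multipower_ideal:
  assumes "\<forall>j\<in>{1..t}. ideal (I j) R"
  shows "ideal (ideal_multipower R t I n) R"
proof -
  interpret IS: comm_monoid "ideals_set R" by (rule ideals_set_is_comm_monoid)
  have "ideal_multipower R t I n \<in> carrier (ideals_set R)"
    unfolding ideal_multipower_def
    by (intro IS.finprod_closed Pi_I IS.nat_pow_closed) (use assms in \<open>simp add: ideals_set_simps\<close>)
  then show ?thesis by (simp add: ideals_set_simps)
qed

lemma (in cring) ideal_multipower_Suc:
  assumes I: "\<forall>j\<in>{1..t}. ideal (I j) R" and j: "j \<in> {1..t}"
  shows "ideal_multipower R t I (n(j := Suc (n j))) = ideal_prod R (I j) (ideal_multipower R t I n)"
proof -
  interpret IS: comm_monoid "ideals_set R" by (rule ideals_set_is_comm_monoid)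
  have Ic: "I i \<in> carrier (ideals_set R)" if "i \<in> {1..t}" for i using bspec[OF I that] by (simp add: ideals_set_simps)
  have pw: "I i [^]\<^bsub>ideals_set R\<^esub> n i \<in> carrier (ideals_set R)" if "i \<in> {1..t}" for i
    by (rule IS.nat_pow_closed[OF Ic[OF that]])
  \<comment> \<open>The extra factor I j is written as a product over all indices that is the unit
    except at j; then the product can be split factor by factor.\<close>
  have "ideal_multipower R t I (n(j := Suc (n j))) =
      (\<Otimes>\<^bsub>ideals_set R\<^esub>i\<in>{1..t}. (if i = j then I i else \<one>\<^bsub>ideals_set R\<^esub>) \<otimes>\<^bsub>ideals_set R\<^esub> I i [^]\<^bsub>ideals_set R\<^esub> n i)"
    unfolding ideal_multipower_def
  proof (rule IS.finprod_cong')
    show "(\<lambda>i. (if i = j then I i else \<one>\<^bsub>ideals_set R\<^esub>) \<otimes>\<^bsub>ideals_set R\<^esub> I i [^]\<^bsub>ideals_set R\<^esub> n i) \<in> {1..t} \<rightarrow> carrier (ideals_set R)"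
      using Ic pw by auto
    fix i assume i: "i \<in> {1..t}"
    show "I i [^]\<^bsub>ideals_set R\<^esub> (n(j := Suc (n j))) i =
        (if i = j then I i else \<one>\<^bsub>ideals_set R\<^esub>) \<otimes>\<^bsub>ideals_set R\<^esub> I i [^]\<^bsub>ideals_set R\<^esub> n i"
      using Ic[OF i] pw[OF i] IS.m_comm[OF Ic[OF i] pw[OF i]] by auto
  qed simp
  also have "\<dots> = (\<Otimes>\<^bsub>ideals_set R\<^esub>i\<in>{1..t}. if i = j then I i else \<one>\<^bsub>ideals_set R\<^esub>) \<otimes>\<^bsub>ideals_set R\<^esub>
      ideal_multipower R t I n"
    unfolding ideal_multipower_def by (rule IS.finprod_multf) (use Ic pw in auto)
  also have "(\<Otimes>\<^bsub>ideals_set R\<^esub>i\<in>{1..t}. if i = j then I i else \<one>\<^bsub>ideals_set R\<^esub>) = I j"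
    by (rule IS.finprod_singleton_swap[OF j]) (use Ic in auto)
  finally show ?thesis unfolding ideals_set_simps .
qed

context graded_generators
begin

text \<open>One inclusion splits a factor of colour j off each monomial. For the other, the r with r
  x in the power at j + m form an ideal, and it contains the generators of colour j.\<close>

lemma ideal_power_add_mset:
  assumes N: "module R N" and H: "submodule H R N"
  shows "ideal_power N {\<zero>\<^bsub>N\<^esub>} H (add_mset j m) =
    ideal_smult R N (Idl (a ` {v \<in> V. col v = j})) (ideal_power N {\<zero>\<^bsub>N\<^esub>} H m)"
proof
  interpret N: module R N by fact
  let ?Y = "ideal_power N {\<zero>\<^bsub>N\<^esub>} H" and ?I = "Idl (a ` {v \<in> V. col v = j})"
  note D0 = N.submodule_singleton_zero
  note Y = ideal_power_submodule[OF N D0 H]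
  have Yc: "?Y n \<subseteq> carrier N" for n by (rule N.submoduleE(1)[OF Y])
  have A: "a ` {v \<in> V. col v = j} \<subseteq> carrier R" using a_closed by blast
  note I = genideal_ideal[OF A]
  note IY = N.submodule_ideal_smult[OF I Yc]
  show "?Y (add_mset j m) \<subseteq> ideal_smult R N ?I (?Y m)"
  proof (rule ideal_power_least[OF N IY])
    show "{\<zero>\<^bsub>N\<^esub>} \<subseteq> ideal_smult R N ?I (?Y m)" using N.submodule_zero_closed[OF IY] by simp
    fix e c assume e: "e \<in> exponents (add_mset j m)" and c: "c \<in> H"
    obtain v f where f: "e = add_mset v f" "col v = j" "image_mset col f = m"
      using e msed_map_invR[of col e j m] by (auto simp: exponents_def)
    then have v: "v \<in> V" "f \<in> exponents m" using e by (auto simp: exponents_def)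
    have cN: "c \<in> carrier N" using c N.submoduleE(1)[OF H] by blast
    have "monomial e = a v \<otimes> monomial f"
      using monomial_union[of "{#v#}" f] monomial_single v f by simp
    then have "monomial e \<odot>\<^bsub>N\<^esub> c = a v \<odot>\<^bsub>N\<^esub> (monomial f \<odot>\<^bsub>N\<^esub> c)"
      using v a_closed cN by (simp add: N.smult_assoc1)
    moreover have "a v \<in> ?I" using genideal_self[OF A] v f(2) by blast
    moreover have "monomial f \<odot>\<^bsub>N\<^esub> c \<in> ?Y m"
      unfolding ideal_power_def by (rule monomial_span_gen[OF N D0 H v(2) c])
    ultimately show "monomial e \<odot>\<^bsub>N\<^esub> c \<in> ideal_smult R N ?I (?Y m)" using N.ideal_smult_mem by simp
  qed
  show "ideal_smult R N ?I (?Y m) \<subseteq> ?Y (add_mset j m)"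
  proof (rule N.ideal_smult_least[OF Y])
    fix r x assume r: "r \<in> ?I" and x: "x \<in> ?Y m"
    have "a ` {v \<in> V. col v = j} \<subseteq> {r \<in> carrier R. r \<odot>\<^bsub>N\<^esub> x \<in> ?Y (add_mset j m)}"
      using graded_familyD(2)[OF graded_family_ideal_power[OF N D0 H] _ x] a_closed by blast
    moreover have "ideal {r \<in> carrier R. r \<odot>\<^bsub>N\<^esub> x \<in> ?Y (add_mset j m)} R"
      by (rule N.ideal_colon[OF Y]) (use x Yc in blast)
    ultimately have "?I \<subseteq> {r \<in> carrier R. r \<odot>\<^bsub>N\<^esub> x \<in> ?Y (add_mset j m)}"
      by (intro genideal_minimal)
    then show "r \<odot>\<^bsub>N\<^esub> x \<in> ?Y (add_mset j m)" using r by blast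
  qed
qed

lemma ideal_power_empty_eq:
  assumes N: "module R N" and H: "submodule H R N"
  shows "ideal_power N {\<zero>\<^bsub>N\<^esub>} H {#} = H"
proof
  interpret N: module R N by fact
  show "ideal_power N {\<zero>\<^bsub>N\<^esub>} H {#} \<subseteq> H"
    by (rule ideal_power_least[OF N H])
       (use N.submodule_zero_closed[OF H] N.submoduleE(4)[OF H] in auto)
qed (rule ideal_power_empty[OF N module.submodule_singleton_zero[OF N] H])

end

text \<open>The colours become natural numbers here, to match the indexing of the ideals by 1, ...,
  t.\<close>

locale nat_graded_generators = graded_generators R V a col
  for R :: "('a, 'r) ring_scheme" (structure) and V a and col :: "nat \<Rightarrow> nat"
begin

lemma ideal_smult_multipower_mset:
  assumes I: "\<forall>j\<in>{1..t}. I j = Idl (a ` {v \<in> V. col v = j})"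
    and N: "module R N" and H: "submodule H R N" and "set_mset m \<subseteq> {1..t}"
  shows "ideal_smult R N (ideal_multipower R t I (count m)) H = ideal_power N {\<zero>\<^bsub>N\<^esub>} H m"
  using assms(4)
proof (induction m)
  case empty
  interpret IS: comm_monoid "ideals_set R" by (rule ideals_set_is_comm_monoid)
  have "ideal_multipower R t I (count {#}) = carrier R"
    unfolding ideal_multipower_def ideals_set_simps(2)[symmetric] by (rule IS.finprod_one_eqI) simp
  then show ?case unfolding ideal_power_empty_eq[OF N H] by (simp only: module.ideal_smult_carrier[OF N H])
next
  case (add j m)
  interpret N: module R N by fact
  have j: "j \<in> {1..t}" using add.prems by simp
  have Iid: "\<forall>i\<in>{1..t}. ideal (I i) R"
  proof
    fix i assume "i \<in> {1..t}"
    then have "I i = Idl (a ` {v \<in> V. col v = i})" using I by blast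
    moreover have "ideal (Idl (a ` {v \<in> V. col v = i})) R" by (rule genideal_ideal) (use a_closed in blast)
    ultimately show "ideal (I i) R" by (rule ssubst)
  qed
  have "count (add_mset j m) = (count m)(j := Suc (count m j))" by (simp add: fun_eq_iff)
  then have "ideal_smult R N (ideal_multipower R t I (count (add_mset j m))) H =
      ideal_smult R N (ideal_prod R (I j) (ideal_multipower R t I (count m))) H"
    by (simp only: ideal_multipower_Suc[OF Iid j])
  also have "\<dots> = ideal_smult R N (I j) (ideal_smult R N (ideal_multipower R t I (count m)) H)"
    by (rule N.ideal_smult_prod[OF bspec[OF Iid j] ideal_multipower_ideal[OF Iid] H])
  also have "\<dots> = ideal_power N {\<zero>\<^bsub>N\<^esub>} H (add_mset j m)"
    using add bspec[OF I j] ideal_power_add_mset[OF N H] by simp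
  finally show ?case .
qed

end

text \<open>An exponent function may take any values outside 1, ..., t. They do not affect the
  product of the ideals, and cutting them off yields a finite multiset over these indices.\<close>

definition exponent_mset :: "nat \<Rightarrow> (nat \<Rightarrow> nat) \<Rightarrow> nat multiset" where
  "exponent_mset t n = (\<Sum>j\<in>{1..t}. replicate_mset (n j) j)"

lemma count_exponent_mset: "count (exponent_mset t n) j = (if j \<in> {1..t} then n j else 0)"
proof -
  have "count (exponent_mset t n) j = (\<Sum>i\<in>{1..t}. if i = j then n j else 0)"
    unfolding exponent_mset_def count_sum by (rule sum.cong) auto
  then show ?thesis by simp
qed

lemma set_exponent_mset: "set_mset (exponent_mset t n) \<subseteq> {1..t}"
proof
  fix j assume "j \<in># exponent_mset t n"
  then have "count (exponent_mset t n) j \<noteq> 0" by simp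
  then show "j \<in> {1..t}" by (simp add: count_exponent_mset split: if_splits)
qed

lemma (in nat_graded_generators) ideal_smult_multipower:
  assumes I: "\<forall>j\<in>{1..t}. I j = Idl (a ` {v \<in> V. col v = j})"
    and N: "module R N" and H: "submodule H R N"
  shows "ideal_smult R N (ideal_multipower R t I n) H = ideal_power N {\<zero>\<^bsub>N\<^esub>} H (exponent_mset t n)"
proof -
  interpret IS: comm_monoid "ideals_set R" by (rule ideals_set_is_comm_monoid)
  have Ic: "I i \<in> carrier (ideals_set R)" if "i \<in> {1..t}" for i
    unfolding bspec[OF I that] ideals_set_simps using genideal_ideal[of "a ` {v \<in> V. col v = i}"] a_closed by blast
  have "ideal_multipower R t I n = ideal_multipower R t I (count (exponent_mset t n))"
    unfolding ideal_multipower_def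
    by (rule IS.finprod_cong') (use Ic in \<open>auto simp: count_exponent_mset intro!: IS.nat_pow_closed\<close>)
  then show ?thesis using ideal_smult_multipower_mset[OF I N H set_exponent_mset] by simp
qed

text \<open>The indices enumerate the disjoint union of finite generating sets of the ideals. Pairs
  are enumerated, not ring elements, because one element may serve as a generator for several ideals
  and then needs several colours.\<close>

lemma finite_graded_generators:
  fixes I :: "nat \<Rightarrow> 'a set"
  assumes cr: "cring R" and noeth: "noetherian_ring R" and I: "\<forall>j\<in>{1..t}. ideal (I j) R"
  obtains V a col where "graded_generators R V a" "col ` V \<subseteq> {1..t}"
    "\<forall>j\<in>{1..t}. I j = genideal R (a ` {v \<in> V. col v = j})"
proof -
  have "\<forall>j\<in>{1..t}. \<exists>A. A \<subseteq> carrier R \<and> finite A \<and> I j = genideal R A"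
    using noetherian_ring.finetely_gen[OF noeth] I by blast
  from bchoice[OF this] obtain A where A: "\<And>j. j \<in> {1..t} \<Longrightarrow> A j \<subseteq> carrier R \<and> finite (A j) \<and> I j = genideal R (A j)"
    by blast
  let ?G = "Sigma {1..t} A"
  have "finite ?G" using A by blast
  then obtain f where f: "bij_betw f {0..<card ?G} ?G" using ex_bij_betw_nat_finite by blast
  define V where "V = {0..<card ?G}"
  define a where "a = (\<lambda>v. snd (f v))"
  define col where "col = (\<lambda>v. fst (f v))"
  have fG: "f v \<in> ?G" if "v \<in> V" for v using bij_betwE[OF f] that by (simp add: V_def)
  have gens: "a ` {v \<in> V. col v = j} = A j" if j: "j \<in> {1..t}" for j
  proof
    show "a ` {v \<in> V. col v = j} \<subseteq> A j" using fG by (force simp: a_def col_def)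
    show "A j \<subseteq> a ` {v \<in> V. col v = j}"
    proof
      fix x assume "x \<in> A j"
      then have "(j, x) \<in> f ` V" using bij_betw_imp_surj_on[OF f] j by (simp add: V_def)
      then obtain v where "v \<in> V" "f v = (j, x)" by auto
      then show "x \<in> a ` {v \<in> V. col v = j}" by (force simp: a_def col_def)
    qed
  qed
  show ?thesis
  proof (rule that[of V a col])
    have "a v \<in> carrier R" if "v \<in> V" for v
      using fG[OF that] A by (cases "f v") (auto simp: a_def)
    then show "graded_generators R V a"
      using cr noeth by (auto simp: graded_generators_def graded_generators_axioms_def V_def)
    show "col ` V \<subseteq> {1..t}" using fG by (force simp: col_def)
    show "\<forall>j\<in>{1..t}. I j = genideal R (a ` {v \<in> V. col v = j})"
      using A gens by simp
  qed
qed

section \<open>Lifting from the quotient\<close>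

context module
begin

context
  fixes Y assumes Y: "submodule Y R M"
begin

abbreviation (input) "quo \<equiv> quotient_module M Y"
abbreviation (input) "prj x \<equiv> Y +>\<^bsub>M\<^esub> x"

lemma quotient_lift:
  assumes "finite B" "f \<in> B \<rightarrow> carrier quo"
  obtains u where "u \<in> carrier (sum_module M B)" "\<forall>b\<in>B. f b = prj (u b)"
proof -
  have "\<forall>b\<in>B. \<exists>x. x \<in> carrier M \<and> f b = prj x"
    using assms(2) quotient_carrier[OF Y] by blast
  from bchoice[OF this] obtain u0 where u0: "\<forall>b\<in>B. u0 b \<in> carrier M \<and> f b = prj (u0 b)" by blast
  show ?thesis
    by (rule that[of "\<lambda>b. if b \<in> B then u0 b else \<zero>\<^bsub>M\<^esub>"], rule sum_module_finiteI[OF assms(1)]) (use u0 in auto)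
qed

lemma linear_extension_quotient:
  assumes u: "u \<in> B \<rightarrow> carrier M" and z: "z \<in> carrier (free_module R B)"
  shows "linear_extension R quo (\<lambda>b. prj (u b)) z = prj (linear_extension R M u z)"
proof -
  have pu: "(\<lambda>b. prj (u b)) \<in> B \<rightarrow> carrier quo" using u linear_map_closed[OF linear_map_quotient[OF Y]] by blast
  show ?thesis
    by (rule free_module_linear_eq[OF module_quotient[OF Y] linear_map_linear_extension[OF module_quotient[OF Y] pu]
          linear_map_comp[OF linear_map_linear_extension[OF module_axioms u] linear_map_quotient[OF Y]] _ z])
       (simp add: linear_extension_gen[OF module_quotient[OF Y] _ pu] linear_extension_gen[OF module_axioms _ u])
qed

text \<open>Cochains with values in M/Y and the cochains that bound their multiples are lifted to M;
  finiteness of B and L makes the lifts finitely supported. Being zero becomes membership in Y, and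
  equality becomes equality up to an element of Y.\<close>

lemma ext_primes_quotient:
  assumes fin: "finite B" "finite L" and d: "d \<in> B \<rightarrow> carrier (free_module R L)" and d': "d \<in> C \<rightarrow> carrier (free_module R B)"
  shows "ext_primes R quo L B C d =
    {P. primeideal P R \<and> (\<exists>u\<in>carrier (sum_module M B). (\<forall>c\<in>C. linear_extension R M u (d c) \<in> Y) \<and>
      P = {r \<in> carrier R. \<exists>v\<in>carrier (sum_module M L). \<forall>b\<in>B. \<exists>y\<in>Y.
        r \<odot>\<^bsub>M\<^esub> u b = y \<oplus>\<^bsub>M\<^esub> linear_extension R M v (d b)})}"
proof -
  interpret X: module R quo by (rule module_quotient[OF Y])
  have fn: "u \<in> A \<rightarrow> carrier M" if "u \<in> carrier (sum_module M A')" for u A and A' :: "'g set"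
    using that by (auto simp: carrier_sum_module)
  have key: "(\<forall>c\<in>C. linear_extension R quo f (d c) = \<zero>\<^bsub>quo\<^esub>) \<longleftrightarrow> (\<forall>c\<in>C. linear_extension R M u (d c) \<in> Y)" (is ?A)
    "{r \<in> carrier R. \<exists>h\<in>L \<rightarrow> carrier quo. \<forall>b\<in>B. r \<odot>\<^bsub>quo\<^esub> f b = linear_extension R quo h (d b)} =
      {r \<in> carrier R. \<exists>v\<in>carrier (sum_module M L). \<forall>b\<in>B. \<exists>y\<in>Y.
        r \<odot>\<^bsub>M\<^esub> u b = y \<oplus>\<^bsub>M\<^esub> linear_extension R M v (d b)}" (is ?B)
    if u: "u \<in> carrier (sum_module M B)" and fu: "\<forall>b\<in>B. f b = prj (u b)" for f u
  proof -
    have uB: "u \<in> B \<rightarrow> carrier M" by (rule fn[OF u])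
    have ub: "u b \<in> carrier M" for b using u by (simp add: carrier_sum_module)
    have ev: "linear_extension R quo f z = prj (linear_extension R M u z)" if z: "z \<in> carrier (free_module R B)" for z
    proof -
      have "(\<lambda>b. prj (u b)) \<in> B \<rightarrow> carrier quo" using ub linear_map_closed[OF linear_map_quotient[OF Y]] by blast
      then have "linear_extension R quo f z = linear_extension R quo (\<lambda>b. prj (u b)) z"
        by (intro linear_extension_cong[OF X.module_axioms z bspec[OF fu]]) (use fu in auto)
      then show ?thesis using linear_extension_quotient[OF uB z] by simp
    qed
    have "linear_extension R quo f (d c) = \<zero>\<^bsub>quo\<^esub> \<longleftrightarrow> linear_extension R M u (d c) \<in> Y" if c: "c \<in> C" for c
    proof -
      have dc: "d c \<in> carrier (free_module R B)" using d' c by blast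
      show ?thesis unfolding ev[OF dc] quotient_zero[OF Y]
        by (rule coset_eq_zero_iff[OF Y linear_extension_closed[OF module_axioms dc uB]])
    qed
    then show ?A by simp
    have vb: "(\<forall>b\<in>B. r \<odot>\<^bsub>quo\<^esub> f b = linear_extension R quo (\<lambda>l. prj (v l)) (d b)) \<longleftrightarrow>
        (\<forall>b\<in>B. \<exists>y\<in>Y. r \<odot>\<^bsub>M\<^esub> u b = y \<oplus>\<^bsub>M\<^esub> linear_extension R M v (d b))"
      if r: "r \<in> carrier R" and v: "v \<in> L \<rightarrow> carrier M" for r v
    proof (rule ball_cong[OF refl])
      fix b assume b: "b \<in> B"
      have db: "d b \<in> carrier (free_module R L)" using d b by blast
      show "r \<odot>\<^bsub>quo\<^esub> f b = linear_extension R quo (\<lambda>l. prj (v l)) (d b) \<longleftrightarrow>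
          (\<exists>y\<in>Y. r \<odot>\<^bsub>M\<^esub> u b = y \<oplus>\<^bsub>M\<^esub> linear_extension R M v (d b))"
        unfolding bspec[OF fu b] quotient_smult[OF Y r ub] linear_extension_quotient[OF v db]
        by (rule coset_eq_iff[OF Y smult_closed[OF r ub] linear_extension_closed[OF module_axioms db v]])
    qed
    show ?B
    proof (rule Collect_cong, rule conj_cong[OF refl])
      fix r assume r: "r \<in> carrier R"
      show "(\<exists>h\<in>L \<rightarrow> carrier quo. \<forall>b\<in>B. r \<odot>\<^bsub>quo\<^esub> f b = linear_extension R quo h (d b)) \<longleftrightarrow>
        (\<exists>v\<in>carrier (sum_module M L). \<forall>b\<in>B. \<exists>y\<in>Y. r \<odot>\<^bsub>M\<^esub> u b = y \<oplus>\<^bsub>M\<^esub> linear_extension R M v (d b))"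
      proof
        assume "\<exists>h\<in>L \<rightarrow> carrier quo. \<forall>b\<in>B. r \<odot>\<^bsub>quo\<^esub> f b = linear_extension R quo h (d b)"
        then obtain h where h: "h \<in> L \<rightarrow> carrier quo" "\<forall>b\<in>B. r \<odot>\<^bsub>quo\<^esub> f b = linear_extension R quo h (d b)" by blast
        obtain v where v: "v \<in> carrier (sum_module M L)" "\<forall>l\<in>L. h l = prj (v l)"
          by (rule quotient_lift[OF fin(2) h(1)])
        have "linear_extension R quo h (d b) = linear_extension R quo (\<lambda>l. prj (v l)) (d b)" if b: "b \<in> B" for b
        proof -
          have db: "d b \<in> carrier (free_module R L)" using d b by blast
          show ?thesis by (rule linear_extension_cong[OF X.module_axioms db bspec[OF v(2)] h(1)])
        qed
        then have "\<forall>b\<in>B. r \<odot>\<^bsub>quo\<^esub> f b = linear_extension R quo (\<lambda>l. prj (v l)) (d b)" using h(2) by simp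
        then show "\<exists>v\<in>carrier (sum_module M L). \<forall>b\<in>B. \<exists>y\<in>Y. r \<odot>\<^bsub>M\<^esub> u b = y \<oplus>\<^bsub>M\<^esub> linear_extension R M v (d b)"
          unfolding vb[OF r fn[OF v(1)]] using v(1) by blast
      next
        assume "\<exists>v\<in>carrier (sum_module M L). \<forall>b\<in>B. \<exists>y\<in>Y. r \<odot>\<^bsub>M\<^esub> u b = y \<oplus>\<^bsub>M\<^esub> linear_extension R M v (d b)"
        then obtain v where v: "v \<in> carrier (sum_module M L)"
          "\<forall>b\<in>B. \<exists>y\<in>Y. r \<odot>\<^bsub>M\<^esub> u b = y \<oplus>\<^bsub>M\<^esub> linear_extension R M v (d b)" by blast
        have "(\<lambda>l. prj (v l)) \<in> L \<rightarrow> carrier quo"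
          using v(1) linear_map_closed[OF linear_map_quotient[OF Y]] by (auto simp: carrier_sum_module)
        then show "\<exists>h\<in>L \<rightarrow> carrier quo. \<forall>b\<in>B. r \<odot>\<^bsub>quo\<^esub> f b = linear_extension R quo h (d b)"
          using iffD2[OF vb[OF r fn[OF v(1)]] v(2)] by blast
      qed
    qed
  qed
  show ?thesis
    unfolding ext_primes_def
  proof (rule Collect_cong, rule conj_cong[OF refl])
    fix P :: "'a set"
    let ?E = "\<lambda>f. (\<forall>c\<in>C. linear_extension R quo f (d c) = \<zero>\<^bsub>quo\<^esub>) \<and>
      P = {r \<in> carrier R. \<exists>h\<in>L \<rightarrow> carrier quo. \<forall>b\<in>B. r \<odot>\<^bsub>quo\<^esub> f b = linear_extension R quo h (d b)}"
    let ?E' = "\<lambda>u. (\<forall>c\<in>C. linear_extension R M u (d c) \<in> Y) \<and>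
      P = {r \<in> carrier R. \<exists>v\<in>carrier (sum_module M L). \<forall>b\<in>B. \<exists>y\<in>Y.
        r \<odot>\<^bsub>M\<^esub> u b = y \<oplus>\<^bsub>M\<^esub> linear_extension R M v (d b)}"
    show "(\<exists>f\<in>B \<rightarrow> carrier quo. ?E f) \<longleftrightarrow> (\<exists>u\<in>carrier (sum_module M B). ?E' u)"
    proof
      assume "\<exists>f\<in>B \<rightarrow> carrier quo. ?E f"
      then obtain f where f: "f \<in> B \<rightarrow> carrier quo" "?E f" by (rule bexE)
      obtain u where u: "u \<in> carrier (sum_module M B)" "\<forall>b\<in>B. f b = prj (u b)"
        by (rule quotient_lift[OF fin(1) f(1)])
      have "?E' u" using f(2) unfolding key[OF u] .
      then show "\<exists>u\<in>carrier (sum_module M B). ?E' u" using u(1) by (rule bexI)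
    next
      assume "\<exists>u\<in>carrier (sum_module M B). ?E' u"
      then obtain u where u: "u \<in> carrier (sum_module M B)" "?E' u" by (rule bexE)
      have "?E (\<lambda>b. prj (u b))" unfolding key[OF u(1), of "\<lambda>b. prj (u b)", simplified] by (rule u(2))
      moreover have "(\<lambda>b. prj (u b)) \<in> B \<rightarrow> carrier quo"
        using u(1) linear_map_closed[OF linear_map_quotient[OF Y]] by (auto simp: carrier_sum_module)
      ultimately show "\<exists>f\<in>B \<rightarrow> carrier quo. ?E f" by (rule bexI)
    qed
  qed
qed

lemma linear_map_sum_quotient: "linear_map R (sum_module M B) (sum_module quo B) (\<lambda>u b. prj (u b))"
proof (rule linear_mapI)
  fix u assume u: "u \<in> carrier (sum_module M B)"
  have "{b. prj (u b) \<noteq> \<zero>\<^bsub>quo\<^esub>} \<subseteq> {b. u b \<noteq> \<zero>\<^bsub>M\<^esub>}"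
    by (rule Collect_mono) (auto simp: quotient_zero[OF Y] coset_zero[OF Y])
  then have "finite {b. prj (u b) \<noteq> \<zero>\<^bsub>quo\<^esub>}" by (rule finite_subset) (use u in \<open>simp add: carrier_sum_module\<close>)
  then show "(\<lambda>b. prj (u b)) \<in> carrier (sum_module quo B)"
    using u linear_map_closed[OF linear_map_quotient[OF Y]] coset_zero[OF Y]
    by (simp add: carrier_sum_module quotient_zero[OF Y])
qed (simp_all add: carrier_sum_module fun_eq_iff quotient_add[OF Y] quotient_smult[OF Y])

lemma pushforward_quotient:
  assumes f: "f \<in> B \<rightarrow> carrier (free_module R C)" and u: "u \<in> carrier (sum_module M B)"
  shows "pushforward quo f (\<lambda>b. prj (u b)) = (\<lambda>c. prj (pushforward M f u c))"
proof -
  interpret X: module R quo by (rule module_quotient[OF Y])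
  show ?thesis
  proof (rule sum_module_linear_eq[OF X.module_sum_module
        linear_map_comp[OF linear_map_sum_quotient X.linear_map_pushforward[OF f]]
        linear_map_comp[OF linear_map_pushforward[OF f] linear_map_sum_quotient] _ u])
    fix b x assume b: "b \<in> B" and x: "x \<in> carrier M"
    have px: "prj x \<in> carrier quo" by (rule linear_map_closed[OF linear_map_quotient[OF Y] x])
    have fb: "f b \<in> carrier (free_module R C)" using f b by blast
    have "(\<lambda>c. prj (sum_single M b x c)) = sum_single quo b (prj x)"
      by (rule ext) (simp add: sum_single_def quotient_zero[OF Y] coset_zero[OF Y])
    moreover have "scale_vector quo (f b) (prj x) = (\<lambda>c. prj (scale_vector M (f b) x c))"
      using fb x by (auto simp: scale_vector_def quotient_smult[OF Y] carrier_free_module)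
    ultimately show "pushforward quo f (\<lambda>c. prj (sum_single M b x c)) = (\<lambda>c. prj (pushforward M f (sum_single M b x) c))"
      using X.pushforward_single[OF f b px] pushforward_single[OF f b x] by simp
  qed
qed

lemma tor_primes_quotient:
  assumes fin: "finite B" "finite C" and d: "d \<in> B \<rightarrow> carrier (free_module R L)" and d': "d \<in> C \<rightarrow> carrier (free_module R B)"
  shows "tor_primes R quo B C d =
    {P. primeideal P R \<and> (\<exists>u\<in>carrier (sum_module M B). (\<forall>l. pushforward M d u l \<in> Y) \<and>
      P = {r \<in> carrier R. \<exists>v\<in>carrier (sum_module M C). \<forall>b\<in>B. \<exists>y\<in>Y.
        r \<odot>\<^bsub>M\<^esub> u b = y \<oplus>\<^bsub>M\<^esub> pushforward M d v b})}"
proof -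
  have lift: "\<exists>u\<in>carrier (sum_module M A). w = (\<lambda>b. prj (u b))"
    if A: "finite A" and w: "w \<in> carrier (sum_module quo A)" for w and A :: "'g set"
  proof -
    have "w \<in> A \<rightarrow> carrier quo" using w by (auto simp: carrier_sum_module)
    then obtain u where u: "u \<in> carrier (sum_module M A)" "\<forall>b\<in>A. w b = prj (u b)"
      by (rule quotient_lift[OF A])
    have "w b = prj (u b)" for b
      using u w coset_zero[OF Y] by (cases "b \<in> A") (auto simp: carrier_sum_module quotient_zero[OF Y])
    then show ?thesis using u(1) by blast
  qed
  have key: "pushforward quo d (\<lambda>b. prj (u b)) = (\<lambda>_. \<zero>\<^bsub>quo\<^esub>) \<longleftrightarrow> (\<forall>l. pushforward M d u l \<in> Y)" (is ?A)
    "{r \<in> carrier R. \<exists>v\<in>carrier (sum_module quo C). (\<lambda>b. r \<odot>\<^bsub>quo\<^esub> prj (u b)) = pushforward quo d v} =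
     {r \<in> carrier R. \<exists>v\<in>carrier (sum_module M C). \<forall>b\<in>B. \<exists>y\<in>Y. r \<odot>\<^bsub>M\<^esub> u b = y \<oplus>\<^bsub>M\<^esub> pushforward M d v b}" (is ?B)
    if u: "u \<in> carrier (sum_module M B)" for u
  proof -
    have ub: "u b \<in> carrier M" for b using u by (simp add: carrier_sum_module)
    have du: "pushforward M d u l \<in> carrier M" for l
      using linear_map_closed[OF linear_map_pushforward[OF d] u] by (simp add: carrier_sum_module)
    show ?A unfolding pushforward_quotient[OF d u] fun_eq_iff quotient_zero[OF Y]
      using coset_eq_zero_iff[OF Y du] by simp
    have vb: "(\<lambda>b. r \<odot>\<^bsub>quo\<^esub> prj (u b)) = pushforward quo d (\<lambda>c. prj (v c)) \<longleftrightarrow>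
        (\<forall>b\<in>B. \<exists>y\<in>Y. r \<odot>\<^bsub>M\<^esub> u b = y \<oplus>\<^bsub>M\<^esub> pushforward M d v b)"
      if r: "r \<in> carrier R" and v: "v \<in> carrier (sum_module M C)" for r v
    proof -
      note dv = linear_map_closed[OF linear_map_pushforward[OF d'] v]
      have dvb: "pushforward M d v b \<in> carrier M" for b using dv by (simp add: carrier_sum_module)
      \<comment> \<open>Outside B both sides are zero, so the witness zero in Y reduces an identity
        at all indices to one on B.\<close>
      have out: "r \<odot>\<^bsub>M\<^esub> u b = \<zero>\<^bsub>M\<^esub> \<oplus>\<^bsub>M\<^esub> pushforward M d v b" if "b \<notin> B" for b
        using that u dv r by (simp add: carrier_sum_module)
      have "(\<lambda>b. r \<odot>\<^bsub>quo\<^esub> prj (u b)) = pushforward quo d (\<lambda>c. prj (v c)) \<longleftrightarrow>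
          (\<forall>b. prj (r \<odot>\<^bsub>M\<^esub> u b) = prj (pushforward M d v b))"
        unfolding pushforward_quotient[OF d' v] fun_eq_iff quotient_smult[OF Y r ub] ..
      also have "\<dots> \<longleftrightarrow> (\<forall>b. \<exists>y\<in>Y. r \<odot>\<^bsub>M\<^esub> u b = y \<oplus>\<^bsub>M\<^esub> pushforward M d v b)"
        unfolding coset_eq_iff[OF Y smult_closed[OF r ub] dvb] ..
      also have "\<dots> \<longleftrightarrow> (\<forall>b\<in>B. \<exists>y\<in>Y. r \<odot>\<^bsub>M\<^esub> u b = y \<oplus>\<^bsub>M\<^esub> pushforward M d v b)"
        using out submodule_zero_closed[OF Y] by blast
      finally show ?thesis .
    qed
    show ?B
    proof (rule Collect_cong, rule conj_cong[OF refl])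
      fix r assume r: "r \<in> carrier R"
      show "(\<exists>v\<in>carrier (sum_module quo C). (\<lambda>b. r \<odot>\<^bsub>quo\<^esub> prj (u b)) = pushforward quo d v) \<longleftrightarrow>
        (\<exists>v\<in>carrier (sum_module M C). \<forall>b\<in>B. \<exists>y\<in>Y. r \<odot>\<^bsub>M\<^esub> u b = y \<oplus>\<^bsub>M\<^esub> pushforward M d v b)"
      proof
        assume "\<exists>v\<in>carrier (sum_module quo C). (\<lambda>b. r \<odot>\<^bsub>quo\<^esub> prj (u b)) = pushforward quo d v"
        then obtain w where w: "w \<in> carrier (sum_module quo C)" "(\<lambda>b. r \<odot>\<^bsub>quo\<^esub> prj (u b)) = pushforward quo d w"
          by (rule bexE)
        obtain v where v: "v \<in> carrier (sum_module M C)" "w = (\<lambda>b. prj (v b))" using lift[OF fin(2) w(1)] by (rule bexE)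
        show "\<exists>v\<in>carrier (sum_module M C). \<forall>b\<in>B. \<exists>y\<in>Y. r \<odot>\<^bsub>M\<^esub> u b = y \<oplus>\<^bsub>M\<^esub> pushforward M d v b"
          using iffD1[OF vb[OF r v(1)] w(2)[unfolded v(2)]] v(1) by (rule bexI)
      next
        assume "\<exists>v\<in>carrier (sum_module M C). \<forall>b\<in>B. \<exists>y\<in>Y. r \<odot>\<^bsub>M\<^esub> u b = y \<oplus>\<^bsub>M\<^esub> pushforward M d v b"
        then obtain v where v: "v \<in> carrier (sum_module M C)"
          "\<forall>b\<in>B. \<exists>y\<in>Y. r \<odot>\<^bsub>M\<^esub> u b = y \<oplus>\<^bsub>M\<^esub> pushforward M d v b" by (rule bexE)
        show "\<exists>v\<in>carrier (sum_module quo C). (\<lambda>b. r \<odot>\<^bsub>quo\<^esub> prj (u b)) = pushforward quo d v"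
          using iffD2[OF vb[OF r v(1)] v(2)] linear_map_closed[OF linear_map_sum_quotient v(1)] by (rule bexI)
      qed
    qed
  qed
  show ?thesis
    unfolding tor_primes_def
  proof (rule Collect_cong, rule conj_cong[OF refl])
    fix P :: "'a set"
    let ?E = "\<lambda>w. pushforward quo d w = (\<lambda>_. \<zero>\<^bsub>quo\<^esub>) \<and>
      P = {r \<in> carrier R. \<exists>v\<in>carrier (sum_module quo C). (\<lambda>b. r \<odot>\<^bsub>quo\<^esub> w b) = pushforward quo d v}"
    let ?E' = "\<lambda>u. (\<forall>l. pushforward M d u l \<in> Y) \<and>
      P = {r \<in> carrier R. \<exists>v\<in>carrier (sum_module M C). \<forall>b\<in>B. \<exists>y\<in>Y. r \<odot>\<^bsub>M\<^esub> u b = y \<oplus>\<^bsub>M\<^esub> pushforward M d v b}"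
    show "(\<exists>w\<in>carrier (sum_module quo B). ?E w) \<longleftrightarrow> (\<exists>u\<in>carrier (sum_module M B). ?E' u)"
    proof
      assume "\<exists>w\<in>carrier (sum_module quo B). ?E w"
      then obtain w where w: "w \<in> carrier (sum_module quo B)" "?E w" by (rule bexE)
      obtain u where u: "u \<in> carrier (sum_module M B)" "w = (\<lambda>b. prj (u b))" using lift[OF fin(1) w(1)] by (rule bexE)
      have "?E' u" using w(2) unfolding u(2) key[OF u(1)] .
      then show "\<exists>u\<in>carrier (sum_module M B). ?E' u" using u(1) by (rule bexI)
    next
      assume "\<exists>u\<in>carrier (sum_module M B). ?E' u"
      then obtain u where u: "u \<in> carrier (sum_module M B)" "?E' u" by (rule bexE)
      have "?E (\<lambda>b. prj (u b))" unfolding key[OF u(1)] by (rule u(2))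
      then show "\<exists>w\<in>carrier (sum_module quo B). ?E w" using linear_map_closed[OF linear_map_sum_quotient u(1)] by (rule bexI)
    qed
  qed
qed

end

text \<open>The map on cochains dual to f, in coordinates. For finite bases Hom out of a free module
  is a direct sum of copies of M; the value zero outside B places the result in that sum.\<close>

definition pullback where
  "pullback B f u = (\<lambda>b. if b \<in> B then linear_extension R M u (f b) else \<zero>\<^bsub>M\<^esub>)"

lemma linear_map_pullback:
  assumes "finite B" and f: "f \<in> B \<rightarrow> carrier (free_module R C)"
  shows "linear_map R (sum_module M C) (sum_module M B) (pullback B f)"
proof (rule linear_mapI)
  have fn: "u \<in> C \<rightarrow> carrier M" if "u \<in> carrier (sum_module M C)" for u
    using that by (auto simp: carrier_sum_module)
  have fb: "f b \<in> carrier (free_module R C)" if "b \<in> B" for b using f that by blast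
  fix u assume u: "u \<in> carrier (sum_module M C)"
  show "pullback B f u \<in> carrier (sum_module M B)"
    by (rule sum_module_finiteI[OF assms(1)])
       (use linear_extension_closed[OF module_axioms fb fn[OF u]] in \<open>auto simp: pullback_def\<close>)
  show "pullback B f (r \<odot>\<^bsub>sum_module M C\<^esub> u) = r \<odot>\<^bsub>sum_module M B\<^esub> pullback B f u" if r: "r \<in> carrier R" for r
    using linear_extension_smult_fun[OF module_axioms fn[OF u] r fb] r by (auto simp: pullback_def fun_eq_iff)
  fix v assume v: "v \<in> carrier (sum_module M C)"
  show "pullback B f (u \<oplus>\<^bsub>sum_module M C\<^esub> v) = pullback B f u \<oplus>\<^bsub>sum_module M B\<^esub> pullback B f v"
    using linear_extension_plus_fun[OF module_axioms fn[OF u] fn[OF v] fb] by (auto simp: pullback_def fun_eq_iff)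
qed

end

section \<open>Stability of the associated primes of Ext and Tor\<close>

lemma subresolution_contraction_locale:
  assumes M: "module R M" and noeth: "noetherian_ring R" and fgM: "finitely_generated_module R M"
  obtains S h p where "contraction R (res_basis R M) S (res_boundary R) h p" "\<And>n. finite (S n)"
proof (rule subresolution_contraction[OF M noeth fgM])
  fix S p h
  assume S: "\<And>n. finite (S n)" "\<And>n. S n \<subseteq> res_basis R M n"
    "\<And>n b. b \<in> S n \<Longrightarrow> res_boundary R b \<in> carrier (free_module R (lower S n))"
    and h: "\<And>n. h n \<in> lower (res_basis R M) n \<rightarrow> carrier (free_module R (res_basis R M n))"
    "\<And>n b. b \<in> lower S n \<Longrightarrow> h n b = (\<lambda>_. \<zero>\<^bsub>R\<^esub>)"
    and p: "\<And>n. p n \<in> res_basis R M n \<rightarrow> carrier (free_module R (S n))"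
    and hom: "\<And>n b. b \<in> res_basis R M n \<Longrightarrow>
      free_gen R b = p n b \<oplus>\<^bsub>free_module R (res_basis R M n)\<^esub>
        (res_diff R (h (Suc n) b) \<oplus>\<^bsub>free_module R (res_basis R M n)\<^esub> free_extension R (h n) (res_boundary R b))"
  interpret M: module R M by fact
  have "contraction R (res_basis R M) S (res_boundary R) h p"
  proof (intro contraction.intro contraction_axioms.intro)
    show "cring R" by (rule M.R.is_cring)
    fix n b
    show "S n \<subseteq> res_basis R M n" by (rule S(2))
    show "res_boundary R \<in> res_basis R M n \<rightarrow> carrier (free_module R (lower (res_basis R M) n))"
      by (rule res_boundary_Pi[OF M])
    show "res_boundary R \<in> S n \<rightarrow> carrier (free_module R (lower S n))" using S(3) by blast
    show "free_extension R (res_boundary R) (res_boundary R b) = (\<lambda>_. \<zero>\<^bsub>R\<^esub>)" if "b \<in> res_basis R M n"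
      using res_diff_boundary[OF M that] unfolding res_diff_eq .
    show "h n \<in> lower (res_basis R M) n \<rightarrow> carrier (free_module R (res_basis R M n))" by (rule h(1))
    show "h n b = (\<lambda>_. \<zero>\<^bsub>R\<^esub>)" if "b \<in> lower S n" by (rule h(2)[OF that])
    show "p n \<in> res_basis R M n \<rightarrow> carrier (free_module R (S n))" by (rule p)
    show "free_gen R b = p n b \<oplus>\<^bsub>free_module R (res_basis R M n)\<^esub>
        (free_extension R (res_boundary R) (h (Suc n) b) \<oplus>\<^bsub>free_module R (res_basis R M n)\<^esub>
          free_extension R (h n) (res_boundary R b))" if "b \<in> res_basis R M n"
      using hom[OF that] unfolding res_diff_eq .
  qed
  then show thesis by (rule that[OF _ S(1)])
qed

theorem theorem4:
  fixes R :: "('a, 'r) ring_scheme"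
    and M :: "('a, 'm, 'e) module_scheme"
    and N :: "('a, 'n, 'f) module_scheme"
    and N' :: "'n set"
    and t :: nat
    and I :: "nat \<Rightarrow> 'a set"
    and i :: nat
  assumes "cring R" and "noetherian_ring R"
    and "\<And>j. j \<in> {1..t} \<Longrightarrow> ideal (I j) R"
    and "finitely_generated_module R M"
    and "finitely_generated_module R N"
    and "submodule N' R N"
  defines "W \<equiv> \<lambda>n. Ext R i M (quotient_module N (ideal_smult R N (ideal_multipower R t I n) N'))"
    and "W' \<equiv> \<lambda>n. Tor R i M (quotient_module N (ideal_smult R N (ideal_multipower R t I n) N'))"
  shows "\<exists>k :: nat \<Rightarrow> nat. \<forall>n :: nat \<Rightarrow> nat. (\<forall>j \<in> {1..t}. k j \<le> n j) \<longrightarrow>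
           Ass R (W n) = Ass R (W k) \<and> Ass R (W' n) = Ass R (W' k)"
proof -
  have M: "module R M" and N: "module R N" using assms(4,5) by (simp_all add: finitely_generated_module_def)
  interpret N: module R N by fact
  obtain V a col where gg: "graded_generators R V a" and col: "col ` V \<subseteq> {1..t}"
    and I: "\<forall>j\<in>{1..t}. I j = genideal R (a ` {v \<in> V. col v = j})"
    by (rule finite_graded_generators[OF assms(1,2) ballI[OF assms(3)]])
  interpret nat_graded_generators R V a col by (rule nat_graded_generators.intro[OF gg])
  obtain S h p where "contraction R (res_basis R M) S (res_boundary R) h p" and finS: "\<And>n. finite (S n)"
    using subresolution_contraction_locale[OF M assms(2,4)] by blast
  interpret c: contraction R "res_basis R M" S "res_boundary R" h p by fact
  have finL: "finite (lower S i)" using finS by (cases i) auto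
  let ?Y = "\<lambda>m. ideal_power N {\<zero>\<^bsub>N\<^esub>} N' m"
  let ?d = "res_boundary R"
  let ?B = "S i" and ?L = "lower S i" and ?C = "S (Suc i)"
  have Y: "submodule (?Y m) R N" for m
    by (rule ideal_power_submodule[OF N N.submodule_singleton_zero assms(6)])
  have noethS: "noetherian_module R (sum_module N A)" if "finite A" for A :: "('a, 'm) res_gen set"
    by (rule noetherian_module_of_fg[OF assms(2) finitely_generated_sum_module[OF assms(5) that]])
  have dB: "?d \<in> ?B \<rightarrow> carrier (free_module R ?L)" by (rule c.dS)
  have dC: "?d \<in> ?C \<rightarrow> carrier (free_module R ?B)" by (rule c.dS_Suc)
  have WY: "quotient_module N (ideal_smult R N (ideal_multipower R t I n) N') = quotient_module N (?Y (exponent_mset t n))" for n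
    using ideal_smult_multipower[OF I N assms(6)] by simp
  have imgD: "submodule (g ` carrier (sum_module N A)) R (sum_module N B)"
    if "linear_map R (sum_module N A) (sum_module N B) g" for g and A B :: "('a, 'm) res_gen set"
    by (rule submodule_image[OF N.module_sum_module N.module_sum_module that
          module.carrier_is_submodule[OF N.module_sum_module]])
  note SH = N.submodule_sum_submodule[OF assms(6)]

  \<comment> \<open>For Ext the differential raises the degree: the cocycle condition is the
    pullback to the basis of degree Suc i, and D is the image of the cochains one degree
    below.\<close>
  let ?E = "homology_primes (sum_module N ?B) (sum_module N ?C) (N.pullback ?C ?d) (sum_submodule N ?C N')
      (N.pullback ?B ?d ` carrier (sum_module N ?L)) (sum_submodule N ?B N')"
  note lC = N.linear_map_pullback[OF finS dC] and lB = N.linear_map_pullback[OF finS dB]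
  have E: "Ass R (W n) = ?E (exponent_mset t n)" for n
  proof -
    let ?m = "exponent_mset t n"
    note X = N.module_quotient[OF Y[of ?m]]
    have "Ass R (W n) = ext_primes R (quotient_module N (?Y ?m)) ?L ?B ?C ?d"
      unfolding W_def WY Ass_Ext[OF M X] by (rule c.ext_primes_contraction[OF X])
    also have "\<dots> = {P. primeideal P R \<and> (\<exists>u\<in>carrier (sum_module N ?B).
      (\<forall>c\<in>?C. linear_extension R N u (?d c) \<in> ?Y ?m) \<and>
      P = {r \<in> carrier R. \<exists>v\<in>carrier (sum_module N ?L). \<forall>b\<in>?B. \<exists>y\<in>?Y ?m.
        r \<odot>\<^bsub>N\<^esub> u b = y \<oplus>\<^bsub>N\<^esub> linear_extension R N v (?d b)})}"
      by (rule N.ext_primes_quotient[OF Y finS finL dB dC])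
    also have "\<dots> = ?E ?m"
    proof -
      \<comment> \<open>The pullback is zero at indices outside ?C, and zero lies in the submodule,
        so quantifying over all indices or over ?C is the same.\<close>
      have "(\<forall>c. N.pullback ?C ?d u c \<in> ?Y ?m) \<longleftrightarrow> (\<forall>c\<in>?C. linear_extension R N u (?d c) \<in> ?Y ?m)" for u
        using N.submodule_zero_closed[OF Y[of ?m]] by (auto simp: N.pullback_def)
      then show ?thesis
        unfolding homology_primes_sum_module[OF N assms(6) finS lC lB] by (simp add: N.pullback_def cong: ball_cong)
    qed
    finally show ?thesis .
  qed
  obtain k1 where k1: "set_mset k1 \<subseteq> {1..t}" "\<And>m. set_mset m \<subseteq> {1..t} \<Longrightarrow> k1 \<subseteq># m \<Longrightarrow> ?E m = ?E k1"
    using homology_primes_stable[OF noethS[OF finS] noethS[OF finS] lC SH imgD[OF lB] SH finite_atLeastAtMost col] by blast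

  \<comment> \<open>For Tor the directions are reversed: g is the boundary map to the degree below,
    and D is the image of the chains of degree Suc i.\<close>
  let ?T = "homology_primes (sum_module N ?B) (sum_module N ?L) (pushforward N ?d) (sum_submodule N ?L N')
      (pushforward N ?d ` carrier (sum_module N ?C)) (sum_submodule N ?B N')"
  note pB = N.linear_map_pushforward[OF dB] and pC = N.linear_map_pushforward[OF dC]
  have T: "Ass R (W' n) = ?T (exponent_mset t n)" for n
  proof -
    let ?m = "exponent_mset t n"
    note X = N.module_quotient[OF Y[of ?m]]
    have "Ass R (W' n) = tor_primes R (quotient_module N (?Y ?m)) ?B ?C ?d"
      unfolding W'_def WY Ass_Tor[OF M X] by (rule c.tor_primes_contraction[OF X])
    also have "\<dots> = ?T ?m"
      unfolding homology_primes_sum_module[OF N assms(6) finS pB pC]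
      by (rule N.tor_primes_quotient[OF Y finS finS dB dC])
    finally show ?thesis .
  qed
  obtain k2 where k2: "set_mset k2 \<subseteq> {1..t}" "\<And>m. set_mset m \<subseteq> {1..t} \<Longrightarrow> k2 \<subseteq># m \<Longrightarrow> ?T m = ?T k2"
    using homology_primes_stable[OF noethS[OF finS] noethS[OF finL] pB SH imgD[OF pC] SH finite_atLeastAtMost col] by blast

  \<comment> \<open>Stability was proved for multisets; \<open>count\<close> turns the sum of both
    thresholds back into a function. It is itself an admissible n, so n and ?k are both compared
    with k1 and with k2.\<close>
  let ?k = "count (k1 + k2)"
  have le: "k1 \<subseteq># exponent_mset t n" "k2 \<subseteq># exponent_mset t n" if n: "\<forall>j\<in>{1..t}. ?k j \<le> n j" for n
  proof -
    have "count (k1 + k2) j \<le> count (exponent_mset t n) j" for j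
    proof (cases "j \<in> {1..t}")
      case False
      then have "count k1 j = 0" "count k2 j = 0" using k1(1) k2(1) by (auto simp: count_eq_zero_iff)
      then show ?thesis by simp
    qed (use n in \<open>simp add: count_exponent_mset\<close>)
    then have "k1 + k2 \<subseteq># exponent_mset t n" by (rule mset_subset_eqI)
    then show "k1 \<subseteq># exponent_mset t n" "k2 \<subseteq># exponent_mset t n"
      by (meson mset_subset_eq_add_left mset_subset_eq_add_right subset_mset.order_trans)+
  qed
  have "Ass R (W n) = Ass R (W ?k) \<and> Ass R (W' n) = Ass R (W' ?k)" if n: "\<forall>j\<in>{1..t}. ?k j \<le> n j" for n
    unfolding E T
    using k1(2)[OF set_exponent_mset le(1)[OF n]] k1(2)[OF set_exponent_mset le(1)[of ?k]]
      k2(2)[OF set_exponent_mset le(2)[OF n]] k2(2)[OF set_exponent_mset le(2)[of ?k]] by simp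
  then show ?thesis by blast
qed

end
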